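(* Let $0<q<\infty$ and $1\le p_1,p_2\le\infty$. There exist constants $0<k\le K<\infty$ depending only on $p_1,p_2,q$ such that for every nondegenerate compact interval $J=[c,d]$ and arbitrary measurable weights $u,v_1,v_2:J\to[0,\infty]$, $$k\,\mathfrak A_J^{\mathrm{op}}\le C_J\le K\,\mathfrak A_J^{\mathrm{op}},\qquad \mathfrak A_J^{\mathrm{op}}=\sup_{m\ge1}\mathfrak A_J^{(m)}$$ (as an equivalence in $[0,\infty]$), where $C_J$ is the optimal constant of the bilinear Hardy inequality on $J$ and the complete regularised characteristic $\mathfrak A_J^{(m)}$ is given by - $\mathfrak B_1^{(m)}$ if $p_1,p_2<\infty$ and $p_1,p_2\le q$; - $\widehat{\mathfrak B}_2^{(m)}$ if $p_1\le q<p_2<\infty$; - $\widehat{\mathfrak B}_3^{(m)}$ if $p_2\le q<p_1<\infty$; - $\mathfrak B_4^{(m)}+\mathfrak B_5^{(m)}$ if $p_1,p_2<\infty$, $q<\min\{p_1,p_2\}$ and $\frac1q\le\frac1{p_1}+\frac1{p_2}$; - $\mathfrak B_6^{(m)}+\mathfrak B_7^{(m)}$ if $p_1,p_2<\infty$, $q<\min\{p_1,p_2\}$ and $\frac1q>\frac1{p_1}+\frac1{p_2}$; - $\mathfrak B_{\infty,2}^{(m)}$ if $p_1=\infty$, $p_2<\infty$; - $\mathfrak B_{1,\infty}^{(m)}$ if $p_1<\infty$, $p_2=\infty$; - $\mathfrak B_{\infty,\infty}^{(m)}$ if $p_1=p_2=\infty$. In the doubly infinite case $p_1=p_2=\infty$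 one has the equality $C_J=\sup_{m\ge1}\mathfrak B_{\infty,\infty}^{(m)}$.
   Context: **Extended product and weighted functionals.** For $a,b\in[0,\infty]$ put $a\odot b=0$ if $a=0$ or $b=0$, $a\odot b=ab$ if $0<a,b<\infty$, and $a\odot b=\infty$ otherwise. For a measurable weight $w:J\to[0,\infty]$ and measurable $h\ge0$: $\|h\|_{L^s(w;J)}=\left(\int_J h(t)^s\odot w(t)\,dt\right)^{1/s}$ for $0<s<\infty$ and $\|h\|_{L^\infty(w;J)}=\operatorname{ess\,sup}_{t\in J}(h(t)\odot w(t))$. All functions are nonnegative and measurable. **Local constant.** $H_Jh(x)=\int_c^xh(t)\,dt$ and $\mathcal B_J(f,g)(x)=H_Jf(x)\odot H_Jg(x)$ for $x\in J$. $C_J$ is the infimum of all finite $C\ge0$ such that $\|\mathcal B_J(f,g)\|_{L^q(u;J)}\le C\|f\|_{L^{p_1}(v_1;J)}\|g\|_{L^{p_2}(v_2;J)}$ for all $f,g\ge0$ with both input functionals finite; $\inf\varnothing=+\infty$. **Profiles.** Let $v:J\to[\delta,\infty]$ be measurable for some $\delta>0$, with $1/v=0$ and $v^{1-p'}=0$ on $\{v=\infty\}$; $p'=p/(p-1)$. For $1<p<\infty$: $\Phi_{p,v;J}(x)=\left(\int_c^x v^{1-p'}dt\right)^{1/p'}$. For $p=\infty$: $\Phi_{\infty,v;J}(x)=\int_c^x\frac{dt}{v(t)}$. For $p=1$: with $F_{v,J}(x)=\operatorname{ess\,sup}_{c<t<x}1/v(t)$ for $c<x\le d$, put $\Phi_{1,v;J}(x)=\lim_{y\downarrow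 x}F_{v,J}(y)$ for $c\le x<d$ and $\Phi_{1,v;J}(d)=F_{v,J}(d)$. **Stieltjes convention.** For $G:[c,d]\to[0,\infty)$ nondecreasing and right-continuous, $dG$ is the Borel measure on $[c,d]$ with $dG([c,x])=G(x)$ for all $x\in[c,d]$ (i.e. $G$ is extended by zero to the left of $c$); in particular $dG(\{c\})=G(c)$. **Regularised quantities.** For $m\ge1$ put $u_m=u\wedge m$, $v_{i,m}=v_i+\frac1m$ (with $\infty+\frac1m=\infty$). The following are formed from $u_m,v_{1,m},v_{2,m}$; the superscript $(m)$ is omitted in the formulas: $\Phi_i=\Phi_{p_i,v_{i,m};J}$, $U(x)=\int_x^d u_m(t)\,dt$, and, when $q<p_i<\infty$, $\frac1{r_i}=\frac1q-\frac1{p_i}$ and $\mu_i=d(\Phi_i^{r_i})$. When $\frac1q>\frac1{p_1}+\frac1{p_2}$, put $\frac1\kappa=\frac1q-\frac1{p_1}-\frac1{p_2}$. Define - $\mathfrak B_1=\sup_{x\in J}U(x)^{1/q}\Phi_1(x)\Phi_2(x)$; - $\widehat{\mathfrak B}_2=\sup_{x\in J}\Phi_1(x)\left[\int_J U(\max\{x,t\})^{r_2/q}d\mu_2(t)\right]^{1/r_2}$; - $\widehat{\mathfrak B}_3=\sup_{x\in J}\Phi_2(x)\left[\int_J U(\max\{x,t\})^{r_1/q}d\mu_1(t)\right]^{1/r_1}$; - $\mathfrak B_4=\sup_{x\in J}\Phi_1(x)\left[\int_{[x,d]}U(t)^{r_2/q}d\mu_2(t)\right]^{1/r_2}$; - $\mathfrak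 B_5=\sup_{x\in J}\Phi_2(x)\left[\int_{(x,d]}U(t)^{r_1/q}d\mu_1(t)\right]^{1/r_1}$; - $\mathfrak B_6=\left[\int_J\left(\int_{[x,d]}U(t)^{r_2/q}d\mu_2(t)\right)^{\kappa/r_2}d(\Phi_1^\kappa)(x)\right]^{1/\kappa}$; - $\mathfrak B_7=\left[\int_J\left(\int_{(x,d]}U(t)^{r_1/q}d\mu_1(t)\right)^{\kappa/r_1}d(\Phi_2^\kappa)(x)\right]^{1/\kappa}$; - with $W_1(x)=\int_x^d\Phi_1(t)^qu_m(t)\,dt$: $\mathfrak B_{\infty,2}=\sup_{x\in J}\Phi_2(x)W_1(x)^{1/q}$ if $p_2\le q$, and $\mathfrak B_{\infty,2}=\left[\int_JW_1^{r_2/q}\,d(\Phi_2^{r_2})\right]^{1/r_2}$ if $q<p_2<\infty$; - with $W_2(x)=\int_x^d\Phi_2(t)^qu_m(t)\,dt$: $\mathfrak B_{1,\infty}=\sup_{x\in J}\Phi_1(x)W_2(x)^{1/q}$ if $p_1\le q$, and $\mathfrak B_{1,\infty}=\left[\int_JW_2^{r_1/q}\,d(\Phi_1^{r_1})\right]^{1/r_1}$ if $q<p_1<\infty$; - $\mathfrak B_{\infty,\infty}=\left[\int_J(\Phi_1\Phi_2)^qu_m\,dx\right]^{1/q}$. *)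

theory Defs
  imports "HOL-Analysis.Analysis" "HOL-Probability.Essential_Supremum"
begin

text \<open>
  All weights and functions take values in \<^typ>\<open>ennreal\<close>, whose multiplication already satisfies
  \<open>0 * \<infinity> = 0\<close> and \<open>a * \<infinity> = \<infinity>\<close> for \<open>a \<noteq> 0\<close>; it is the extended product of the theory.
  The interval is \<open>J = {c..d}\<close>, functions on \<open>J\<close> are functions on the reals of which only the values
  on \<open>J\<close> matter, and measurability is Lebesgue measurability on \<open>J\<close>.
\<close>

definition epow :: "ennreal \<Rightarrow> real \<Rightarrow> ennreal" where
  "epow x a =
     (if a = 0 then 1
      else if x = \<infinity> then (if a > 0 then \<infinity> else 0)
      else if x = 0 then (if a > 0 then 0 else \<infinity>)
      else ennreal (enn2real x powr a))"

definition wnorm :: "ennreal \<Rightarrow> real \<Rightarrow> real \<Rightarrow> (real \<Rightarrow> ennreal) \<Rightarrow> (real \<Rightarrow> ennreal) \<Rightarrow> ennreal" where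
  "wnorm s c d w h =
     (if s = \<infinity> then esssup (lebesgue_on {c..d}) (\<lambda>t. h t * w t)
      else epow (\<integral>\<^sup>+ t. epow (h t) (enn2real s) * w t \<partial>lebesgue_on {c..d}) (1 / enn2real s))"

definition hardy :: "real \<Rightarrow> (real \<Rightarrow> ennreal) \<Rightarrow> real \<Rightarrow> ennreal" where
  "hardy c h x = (\<integral>\<^sup>+ t. h t \<partial>lebesgue_on {c..x})"

definition bilinear_hardy ::
  "real \<Rightarrow> (real \<Rightarrow> ennreal) \<Rightarrow> (real \<Rightarrow> ennreal) \<Rightarrow> real \<Rightarrow> ennreal" where
  "bilinear_hardy c f g x = hardy c f x * hardy c g x"

definition hardy_const ::
  "real \<Rightarrow> ennreal \<Rightarrow> ennreal \<Rightarrow> real \<Rightarrow> real \<Rightarrow>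
   (real \<Rightarrow> ennreal) \<Rightarrow> (real \<Rightarrow> ennreal) \<Rightarrow> (real \<Rightarrow> ennreal) \<Rightarrow> ennreal" where
  "hardy_const q p1 p2 c d u v1 v2 =
     Inf {C. C < \<infinity> \<and>
       (\<forall>f \<in> borel_measurable (lebesgue_on {c..d}). \<forall>g \<in> borel_measurable (lebesgue_on {c..d}).
          wnorm p1 c d v1 f < \<infinity> \<longrightarrow> wnorm p2 c d v2 g < \<infinity> \<longrightarrow>
          wnorm (ennreal q) c d u (bilinear_hardy c f g)
            \<le> C * wnorm p1 c d v1 f * wnorm p2 c d v2 g)}"

definition conj_exp :: "ennreal \<Rightarrow> real" where
  "conj_exp p = enn2real p / (enn2real p - 1)"

definition inv_esssup :: "real \<Rightarrow> (real \<Rightarrow> ennreal) \<Rightarrow> real \<Rightarrow> ennreal" where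
  "inv_esssup c v x = esssup (lebesgue_on {c<..<x}) (\<lambda>t. inverse (v t))"

text \<open>The profile, meant for weights \<open>v\<close> bounded below by a positive constant; it is then finite,
  nondecreasing and right-continuous on \<open>J\<close>.\<close>

definition profile :: "ennreal \<Rightarrow> real \<Rightarrow> real \<Rightarrow> (real \<Rightarrow> ennreal) \<Rightarrow> real \<Rightarrow> ennreal" where
  "profile p c d v x =
     (if p = \<infinity> then (\<integral>\<^sup>+ t. inverse (v t) \<partial>lebesgue_on {c..x})
      else if p = 1 then
        (if x < d then Lim (at_right x) (inv_esssup c v) else inv_esssup c v d)
      else epow (\<integral>\<^sup>+ t. epow (v t) (1 - conj_exp p) \<partial>lebesgue_on {c..x}) (1 / conj_exp p))"

text \<open>The Stieltjes measure \<open>dG\<close> on \<open>[c,d]\<close>: the distribution function is extended by \<open>0\<close> to the left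
  of \<open>c\<close>, so that \<open>c\<close> carries the mass \<open>G c\<close>, and by \<open>G d\<close> to the right of \<open>d\<close>, so that nothing lies
  outside \<open>[c,d]\<close>.\<close>

definition stieltjes :: "real \<Rightarrow> real \<Rightarrow> (real \<Rightarrow> ennreal) \<Rightarrow> real measure" where
  "stieltjes c d G = interval_measure (\<lambda>x. if x < c then 0 else enn2real (G (min x d)))"

lemma emeasure_stieltjes_Icc:
  assumes "c \<le> x" "x \<le> d"
    and mono: "\<And>x y. c \<le> x \<Longrightarrow> x \<le> y \<Longrightarrow> y \<le> d \<Longrightarrow> G x \<le> G y"
    and fin: "\<And>x. c \<le> x \<Longrightarrow> x \<le> d \<Longrightarrow> G x < \<infinity>"
    and rc: "\<And>x. c \<le> x \<Longrightarrow> x < d \<Longrightarrow> (G \<longlongrightarrow> G x) (at_right x)"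
  shows "emeasure (stieltjes c d G) {c..x} = G x"
proof -
  define F where "F = (\<lambda>x. if x < c then 0 else enn2real (G (min x d)))"
  have cd: "c \<le> d" using assms by simp
  have F_mono: "F a \<le> F b" if "a \<le> b" for a b
    using that cd fin[of "min b d"] mono[of "min a d" "min b d"]
    by (auto simp: F_def min_le_iff_disj intro!: enn2real_mono)
  have F_rc: "continuous (at_right a) F" for a
  proof -
    consider "a < c" | "c \<le> a" "a < d" | "d \<le> a" by linarith
    then have "(F \<longlongrightarrow> F a) (at_right a)"
    proof cases
      case 1
      have "eventually (\<lambda>y. y < c) (at_right a)"
        using 1 eventually_at_right_field by blast
      then have "eventually (\<lambda>y. F y = F a) (at_right a)"
        by eventually_elim (use 1 in \<open>simp add: F_def\<close>)
      then show ?thesis by (rule tendsto_eventually)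
    next
      case 2
      have "((\<lambda>y. enn2real (G y)) \<longlongrightarrow> enn2real (G a)) (at_right a)"
        using rc[OF 2] fin[of a] 2
        by (intro tendsto_enn2real) (auto simp: ennreal_enn2real_if)
      moreover have "eventually (\<lambda>y. a < y \<and> y < d) (at_right a)"
        using 2 eventually_at_right_field by blast
      then have "eventually (\<lambda>y. enn2real (G y) = F y) (at_right a)"
        by eventually_elim (use 2 in \<open>simp add: F_def\<close>)
      ultimately have "(F \<longlongrightarrow> enn2real (G a)) (at_right a)"
        by (rule Lim_transform_eventually)
      then show ?thesis using 2 by (simp add: F_def)
    next
      case 3
      have "eventually (\<lambda>y. a < y) (at_right a)"
        by (simp add: eventually_at_right_less)
      then have "eventually (\<lambda>y. F y = F a) (at_right a)"
        by eventually_elim (use 3 cd in \<open>simp add: F_def\<close>)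
      then show ?thesis by (rule tendsto_eventually)
    qed
    then show ?thesis by (simp add: continuous_within)
  qed
  have fm: "emeasure (interval_measure F) {a<..b} = ennreal (F b - F a)" if "a \<le> b" for a b
    using emeasure_interval_measure_Ioc[OF that F_mono F_rc] by simp
  let ?A = "\<lambda>n. {c - 1 / real (Suc n)<..x}"
  have "(\<lambda>n. emeasure (interval_measure F) (?A n)) \<longlonglongrightarrow> emeasure (interval_measure F) (\<Inter>n. ?A n)"
  proof (rule Lim_emeasure_decseq)
    show "decseq ?A"
    proof (rule decseq_SucI)
      fix n
      have "1 / real (Suc (Suc n)) \<le> 1 / real (Suc n)" by (simp add: field_simps)
      then show "?A (Suc n) \<subseteq> ?A n" by force
    qed
    show "emeasure (interval_measure F) (?A n) \<noteq> \<infinity>" for n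
    proof -
      have "0 \<le> 1 / real (Suc n)" by simp
      then have "c - 1 / real (Suc n) \<le> x" using \<open>c \<le> x\<close> by linarith
      then show ?thesis by (subst fm) auto
    qed
  qed auto
  moreover have "emeasure (interval_measure F) (?A n) = G x" for n
  proof -
    have "c - 1 / real (Suc n) < c" by simp
    then have "F (c - 1 / real (Suc n)) = 0" unfolding F_def by simp
    moreover have "F x = enn2real (G x)" using assms(1,2) by (simp add: F_def)
    moreover have "c - 1 / real (Suc n) \<le> x"
      using \<open>c - 1 / real (Suc n) < c\<close> assms(1) by linarith
    ultimately show ?thesis
      using fin[of x] assms(1,2) by (simp add: fm del: of_nat_Suc)
  qed
  moreover have "(\<Inter>n. ?A n) = {c..x}"
  proof (intro equalityI subsetI)
    fix y assume y: "y \<in> (\<Inter>n. ?A n)"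
    have "c \<le> y"
    proof (rule ccontr)
      assume "\<not> c \<le> y"
      then obtain n where "inverse (real (Suc n)) < c - y"
        using reals_Archimedean[of "c - y"] by auto
      moreover have "c - 1 / real (Suc n) < y" using y by auto
      ultimately show False by (simp add: inverse_eq_divide)
    qed
    then show "y \<in> {c..x}" using y by auto
  next
    fix y assume y: "y \<in> {c..x}"
    have "c - 1 / real (Suc n) < y" for n
    proof -
      have "0 < 1 / real (Suc n)" by simp
      moreover have "c \<le> y" using y by simp
      ultimately show ?thesis by linarith
    qed
    then show "y \<in> (\<Inter>n. ?A n)" using y by auto
  qed
  ultimately have "(\<lambda>n::nat. G x) \<longlonglongrightarrow> emeasure (interval_measure F) {c..x}" by simp
  then have "emeasure (interval_measure F) {c..x} = G x"
    using LIMSEQ_unique tendsto_const by blast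
  then show ?thesis by (simp add: stieltjes_def F_def)
qed

definition r_exp :: "real \<Rightarrow> ennreal \<Rightarrow> real" where
  "r_exp q p = 1 / (1 / q - 1 / enn2real p)"

definition kappa_exp :: "real \<Rightarrow> ennreal \<Rightarrow> ennreal \<Rightarrow> real" where
  "kappa_exp q p1 p2 = 1 / (1 / q - 1 / enn2real p1 - 1 / enn2real p2)"

definition tail :: "real \<Rightarrow> (real \<Rightarrow> ennreal) \<Rightarrow> real \<Rightarrow> ennreal" where
  "tail d w x = (\<integral>\<^sup>+ t. w t \<partial>lebesgue_on {x..d})"

text \<open>The functionals below take the already regularised weight \<open>u\<close> and the profiles
  \<open>\<Phi>1\<close>, \<open>\<Phi>2\<close> of the already regularised weights as arguments.\<close>

definition B1 :: "real \<Rightarrow> real \<Rightarrow> real \<Rightarrow>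
    (real \<Rightarrow> ennreal) \<Rightarrow> (real \<Rightarrow> ennreal) \<Rightarrow> (real \<Rightarrow> ennreal) \<Rightarrow> ennreal" where
  "B1 q c d u \<Phi>1 \<Phi>2 = (SUP x\<in>{c..d}. epow (tail d u x) (1 / q) * \<Phi>1 x * \<Phi>2 x)"

definition B2_hat :: "real \<Rightarrow> ennreal \<Rightarrow> real \<Rightarrow> real \<Rightarrow>
    (real \<Rightarrow> ennreal) \<Rightarrow> (real \<Rightarrow> ennreal) \<Rightarrow> (real \<Rightarrow> ennreal) \<Rightarrow> ennreal" where
  "B2_hat q p2 c d u \<Phi>1 \<Phi>2 =
     (let r2 = r_exp q p2; \<mu>2 = stieltjes c d (\<lambda>t. epow (\<Phi>2 t) r2)
      in SUP x\<in>{c..d}. \<Phi>1 x *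
           epow (\<integral>\<^sup>+ t\<in>{c..d}. epow (tail d u (max x t)) (r2 / q) \<partial>\<mu>2) (1 / r2))"

definition B3_hat :: "real \<Rightarrow> ennreal \<Rightarrow> real \<Rightarrow> real \<Rightarrow>
    (real \<Rightarrow> ennreal) \<Rightarrow> (real \<Rightarrow> ennreal) \<Rightarrow> (real \<Rightarrow> ennreal) \<Rightarrow> ennreal" where
  "B3_hat q p1 c d u \<Phi>1 \<Phi>2 =
     (let r1 = r_exp q p1; \<mu>1 = stieltjes c d (\<lambda>t. epow (\<Phi>1 t) r1)
      in SUP x\<in>{c..d}. \<Phi>2 x *
           epow (\<integral>\<^sup>+ t\<in>{c..d}. epow (tail d u (max x t)) (r1 / q) \<partial>\<mu>1) (1 / r1))"

definition B4 :: "real \<Rightarrow> ennreal \<Rightarrow> real \<Rightarrow> real \<Rightarrow>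
    (real \<Rightarrow> ennreal) \<Rightarrow> (real \<Rightarrow> ennreal) \<Rightarrow> (real \<Rightarrow> ennreal) \<Rightarrow> ennreal" where
  "B4 q p2 c d u \<Phi>1 \<Phi>2 =
     (let r2 = r_exp q p2; \<mu>2 = stieltjes c d (\<lambda>t. epow (\<Phi>2 t) r2)
      in SUP x\<in>{c..d}. \<Phi>1 x *
           epow (\<integral>\<^sup>+ t\<in>{x..d}. epow (tail d u t) (r2 / q) \<partial>\<mu>2) (1 / r2))"

definition B5 :: "real \<Rightarrow> ennreal \<Rightarrow> real \<Rightarrow> real \<Rightarrow>
    (real \<Rightarrow> ennreal) \<Rightarrow> (real \<Rightarrow> ennreal) \<Rightarrow> (real \<Rightarrow> ennreal) \<Rightarrow> ennreal" where
  "B5 q p1 c d u \<Phi>1 \<Phi>2 =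
     (let r1 = r_exp q p1; \<mu>1 = stieltjes c d (\<lambda>t. epow (\<Phi>1 t) r1)
      in SUP x\<in>{c..d}. \<Phi>2 x *
           epow (\<integral>\<^sup>+ t\<in>{x<..d}. epow (tail d u t) (r1 / q) \<partial>\<mu>1) (1 / r1))"

definition B6 :: "real \<Rightarrow> ennreal \<Rightarrow> ennreal \<Rightarrow> real \<Rightarrow> real \<Rightarrow>
    (real \<Rightarrow> ennreal) \<Rightarrow> (real \<Rightarrow> ennreal) \<Rightarrow> (real \<Rightarrow> ennreal) \<Rightarrow> ennreal" where
  "B6 q p1 p2 c d u \<Phi>1 \<Phi>2 =
     (let r2 = r_exp q p2; \<kappa> = kappa_exp q p1 p2; \<mu>2 = stieltjes c d (\<lambda>t. epow (\<Phi>2 t) r2)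
      in epow (\<integral>\<^sup>+ x\<in>{c..d}.
                 epow (\<integral>\<^sup>+ t\<in>{x..d}. epow (tail d u t) (r2 / q) \<partial>\<mu>2) (\<kappa> / r2)
               \<partial>stieltjes c d (\<lambda>x. epow (\<Phi>1 x) \<kappa>)) (1 / \<kappa>))"

definition B7 :: "real \<Rightarrow> ennreal \<Rightarrow> ennreal \<Rightarrow> real \<Rightarrow> real \<Rightarrow>
    (real \<Rightarrow> ennreal) \<Rightarrow> (real \<Rightarrow> ennreal) \<Rightarrow> (real \<Rightarrow> ennreal) \<Rightarrow> ennreal" where
  "B7 q p1 p2 c d u \<Phi>1 \<Phi>2 =
     (let r1 = r_exp q p1; \<kappa> = kappa_exp q p1 p2; \<mu>1 = stieltjes c d (\<lambda>t. epow (\<Phi>1 t) r1)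
      in epow (\<integral>\<^sup>+ x\<in>{c..d}.
                 epow (\<integral>\<^sup>+ t\<in>{x<..d}. epow (tail d u t) (r1 / q) \<partial>\<mu>1) (\<kappa> / r1)
               \<partial>stieltjes c d (\<lambda>x. epow (\<Phi>2 x) \<kappa>)) (1 / \<kappa>))"

definition B_inf_2 :: "real \<Rightarrow> ennreal \<Rightarrow> real \<Rightarrow> real \<Rightarrow>
    (real \<Rightarrow> ennreal) \<Rightarrow> (real \<Rightarrow> ennreal) \<Rightarrow> (real \<Rightarrow> ennreal) \<Rightarrow> ennreal" where
  "B_inf_2 q p2 c d u \<Phi>1 \<Phi>2 =
     (let W1 = tail d (\<lambda>t. epow (\<Phi>1 t) q * u t); r2 = r_exp q p2
      in if p2 \<le> ennreal q then SUP x\<in>{c..d}. \<Phi>2 x * epow (W1 x) (1 / q)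
         else epow (\<integral>\<^sup>+ x\<in>{c..d}. epow (W1 x) (r2 / q)
                     \<partial>stieltjes c d (\<lambda>x. epow (\<Phi>2 x) r2)) (1 / r2))"

definition B_1_inf :: "real \<Rightarrow> ennreal \<Rightarrow> real \<Rightarrow> real \<Rightarrow>
    (real \<Rightarrow> ennreal) \<Rightarrow> (real \<Rightarrow> ennreal) \<Rightarrow> (real \<Rightarrow> ennreal) \<Rightarrow> ennreal" where
  "B_1_inf q p1 c d u \<Phi>1 \<Phi>2 =
     (let W2 = tail d (\<lambda>t. epow (\<Phi>2 t) q * u t); r1 = r_exp q p1
      in if p1 \<le> ennreal q then SUP x\<in>{c..d}. \<Phi>1 x * epow (W2 x) (1 / q)
         else epow (\<integral>\<^sup>+ x\<in>{c..d}. epow (W2 x) (r1 / q)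
                     \<partial>stieltjes c d (\<lambda>x. epow (\<Phi>1 x) r1)) (1 / r1))"

definition B_inf_inf :: "real \<Rightarrow> real \<Rightarrow> real \<Rightarrow>
    (real \<Rightarrow> ennreal) \<Rightarrow> (real \<Rightarrow> ennreal) \<Rightarrow> (real \<Rightarrow> ennreal) \<Rightarrow> ennreal" where
  "B_inf_inf q c d u \<Phi>1 \<Phi>2 =
     epow (\<integral>\<^sup>+ x. epow (\<Phi>1 x * \<Phi>2 x) q * u x \<partial>lebesgue_on {c..d}) (1 / q)"

definition reg_u :: "nat \<Rightarrow> (real \<Rightarrow> ennreal) \<Rightarrow> real \<Rightarrow> ennreal" where
  "reg_u m u t = min (u t) (of_nat m)"

definition reg_v :: "nat \<Rightarrow> (real \<Rightarrow> ennreal) \<Rightarrow> real \<Rightarrow> ennreal" where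
  "reg_v m v t = v t + ennreal (1 / real m)"

definition reg_char :: "real \<Rightarrow> ennreal \<Rightarrow> ennreal \<Rightarrow> real \<Rightarrow> real \<Rightarrow>
    (real \<Rightarrow> ennreal) \<Rightarrow> (real \<Rightarrow> ennreal) \<Rightarrow> (real \<Rightarrow> ennreal) \<Rightarrow> nat \<Rightarrow> ennreal" where
  "reg_char q p1 p2 c d u v1 v2 m =
     (let um = reg_u m u;
          \<Phi>1 = profile p1 c d (reg_v m v1);
          \<Phi>2 = profile p2 c d (reg_v m v2)
      in if p1 < \<infinity> \<and> p2 < \<infinity> \<and> p1 \<le> ennreal q \<and> p2 \<le> ennreal q then B1 q c d um \<Phi>1 \<Phi>2
         else if p1 \<le> ennreal q \<and> ennreal q < p2 \<and> p2 < \<infinity> then B2_hat q p2 c d um \<Phi>1 \<Phi>2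
         else if p2 \<le> ennreal q \<and> ennreal q < p1 \<and> p1 < \<infinity> then B3_hat q p1 c d um \<Phi>1 \<Phi>2
         else if p1 < \<infinity> \<and> p2 < \<infinity> \<and> ennreal q < min p1 p2 \<and> 1 / ennreal q \<le> 1 / p1 + 1 / p2
           then B4 q p2 c d um \<Phi>1 \<Phi>2 + B5 q p1 c d um \<Phi>1 \<Phi>2
         else if p1 < \<infinity> \<and> p2 < \<infinity> \<and> ennreal q < min p1 p2 \<and> 1 / ennreal q > 1 / p1 + 1 / p2
           then B6 q p1 p2 c d um \<Phi>1 \<Phi>2 + B7 q p1 p2 c d um \<Phi>1 \<Phi>2
         else if p1 = \<infinity> \<and> p2 < \<infinity> then B_inf_2 q p2 c d um \<Phi>1 \<Phi>2
         else if p1 < \<infinity> \<and> p2 = \<infinity> then B_1_inf q p1 c d um \<Phi>1 \<Phi>2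
         else B_inf_inf q c d um \<Phi>1 \<Phi>2)"

definition op_char :: "real \<Rightarrow> ennreal \<Rightarrow> ennreal \<Rightarrow> real \<Rightarrow> real \<Rightarrow>
    (real \<Rightarrow> ennreal) \<Rightarrow> (real \<Rightarrow> ennreal) \<Rightarrow> (real \<Rightarrow> ennreal) \<Rightarrow> ennreal" where
  "op_char q p1 p2 c d u v1 v2 = (SUP m\<in>{1..}. reg_char q p1 p2 c d u v1 v2 m)"

end

theory Submission
  imports Defs
begin

text \<open>
  The inequality is first freed of its infinities. It holds with a constant \<open>C\<close> for the weights
  \<open>u\<close>, \<open>v1\<close>, \<open>v2\<close> if and only if it holds with \<open>C\<close> for all regularised weights \<open>u \<and> m\<close>,
  \<open>v1 + 1/m\<close>, \<open>v2 + 1/m\<close>: enlarging the \<open>v\<close>'s and reducing \<open>u\<close> weakens it, and conversely one tests it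
  with bounded functions, lets \<open>m\<close> tend to infinity and removes the truncations by monotone
  convergence (\<open>hardy_ineq_reg\<close>, \<open>hardy_ineq_of_reg\<close>). So it is enough to find, with constants
  depending on the exponents only, the best constant for a bounded weight \<open>u\<close> and weights \<open>v1\<close>,
  \<open>v2\<close> bounded below. Then the profiles \<open>\<Phi>1\<close>, \<open>\<Phi>2\<close> are finite and the tail \<open>U(x) = \<integral>\<^sub>x\<^sup>d u\<close> is
  finite and continuous.

  Continuity of \<open>U\<close> provides, if \<open>U(c) > 0\<close>, points \<open>c = z\<^sub>0 < z\<^sub>1 < \<dots>\<close> with \<open>U(z\<^sub>k) = 2\<^sup>-\<^sup>k U(c)\<close>. Put
  \<open>U\<^sub>k = U(z\<^sub>k)\<close>, \<open>\<phi>\<^sub>k = \<Phi>1(z\<^sub>k)\<close> and \<open>\<psi>\<^sub>k = \<Phi>2(z\<^sub>k)\<close>. The inequality for functions is equivalent to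
  one for sequences \<open>\<alpha>, \<beta> \<ge> 0\<close>:
  \<open>(\<Sum>\<^sub>k U\<^sub>k (A\<^sub>k B\<^sub>k)\<^sup>q)\<^sup>1\<^sup>/\<^sup>q \<le> D |\<alpha>|\<^sub>p\<^sub>1 |\<beta>|\<^sub>p\<^sub>2\<close>, where \<open>A\<^sub>k = max\<^sub>i\<^sub>\<le>\<^sub>k \<alpha>\<^sub>i \<phi>\<^sub>i\<close> and
  \<open>B\<^sub>k = max\<^sub>j\<^sub>\<le>\<^sub>k \<beta>\<^sub>j \<psi>\<^sub>j\<close>. In one direction, the points where a primitive \<open>Hf\<close> doubles and the Hoelder
  inequality between two of them produce \<open>\<alpha>\<close> with \<open>Hf(z\<^sub>k) \<le> 4 A\<^sub>k\<close> and \<open>|\<alpha>|\<^sub>p\<^sub>1 \<le> \<parallel>f\<parallel>\<close>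
  (\<open>records_dominate\<close>). In the other, \<open>f = max\<^sub>i \<alpha>\<^sub>i f\<^sub>i\<close>, with \<open>f\<^sub>i\<close> nearly extremal for the Hoelder
  inequality on \<open>[c, z\<^sub>i]\<close>, has norm at most \<open>|\<alpha>|\<^sub>p\<^sub>1\<close> although the \<open>f\<^sub>i\<close> overlap, because
  \<open>max\<^sub>i (\<alpha>\<^sub>i f\<^sub>i)\<^sup>p \<le> \<Sum>\<^sub>i (\<alpha>\<^sub>i f\<^sub>i)\<^sup>p\<close>. The same argument covers \<open>p = 1\<close> and \<open>q < 1\<close>
  (\<open>hardy_system_hardy_ops\<close>).

  The discrete inequality splits. Of two indices at which \<open>A\<^sub>k\<close> and \<open>B\<^sub>k\<close> are attained one is the
  larger, and since \<open>U\<^sub>k\<close> is geometric the left side is comparable to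
  \<open>\<Sum>\<^sub>j U\<^sub>j (A\<^sub>j \<beta>\<^sub>j \<psi>\<^sub>j)\<^sup>q + \<Sum>\<^sub>i U\<^sub>i (B\<^sub>i \<alpha>\<^sub>i \<phi>\<^sub>i)\<^sup>q\<close> (\<open>runmax_product_split\<close>). In the first sum \<open>\<beta>\<close> is
  removed by duality. If \<open>p2 \<le> q\<close> there remains the supremum of \<open>U\<^sub>j\<^sup>1\<^sup>/\<^sup>q \<phi>\<^sub>j \<psi>\<^sub>j\<close>; if \<open>q < p2\<close>, the
  linear inequality \<open>|A w|\<^sub>r\<^sub>2 \<le> D |\<alpha>|\<^sub>p\<^sub>1\<close> with \<open>w\<^sub>j = U\<^sub>j\<^sup>1\<^sup>/\<^sup>q \<psi>\<^sub>j\<close>. Its constant is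
  \<open>sup\<^sub>i \<phi>\<^sub>i (\<Sum>\<^sub>j\<^sub>\<ge>\<^sub>i w\<^sub>j\<^sup>r\<^sup>2)\<^sup>1\<^sup>/\<^sup>r\<^sup>2\<close> if \<open>p1 \<le> r2\<close>, that is \<open>1/q \<le> 1/p1 + 1/p2\<close>, and otherwise an
  \<open>l\<^sup>\<kappa>\<close> norm, whose necessity needs a second dyadic decomposition, of the tails of \<open>\<Sum> w\<^sub>j\<^sup>r\<^sup>2\<close>
  (\<open>runmax_lower_levels\<close>).

  It remains to recognise these numbers. Since \<open>\<Phi>2(z\<^sub>j)\<^sup>r\<^sup>2\<close> is the \<open>d(\<Phi>2\<^sup>r\<^sup>2)\<close> measure of \<open>[c, z\<^sub>j]\<close>
  and \<open>U\<^sub>j\<close> is geometric, sums over the grid turn into the Stieltjes integrals over \<open>[x, d]\<close>, up to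
  a term \<open>U(x)\<^sup>1\<^sup>/\<^sup>q \<Phi>1(x) \<Phi>2(x)\<close>. Where the characteristic is a sum of two terms this diagonal term
  is absorbed by them: if \<open>y\<close> is the first place where \<open>\<Phi>1\<close> reaches half of \<open>\<Phi>1(x)\<close>, then \<open>\<Phi>2\<close>
  either gains half of its value from \<open>y\<close> on or has half of it strictly before \<open>y\<close>
  (\<open>profile_split\<close>). This is why one of the two integrals is over a closed interval and the other
  over a half-open one.

  If \<open>p1 = \<infinity>\<close>, then \<open>f = 1/v1\<close> is extremal at every point, and the inequality is the linear one for
  the weight \<open>\<Phi>1\<^sup>q u\<close>, which is the bilinear one for constant first factors, profile \<open>1\<close> and exponent
  \<open>q\<close>. If both exponents are infinite, both extremals are exact and the constants are \<open>1\<close>.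
\<close>

section \<open>Finite sequences: power norms and running maxima\<close>

text \<open>
  The power norm over a finite index set; for exponents below one it is only a quasi-norm, which
  suffices because only Hoelder's inequality, its converse and the inclusion of these spaces are used.
\<close>

definition lpn :: "'a set \<Rightarrow> real \<Rightarrow> ('a \<Rightarrow> real) \<Rightarrow> real" where
  "lpn S a x = (\<Sum>i\<in>S. x i powr a) powr (1 / a)"

lemma lpn_nonneg [simp]: "0 \<le> lpn S a x"
  by (simp add: lpn_def)

lemma lpn_powr: "a \<noteq> 0 \<Longrightarrow> lpn S a x powr a = (\<Sum>i\<in>S. x i powr a)"
  by (simp add: lpn_def powr_powr sum_nonneg)

lemma lpn_mono:
  assumes "0 < a" "\<And>i. i \<in> S \<Longrightarrow> 0 \<le> x i" "\<And>i. i \<in> S \<Longrightarrow> x i \<le> y i"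
  shows "lpn S a x \<le> lpn S a y"
  unfolding lpn_def using assms by (intro powr_mono2 sum_mono sum_nonneg) auto

lemma lpn_cmult:
  assumes "0 < a" "0 \<le> M" "\<And>i. i \<in> S \<Longrightarrow> 0 \<le> x i"
  shows "lpn S a (\<lambda>i. M * x i) = M * lpn S a x"
proof -
  have "(\<Sum>i\<in>S. (M * x i) powr a) = M powr a * (\<Sum>i\<in>S. x i powr a)"
    using assms by (simp add: powr_mult sum_distrib_left)
  then show ?thesis using assms by (simp add: lpn_def powr_mult powr_powr sum_nonneg)
qed

lemma lpn_le_powrD:
  assumes "0 < a" "lpn S a x \<le> M"
  shows "(\<Sum>i\<in>S. x i powr a) \<le> M powr a"
proof -
  have "lpn S a x powr a \<le> M powr a" using assms by (intro powr_mono2) auto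
  then show ?thesis using assms by (simp add: lpn_powr)
qed

lemma lpn_leI:
  assumes "0 < a" "0 \<le> M" "(\<Sum>i\<in>S. x i powr a) \<le> M powr a"
  shows "lpn S a x \<le> M"
proof -
  have "lpn S a x \<le> (M powr a) powr (1/a)" unfolding lpn_def
    using assms by (intro powr_mono2 sum_nonneg) auto
  then show ?thesis using assms by (simp add: powr_powr)
qed

lemma member_le_lpn:
  assumes "finite S" "i \<in> S" "0 < a" "0 \<le> x i"
  shows "x i \<le> lpn S a x"
proof -
  have "x i powr a \<le> (\<Sum>i\<in>S. x i powr a)" using assms by (intro member_le_sum) auto
  then have "(x i powr a) powr (1/a) \<le> lpn S a x" unfolding lpn_def using assms
    by (intro powr_mono2) auto
  then show ?thesis using assms by (simp add: powr_powr)
qed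

lemma lpn_Holder:
  assumes fin: "finite S" and pos: "0 < a" "0 < b" "0 < e" and conj: "1 / e = 1 / a + 1 / b"
    and x: "\<And>i. i \<in> S \<Longrightarrow> 0 \<le> x i" and y: "\<And>i. i \<in> S \<Longrightarrow> 0 \<le> y i"
  shows "lpn S e (\<lambda>i. x i * y i) \<le> lpn S a x * lpn S b y"
proof -
  define X where "X = (\<Sum>i\<in>S. x i powr a)"
  define Y where "Y = (\<Sum>i\<in>S. y i powr b)"
  have X0: "0 \<le> X" and Y0: "0 \<le> Y" by (simp_all add: X_def Y_def sum_nonneg)
  have one: "e / a + e / b = 1"
  proof -
    have "e * (1 / e) = e * (1 / a + 1 / b)" using conj by simp
    then show ?thesis using pos by (simp add: distrib_left)
  qed
  consider "X = 0" | "Y = 0" | "0 < X" "0 < Y" using X0 Y0 by fastforce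
  then have "(\<Sum>i\<in>S. (x i * y i) powr e) \<le> X powr (e/a) * Y powr (e/b)"
  proof cases
    case 1
    then have "\<forall>i\<in>S. x i powr a = 0" using fin by (simp add: X_def sum_nonneg_eq_0_iff)
    then show ?thesis by simp
  next
    case 2
    then have "\<forall>i\<in>S. y i powr b = 0" using fin by (simp add: Y_def sum_nonneg_eq_0_iff)
    then show ?thesis by simp
  next
    case 3
    have "(x i * y i) powr e \<le>
          X powr (e/a) * Y powr (e/b) * (e / a * (x i powr a / X) + e / b * (y i powr b / Y))"
      if i: "i \<in> S" for i
    proof -
      have *: "(x i powr a / X) powr (e/a) * (y i powr b / Y) powr (e/b)
            \<le> e / a * (x i powr a / X) + e / b * (y i powr b / Y)"
      proof (cases "x i = 0 \<or> y i = 0")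
        case True
        then show ?thesis using pos 3 by auto
      next
        case False
        then show ?thesis using one pos 3 by (intro Youngs_inequality_0) auto
      qed
      have "(x i * y i) powr e =
        X powr (e/a) * Y powr (e/b) * ((x i powr a / X) powr (e/a) * (y i powr b / Y) powr (e/b))"
        using 3 pos x[OF i] y[OF i] by (simp add: powr_divide powr_powr powr_mult)
      also have "\<dots> \<le> X powr (e/a) * Y powr (e/b) * (e / a * (x i powr a / X) + e / b * (y i powr b / Y))"
        using * by (intro mult_left_mono) auto
      finally show ?thesis .
    qed
    then have "(\<Sum>i\<in>S. (x i * y i) powr e) \<le>
        (\<Sum>i\<in>S. X powr (e/a) * Y powr (e/b) * (e / a * (x i powr a / X) + e / b * (y i powr b / Y)))"
      by (rule sum_mono)
    also have "\<dots> = X powr (e/a) * Y powr (e/b) * (e / a * (X / X) + e / b * (Y / Y))"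
      by (simp add: X_def Y_def sum.distrib sum_distrib_left[symmetric] sum_divide_distrib[symmetric])
    also have "\<dots> = X powr (e/a) * Y powr (e/b)" using 3 one by simp
    finally show ?thesis .
  qed
  then have "lpn S e (\<lambda>i. x i * y i) \<le> (X powr (e/a) * Y powr (e/b)) powr (1/e)"
    unfolding lpn_def using pos by (intro powr_mono2 sum_nonneg) auto
  also have "\<dots> = lpn S a x * lpn S b y"
    using pos by (simp add: lpn_def X_def Y_def powr_mult powr_powr)
  finally show ?thesis .
qed

lemma lpn_antimono_exponent:
  assumes fin: "finite S" and ab: "0 < a" "a \<le> b" and x: "\<And>i. i \<in> S \<Longrightarrow> 0 \<le> x i"
  shows "lpn S b x \<le> lpn S a x"
proof (rule lpn_leI)
  let ?X = "lpn S a x"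
  have "x i powr b \<le> x i powr a * ?X powr (b - a)" if "i \<in> S" for i
  proof -
    have "x i powr (b - a) \<le> ?X powr (b - a)"
      using member_le_lpn[OF fin that ab(1)] x[OF that] ab by (intro powr_mono2) auto
    then have "x i powr a * x i powr (b - a) \<le> x i powr a * ?X powr (b - a)"
      by (intro mult_left_mono) auto
    then show ?thesis by (simp add: powr_add[symmetric])
  qed
  then have "(\<Sum>i\<in>S. x i powr b) \<le> (\<Sum>i\<in>S. x i powr a * ?X powr (b - a))" by (rule sum_mono)
  also have "\<dots> = ?X powr a * ?X powr (b - a)" using ab by (simp add: sum_distrib_right lpn_powr)
  also have "\<dots> = ?X powr b" by (simp add: powr_add[symmetric])
  finally show "(\<Sum>i\<in>S. x i powr b) \<le> ?X powr b" .
qed (use ab in auto)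

lemma sum_powr_le_powr_sum:
  fixes x :: "'a \<Rightarrow> real" and s :: real
  assumes "finite S" "1 \<le> s" "\<And>i. i \<in> S \<Longrightarrow> 0 \<le> x i"
  shows "(\<Sum>i\<in>S. x i powr s) \<le> (\<Sum>i\<in>S. x i) powr s"
  using lpn_le_powrD[OF _ lpn_antimono_exponent[of S 1 s x]] assms
  by (simp add: lpn_def sum_nonneg)

text \<open>
  The sequence \<open>\<beta> = y\<^sup>r\<^sup>/\<^sup>p\<close> turns Hoelder's inequality into an
  equality, so testing with it recovers the norm of \<open>y\<close>.
\<close>

lemma lpn_converse_Holder:
  assumes fin: "finite S" and pos: "0 < q" "0 < r" "0 < p" and conj: "1 / q = 1 / r + 1 / p"
    and y: "\<And>i. i \<in> S \<Longrightarrow> 0 \<le> y i" and E: "0 \<le> E"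
    and bound: "\<And>\<beta>. (\<And>i. 0 \<le> \<beta> i) \<Longrightarrow> lpn S q (\<lambda>i. y i * \<beta> i) \<le> E * lpn S p \<beta>"
  shows "lpn S r y \<le> E"
proof (cases "(\<Sum>i\<in>S. y i powr r) = 0")
  case True
  then show ?thesis using E by (simp add: lpn_def)
next
  case False
  define T where "T = (\<Sum>i\<in>S. y i powr r)"
  have T: "0 < T" using False by (simp add: T_def sum_nonneg less_le)
  have rq: "q + r / p * q = r"
  proof -
    have "q * r * (1 / q) = q * r * (1 / r + 1 / p)" using conj by simp
    then show ?thesis using pos by (simp add: algebra_simps)
  qed
  have "lpn S q (\<lambda>i. y i * y i powr (r / p)) = T powr (1 / q)"
  proof -
    have "(y i * y i powr (r / p)) powr q = y i powr r" if "i \<in> S" for i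
    proof (cases "y i = 0")
      case False
      then have "y i * y i powr (r/p) = y i powr (1 + r/p)" using y[OF that] by (simp add: powr_add)
      moreover have "(1 + r/p) * q = r" using rq by (simp add: algebra_simps)
      ultimately show ?thesis by (simp add: powr_powr)
    qed simp
    then show ?thesis by (simp add: lpn_def T_def)
  qed
  moreover have "lpn S p (\<lambda>i. y i powr (r / p)) = T powr (1 / p)"
    using pos by (simp add: lpn_def T_def powr_powr)
  ultimately have "T powr (1 / q) \<le> E * T powr (1 / p)"
    using bound[of "\<lambda>i. y i powr (r / p)"] by simp
  moreover have "T powr (1 / q) = T powr (1 / r) * T powr (1 / p)"
    using conj by (simp add: powr_add)
  ultimately have "T powr (1 / r) \<le> E" using T by simp
  then show ?thesis by (simp add: lpn_def T_def)
qed

definition runmax :: "(nat \<Rightarrow> real) \<Rightarrow> (nat \<Rightarrow> real) \<Rightarrow> nat \<Rightarrow> real" where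
  "runmax \<alpha> \<phi> k = Max ((\<lambda>i. \<alpha> i * \<phi> i) ` {..k})"

lemma le_runmax: "i \<le> k \<Longrightarrow> \<alpha> i * \<phi> i \<le> runmax \<alpha> \<phi> k"
  unfolding runmax_def by (intro Max_ge) auto

lemma runmax_attained: "\<exists>i\<le>k. runmax \<alpha> \<phi> k = \<alpha> i * \<phi> i"
proof -
  have "runmax \<alpha> \<phi> k \<in> (\<lambda>i. \<alpha> i * \<phi> i) ` {..k}" unfolding runmax_def by (intro Max_in) auto
  then show ?thesis by auto
qed

lemma runmax_mono: "k \<le> l \<Longrightarrow> runmax \<alpha> \<phi> k \<le> runmax \<alpha> \<phi> l"
  unfolding runmax_def by (intro Max_mono) auto

lemma runmax_nonneg: "(\<And>i. 0 \<le> \<alpha> i) \<Longrightarrow> (\<And>i. 0 \<le> \<phi> i) \<Longrightarrow> 0 \<le> runmax \<alpha> \<phi> k"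
  using runmax_attained[of k \<alpha> \<phi>] by auto

text \<open>
  Geometric decay: the first term dominates the sum, whatever its length.
\<close>

lemma halving_sum:
  fixes a :: "nat \<Rightarrow> real"
  assumes "\<And>j. 0 \<le> a j" "\<And>j. a (Suc j) \<le> a j / 2"
  shows "(\<Sum>j=i..N. a j) \<le> 2 * a i"
proof (cases "i \<le> N")
  case True
  then have "(\<Sum>j=i..N. a j) + a N \<le> 2 * a i"
  proof (induction N rule: dec_induct)
    case (step n)
    then show ?case using assms(2)[of n] by simp
  qed simp
  then show ?thesis using assms(1)[of N] by linarith
qed (use assms(1)[of i] in simp)

lemma sum_triangle_swap:
  fixes f :: "nat \<Rightarrow> nat \<Rightarrow> real"
  shows "(\<Sum>k\<le>N. \<Sum>j\<le>k. f k j) = (\<Sum>j\<le>N. \<Sum>k=j..N. f k j)"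
proof -
  have "(\<Sum>k\<le>N. \<Sum>j\<le>k. f k j) = (\<Sum>k\<le>N. \<Sum>j\<le>N. if j \<le> k then f k j else 0)"
    by (intro sum.cong refl sum.mono_neutral_cong_left) auto
  also have "\<dots> = (\<Sum>j\<le>N. \<Sum>k\<le>N. if j \<le> k then f k j else 0)" by (rule sum.swap)
  also have "\<dots> = (\<Sum>j\<le>N. \<Sum>k=j..N. f k j)"
    by (intro sum.cong refl sum.mono_neutral_cong_right) auto
  finally show ?thesis .
qed

lemma powr_add_le:
  fixes x y :: real
  assumes "0 \<le> x" "0 \<le> y" "0 < e"
  shows "(x + y) powr e \<le> 2 powr e * (x powr e + y powr e)"
proof -
  have "(x + y) powr e \<le> (2 * max x y) powr e" using assms by (intro powr_mono2) auto
  also have "\<dots> = 2 powr e * max x y powr e" using assms by (simp add: powr_mult)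
  also have "max x y powr e \<le> x powr e + y powr e" by (auto simp: max_def)
  finally show ?thesis by simp
qed

text \<open>
  Let \<open>A\<^sub>k\<close> be attained at \<open>i \<le> k\<close> and \<open>B\<^sub>k\<close> at
  \<open>j \<le> k\<close>. If \<open>i \<le> j\<close>, then \<open>A\<^sub>k \<le>
  A\<^sub>j\<close>, so the product is at most \<open>A\<^sub>j \<beta>\<^sub>j
  \<psi>\<^sub>j\<close>; otherwise the roles are exchanged. Summing over \<open>k \<ge> j\<close>
  costs only a factor 2, because the weights at least halve at each step. The two halves are treated
  separately from here on.
\<close>

lemma runmax_product_split:
  assumes nn: "\<And>i. 0 \<le> \<alpha> i" "\<And>i. 0 \<le> \<beta> i" "\<And>i. 0 \<le> \<phi> i" "\<And>i. 0 \<le> \<psi> i"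
    and U: "\<And>j. 0 \<le> U j" "\<And>j. U (Suc j) \<le> U j / 2" and q: "0 < q"
  shows "lpn {..N} q (\<lambda>k. U k powr (1/q) * (runmax \<alpha> \<phi> k * runmax \<beta> \<psi> k)) \<le>
     4 powr (1/q) * (lpn {..N} q (\<lambda>j. runmax \<alpha> \<phi> j * (U j powr (1/q) * \<psi> j) * \<beta> j)
          + lpn {..N} q (\<lambda>j. runmax \<beta> \<psi> j * (U j powr (1/q) * \<phi> j) * \<alpha> j))"
proof -
  let ?A = "runmax \<alpha> \<phi>" and ?B = "runmax \<beta> \<psi>"
  define s where "s j = (?A j * (\<beta> j * \<psi> j)) powr q + (?B j * (\<alpha> j * \<phi> j)) powr q" for j
  have A0: "0 \<le> ?A k" and B0: "0 \<le> ?B k" for k using nn by (simp_all add: runmax_nonneg)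
  have s0: "0 \<le> s j" for j by (simp add: s_def)
  have pt: "(?A k * ?B k) powr q \<le> (\<Sum>j\<le>k. s j)" for k
  proof -
    obtain i where i: "i \<le> k" "?A k = \<alpha> i * \<phi> i" using runmax_attained by blast
    obtain j where j: "j \<le> k" "?B k = \<beta> j * \<psi> j" using runmax_attained by blast
    have "\<exists>l\<le>k. (?A k * ?B k) powr q \<le> s l"
    proof (cases "i \<le> j")
      case True
      then have "?A k \<le> ?A j" using le_runmax[of i j \<alpha> \<phi>] i by simp
      then have "?A k * ?B k \<le> ?A j * (\<beta> j * \<psi> j)" using j nn by (simp add: mult_right_mono)
      then have "(?A k * ?B k) powr q \<le> s j" unfolding s_def using A0[of k] B0[of k] q
        by (intro add_increasing2 powr_mono2) auto
      then show ?thesis using j by blast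
    next
      case False
      then have "?B k \<le> ?B i" using le_runmax[of j i \<beta> \<psi>] j by simp
      then have "?A k * ?B k \<le> ?B i * (\<alpha> i * \<phi> i)" unfolding i(2) mult.commute[of "\<alpha> i * \<phi> i"]
        using nn by (intro mult_right_mono) auto
      then have "(?A k * ?B k) powr q \<le> s i" unfolding s_def using A0[of k] B0[of k] q
        by (intro add_increasing powr_mono2) auto
      then show ?thesis using i by blast
    qed
    then obtain l where l: "l \<le> k" "(?A k * ?B k) powr q \<le> s l" by blast
    have "s l \<le> (\<Sum>j\<le>k. s j)" using l s0 by (intro member_le_sum) auto
    then show ?thesis using l by linarith
  qed
  have Uq: "(U k powr (1/q) * x) powr q = U k * x powr q" if "0 \<le> x" for k x
    using U(1)[of k] q that by (simp add: powr_mult powr_powr)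
  let ?X = "\<lambda>j. ?A j * (U j powr (1/q) * \<psi> j) * \<beta> j" and ?Y = "\<lambda>j. ?B j * (U j powr (1/q) * \<phi> j) * \<alpha> j"
  have X: "U j * (?A j * (\<beta> j * \<psi> j)) powr q = ?X j powr q" for j
    using Uq[of "?A j * (\<beta> j * \<psi> j)" j] A0[of j] nn by (simp add: mult_ac)
  have Y: "U j * (?B j * (\<alpha> j * \<phi> j)) powr q = ?Y j powr q" for j
    using Uq[of "?B j * (\<alpha> j * \<phi> j)" j] B0[of j] nn by (simp add: mult_ac)
  have "(\<Sum>k\<le>N. (U k powr (1/q) * (?A k * ?B k)) powr q) = (\<Sum>k\<le>N. U k * (?A k * ?B k) powr q)"
    using A0 B0 by (simp add: Uq)
  also have "\<dots> \<le> (\<Sum>k\<le>N. U k * (\<Sum>j\<le>k. s j))" using pt U(1) by (intro sum_mono mult_left_mono)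
  also have "\<dots> = (\<Sum>j\<le>N. (\<Sum>k=j..N. U k) * s j)"
    by (simp add: sum_distrib_left sum_distrib_right sum_triangle_swap)
  also have "\<dots> \<le> (\<Sum>j\<le>N. (2 * U j) * s j)"
    using halving_sum[of U, OF U] s0 by (intro sum_mono mult_right_mono)
  also have "\<dots> = 2 * ((\<Sum>j\<le>N. ?X j powr q) + (\<Sum>j\<le>N. ?Y j powr q))"
    by (simp add: s_def distrib_left mult.assoc X Y sum.distrib sum_distrib_left)
  finally have "lpn {..N} q (\<lambda>k. U k powr (1/q) * (?A k * ?B k)) \<le>
     (2 * ((\<Sum>j\<le>N. ?X j powr q) + (\<Sum>j\<le>N. ?Y j powr q))) powr (1/q)"
    unfolding lpn_def using q by (intro powr_mono2) (auto simp: sum_nonneg)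
  also have "\<dots> = 2 powr (1/q) * ((\<Sum>j\<le>N. ?X j powr q) + (\<Sum>j\<le>N. ?Y j powr q)) powr (1/q)"
    by (rule powr_mult)
  also have "\<dots> \<le> 2 powr (1/q) * (2 powr (1/q) * (lpn {..N} q ?X + lpn {..N} q ?Y))"
    unfolding lpn_def using q by (intro mult_left_mono powr_add_le sum_nonneg) auto
  also have "\<dots> = 4 powr (1/q) * (lpn {..N} q ?X + lpn {..N} q ?Y)"
    using powr_mult[of 2 2 "1/q"] by simp
  finally show ?thesis .
qed

text \<open>
  For \<open>p2 \<le> q\<close> the norm of \<open>\<beta>\<close> in \<open>l\<^sup>q\<close> is at
  most the one in \<open>l\<^sup>p\<^sup>2\<close>, and \<open>A\<^sub>j \<le> |\<alpha>|
  \<phi>\<^sub>j\<close> by monotonicity of \<open>\<phi>\<close>.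
\<close>

lemma runmax_half_bound_sup:
  assumes nn: "\<And>i. 0 \<le> \<alpha> i" "\<And>i. 0 \<le> \<beta> i" "\<And>i. 0 \<le> \<phi> i" "\<And>i. 0 \<le> \<psi> i" "\<And>i. 0 \<le> U i"
    and \<phi>: "mono \<phi>" and p: "0 < p1" "0 < p2" "p2 \<le> q"
    and M: "\<And>i. i \<le> N \<Longrightarrow> U i powr (1/q) * \<phi> i * \<psi> i \<le> M"
  shows "lpn {..N} q (\<lambda>j. runmax \<alpha> \<phi> j * (U j powr (1/q) * \<psi> j) * \<beta> j)
     \<le> M * lpn {..N} p1 \<alpha> * lpn {..N} p2 \<beta>"
proof -
  let ?a = "lpn {..N} p1 \<alpha>"
  have q: "0 < q" using p by simp
  have A0: "0 \<le> runmax \<alpha> \<phi> k" for k using nn by (simp add: runmax_nonneg)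
  have M0: "0 \<le> M" using M[of 0] nn by (meson mult_nonneg_nonneg order_trans powr_ge_zero zero_le)
  have *: "runmax \<alpha> \<phi> j * (U j powr (1/q) * \<psi> j) \<le> M * ?a" if "j \<le> N" for j
  proof -
    obtain i where i: "i \<le> j" "runmax \<alpha> \<phi> j = \<alpha> i * \<phi> i" using runmax_attained by blast
    have "\<alpha> i \<le> ?a" using i that p nn by (intro member_le_lpn) auto
    moreover have "\<phi> i \<le> \<phi> j" using \<phi> i by (simp add: monoD)
    ultimately have "runmax \<alpha> \<phi> j \<le> ?a * \<phi> j" unfolding i(2) using nn by (intro mult_mono) auto
    then have "runmax \<alpha> \<phi> j * (U j powr (1/q) * \<psi> j) \<le> ?a * \<phi> j * (U j powr (1/q) * \<psi> j)"
      using nn by (intro mult_right_mono) auto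
    also have "\<dots> = ?a * (U j powr (1/q) * \<phi> j * \<psi> j)" by (simp add: mult_ac)
    also have "\<dots> \<le> ?a * M" using M[OF that] by (intro mult_left_mono) auto
    finally show ?thesis by (simp add: mult.commute)
  qed
  have "lpn {..N} q (\<lambda>j. runmax \<alpha> \<phi> j * (U j powr (1/q) * \<psi> j) * \<beta> j)
      \<le> lpn {..N} q (\<lambda>j. (M * ?a) * \<beta> j)"
    using * nn A0 q by (intro lpn_mono mult_right_mono) auto
  also have "\<dots> = M * ?a * lpn {..N} q \<beta>" using q M0 nn by (intro lpn_cmult) auto
  also have "\<dots> \<le> M * ?a * lpn {..N} p2 \<beta>"
    using p nn M0 by (intro mult_left_mono lpn_antimono_exponent) auto
  finally show ?thesis .
qed

text \<open>
  For \<open>q < p2\<close> Hoelder's inequality removes \<open>\<beta>\<close> and leaves a linear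
  inequality for the running maximum with the exponent \<open>r\<close>.
\<close>

lemma runmax_half_Holder:
  assumes nn: "\<And>i. 0 \<le> \<alpha> i" "\<And>i. 0 \<le> \<beta> i" "\<And>i. 0 \<le> \<phi> i" "\<And>i. 0 \<le> W i"
    and p: "0 < q" "0 < p2" "0 < r" "1 / q = 1 / r + 1 / p2"
    and bound: "lpn {..N} r (\<lambda>j. runmax \<alpha> \<phi> j * W j) \<le> M * lpn {..N} p1 \<alpha>"
  shows "lpn {..N} q (\<lambda>j. runmax \<alpha> \<phi> j * W j * \<beta> j) \<le> M * lpn {..N} p1 \<alpha> * lpn {..N} p2 \<beta>"
proof -
  have A0: "0 \<le> runmax \<alpha> \<phi> k" for k using nn by (simp add: runmax_nonneg)
  have "lpn {..N} q (\<lambda>j. (runmax \<alpha> \<phi> j * W j) * \<beta> j)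
      \<le> lpn {..N} r (\<lambda>j. runmax \<alpha> \<phi> j * W j) * lpn {..N} p2 \<beta>"
    using nn A0 p by (intro lpn_Holder) auto
  also have "\<dots> \<le> M * lpn {..N} p1 \<alpha> * lpn {..N} p2 \<beta>"
    using bound by (intro mult_right_mono) auto
  finally show ?thesis .
qed

text \<open>
  For \<open>p1 \<le> r\<close> nothing is lost by replacing the \<open>r\<close>-th power of a
  maximum by the sum of the \<open>r\<close>-th powers.
\<close>

lemma runmax_linear_bound_sup:
  assumes nn: "\<And>i. 0 \<le> \<alpha> i" "\<And>i. 0 \<le> \<phi> i" "\<And>i. 0 \<le> W i"
    and p: "0 < p1" "p1 \<le> r" and M0: "0 \<le> M"
    and M: "\<And>i. i \<le> N \<Longrightarrow> \<phi> i * (\<Sum>j=i..N. W j powr r) powr (1/r) \<le> M"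
  shows "lpn {..N} r (\<lambda>j. runmax \<alpha> \<phi> j * W j) \<le> M * lpn {..N} p1 \<alpha>"
proof -
  have r: "0 < r" using p by simp
  have A0: "0 \<le> runmax \<alpha> \<phi> k" for k using nn by (simp add: runmax_nonneg)
  have pt: "(runmax \<alpha> \<phi> j * W j) powr r \<le> (\<Sum>i\<le>j. (\<alpha> i * \<phi> i) powr r * W j powr r)" for j
  proof -
    obtain i where i: "i \<le> j" "runmax \<alpha> \<phi> j = \<alpha> i * \<phi> i" using runmax_attained by blast
    have "(runmax \<alpha> \<phi> j * W j) powr r = (\<alpha> i * \<phi> i) powr r * W j powr r"
      unfolding i(2) by (rule powr_mult)
    also have "\<dots> \<le> (\<Sum>i\<le>j. (\<alpha> i * \<phi> i) powr r * W j powr r)" using i by (intro member_le_sum) auto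
    finally show ?thesis .
  qed
  have M': "\<phi> i powr r * (\<Sum>j=i..N. W j powr r) \<le> M powr r" if "i \<le> N" for i
  proof -
    have "(\<phi> i * (\<Sum>j=i..N. W j powr r) powr (1/r)) powr r \<le> M powr r"
      using M[OF that] r nn by (intro powr_mono2) auto
    then show ?thesis using r nn by (simp add: powr_mult powr_powr sum_nonneg)
  qed
  have "lpn {..N} r (\<lambda>j. runmax \<alpha> \<phi> j * W j) \<le> M * lpn {..N} r \<alpha>"
  proof (rule lpn_leI)
    have "(\<Sum>j\<le>N. (runmax \<alpha> \<phi> j * W j) powr r) \<le> (\<Sum>j\<le>N. \<Sum>i\<le>j. (\<alpha> i * \<phi> i) powr r * W j powr r)"
      by (intro sum_mono pt)
    also have "\<dots> = (\<Sum>i\<le>N. \<alpha> i powr r * (\<phi> i powr r * (\<Sum>j=i..N. W j powr r)))"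
      using nn by (simp add: sum_triangle_swap sum_distrib_left powr_mult mult.assoc)
    also have "\<dots> \<le> (\<Sum>i\<le>N. \<alpha> i powr r * M powr r)"
      using M' by (intro sum_mono mult_left_mono) auto
    also have "\<dots> = (M * lpn {..N} r \<alpha>) powr r"
      using M0 r by (simp add: powr_mult lpn_powr sum_distrib_left mult.commute)
    finally show "(\<Sum>j\<le>N. (runmax \<alpha> \<phi> j * W j) powr r) \<le> (M * lpn {..N} r \<alpha>) powr r" .
  qed (use r M0 in auto)
  also have "\<dots> \<le> M * lpn {..N} p1 \<alpha>"
    using p nn M0 by (intro mult_left_mono lpn_antimono_exponent) auto
  finally show ?thesis .
qed

text \<open>
  For \<open>r < p1\<close> that replacement loses too much. Instead the indices \<open>j\<close> are
  grouped by the place \<open>\<iota> j \<le> j\<close> at which the maximum up to \<open>j\<close> is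
  attained, and Hoelder's inequality is applied to the sum over the groups. Which grouping occurs
  depends on \<open>\<alpha>\<close>, hence the bound is required for all of them.
\<close>

lemma runmax_linear_bound_sum:
  assumes nn: "\<And>i. 0 \<le> \<alpha> i" "\<And>i. 0 \<le> \<phi> i" "\<And>i. 0 \<le> W i"
    and p: "0 < p1" "0 < r" "0 < \<kappa>" "1 / r = 1 / \<kappa> + 1 / p1" and M0: "0 \<le> M"
    and M: "\<And>\<iota>. (\<And>j. \<iota> j \<le> j) \<Longrightarrow>
       (\<Sum>i\<le>N. \<phi> i powr \<kappa> * (\<Sum>j\<in>{j\<in>{..N}. \<iota> j = i}. W j powr r) powr (\<kappa> / r)) \<le> M powr \<kappa>"
  shows "lpn {..N} r (\<lambda>j. runmax \<alpha> \<phi> j * W j) \<le> M * lpn {..N} p1 \<alpha>"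
proof -
  have "\<forall>j. \<exists>i\<le>j. runmax \<alpha> \<phi> j = \<alpha> i * \<phi> i" using runmax_attained by blast
  then obtain \<iota> where \<iota>: "\<And>j. \<iota> j \<le> j" "\<And>j. runmax \<alpha> \<phi> j = \<alpha> (\<iota> j) * \<phi> (\<iota> j)" by metis
  define w where "w i = (\<Sum>j\<in>{j\<in>{..N}. \<iota> j = i}. W j powr r)" for i
  have w0: "0 \<le> w i" for i by (simp add: w_def sum_nonneg)
  \<comment> \<open>group \<open>i\<close> contributes \<open>(\<alpha>\<^sub>i \<phi>\<^sub>i)\<^sup>r w\<^sub>i\<close>\<close>
  let ?y = "\<lambda>i. \<phi> i * w i powr (1/r)"
  have "(\<Sum>j\<le>N. (runmax \<alpha> \<phi> j * W j) powr r)
      = (\<Sum>i\<le>N. \<Sum>j\<in>{j\<in>{..N}. \<iota> j = i}. (runmax \<alpha> \<phi> j * W j) powr r)"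
    using \<iota>(1) by (intro sum.group[symmetric]) (auto intro: order_trans)
  also have "\<dots> = (\<Sum>i\<le>N. (?y i * \<alpha> i) powr r)"
  proof (rule sum.cong[OF refl])
    fix i
    have "(\<Sum>j\<in>{j\<in>{..N}. \<iota> j = i}. (runmax \<alpha> \<phi> j * W j) powr r)
        = (\<Sum>j\<in>{j\<in>{..N}. \<iota> j = i}. (\<alpha> i * \<phi> i) powr r * W j powr r)"
      using nn by (intro sum.cong) (auto simp: \<iota>(2) powr_mult)
    also have "\<dots> = (\<alpha> i * \<phi> i) powr r * w i" by (simp add: w_def sum_distrib_left)
    also have "\<dots> = (?y i * \<alpha> i) powr r"
      using nn w0[of i] p(2) by (simp add: powr_mult powr_powr)
    finally show "(\<Sum>j\<in>{j\<in>{..N}. \<iota> j = i}. (runmax \<alpha> \<phi> j * W j) powr r) = (?y i * \<alpha> i) powr r" .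
  qed
  finally have "lpn {..N} r (\<lambda>j. runmax \<alpha> \<phi> j * W j) = lpn {..N} r (\<lambda>i. ?y i * \<alpha> i)"
    by (simp add: lpn_def)
  also have "\<dots> \<le> lpn {..N} \<kappa> ?y * lpn {..N} p1 \<alpha>"
    using nn p by (intro lpn_Holder) auto
  also have "lpn {..N} \<kappa> ?y \<le> M"
  proof (rule lpn_leI)
    have "(\<Sum>i\<le>N. ?y i powr \<kappa>) = (\<Sum>i\<le>N. \<phi> i powr \<kappa> * w i powr (\<kappa> / r))"
      using nn w0 by (simp add: powr_mult powr_powr)
    also have "\<dots> \<le> M powr \<kappa>" unfolding w_def by (rule M) (rule \<iota>(1))
    finally show "(\<Sum>i\<le>N. ?y i powr \<kappa>) \<le> M powr \<kappa>" .
  qed (use p M0 in auto)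
  finally show ?thesis by (simp add: mult_right_mono)
qed

section \<open>Necessary conditions for running maxima\<close>

text \<open>
  Testing the linear inequality with the formally extremal sequence fails, since a single \<open>W
  j\<close> may be small compared with the tail \<open>V j\<close> that it starts. The mass is
  therefore put at the last indices \<open>l n\<close> where the tail is at least
  \<open>2\<^sup>-\<^sup>n V 0\<close>. Each of these tails overlaps the later ones, but writing the
  nondecreasing running maximum as a sum of its increments shows that the overlap costs only the
  factor \<open>\<Sum>\<^sub>m 2\<^sup>-\<^sup>m = 2\<close>.
\<close>

lemma runmax_lower_levels:
  fixes \<phi> W :: "nat \<Rightarrow> real"
  assumes nn: "\<And>i. 0 \<le> \<phi> i" "\<And>i. 0 \<le> W i"
    and p: "0 < p" "0 < r" "0 < \<kappa>" "1 / r = 1 / \<kappa> + 1 / p" and D: "0 \<le> D"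
    and bound: "\<And>\<alpha>. (\<And>i. 0 \<le> \<alpha> i) \<Longrightarrow>
       lpn {..N} r (\<lambda>j. runmax \<alpha> \<phi> j * W j) \<le> D * lpn {..N} p \<alpha>"
    and WN: "0 < W N"
    and V_def: "\<And>i. V i = (\<Sum>j=i..N. W j powr r)"
  shows "\<exists>M l. (\<forall>n. l n \<le> N) \<and>
     (\<forall>j\<le>N. V j powr (\<kappa>/r) \<le> 2 powr (\<kappa>/r) * (\<Sum>n\<in>{n\<in>{..M}. j \<le> l n}. (V 0 / 2^n) powr (\<kappa>/r))) \<and>
     (\<Sum>n\<le>M. (V 0 / 2^n) powr (\<kappa>/r) * \<phi> (l n) powr \<kappa>) \<le> 2 powr (\<kappa>/r) * D powr \<kappa>"
proof -
  have \<kappa>: "\<kappa> = r + \<kappa> * r / p" and s1: "1 + \<kappa> / p = \<kappa> / r"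
  proof -
    have "\<kappa> * (1 / r) = \<kappa> * (1 / \<kappa> + 1 / p)" using p by simp
    then show s1: "1 + \<kappa> / p = \<kappa> / r" using p(3) by (simp add: distrib_left)
    have "r * (1 + \<kappa> / p) = r * (\<kappa> / r)" using s1 by simp
    then show "\<kappa> = r + \<kappa> * r / p" using p(2) by (simp add: distrib_left mult.commute)
  qed
  have V_anti: "V j \<le> V i" if "i \<le> j" for i j
    unfolding V_def using that by (intro sum_mono2) auto
  have VN: "0 < V N" using WN by (simp add: V_def)
  have Vpos: "0 < V i" if "i \<le> N" for i using V_anti[OF that] VN by linarith
  then have V0: "0 < V 0" by simp
  have "\<exists>M. V 0 / V N < 2 ^ M" by (rule real_arch_pow) simp
  then obtain M where "V 0 / V N < 2 ^ M" by blast
  then have M: "V 0 / 2 ^ M \<le> V N" using VN by (simp add: field_simps)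
  define l where "l n = Max {j. j \<le> N \<and> V 0 / 2 ^ n \<le> V j}" for n :: nat
  have lin: "l n \<in> {j. j \<le> N \<and> V 0 / 2 ^ n \<le> V j}" for n
  proof -
    have "V 0 / 2 ^ n \<le> V 0" using V0 by (simp add: field_simps)
    then have "0 \<in> {j. j \<le> N \<and> V 0 / 2 ^ n \<le> V j}" by simp
    then show ?thesis unfolding l_def by (intro Max_in) auto
  qed
  then have lN: "l n \<le> N" for n by blast
  have l_iff: "j \<le> l n \<longleftrightarrow> V 0 / 2 ^ n \<le> V j" if "j \<le> N" for j n
  proof
    assume "j \<le> l n"
    then show "V 0 / 2 ^ n \<le> V j" using V_anti lin[of n] by fastforce
  next
    assume "V 0 / 2 ^ n \<le> V j"
    then show "j \<le> l n" unfolding l_def using that by (intro Max_ge) auto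
  qed
  have ex_level: "\<exists>n0\<le>M. V 0 / 2 ^ n0 \<le> V j \<and> V j \<le> 2 * (V 0 / 2 ^ n0) \<and> (\<forall>n. V 0 / 2 ^ n \<le> V j \<longrightarrow> n0 \<le> n)"
    if "j \<le> N" for j
  proof -
    define n0 where "n0 = (LEAST n. V 0 / 2 ^ n \<le> V j)"
    have MM: "V 0 / 2 ^ M \<le> V j" using M V_anti[OF that] by linarith
    have "V 0 / 2 ^ n0 \<le> V j" unfolding n0_def using MM by (rule LeastI)
    moreover have "n0 \<le> M" unfolding n0_def using MM by (rule Least_le)
    moreover have "V j \<le> 2 * (V 0 / 2 ^ n0)"
    proof (cases n0)
      case 0
      have "V j \<le> V 0" using V_anti by simp
      then show ?thesis using 0 V0 by simp
    next
      case (Suc n)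
      then have "\<not> V 0 / 2 ^ n \<le> V j" using not_less_Least[of n "\<lambda>n. V 0 / 2 ^ n \<le> V j"] n0_def by simp
      then show ?thesis using Suc by simp
    qed
    moreover have "\<forall>n. V 0 / 2 ^ n \<le> V j \<longrightarrow> n0 \<le> n" unfolding n0_def by (auto intro: Least_le)
    ultimately show ?thesis by blast
  qed
  have A: "V j powr (\<kappa>/r) \<le> 2 powr (\<kappa>/r) * (\<Sum>n\<in>{n\<in>{..M}. j \<le> l n}. (V 0 / 2^n) powr (\<kappa>/r))"
    if j: "j \<le> N" for j
  proof -
    obtain n0 where n0: "n0 \<le> M" "V 0 / 2 ^ n0 \<le> V j" "V j \<le> 2 * (V 0 / 2 ^ n0)"
      using ex_level[OF j] by blast
    have "V j powr (\<kappa>/r) \<le> (2 * (V 0 / 2 ^ n0)) powr (\<kappa>/r)"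
      using n0 Vpos[OF j] p by (intro powr_mono2) auto
    also have "\<dots> = 2 powr (\<kappa>/r) * (V 0 / 2 ^ n0) powr (\<kappa>/r)" by (rule powr_mult)
    also have "(V 0 / 2 ^ n0) powr (\<kappa>/r) \<le> (\<Sum>n\<in>{n\<in>{..M}. j \<le> l n}. (V 0 / 2^n) powr (\<kappa>/r))"
      using n0 j by (intro member_le_sum) (auto simp: l_iff)
    finally show ?thesis by simp
  qed
  define h where "h n = (V 0 / 2^n) powr (\<kappa>/r) * \<phi> (l n) powr \<kappa>" for n
  define S where "S = (\<Sum>n\<le>M. h n)"
  have h0: "0 \<le> h n" for n by (simp add: h_def)
  have S0: "0 \<le> S" using h0 by (simp add: S_def sum_nonneg)
  \<comment> \<open>several levels may share the index \<open>i\<close>; adding their masses keeps the norm equal to \<open>S\<close>\<close>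
  define \<alpha> where "\<alpha> i = (\<Sum>n\<in>{n\<in>{..M}. l n = i}. h n) powr (1/p)" for i
  have \<alpha>0: "0 \<le> \<alpha> i" for i by (simp add: \<alpha>_def)
  have "(\<Sum>i\<le>N. \<alpha> i powr p) = (\<Sum>i\<le>N. \<Sum>n\<in>{n\<in>{..M}. l n = i}. h n)"
    using p h0 by (simp add: \<alpha>_def powr_powr sum_nonneg)
  also have "\<dots> = S" unfolding S_def using lN by (intro sum.group) auto
  finally have norm\<alpha>: "lpn {..N} p \<alpha> = S powr (1/p)" by (simp add: lpn_def)
  have \<alpha>l: "h n powr (1/p) \<le> \<alpha> (l n)" if "n \<le> M" for n
    unfolding \<alpha>_def using that h0 p by (intro powr_mono2 member_le_sum) auto
  define R where "R j = runmax \<alpha> \<phi> j powr r" for j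
  have rm0: "0 \<le> runmax \<alpha> \<phi> j" for j using \<alpha>0 nn by (simp add: runmax_nonneg)
  have R_mono: "R i \<le> R j" if "i \<le> j" for i j
    unfolding R_def using runmax_mono[OF that] rm0 p by (intro powr_mono2) auto
  \<comment> \<open>summation by parts: every level and every \<open>W j\<close> is charged to the increments of \<open>R\<close>\<close>
  define \<rho> where "\<rho> i = (if i = 0 then R 0 else R i - R (i - 1))" for i
  have \<rho>0: "0 \<le> \<rho> i" for i using R_mono[of "i-1" i] by (simp add: \<rho>_def R_def)
  have R_sum: "R j = (\<Sum>i\<le>j. \<rho> i)" for j by (induction j) (simp_all add: \<rho>_def)
  have hR: "h n \<le> (V 0 / 2^n) * R (l n)" if n: "n \<le> M" for n
  proof -
    define v where "v = V 0 / 2 ^ n"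
    have v: "0 < v" using V0 by (simp add: v_def)
    have "h n powr (1/p) * \<phi> (l n) \<le> \<alpha> (l n) * \<phi> (l n)" using \<alpha>l[OF n] nn by (intro mult_right_mono)
    also have "\<dots> \<le> runmax \<alpha> \<phi> (l n)" by (rule le_runmax) simp
    finally have "(h n powr (1/p) * \<phi> (l n)) powr r \<le> R (l n)"
      unfolding R_def using nn p by (intro powr_mono2) auto
    then have *: "v * (h n powr (1/p) * \<phi> (l n)) powr r \<le> v * R (l n)"
      using v by (intro mult_left_mono) auto
    have "v * (h n powr (1/p) * \<phi> (l n)) powr r = h n"
    proof (cases "\<phi> (l n) = 0")
      case True
      then show ?thesis by (simp add: h_def)
    next
      case False
      then have f: "0 < \<phi> (l n)" using nn[of "l n"] by simp
      have "(h n powr (1/p) * \<phi> (l n)) powr r = v powr (\<kappa> / p) * \<phi> (l n) powr (\<kappa> * r / p + r)"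
        using f v p(1,2) nn by (simp add: h_def v_def[symmetric] powr_mult powr_powr powr_add)
      moreover have "v * v powr (\<kappa> / p) = v powr (1 + \<kappa> / p)" using v by (simp add: powr_add)
      ultimately show ?thesis using \<kappa> s1
        by (simp add: h_def v_def[symmetric] mult.assoc[symmetric] add.commute)
    qed
    then show ?thesis using * by (simp add: v_def)
  qed
  have geo: "(\<Sum>n\<in>{n\<in>{..M}. i \<le> l n}. V 0 / 2^n) \<le> 2 * V i" if i: "i \<le> N" for i
  proof -
    obtain n0 where n0: "n0 \<le> M" "V 0 / 2 ^ n0 \<le> V i" "\<And>n. V 0 / 2 ^ n \<le> V i \<Longrightarrow> n0 \<le> n"
      using ex_level[OF i] by blast
    have "(\<Sum>n\<in>{n\<in>{..M}. i \<le> l n}. V 0 / 2^n) \<le> (\<Sum>n=n0..M. V 0 / 2^n)"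
      using n0 V0 i by (intro sum_mono2) (auto simp: l_iff)
    also have "\<dots> \<le> 2 * (V 0 / 2 ^ n0)" using V0 by (intro halving_sum) auto
    finally show ?thesis using n0 by simp
  qed
  have "S \<le> (\<Sum>n\<le>M. (V 0 / 2^n) * R (l n))" unfolding S_def using hR by (intro sum_mono) auto
  also have "\<dots> = (\<Sum>n\<le>M. \<Sum>i\<le>N. if i \<le> l n then (V 0 / 2^n) * \<rho> i else 0)"
  proof (rule sum.cong[OF refl])
    fix n
    have "(V 0 / 2^n) * R (l n) = (\<Sum>i\<le>l n. (V 0 / 2^n) * \<rho> i)" by (simp only: R_sum sum_distrib_left)
    also have "\<dots> = (\<Sum>i\<le>N. if i \<le> l n then (V 0 / 2^n) * \<rho> i else 0)"
      using lN[of n] by (intro sum.mono_neutral_cong_left) auto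
    finally show "(V 0 / 2^n) * R (l n) = (\<Sum>i\<le>N. if i \<le> l n then (V 0 / 2^n) * \<rho> i else 0)" .
  qed
  also have "\<dots> = (\<Sum>i\<le>N. \<Sum>n\<le>M. if i \<le> l n then (V 0 / 2^n) * \<rho> i else 0)" by (rule sum.swap)
  also have "\<dots> = (\<Sum>i\<le>N. (\<Sum>n\<in>{n\<in>{..M}. i \<le> l n}. V 0 / 2^n) * \<rho> i)"
    unfolding sum_distrib_right by (intro sum.cong refl sum.mono_neutral_cong_right) auto
  also have "\<dots> \<le> (\<Sum>i\<le>N. 2 * V i * \<rho> i)"
    using geo \<rho>0 by (intro sum_mono mult_right_mono) auto
  also have "\<dots> = 2 * (\<Sum>i\<le>N. \<Sum>j=i..N. \<rho> i * W j powr r)"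
    by (simp add: V_def sum_distrib_left sum_distrib_right mult_ac)
  also have "\<dots> = 2 * (\<Sum>j\<le>N. \<Sum>i\<le>j. \<rho> i * W j powr r)" by (simp add: sum_triangle_swap)
  also have "\<dots> = 2 * (\<Sum>j\<le>N. R j * W j powr r)" by (simp add: R_sum sum_distrib_right)
  also have "\<dots> = 2 * (\<Sum>j\<le>N. (runmax \<alpha> \<phi> j * W j) powr r)"
    using rm0 nn by (simp add: R_def powr_mult)
  also have "\<dots> \<le> 2 * (D * S powr (1/p)) powr r"
    using lpn_le_powrD[OF p(2) bound[of \<alpha>, OF \<alpha>0]] norm\<alpha> by simp
  finally have main: "S \<le> 2 * (D * S powr (1/p)) powr r" .
  have "S \<le> 2 powr (\<kappa>/r) * D powr \<kappa>"
  proof (cases "S = 0")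
    case False
    then have S: "0 < S" using S0 by simp
    have "r * (1 / r) = r * (1 / \<kappa> + 1 / p)" using p(4) by simp
    then have e: "r / \<kappa> + r / p = 1" using p(2) by (simp add: distrib_left)
    have "S = S powr (r / \<kappa>) * S powr (r / p)" using S e by (simp add: powr_add[symmetric])
    moreover have "(D * S powr (1/p)) powr r = D powr r * S powr (r / p)"
      using D by (simp add: powr_mult powr_powr)
    ultimately have "S powr (r / \<kappa>) * S powr (r / p) \<le> 2 * D powr r * S powr (r / p)"
      using main by simp
    then have "S powr (r / \<kappa>) \<le> 2 * D powr r" using S by simp
    then have "(S powr (r / \<kappa>)) powr (\<kappa> / r) \<le> (2 * D powr r) powr (\<kappa> / r)"
      using p by (intro powr_mono2) auto
    then show ?thesis using S p(2,3) D by (simp add: powr_powr powr_mult)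
  qed simp
  then show ?thesis using A lN unfolding S_def h_def by blast
qed

lemma lpn_delta: "(k::nat) \<le> N \<Longrightarrow> lpn {..N} p (\<lambda>i. if i = k then 1 else 0) = 1"
proof -
  assume "k \<le> N"
  have "(\<Sum>i\<le>N. (if i = k then 1 else 0 :: real) powr p) = (\<Sum>i\<le>N. if i = k then 1 else 0)"
    by (intro sum.cong) auto
  then show ?thesis using \<open>k \<le> N\<close> by (simp add: lpn_def)
qed

lemma runmax_product_lower_diag:
  assumes nn: "\<And>i. 0 \<le> \<phi> i" "\<And>i. 0 \<le> \<psi> i" and q: "0 < q"
    and bound: "\<And>\<alpha> \<beta>. (\<And>i. 0 \<le> \<alpha> i) \<Longrightarrow> (\<And>i. 0 \<le> \<beta> i) \<Longrightarrow>
       lpn {..N} q (\<lambda>k. U k powr (1/q) * (runmax \<alpha> \<phi> k * runmax \<beta> \<psi> k))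
         \<le> D * lpn {..N} p1 \<alpha> * lpn {..N} p2 \<beta>"
    and k: "k \<le> N"
  shows "U k powr (1/q) * \<phi> k * \<psi> k \<le> D"
proof -
  let ?\<delta> = "\<lambda>i. if i = k then 1 else 0 :: real"
  have a: "\<phi> k \<le> runmax ?\<delta> \<phi> k" "\<psi> k \<le> runmax ?\<delta> \<psi> k"
    using le_runmax[of k k ?\<delta> \<phi>] le_runmax[of k k ?\<delta> \<psi>] by simp_all
  have "U k powr (1/q) * \<phi> k * \<psi> k \<le> U k powr (1/q) * (runmax ?\<delta> \<phi> k * runmax ?\<delta> \<psi> k)"
    unfolding mult.assoc using a nn by (intro mult_left_mono mult_mono) (auto intro: order_trans)
  also have "\<dots> \<le> lpn {..N} q (\<lambda>k. U k powr (1/q) * (runmax ?\<delta> \<phi> k * runmax ?\<delta> \<psi> k))"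
    using k q nn by (intro member_le_lpn) (auto simp: runmax_nonneg)
  also have "\<dots> \<le> D" using bound[of ?\<delta> ?\<delta>] k by (simp add: lpn_delta)
  finally show ?thesis .
qed

text \<open>
  Of the running maximum of \<open>\<beta> \<psi>\<close> only its last entry is kept; the converse of
  Hoelder's inequality then optimises over \<open>\<beta>\<close> for a fixed \<open>\<alpha>\<close>.
\<close>

lemma runmax_product_lower_half:
  assumes nn: "\<And>i. 0 \<le> \<phi> i" "\<And>i. 0 \<le> \<psi> i" and q: "0 < q" "0 < r" "0 < p2" "1 / q = 1 / r + 1 / p2"
    and D: "0 \<le> D"
    and bound: "\<And>\<alpha> \<beta>. (\<And>i. 0 \<le> \<alpha> i) \<Longrightarrow> (\<And>i. 0 \<le> \<beta> i) \<Longrightarrow>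
       lpn {..N} q (\<lambda>k. U k powr (1/q) * (runmax \<alpha> \<phi> k * runmax \<beta> \<psi> k))
         \<le> D * lpn {..N} p1 \<alpha> * lpn {..N} p2 \<beta>"
    and \<alpha>: "\<And>i. 0 \<le> \<alpha> i"
  shows "lpn {..N} r (\<lambda>j. runmax \<alpha> \<phi> j * (U j powr (1/q) * \<psi> j)) \<le> D * lpn {..N} p1 \<alpha>"
proof (rule lpn_converse_Holder)
  fix \<beta> :: "nat \<Rightarrow> real" assume \<beta>: "\<And>i. 0 \<le> \<beta> i"
  have A0: "0 \<le> runmax \<alpha> \<phi> k" for k using nn \<alpha> by (simp add: runmax_nonneg)
  have "lpn {..N} q (\<lambda>j. runmax \<alpha> \<phi> j * (U j powr (1/q) * \<psi> j) * \<beta> j)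
     \<le> lpn {..N} q (\<lambda>k. U k powr (1/q) * (runmax \<alpha> \<phi> k * runmax \<beta> \<psi> k))"
  proof (rule lpn_mono)
    fix j
    have "U j powr (1/q) * runmax \<alpha> \<phi> j * (\<beta> j * \<psi> j) \<le> U j powr (1/q) * runmax \<alpha> \<phi> j * runmax \<beta> \<psi> j"
      using A0 by (intro mult_left_mono le_runmax) auto
    then show "runmax \<alpha> \<phi> j * (U j powr (1/q) * \<psi> j) * \<beta> j
       \<le> U j powr (1/q) * (runmax \<alpha> \<phi> j * runmax \<beta> \<psi> j)" by (simp add: mult_ac)
  qed (use q A0 nn \<beta> in auto)
  also have "\<dots> \<le> D * lpn {..N} p1 \<alpha> * lpn {..N} p2 \<beta>" using bound \<alpha> \<beta> by blast
  finally show "lpn {..N} q (\<lambda>j. runmax \<alpha> \<phi> j * (U j powr (1/q) * \<psi> j) * \<beta> j)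
     \<le> D * lpn {..N} p1 \<alpha> * lpn {..N} p2 \<beta>" .
qed (use nn q D \<alpha> runmax_nonneg[of \<alpha> \<phi>] in auto)

lemma runmax_lower_single:
  assumes nn: "\<And>i. 0 \<le> \<phi> i" "\<And>i. 0 \<le> W i" and r: "0 < r"
    and bound: "\<And>\<alpha>. (\<And>i. 0 \<le> \<alpha> i) \<Longrightarrow>
       lpn {..N} r (\<lambda>j. runmax \<alpha> \<phi> j * W j) \<le> D * lpn {..N} p \<alpha>"
    and i: "i \<le> N"
  shows "\<phi> i * (\<Sum>j=i..N. W j powr r) powr (1/r) \<le> D"
proof -
  let ?\<delta> = "\<lambda>j. if j = i then 1 else 0 :: real"
  have rm: "\<phi> i \<le> runmax ?\<delta> \<phi> j" if "i \<le> j" for j using le_runmax[OF that, of ?\<delta> \<phi>] by simp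
  have "\<phi> i * (\<Sum>j=i..N. W j powr r) powr (1/r) = lpn {i..N} r (\<lambda>j. \<phi> i * W j)"
    using nn r by (subst lpn_cmult) (auto simp: lpn_def)
  also have "\<dots> \<le> lpn {i..N} r (\<lambda>j. runmax ?\<delta> \<phi> j * W j)"
    using nn r rm by (intro lpn_mono mult_right_mono) auto
  also have "\<dots> \<le> lpn {..N} r (\<lambda>j. runmax ?\<delta> \<phi> j * W j)"
    unfolding lpn_def using r by (intro powr_mono2 sum_mono2 sum_nonneg) auto
  also have "\<dots> \<le> D" using bound[of ?\<delta>] i by (simp add: lpn_delta)
  finally show ?thesis .
qed

section \<open>Extended powers, profiles and their Stieltjes measures\<close>

lemma epow_ennreal: "0 \<le> a \<Longrightarrow> 0 < b \<Longrightarrow> epow (ennreal a) b = ennreal (a powr b)"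
  by (simp add: epow_def ennreal_eq_0_iff)

lemma epow_top [simp]: "0 < b \<Longrightarrow> epow top b = top"
  by (simp add: epow_def)

lemma epow_zero [simp]: "0 < b \<Longrightarrow> epow 0 b = 0"
  by (simp add: epow_def)

lemma epow_one [simp]: "epow x 1 = x"
  by (cases x rule: ennreal_cases) (simp_all add: epow_ennreal)

lemma epow_epow: "0 < a \<Longrightarrow> 0 < b \<Longrightarrow> epow (epow x a) b = epow x (a * b)"
  by (cases x rule: ennreal_cases) (simp_all add: epow_ennreal powr_powr)

lemma epow_mono: "0 < b \<Longrightarrow> x \<le> y \<Longrightarrow> epow x b \<le> epow y b"
  by (cases x rule: ennreal_cases; cases y rule: ennreal_cases)
    (auto simp: epow_ennreal top_unique intro!: ennreal_leI powr_mono2)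

text \<open>
  Positive powers are order automorphisms of \<open>[0, \<infinity>]\<close>; this is how roots are
  moved across inequalities and suprema.
\<close>

lemma epow_le_iff: "0 < b \<Longrightarrow> epow x b \<le> y \<longleftrightarrow> x \<le> epow y (1 / b)"
  using epow_mono[of "1/b" "epow x b" y] epow_mono[of b x "epow y (1/b)"] by (auto simp: epow_epow)

lemma epow_eq_0_iff: "0 < b \<Longrightarrow> epow x b = 0 \<longleftrightarrow> x = 0"
  using epow_le_iff[of b x 0] by simp

lemma epow_less_top_iff: "0 < b \<Longrightarrow> epow x b < top \<longleftrightarrow> x < top"
  by (cases x rule: ennreal_cases) (simp_all add: epow_ennreal)

lemma epow_mult: "0 < b \<Longrightarrow> epow (x * y) b = epow x b * epow y b"
  by (cases x rule: ennreal_cases; cases y rule: ennreal_cases)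
    (auto simp: epow_ennreal powr_mult ennreal_mult[symmetric] ennreal_mult_top ennreal_top_mult ennreal_eq_0_iff)

lemma epow_add_le: "0 < b \<Longrightarrow> epow (x + y) b \<le> ennreal (2 powr b) * (epow x b + epow y b)"
  by (cases x rule: ennreal_cases; cases y rule: ennreal_cases)
    (auto simp: epow_ennreal ennreal_plus[symmetric] ennreal_mult[symmetric] ennreal_mult_top
        simp del: ennreal_plus intro!: ennreal_leI powr_add_le)

lemma epow_SUP:
  assumes "0 < b" "I \<noteq> {}"
  shows "epow (SUP i\<in>I. f i) b = (SUP i\<in>I. epow (f i) b)"
proof (rule antisym)
  show "epow (SUP i\<in>I. f i) b \<le> (SUP i\<in>I. epow (f i) b)"
    unfolding epow_le_iff[OF assms(1)]
  proof (rule SUP_least)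
    fix i assume "i \<in> I"
    then have "epow (f i) b \<le> (SUP i\<in>I. epow (f i) b)" by (rule SUP_upper)
    then show "f i \<le> epow (SUP i\<in>I. epow (f i) b) (1 / b)" by (simp add: epow_le_iff assms(1))
  qed
  show "(SUP i\<in>I. epow (f i) b) \<le> epow (SUP i\<in>I. f i) b"
    by (intro SUP_least epow_mono SUP_upper assms)
qed

lemma sum_epow_le:
  assumes "finite S" "1 \<le> s"
  shows "(\<Sum>i\<in>S. epow (f i) s) \<le> epow (\<Sum>i\<in>S. f i) s"
proof (cases "\<exists>i\<in>S. f i = top")
  case True
  then have e: "(\<Sum>i\<in>S. f i) = top" using assms by simp
  show ?thesis unfolding e using assms by simp
next
  case False
  define g where "g i = enn2real (f i)" for i
  have g: "f i = ennreal (g i)" if "i \<in> S" for i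
    using False that by (auto simp: g_def less_top[symmetric])
  have g0: "0 \<le> g i" for i by (simp add: g_def)
  have "(\<Sum>i\<in>S. epow (f i) s) = ennreal (\<Sum>i\<in>S. g i powr s)"
    using assms g0 by (simp add: g epow_ennreal)
  also have "\<dots> \<le> ennreal ((\<Sum>i\<in>S. g i) powr s)"
    using assms g0 by (intro ennreal_leI sum_powr_le_powr_sum) auto
  also have "\<dots> = epow (\<Sum>i\<in>S. f i) s"
    using assms g0 by (simp add: g epow_ennreal sum_nonneg)
  finally show ?thesis .
qed

lemma borel_measurable_epow [measurable]:
  assumes [measurable]: "f \<in> borel_measurable N"
  shows "(\<lambda>x. epow (f x) a) \<in> borel_measurable N"
  unfolding epow_def by measurable

lemma borel_measurable_antimono_ennreal:
  fixes f :: "real \<Rightarrow> ennreal"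
  assumes "\<And>x y. x \<le> y \<Longrightarrow> f y \<le> f x"
  shows "f \<in> borel_measurable borel"
proof (rule borel_measurableI_greater)
  fix a
  have "is_interval {x. a < f x}"
    unfolding is_interval_1 using assms by (fastforce intro: less_le_trans)
  then have "{x. a < f x} \<in> sets borel" by (rule real_interval_borel_measurable)
  then show "{x \<in> space borel. a < f x} \<in> sets borel" by simp
qed

lemma borel_measurable_mono_ennreal:
  fixes f :: "real \<Rightarrow> ennreal"
  assumes "\<And>x y. x \<le> y \<Longrightarrow> f x \<le> f y"
  shows "f \<in> borel_measurable borel"
proof (rule borel_measurableI_greater)
  fix a
  have "is_interval {x. a < f x}"
    unfolding is_interval_1 using assms by (fastforce intro: less_le_trans)
  then have "{x. a < f x} \<in> sets borel" by (rule real_interval_borel_measurable)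
  then show "{x \<in> space borel. a < f x} \<in> sets borel" by simp
qed

lemma tendsto_epow:
  assumes "(f \<longlongrightarrow> l) F" "l < top" "0 < a"
  shows "((\<lambda>x. epow (f x) a) \<longlongrightarrow> epow l a) F"
proof -
  have "((\<lambda>x. ennreal (enn2real (f x) powr a)) \<longlongrightarrow> ennreal (enn2real l powr a)) F"
    using assms by (intro tendsto_ennrealI tendsto_powr' tendsto_enn2real) (auto simp: less_top[symmetric])
  moreover have "eventually (\<lambda>x. f x < top) F" using assms(1,2) by (rule order_tendstoD)
  then have "eventually (\<lambda>x. ennreal (enn2real (f x) powr a) = epow (f x) a) F"
  proof eventually_elim
    case (elim x)
    then show ?case using assms(3) epow_ennreal[of "enn2real (f x)" a] by simp
  qed
  ultimately have "((\<lambda>x. epow (f x) a) \<longlongrightarrow> ennreal (enn2real l powr a)) F"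
    by (rule Lim_transform_eventually)
  then show ?thesis using assms(2,3) epow_ennreal[of "enn2real l" a] by simp
qed

text \<open>
  The properties of a profile that make \<open>d(\<Phi>\<^sup>a)\<close> a finite measure with
  distribution function \<open>\<Phi>\<^sup>a\<close> for every \<open>a > 0\<close>.
\<close>

definition is_profile :: "real \<Rightarrow> real \<Rightarrow> (real \<Rightarrow> ennreal) \<Rightarrow> bool" where
  "is_profile c d \<Phi> \<longleftrightarrow> (\<forall>x\<in>{c..d}. \<Phi> x < \<infinity>) \<and> (\<forall>x\<in>{c..d}. \<forall>y\<in>{c..d}. x \<le> y \<longrightarrow> \<Phi> x \<le> \<Phi> y) \<and>
     (\<forall>x\<in>{c..<d}. (\<Phi> \<longlongrightarrow> \<Phi> x) (at_right x))"

lemma is_profile_const: "is_profile c d (\<lambda>_. 1)"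
  by (simp add: is_profile_def)

lemma sets_stieltjes [simp, measurable_cong]: "sets (stieltjes c d G) = sets borel"
  by (simp add: stieltjes_def)

lemma emeasure_stieltjes_profile:
  assumes \<Phi>: "is_profile c d \<Phi>" and a: "0 < a" and x: "x \<in> {c..d}"
  shows "emeasure (stieltjes c d (\<lambda>t. epow (\<Phi> t) a)) {c..x} = epow (\<Phi> x) a"
proof (rule emeasure_stieltjes_Icc)
  fix y assume y: "c \<le> y" "y < d"
  show "((\<lambda>t. epow (\<Phi> t) a) \<longlongrightarrow> epow (\<Phi> y) a) (at_right y)"
    using \<Phi> y a by (intro tendsto_epow) (auto simp: is_profile_def)
qed (use \<Phi> a x in \<open>auto simp: is_profile_def epow_less_top_iff intro!: epow_mono\<close>)

lemma emeasure_stieltjes_Ioc: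
  assumes \<Phi>: "is_profile c d \<Phi>" and a: "0 < a" and xy: "c \<le> x" "x \<le> y" "y \<le> d"
  shows "emeasure (stieltjes c d (\<lambda>t. epow (\<Phi> t) a)) {c..x}
       + emeasure (stieltjes c d (\<lambda>t. epow (\<Phi> t) a)) {x<..y} = epow (\<Phi> y) a"
proof -
  let ?\<mu> = "stieltjes c d (\<lambda>t. epow (\<Phi> t) a)"
  have "emeasure ?\<mu> {c..x} + emeasure ?\<mu> {x<..y} = emeasure ?\<mu> ({c..x} \<union> {x<..y})"
    by (rule plus_emeasure) auto
  also have "{c..x} \<union> {x<..y} = {c..y}" using xy by auto
  finally show ?thesis using emeasure_stieltjes_profile[OF \<Phi> a, of y] xy by simp
qed

text \<open>
  If an initial piece carries at most the mass belonging to half of the profile value, the rest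
  carries a fixed fraction of the whole.
\<close>

lemma complement_mass_ge:
  fixes m :: ennreal
  assumes F: "0 \<le> F" and h: "m1 \<le> epow (ennreal (F / 2)) r" and eq: "m1 + m = epow (ennreal F) r" and r: "0 < r"
  shows "ennreal ((1 - (1/2) powr r) * F powr r) \<le> m"
proof -
  have "m1 \<le> ennreal ((F / 2) powr r)" using h r F by (simp add: epow_ennreal)
  then obtain b where b: "m1 = ennreal b" "0 \<le> b" "b \<le> (F / 2) powr r"
    by (cases m1 rule: ennreal_cases) (auto simp: top_unique)
  have eq': "ennreal b + m = ennreal (F powr r)" using eq r F b by (simp add: epow_ennreal)
  then obtain e where e: "m = ennreal e" "0 \<le> e" by (cases m rule: ennreal_cases) auto
  have "b + e = F powr r" using eq' b e by (simp add: ennreal_plus[symmetric] del: ennreal_plus)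
  moreover have "(F / 2) powr r = F powr r * (1/2) powr r" using powr_mult[of F "1/2" r] by simp
  ultimately show ?thesis unfolding e using b by (intro ennreal_leI) (auto simp: algebra_simps)
qed

text \<open>
  Let \<open>y\<close> be the first point where \<open>\<Phi>1\<close> has reached half of
  \<open>\<Phi>1(z)\<close>; right-continuity makes it a minimum. If \<open>\<Phi>2\<close> stays
  below half of \<open>\<Phi>2(z)\<close> strictly before \<open>y\<close>, then
  \<open>d(\<Phi>2\<^sup>r\<^sup>2)\<close> has at least a fixed fraction of its mass in the closed
  interval \<open>[y, z]\<close>, a jump at \<open>y\<close> included. Otherwise some earlier point
  has \<open>\<Phi>2\<close> at half of its value while \<open>\<Phi>1\<close> is still below half of
  its own, and the half-open interval after it carries a fixed fraction of the mass of
  \<open>d(\<Phi>1\<^sup>r\<^sup>1)\<close>.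
\<close>

lemma profile_split:
  assumes \<Phi>1: "is_profile c d \<Phi>1" and \<Phi>2: "is_profile c d \<Phi>2" and r: "0 < r1" "0 < r2"
    and z: "z \<in> {c..d}"
  obtains (left) y where "c \<le> y" "y \<le> z" "\<Phi>1 z \<le> 2 * \<Phi>1 y"
      "ennreal (1 - (1/2) powr r2) * epow (\<Phi>2 z) r2 \<le> emeasure (stieltjes c d (\<lambda>t. epow (\<Phi>2 t) r2)) {y..z}"
  | (right) y where "c \<le> y" "y \<le> z" "\<Phi>2 z \<le> 2 * \<Phi>2 y"
      "ennreal (1 - (1/2) powr r1) * epow (\<Phi>1 z) r1 \<le> emeasure (stieltjes c d (\<lambda>t. epow (\<Phi>1 t) r1)) {y<..z}"
proof -
  define F1 where "F1 x = enn2real (\<Phi>1 x)" for x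
  define F2 where "F2 x = enn2real (\<Phi>2 x)" for x
  have F1: "\<Phi>1 x = ennreal (F1 x)" if "x \<in> {c..d}" for x using \<Phi>1 that by (simp add: is_profile_def F1_def)
  have F2: "\<Phi>2 x = ennreal (F2 x)" if "x \<in> {c..d}" for x using \<Phi>2 that by (simp add: is_profile_def F2_def)
  have F0: "0 \<le> F1 x" "0 \<le> F2 x" for x by (simp_all add: F1_def F2_def)
  have m1: "F1 x \<le> F1 y" if "c \<le> x" "x \<le> y" "y \<le> d" for x y
    unfolding F1_def using \<Phi>1 that by (intro enn2real_mono) (auto simp: is_profile_def)
  have m2: "F2 x \<le> F2 y" if "c \<le> x" "x \<le> y" "y \<le> d" for x y
    unfolding F2_def using \<Phi>2 that by (intro enn2real_mono) (auto simp: is_profile_def)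
  let ?\<mu>2 = "stieltjes c d (\<lambda>t. epow (\<Phi>2 t) r2)"
  define A where "A = {x\<in>{c..z}. F1 z / 2 \<le> F1 x}"
  have zA: "z \<in> A" using F0[of z] z by (simp add: A_def)
  have bdd: "bdd_below A" unfolding A_def by (intro bdd_belowI[of _ c]) auto
  define y where "y = Inf A"
  have yz: "y \<le> z" unfolding y_def by (rule cInf_lower[OF zA bdd])
  have cy: "c \<le> y" unfolding y_def by (rule cInf_greatest) (use zA in \<open>auto simp: A_def\<close>)
  have below: "F1 x < F1 z / 2" if "c \<le> x" "x < y" for x
    using that cInf_lower[OF _ bdd, of x] yz by (auto simp: A_def y_def not_le[symmetric])
  have Fy: "F1 z / 2 \<le> F1 y"
  proof (cases "y = z")
    case False
    then have yd: "y < d" and yz': "y < z" using yz z by auto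
    have tend: "(F1 \<longlongrightarrow> F1 y) (at_right y)"
      unfolding F1_def using \<Phi>1 cy yd
      by (intro tendsto_enn2real) (auto simp: is_profile_def less_top[symmetric])
    have "eventually (\<lambda>t. t \<in> {y<..<z}) (at_right y)" using yz' eventually_at_right_real by blast
    then have "eventually (\<lambda>t. F1 z / 2 \<le> F1 t) (at_right y)"
    proof eventually_elim
      case (elim t)
      then obtain x where "x \<in> A" "x < t" using cInf_lessD[of A t] zA by (auto simp: y_def)
      then show ?case using m1[of x t] elim z by (force simp: A_def)
    qed
    then show ?thesis by (rule tendsto_lowerbound[OF tend]) simp
  qed (use F0[of z] in simp)
  show thesis
  proof (cases "\<exists>x\<in>{c..<y}. F2 z / 2 \<le> F2 x")
    case True
    then obtain x where x: "c \<le> x" "x < y" "F2 z / 2 \<le> F2 x" by auto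
    have xz: "x \<le> z" using x yz by simp
    show thesis
    proof (rule right[of x])
      show "\<Phi>2 z \<le> 2 * \<Phi>2 x"
        using x xz z F0 by (simp add: F2 ennreal_mult[symmetric] ennreal_leI flip: ennreal_numeral)
      have "ennreal ((1 - (1/2) powr r1) * F1 z powr r1) \<le> emeasure (stieltjes c d (\<lambda>t. epow (\<Phi>1 t) r1)) {x<..z}"
      proof (rule complement_mass_ge)
        show "emeasure (stieltjes c d (\<lambda>t. epow (\<Phi>1 t) r1)) {c..x} \<le> epow (ennreal (F1 z / 2)) r1"
          using x xz z r below[of x] emeasure_stieltjes_profile[OF \<Phi>1 r(1), of x]
          by (simp add: F1 epow_mono ennreal_leI)
        show "emeasure (stieltjes c d (\<lambda>t. epow (\<Phi>1 t) r1)) {c..x} +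
            emeasure (stieltjes c d (\<lambda>t. epow (\<Phi>1 t) r1)) {x<..z} = epow (ennreal (F1 z)) r1"
          using emeasure_stieltjes_Ioc[OF \<Phi>1 r(1), of x z] x xz z by (simp add: F1)
      qed (use F0 r in auto)
      moreover have "(1/2::real) powr r1 \<le> 1" using r by (simp add: powr_le_one_le powr_le1)
      ultimately show "ennreal (1 - (1/2) powr r1) * epow (\<Phi>1 z) r1
          \<le> emeasure (stieltjes c d (\<lambda>t. epow (\<Phi>1 t) r1)) {x<..z}"
        using z r F0 by (simp add: F1 epow_ennreal ennreal_mult)
    qed (use x xz in auto)
  next
    case False
    then have lt: "F2 x < F2 z / 2" if "c \<le> x" "x < y" for x using that by force
    have "emeasure ?\<mu>2 {c..<y} \<le> epow (ennreal (F2 z / 2)) r2"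
    proof (cases "c = y")
      case True
      then show ?thesis by simp
    next
      case False
      then have "c < y" using cy by simp
      \<comment> \<open>\<open>[c, y)\<close> is exhausted by closed intervals, whose mass is known\<close>
      define x where "x n = max c (y - 1 / real (Suc n))" for n
      have xlt: "x n < y" and xc: "c \<le> x n" for n using \<open>c < y\<close> by (auto simp: x_def)
      have inc: "incseq (\<lambda>n. {c..x n})"
      proof (rule incseq_SucI)
        fix n
        have "1 / real (Suc (Suc n)) \<le> 1 / real (Suc n)" by (simp add: field_simps)
        then show "{c..x n} \<le> {c..x (Suc n)}" by (auto simp: x_def max_def)
      qed
      have "(\<Union>n. {c..x n}) = {c..<y}"
      proof (intro equalityI subsetI)
        fix t assume t: "t \<in> {c..<y}"
        then obtain n where "inverse (real (Suc n)) < y - t" using reals_Archimedean[of "y - t"] by auto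
        then have "t \<le> x n" by (simp add: x_def inverse_eq_divide)
        then show "t \<in> (\<Union>n. {c..x n})" using t by auto
      qed (use xlt in \<open>auto intro: le_less_trans\<close>)
      then have "emeasure ?\<mu>2 {c..<y} = (SUP n. emeasure ?\<mu>2 {c..x n})"
        using SUP_emeasure_incseq[OF _ inc, of ?\<mu>2] by (simp add: image_subset_iff)
      also have "\<dots> \<le> epow (ennreal (F2 z / 2)) r2"
      proof (rule SUP_least)
        fix n
        have "x n \<in> {c..d}" using xlt[of n] xc[of n] yz z by auto
        then show "emeasure ?\<mu>2 {c..x n} \<le> epow (ennreal (F2 z / 2)) r2"
          using emeasure_stieltjes_profile[OF \<Phi>2 r(2), of "x n"] r lt[OF xc xlt, of n]
          by (simp add: F2 epow_mono ennreal_leI)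
      qed
      finally show ?thesis .
    qed
    moreover have "emeasure ?\<mu>2 {c..<y} + emeasure ?\<mu>2 {y..z} = epow (ennreal (F2 z)) r2"
    proof -
      have "emeasure ?\<mu>2 {c..<y} + emeasure ?\<mu>2 {y..z} = emeasure ?\<mu>2 ({c..<y} \<union> {y..z})"
        by (rule plus_emeasure) auto
      also have "{c..<y} \<union> {y..z} = {c..z}" using cy yz by auto
      finally show ?thesis using emeasure_stieltjes_profile[OF \<Phi>2 r(2), of z] z by (simp add: F2)
    qed
    ultimately have *: "ennreal ((1 - (1/2) powr r2) * F2 z powr r2) \<le> emeasure ?\<mu>2 {y..z}"
      using F0 r by (intro complement_mass_ge) auto
    have "(1/2::real) powr r2 \<le> 1" using r by (simp add: powr_le_one_le powr_le1)
    then show thesis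
      using * z r F0 cy yz Fy
      by (intro left[of y]) (auto simp: F1 F2 epow_ennreal ennreal_mult[symmetric] ennreal_leI
          simp flip: ennreal_numeral)
  qed
qed

section \<open>The grid on which the tail of the weight halves\<close>

lemma nn_integral_lebesgue_on:
  "S \<in> sets lebesgue \<Longrightarrow> (\<integral>\<^sup>+ t. f t \<partial>lebesgue_on S) = (\<integral>\<^sup>+ t. f t * indicator S t \<partial>lebesgue)"
  by (subst nn_integral_restrict_space) auto

lemma indicator_mult_measurable:
  fixes f :: "real \<Rightarrow> ennreal"
  assumes "f \<in> borel_measurable (lebesgue_on S)" "S \<in> sets lebesgue"
  shows "(\<lambda>t. f t * indicator S t) \<in> borel_measurable lebesgue"
  using assms borel_measurable_restrict_space_iff_ennreal[of S lebesgue f] by simp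

lemma tail_antimono: "x \<le> y \<Longrightarrow> tail d w y \<le> tail d w x"
  unfolding tail_def
  by (simp add: nn_integral_lebesgue_on) (intro nn_integral_mono, auto split: split_indicator)

lemma borel_measurable_tail_powr [measurable]: "0 < \<gamma> \<Longrightarrow> (\<lambda>t. epow (tail d w t) \<gamma>) \<in> borel_measurable borel"
  by (intro borel_measurable_antimono_ennreal epow_mono tail_antimono)

text \<open>
  A bounded weight on \<open>[c, d]\<close>; the bound makes its tail Lipschitz, so that the
  intermediate value theorem provides the grid.
\<close>

locale weight_grid =
  fixes c d q M :: real and u :: "real \<Rightarrow> ennreal"
  assumes cd: "c < d" and q: "0 < q"
    and u_meas: "u \<in> borel_measurable (lebesgue_on {c..d})"
    and M: "0 \<le> M" and u_le: "\<And>t. t \<in> {c..d} \<Longrightarrow> u t \<le> ennreal M"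
begin

definition T :: "real \<Rightarrow> real" where "T x = enn2real (tail d u x)"

definition ubar :: "real \<Rightarrow> ennreal" where "ubar t = u t * indicator {c..d} t"

lemma ubar_meas [measurable]: "ubar \<in> borel_measurable lebesgue"
  unfolding ubar_def using u_meas by (intro indicator_mult_measurable) auto

lemma ubar_indicator_meas:
  "S \<in> sets borel \<Longrightarrow> (\<lambda>t. ubar t * indicator S t) \<in> borel_measurable lebesgue"
  by (intro borel_measurable_times_ennreal borel_measurable_indicator ubar_meas)
    (simp add: sets_completionI_sets)

lemma ubar_le: "ubar t \<le> ennreal M"
  using u_le[of t] by (auto simp: ubar_def split: split_indicator)

lemma tail_eq_ubar: "x \<in> {c..d} \<Longrightarrow> tail d u x = (\<integral>\<^sup>+ t. ubar t * indicator {x..d} t \<partial>lebesgue)"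
  unfolding tail_def
  by (simp add: nn_integral_lebesgue_on)
    (intro nn_integral_cong, auto simp: ubar_def split: split_indicator)

lemma integral_ubar_le: "a \<le> b \<Longrightarrow> (\<integral>\<^sup>+ t. ubar t * indicator {a..b} t \<partial>lebesgue) \<le> ennreal (M * (b - a))"
proof -
  assume ab: "a \<le> b"
  have "(\<integral>\<^sup>+ t. ubar t * indicator {a..b} t \<partial>lebesgue) \<le> (\<integral>\<^sup>+ t. ennreal M * indicator {a..b} t \<partial>lebesgue)"
    using ubar_le by (intro nn_integral_mono mult_right_mono) auto
  also have "\<dots> = ennreal (M * (b - a))"
    using ab M by (simp add: nn_integral_cmult_indicator ennreal_mult)
  finally show ?thesis .
qed

lemma tail_finite: "x \<in> {c..d} \<Longrightarrow> tail d u x < top"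
  using integral_ubar_le[of x d] by (auto simp: tail_eq_ubar less_top[symmetric] top_unique)

lemma T_nonneg [simp]: "0 \<le> T x"
  by (simp add: T_def)

lemma tail_eq_T: "x \<in> {c..d} \<Longrightarrow> tail d u x = ennreal (T x)"
  using tail_finite by (simp add: T_def)

lemma epow_tail: "x \<in> {c..d} \<Longrightarrow> 0 < \<gamma> \<Longrightarrow> epow (tail d u x) \<gamma> = ennreal (T x powr \<gamma>)"
  by (simp add: tail_eq_T epow_ennreal)

lemma integral_ubar_Ioc:
  assumes "c \<le> a" "a \<le> b" "b \<le> d"
  shows "(\<integral>\<^sup>+ t. ubar t * indicator {a<..b} t \<partial>lebesgue) = ennreal (T a - T b)"
    and "T b \<le> T a" and "T a - T b \<le> M * (b - a)"
proof -
  let ?I = "\<integral>\<^sup>+ t. ubar t * indicator {a<..b} t \<partial>lebesgue"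
  have "AE t in lebesgue. t \<noteq> a"
    by (rule AE_I'[of "{a}"]) (auto intro: negligible_imp_measure0 simp: null_sets_def)
  moreover have "AE t in lebesgue. t \<noteq> b"
    by (rule AE_I'[of "{b}"]) (auto simp: null_sets_def)
  ultimately have "(\<integral>\<^sup>+ t. ubar t * indicator {a..d} t \<partial>lebesgue)
      = (\<integral>\<^sup>+ t. ubar t * indicator {a<..b} t + ubar t * indicator {b..d} t \<partial>lebesgue)"
    using assms by (intro nn_integral_cong_AE) (auto elim!: eventually_elim2 split: split_indicator)
  also have "\<dots> = ?I + (\<integral>\<^sup>+ t. ubar t * indicator {b..d} t \<partial>lebesgue)"
    by (rule nn_integral_add) (auto intro: ubar_indicator_meas)
  finally have eq: "ennreal (T a) = ?I + ennreal (T b)"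
    using assms by (simp add: tail_eq_ubar[symmetric] tail_eq_T)
  have "?I \<le> (\<integral>\<^sup>+ t. ubar t * indicator {a..b} t \<partial>lebesgue)"
    by (intro nn_integral_mono) (auto split: split_indicator)
  also have "\<dots> \<le> ennreal (M * (b - a))" using assms by (intro integral_ubar_le) auto
  finally have le: "?I \<le> ennreal (M * (b - a))" .
  then obtain e where e: "?I = ennreal e" "0 \<le> e" by (cases ?I rule: ennreal_cases) (auto simp: top_unique)
  have "T a = e + T b" using eq e by (simp add: ennreal_plus[symmetric] del: ennreal_plus)
  then show "?I = ennreal (T a - T b)" "T b \<le> T a" using e by simp_all
  show "T a - T b \<le> M * (b - a)" using le e M assms \<open>T a = e + T b\<close> by simp
qed

lemma T_antimono: "c \<le> a \<Longrightarrow> a \<le> b \<Longrightarrow> b \<le> d \<Longrightarrow> T b \<le> T a"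
  by (rule integral_ubar_Ioc)

lemma T_end: "T d = 0"
proof -
  have "(\<integral>\<^sup>+ t. ubar t * indicator {d..d} t \<partial>lebesgue) \<le> ennreal (M * (d - d))" by (rule integral_ubar_le) simp
  then show ?thesis using cd by (simp add: T_def tail_eq_ubar)
qed

lemma T_continuous: "continuous_on {c..d} T"
proof (rule continuous_on_subset[OF _ order_refl])
  have "M-lipschitz_on {c..d} T"
  proof (rule lipschitz_onI)
    fix x y assume xy: "x \<in> {c..d}" "y \<in> {c..d}"
    show "dist (T x) (T y) \<le> M * dist x y"
    proof (cases "x \<le> y")
      case True
      then show ?thesis using integral_ubar_Ioc(2,3)[of x y] xy by (simp add: dist_real_def abs_if)
    next
      case False
      then show ?thesis using integral_ubar_Ioc(2,3)[of y x] xy by (simp add: dist_real_def abs_if)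
    qed
  qed (rule M)
  then show "continuous_on {c..d} T" by (rule lipschitz_on_continuous_on)
qed

text \<open>
  The tail at \<open>z k\<close> is \<open>2\<^sup>-\<^sup>k T c\<close>. For a weight that vanishes
  almost everywhere all points are put at \<open>c\<close>, which keeps the upper bounds valid without
  a case distinction.
\<close>

definition z :: "nat \<Rightarrow> real" where
  "z k = (if k = 0 \<or> T c = 0 then c else (SOME x. c \<le> x \<and> x \<le> d \<and> T x = T c / 2 ^ k))"

definition U :: "nat \<Rightarrow> real" where "U k = T c / 2 ^ k"

lemma z_props: "c \<le> z k \<and> z k \<le> d \<and> T (z k) = U k"
proof (cases "k = 0 \<or> T c = 0")
  case False
  have "\<exists>x\<ge>c. x \<le> d \<and> T x = T c / 2 ^ k"
  proof (rule IVT2')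
    show "T d \<le> T c / 2 ^ k" by (simp add: T_end)
    have "T c * 1 \<le> T c * 2 ^ k" by (intro mult_left_mono) auto
    then show "T c / 2 ^ k \<le> T c" by (simp add: field_simps)
  qed (use cd T_continuous in auto)
  then have "\<exists>x. c \<le> x \<and> x \<le> d \<and> T x = T c / 2 ^ k" by blast
  from someI_ex[OF this] show ?thesis using False by (simp add: z_def U_def)
qed (use cd in \<open>auto simp: z_def U_def\<close>)

lemma z_in: "z k \<in> {c..d}" and z_ge: "c \<le> z k" and z_le: "z k \<le> d" and T_z: "T (z k) = U k"
  using z_props[of k] by auto

lemma z_0 [simp]: "z 0 = c"
  by (simp add: z_def)

lemma U_nonneg [simp]: "0 \<le> U k"
  by (simp add: U_def)

lemma U_Suc: "U (Suc k) = U k / 2"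
  by (simp add: U_def)

lemma z_less: "T c \<noteq> 0 \<Longrightarrow> k < l \<Longrightarrow> z k < z l"
proof (rule ccontr)
  assume *: "T c \<noteq> 0" "k < l" "\<not> z k < z l"
  then have "U k \<le> U l" using T_antimono[of "z l" "z k"] z_props by (simp add: T_z)
  moreover have "U l < U k"
    using * T_nonneg[of c] by (simp add: U_def frac_less2 del: T_nonneg)
  ultimately show False by simp
qed

lemma z_mono: "k \<le> l \<Longrightarrow> z k \<le> z l"
proof (cases "T c = 0")
  case True
  then show ?thesis by (simp add: z_def)
next
  case False
  assume "k \<le> l"
  then show ?thesis using z_less[OF False, of k l] by (cases "k = l") auto
qed

text \<open>
  Between two grid points the mass of \<open>u\<close> is \<open>U (k - 1) - U k = U k\<close>, so
  bounding \<open>H\<close> by its value at the right end gives the sum over the grid. What lies to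
  the right of \<open>z N\<close> has mass \<open>U N\<close>, which is small for large
  \<open>N\<close>.
\<close>

lemma integral_grid_upper:
  fixes H :: "real \<Rightarrow> ennreal"
  assumes H: "\<And>s t. c \<le> s \<Longrightarrow> s \<le> t \<Longrightarrow> t \<le> d \<Longrightarrow> H s \<le> H t"
  shows "(\<integral>\<^sup>+ t. H t * u t \<partial>lebesgue_on {c..d}) \<le> (\<Sum>k\<le>N. ennreal (U k) * H (z k)) + ennreal (U N) * H d"
proof -
  let ?f = "\<lambda>k t. H (z (Suc k)) * (ubar t * indicator {z k<..z (Suc k)} t)"
  let ?g = "\<lambda>t. H d * (ubar t * indicator {z N<..d} t)"
  have pt: "H t * u t * indicator {c..d} t \<le> (\<Sum>k<N. ?f k t) + ?g t" if "t \<noteq> c" for t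
  proof (cases "t \<in> {c..d}")
    case True
    then have t: "c < t" "t \<le> d" using that by auto
    show ?thesis
    proof (cases "z N < t")
      case True
      then have "H t * u t \<le> ?g t" using t H[of t d] by (auto simp: ubar_def intro!: mult_right_mono)
      then show ?thesis using t by (intro add_increasing) (auto simp: sum_nonneg)
    next
      case False
      then have ex: "\<exists>k. t \<le> z k" by (meson not_le)
      define k where "k = (LEAST k. t \<le> z k)"
      have k: "t \<le> z k" unfolding k_def using ex by (rule LeastI_ex)
      have kN: "k \<le> N" unfolding k_def using False by (intro Least_le) simp
      have k0: "k \<noteq> 0" using k t by (intro notI) simp
      then obtain l where l: "k = Suc l" using not0_implies_Suc by blast
      have "\<not> t \<le> z l" using not_less_Least[of l "\<lambda>k. t \<le> z k"] l by (simp add: k_def)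
      then have "H t * u t \<le> ?f l t"
        using t k l H[of t "z k"] z_le[of k] by (auto simp: ubar_def intro!: mult_right_mono)
      also have "\<dots> \<le> (\<Sum>k<N. ?f k t)" using kN l by (intro member_le_sum) auto
      finally show ?thesis using t by (intro add_increasing2) auto
    qed
  qed simp
  have "AE t in lebesgue. t \<noteq> c" by (rule AE_I'[of "{c}"]) (auto simp: null_sets_def)
  then have ae: "AE t in lebesgue. H t * u t * indicator {c..d} t \<le> (\<Sum>k<N. ?f k t) + ?g t"
    by (rule eventually_mono) (rule pt)
  have "(\<integral>\<^sup>+ t. H t * u t \<partial>lebesgue_on {c..d}) \<le> (\<integral>\<^sup>+ t. (\<Sum>k<N. ?f k t) + ?g t \<partial>lebesgue)"
    unfolding nn_integral_lebesgue_on[OF lmeasurable_interval(1)[THEN fmeasurableD]]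
    by (rule nn_integral_mono_AE[OF ae])
  also have "\<dots> = (\<Sum>k<N. H (z (Suc k)) * (\<integral>\<^sup>+ t. ubar t * indicator {z k<..z (Suc k)} t \<partial>lebesgue))
       + H d * (\<integral>\<^sup>+ t. ubar t * indicator {z N<..d} t \<partial>lebesgue)"
    by (simp add: nn_integral_add nn_integral_sum nn_integral_cmult ubar_indicator_meas
        borel_measurable_sum borel_measurable_times_ennreal)
  also have "\<dots> = (\<Sum>k<N. ennreal (U (Suc k)) * H (z (Suc k))) + ennreal (U N) * H d"
    using z_mono[of _ "Suc _"] z_props T_end
    by (simp add: integral_ubar_Ioc T_z U_Suc mult.commute)
  also have "(\<Sum>k<N. ennreal (U (Suc k)) * H (z (Suc k))) = (\<Sum>k\<in>Suc ` {..<N}. ennreal (U k) * H (z k))"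
    by (subst sum.reindex) auto
  also have "\<dots> \<le> (\<Sum>k\<le>N. ennreal (U k) * H (z k))"
    by (intro sum_mono2) auto
  finally show ?thesis by (simp add: add_right_mono)
qed

text \<open>
  Here \<open>H\<close> is bounded below by its value at the left end, and the index is shifted by one
  because a test function for the point \<open>z k\<close> reaches its full size only at \<open>z (Suc
  k)\<close>.
\<close>

lemma integral_grid_lower:
  fixes H :: "real \<Rightarrow> ennreal"
  assumes H: "\<And>s t. c \<le> s \<Longrightarrow> s \<le> t \<Longrightarrow> t \<le> d \<Longrightarrow> H s \<le> H t"
  shows "(\<Sum>k\<le>N. ennreal (U (k + 2)) * H (z (Suc k))) \<le> (\<integral>\<^sup>+ t. H t * u t \<partial>lebesgue_on {c..d})"
proof -
  let ?f = "\<lambda>k t. H (z (Suc k)) * (ubar t * indicator {z (Suc k)<..z (Suc (Suc k))} t)"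
  have "(\<Sum>k\<le>N. ?f k t) \<le> H t * u t * indicator {c..d} t" for t
  proof (cases "\<exists>l\<le>N. t \<in> {z (Suc l)<..z (Suc (Suc l))}")
    case True
    then obtain l where l: "l \<le> N" "t \<in> {z (Suc l)<..z (Suc (Suc l))}" by blast
    have "t \<notin> {z (Suc k)<..z (Suc (Suc k))}" if "k \<noteq> l" for k
    proof (cases "k < l")
      case True
      then show ?thesis using z_mono[of "Suc (Suc k)" "Suc l"] l by auto
    next
      case False
      then show ?thesis using z_mono[of "Suc (Suc l)" "Suc k"] l that by auto
    qed
    then have "(\<Sum>k\<le>N. ?f k t) = (\<Sum>k\<le>N. if k = l then ?f l t else 0)"
      by (intro sum.cong) auto
    also have "\<dots> = ?f l t" using l by simp
    also have "\<dots> \<le> H t * u t * indicator {c..d} t"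
      using l z_in[of "Suc l"] z_in[of "Suc (Suc l)"] H[of "z (Suc l)" t]
      by (auto simp: ubar_def intro!: mult_right_mono)
    finally show ?thesis .
  next
    case False
    then have "(\<Sum>k\<le>N. ?f k t) = 0" by (intro sum.neutral) auto
    then show ?thesis by (simp only: zero_le)
  qed
  then have "(\<integral>\<^sup>+ t. (\<Sum>k\<le>N. ?f k t) \<partial>lebesgue) \<le> (\<integral>\<^sup>+ t. H t * u t \<partial>lebesgue_on {c..d})"
    unfolding nn_integral_lebesgue_on[OF lmeasurable_interval(1)[THEN fmeasurableD]]
    by (intro nn_integral_mono)
  also have "(\<integral>\<^sup>+ t. (\<Sum>k\<le>N. ?f k t) \<partial>lebesgue)
      = (\<Sum>k\<le>N. H (z (Suc k)) * (\<integral>\<^sup>+ t. ubar t * indicator {z (Suc k)<..z (Suc (Suc k))} t \<partial>lebesgue))"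
    by (simp add: nn_integral_sum nn_integral_cmult ubar_indicator_meas borel_measurable_times_ennreal)
  also have "\<dots> = (\<Sum>k\<le>N. ennreal (U (k + 2)) * H (z (Suc k)))"
    using z_mono[of _ "Suc _"] z_props
    by (simp add: integral_ubar_Ioc T_z U_Suc mult.commute)
  finally show ?thesis .
qed

lemma grid_sum_le:
  assumes \<gamma>: "1 \<le> \<gamma>" and x: "x \<le> z N"
  shows "\<exists>j\<le>N. x \<le> z j \<and> (\<Sum>k\<in>{k\<in>{..N}. x \<le> z k}. U k powr \<gamma>) \<le> 2 * U j powr \<gamma>"
proof -
  define j where "j = (LEAST j. x \<le> z j)"
  have j: "x \<le> z j" unfolding j_def using x by (rule LeastI)
  have jN: "j \<le> N" unfolding j_def using x by (rule Least_le)
  have "{k\<in>{..N}. x \<le> z k} \<subseteq> {j..N}" unfolding j_def by (auto intro: Least_le)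
  then have "(\<Sum>k\<in>{k\<in>{..N}. x \<le> z k}. U k powr \<gamma>) \<le> (\<Sum>k=j..N. U k powr \<gamma>)"
    by (intro sum_mono2) auto
  also have "\<dots> \<le> 2 * U j powr \<gamma>"
  proof (rule halving_sum)
    fix k
    have "(2::real) powr 1 \<le> 2 powr \<gamma>" using \<gamma> by (intro powr_mono) auto
    then show "U (Suc k) powr \<gamma> \<le> U k powr \<gamma> / 2"
      using mult_left_mono[of 2 "2 powr \<gamma>" "U k powr \<gamma>"]
      by (simp add: U_Suc powr_divide field_simps)
  qed simp
  finally show ?thesis using j jN by blast
qed

end

section \<open>Grid sums against Stieltjes integrals\<close>

definition split_const :: "real \<Rightarrow> real" where
  "split_const r = (1 - (1/2) powr r) powr (- 1 / r)"

lemma half_powr_less_one: "0 < r \<Longrightarrow> (1/2::real) powr r < 1"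
  using powr_less_mono2_neg[of "-r" 1 2] by (simp add: powr_minus powr_divide inverse_eq_divide)

lemma split_const_pos: "0 < r \<Longrightarrow> 0 < split_const r"
  using half_powr_less_one[of r] by (simp add: split_const_def)

text \<open>
  The constant is chosen so that it undoes the fraction \<open>1 - 2\<^sup>-\<^sup>r\<close> lost in
  splitting a profile.
\<close>

lemma split_const_cancel:
  assumes r: "0 < r" and k: "0 < k" and L: "ennreal (1 - (1/2) powr r) * A \<le> B"
  shows "epow A (k / r) \<le> ennreal (split_const r powr k) * epow B (k / r)"
proof -
  let ?\<theta> = "1 - (1/2::real) powr r"
  have \<theta>: "0 < ?\<theta>" using half_powr_less_one[OF r] by simp
  have "ennreal (?\<theta> powr (k / r)) * epow A (k / r) = epow (ennreal ?\<theta> * A) (k / r)"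
    using \<theta> r k by (simp add: epow_mult epow_ennreal)
  also have "\<dots> \<le> epow B (k / r)" using r k L by (intro epow_mono) auto
  finally have "ennreal (split_const r powr k) * (ennreal (?\<theta> powr (k / r)) * epow A (k / r))
      \<le> ennreal (split_const r powr k) * epow B (k / r)" by (intro mult_left_mono) auto
  moreover have "split_const r powr k * ?\<theta> powr (k / r) = 1"
    using \<theta> r by (simp add: split_const_def powr_powr powr_add[symmetric])
  ultimately show ?thesis
    by (simp add: mult.assoc[symmetric] ennreal_mult[symmetric])
qed

context weight_grid
begin

text \<open>
  The inner integrals of the characteristics, over the closed and over the half-open interval.
\<close>

abbreviation Jc :: "(real \<Rightarrow> ennreal) \<Rightarrow> real \<Rightarrow> real \<Rightarrow> ennreal" where
  "Jc \<Phi> r x \<equiv> (\<integral>\<^sup>+ t\<in>{x..d}. epow (tail d u t) (r / q) \<partial>stieltjes c d (\<lambda>t. epow (\<Phi> t) r))"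

abbreviation Jo :: "(real \<Rightarrow> ennreal) \<Rightarrow> real \<Rightarrow> real \<Rightarrow> ennreal" where
  "Jo \<Phi> r x \<equiv> (\<integral>\<^sup>+ t\<in>{x<..d}. epow (tail d u t) (r / q) \<partial>stieltjes c d (\<lambda>t. epow (\<Phi> t) r))"

lemma Jo_le_Jc: "Jo \<Phi> r x \<le> Jc \<Phi> r x"
  by (intro nn_integral_mono mult_left_mono) (auto split: split_indicator)

definition grid_val :: "(real \<Rightarrow> ennreal) \<Rightarrow> nat \<Rightarrow> real" where "grid_val \<Phi> k = enn2real (\<Phi> (z k))"

lemma grid_val_nonneg [simp]: "0 \<le> grid_val \<Phi> k"
  by (simp add: grid_val_def)

lemma grid_val_eq: "is_profile c d \<Phi> \<Longrightarrow> \<Phi> (z k) = ennreal (grid_val \<Phi> k)"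
  using z_in[of k] by (simp add: grid_val_def is_profile_def)

lemma profile_mono: "is_profile c d \<Phi> \<Longrightarrow> c \<le> x \<Longrightarrow> x \<le> y \<Longrightarrow> y \<le> d \<Longrightarrow> \<Phi> x \<le> \<Phi> y"
  by (simp add: is_profile_def)

lemma grid_val_mono: "is_profile c d \<Phi> \<Longrightarrow> mono (grid_val \<Phi>)"
proof (rule monoI)
  fix k l :: nat assume a: "is_profile c d \<Phi>" "k \<le> l"
  then have "\<Phi> (z k) \<le> \<Phi> (z l)" using z_mono z_ge z_le by (intro profile_mono) auto
  then show "grid_val \<Phi> k \<le> grid_val \<Phi> l" using a by (simp add: grid_val_eq)
qed

text \<open>
  The discrete counterpart of the inner integrals at \<open>x\<close>: the tail powers at the grid
  points from \<open>x\<close> on, weighted with the mass of \<open>[c, z k]\<close>.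
\<close>

definition grid_sum :: "(real \<Rightarrow> ennreal) \<Rightarrow> real \<Rightarrow> nat \<Rightarrow> real \<Rightarrow> ennreal" where
  "grid_sum \<Phi> r N x = (\<Sum>k\<in>{k\<in>{..N}. x \<le> z k}. ennreal (U k powr (r / q)) * epow (\<Phi> (z k)) r)"

lemma grid_sum_measurable [measurable]: "grid_sum \<Phi> r N \<in> borel_measurable borel"
  by (intro borel_measurable_antimono_ennreal) (auto simp: grid_sum_def intro!: sum_mono2)

text \<open>
  At a point \<open>t\<close> the grid points from \<open>t\<close> on contribute a geometric sum,
  which is at most twice its first term and hence at most twice the power of the tail at
  \<open>t\<close>.
\<close>

lemma grid_integral_le:
  assumes \<gamma>: "1 \<le> \<gamma>" and S: "S \<in> sets borel" "S \<subseteq> {c..d}" and \<mu>: "sets \<mu> = sets borel"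
  shows "(\<Sum>k\<le>N. ennreal (U k powr \<gamma>) * emeasure \<mu> (S \<inter> {..z k}))
     \<le> 2 * (\<integral>\<^sup>+ t\<in>S. epow (tail d u t) \<gamma> \<partial>\<mu>)"
proof -
  have [measurable_cong]: "sets \<mu> = sets borel" by fact
  have Sk: "S \<inter> {..z k} \<in> sets \<mu>" for k using S \<mu> by simp
  have [measurable]: "(\<lambda>t. epow (tail d u t) \<gamma>) \<in> borel_measurable \<mu>"
    using \<gamma> borel_measurable_tail_powr[of \<gamma> d u] measurable_cong_sets[OF \<mu> refl] by auto
  have [measurable]: "S \<in> sets \<mu>" using S \<mu> by simp
  have "(\<Sum>k\<le>N. ennreal (U k powr \<gamma>) * emeasure \<mu> (S \<inter> {..z k}))
      = (\<integral>\<^sup>+ t. (\<Sum>k\<le>N. ennreal (U k powr \<gamma>) * indicator (S \<inter> {..z k}) t) \<partial>\<mu>)"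
  proof -
    have "(\<integral>\<^sup>+ t. (\<Sum>k\<le>N. ennreal (U k powr \<gamma>) * indicator (S \<inter> {..z k}) t) \<partial>\<mu>)
       = (\<Sum>k\<le>N. \<integral>\<^sup>+ t. ennreal (U k powr \<gamma>) * indicator (S \<inter> {..z k}) t \<partial>\<mu>)"
      using Sk by (intro nn_integral_sum borel_measurable_times_ennreal borel_measurable_indicator) auto
    then show ?thesis by (simp only: nn_integral_cmult_indicator[OF Sk])
  qed
  also have "\<dots> \<le> (\<integral>\<^sup>+ t. 2 * (epow (tail d u t) \<gamma> * indicator S t) \<partial>\<mu>)"
  proof (rule nn_integral_mono)
    fix t
    have eq: "(\<Sum>k\<le>N. ennreal (U k powr \<gamma>) * indicator (S \<inter> {..z k}) t)
        = (\<Sum>k\<in>{k\<in>{..N}. t \<le> z k}. ennreal (U k powr \<gamma>)) * indicator S t"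
      unfolding sum_distrib_right by (intro sum.mono_neutral_cong_right) (auto split: split_indicator)
    show "(\<Sum>k\<le>N. ennreal (U k powr \<gamma>) * indicator (S \<inter> {..z k}) t)
        \<le> 2 * (epow (tail d u t) \<gamma> * indicator S t)"
    proof (cases "t \<in> S \<and> t \<le> z N")
      case True
      then have t: "t \<in> {c..d}" using S by auto
      obtain j where j: "j \<le> N" "t \<le> z j"
        "(\<Sum>k\<in>{k\<in>{..N}. t \<le> z k}. U k powr \<gamma>) \<le> 2 * U j powr \<gamma>"
        using grid_sum_le[OF \<gamma>, of t N] True by blast
      have "U j \<le> T t" using T_antimono[of t "z j"] t j z_le by (simp add: T_z)
      then have "U j powr \<gamma> \<le> T t powr \<gamma>" using \<gamma> by (intro powr_mono2) auto
      then have "(\<Sum>k\<in>{k\<in>{..N}. t \<le> z k}. U k powr \<gamma>) \<le> 2 * T t powr \<gamma>" using j by linarith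
      then have "ennreal (\<Sum>k\<in>{k\<in>{..N}. t \<le> z k}. U k powr \<gamma>) \<le> 2 * epow (tail d u t) \<gamma>"
        using t \<gamma> by (simp add: epow_tail ennreal_mult[symmetric] ennreal_leI flip: ennreal_numeral)
      then show ?thesis unfolding eq using True by simp
    next
      case False
      have emp: "{k\<in>{..N}. t \<le> z k} = {}" if "\<not> t \<le> z N"
        using that z_mono by (auto intro: order_trans)
      then have "(\<Sum>k\<in>{k\<in>{..N}. t \<le> z k}. ennreal (U k powr \<gamma>)) * indicator S t = 0"
      proof (cases "t \<in> S")
        case True
        then have "{k\<in>{..N}. t \<le> z k} = {}" using emp False by blast
        then show ?thesis by (simp only: sum.empty mult_zero_left)
      qed simp
      then show ?thesis unfolding eq by (simp only: zero_le)
    qed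
  qed
  also have "\<dots> = 2 * (\<integral>\<^sup>+ t\<in>S. epow (tail d u t) \<gamma> \<partial>\<mu>)"
    by (rule nn_integral_cmult) measurable
  finally show ?thesis .
qed

text \<open>
  Splitting \<open>[c, z k]\<close> at \<open>x\<close> separates the integral over \<open>(x,
  d]\<close> from the diagonal term. The latter is kept with the tail at a grid point
  \<open>j\<close>, so that it can also be summed over the grid.
\<close>

lemma grid_sum_upper:
  assumes \<Phi>: "is_profile c d \<Phi>" and r: "q \<le> r" and x: "c \<le> x" "x \<le> z N"
  shows "\<exists>j\<le>N. x \<le> z j \<and> grid_sum \<Phi> r N x \<le> 2 * Jo \<Phi> r x + 2 * (ennreal (U j powr (r / q)) * epow (\<Phi> x) r)"
proof -
  let ?\<mu> = "stieltjes c d (\<lambda>t. epow (\<Phi> t) r)"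
  have r0: "0 < r" and \<gamma>: "1 \<le> r / q" using q r by auto
  have xd: "x \<le> d" using x z_le[of N] by simp
  obtain j where j: "j \<le> N" "x \<le> z j"
    "(\<Sum>k\<in>{k\<in>{..N}. x \<le> z k}. U k powr (r / q)) \<le> 2 * U j powr (r / q)"
    using grid_sum_le[OF \<gamma> x(2)] by blast
  have "grid_sum \<Phi> r N x = (\<Sum>k\<in>{k\<in>{..N}. x \<le> z k}. ennreal (U k powr (r/q)) * (epow (\<Phi> x) r + emeasure ?\<mu> ({x<..d} \<inter> {..z k})))"
    unfolding grid_sum_def
  proof (intro sum.cong refl)
    fix k assume "k \<in> {k\<in>{..N}. x \<le> z k}"
    then have k: "x \<le> z k" by simp
    have "{x<..d} \<inter> {..z k} = {x<..z k}" using z_le[of k] by auto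
    then show "ennreal (U k powr (r/q)) * epow (\<Phi> (z k)) r =
        ennreal (U k powr (r/q)) * (epow (\<Phi> x) r + emeasure ?\<mu> ({x<..d} \<inter> {..z k}))"
      using emeasure_stieltjes_Ioc[OF \<Phi> r0 x(1) k z_le] emeasure_stieltjes_profile[OF \<Phi> r0, of x] x xd by simp
  qed
  also have "\<dots> = ennreal (\<Sum>k\<in>{k\<in>{..N}. x \<le> z k}. U k powr (r / q)) * epow (\<Phi> x) r
     + (\<Sum>k\<in>{k\<in>{..N}. x \<le> z k}. ennreal (U k powr (r/q)) * emeasure ?\<mu> ({x<..d} \<inter> {..z k}))"
    by (simp add: distrib_left sum.distrib sum_distrib_right flip: sum_ennreal)
  also have "\<dots> \<le> ennreal (2 * U j powr (r / q)) * epow (\<Phi> x) r + 2 * Jo \<Phi> r x"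
  proof (rule add_mono)
    show "ennreal (\<Sum>k\<in>{k\<in>{..N}. x \<le> z k}. U k powr (r / q)) * epow (\<Phi> x) r
       \<le> ennreal (2 * U j powr (r / q)) * epow (\<Phi> x) r"
      using j by (intro mult_right_mono ennreal_leI) auto
    have "(\<Sum>k\<in>{k\<in>{..N}. x \<le> z k}. ennreal (U k powr (r/q)) * emeasure ?\<mu> ({x<..d} \<inter> {..z k}))
        \<le> (\<Sum>k\<le>N. ennreal (U k powr (r/q)) * emeasure ?\<mu> ({x<..d} \<inter> {..z k}))"
      by (intro sum_mono2) auto
    also have "\<dots> \<le> 2 * Jo \<Phi> r x" using \<gamma> x by (intro grid_integral_le) auto
    finally show "(\<Sum>k\<in>{k\<in>{..N}. x \<le> z k}. ennreal (U k powr (r/q)) * emeasure ?\<mu> ({x<..d} \<inter> {..z k}))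
        \<le> 2 * Jo \<Phi> r x" .
  qed
  finally show ?thesis using j by (auto simp: ennreal_mult mult.assoc add.commute)
qed

text \<open>
  Every \<open>t \<ge> x\<close> with a positive tail has a first grid point \<open>z k \<ge>
  t\<close>, and there the tail has dropped by at most a factor 2.
\<close>

lemma Jc_le_SUP:
  assumes \<Phi>: "is_profile c d \<Phi>" and r: "0 < r" and x: "x \<in> {c..d}"
  shows "Jc \<Phi> r x \<le> (SUP N. ennreal (2 powr (r / q)) * grid_sum \<Phi> r N x)"
proof -
  let ?\<mu> = "stieltjes c d (\<lambda>t. epow (\<Phi> t) r)"
  define a where "a k = ennreal (2 powr (r/q)) * (if x \<le> z k then ennreal (U k powr (r/q)) else 0)" for k
  have pos: "0 < r / q" using r q by simp
  have pt: "epow (tail d u t) (r / q) * indicator {x..d} t \<le> (\<Sum>k. a k * indicator {c..z k} t)" for t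
  proof (cases "t \<in> {x..d} \<and> T t \<noteq> 0")
    case True
    then have t: "c \<le> t" "x \<le> t" "t \<le> d" "0 < T t" using x T_nonneg[of t] by (auto simp: less_le)
    have "\<exists>k. T c / T t < 2 ^ k" by (rule real_arch_pow) simp
    then obtain k0 where "T c / T t < 2 ^ k0" by blast
    then have "U k0 < T t" using t by (simp add: U_def field_simps)
    then have ex: "\<exists>k. t \<le> z k" using T_antimono[of "z k0" t] z_ge[of k0] t T_z[of k0] by (metis linear not_le)
    define k where "k = (LEAST k. t \<le> z k)"
    have k: "t \<le> z k" unfolding k_def using ex by (rule LeastI_ex)
    have "T t \<le> 2 * U k"
    proof (cases k)
      case 0
      then show ?thesis using T_antimono[of c t] t by (simp add: U_def)
    next
      case (Suc l)
      then have "\<not> t \<le> z l" using not_less_Least[of l "\<lambda>k. t \<le> z k"] by (simp add: k_def)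
      then have "T t \<le> T (z l)" using t z_ge by (intro T_antimono) auto
      then show ?thesis using Suc by (simp add: T_z U_Suc)
    qed
    then have "T t powr (r/q) \<le> (2 * U k) powr (r/q)" using pos by (intro powr_mono2) auto
    then have "epow (tail d u t) (r / q) * indicator {x..d} t \<le> a k * indicator {c..z k} t"
      using t k pos by (simp add: epow_tail a_def ennreal_mult[symmetric] powr_mult ennreal_leI)
    also have "\<dots> \<le> (\<Sum>k. a k * indicator {c..z k} t)"
    proof -
      define f where "f = (\<lambda>k. a k * indicator {c..z k} t)"
      have "f k \<le> suminf f" using sum_le_suminf[of f "{k}"] by simp
      then show ?thesis unfolding f_def .
    qed
    finally show ?thesis .
  next
    case False
    then have "epow (tail d u t) (r / q) * indicator {x..d} t = 0"
      using x pos by (auto simp: tail_eq_T split: split_indicator)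
    then show ?thesis by (simp only: zero_le)
  qed
  have "Jc \<Phi> r x \<le> (\<integral>\<^sup>+ t. (\<Sum>k. a k * indicator {c..z k} t) \<partial>?\<mu>)"
    by (intro nn_integral_mono pt)
  also have "\<dots> = (\<Sum>k. a k * emeasure ?\<mu> {c..z k})"
    by (subst nn_integral_suminf) (simp_all add: nn_integral_cmult_indicator)
  also have "\<dots> = (SUP n. \<Sum>k<n. a k * emeasure ?\<mu> {c..z k})" by (rule suminf_eq_SUP)
  also have "\<dots> \<le> (SUP N. ennreal (2 powr (r / q)) * grid_sum \<Phi> r N x)"
  proof (rule SUP_least)
    fix n
    have "(\<Sum>k<n. a k * emeasure ?\<mu> {c..z k}) \<le> (\<Sum>k\<le>n. a k * emeasure ?\<mu> {c..z k})"
      by (intro sum_mono2) auto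
    also have "\<dots> = ennreal (2 powr (r / q)) * grid_sum \<Phi> r n x"
      unfolding grid_sum_def sum_distrib_left
      by (intro sum.mono_neutral_cong_right)
        (auto simp: a_def emeasure_stieltjes_profile[OF \<Phi> r z_in] mult.assoc)
    also have "\<dots> \<le> (SUP N. ennreal (2 powr (r / q)) * grid_sum \<Phi> r N x)" by (rule SUP_upper) simp
    finally show "(\<Sum>k<n. a k * emeasure ?\<mu> {c..z k}) \<le> (SUP N. ennreal (2 powr (r / q)) * grid_sum \<Phi> r N x)" .
  qed
  finally show ?thesis .
qed

lemma grid_sum_summand:
  assumes \<Phi>: "is_profile c d \<Phi>" and r: "0 < r"
  shows "ennreal (U k powr (r / q)) * epow (\<Phi> (z k)) r = ennreal ((U k powr (1/q) * grid_val \<Phi> k) powr r)"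
  using r by (simp add: grid_val_eq[OF \<Phi>] epow_ennreal powr_mult powr_powr ennreal_mult)

lemma grid_sum_eq:
  assumes \<Phi>: "is_profile c d \<Phi>" and r: "0 < r" and x: "x \<le> z N"
  shows "\<exists>i\<le>N. x \<le> z i \<and> grid_sum \<Phi> r N x = ennreal (\<Sum>j=i..N. (U j powr (1/q) * grid_val \<Phi> j) powr r)"
proof -
  define i where "i = (LEAST i. x \<le> z i)"
  have i: "x \<le> z i" unfolding i_def using x by (rule LeastI)
  have iN: "i \<le> N" unfolding i_def using x by (rule Least_le)
  have "{k\<in>{..N}. x \<le> z k} = {i..N}"
    using i z_mono[of i] by (auto simp: i_def intro: Least_le order_trans)
  then have "grid_sum \<Phi> r N x = ennreal (\<Sum>j=i..N. (U j powr (1/q) * grid_val \<Phi> j) powr r)"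
    by (simp add: grid_sum_def grid_sum_summand[OF \<Phi> r])
  then show ?thesis using i iN by blast
qed

lemma grid_sum_eq_0: "z N < x \<Longrightarrow> grid_sum \<Phi> r N x = 0"
  unfolding grid_sum_def using z_mono[of _ N] by (intro sum.neutral) fastforce

lemma le_grid_sum_at:
  assumes \<Phi>: "is_profile c d \<Phi>" and r: "0 < r"
  shows "ennreal (\<Sum>j=i..N. (U j powr (1/q) * grid_val \<Phi> j) powr r) \<le> grid_sum \<Phi> r N (z i)"
proof -
  have "ennreal (\<Sum>j=i..N. (U j powr (1/q) * grid_val \<Phi> j) powr r)
     = (\<Sum>j=i..N. ennreal (U j powr (r / q)) * epow (\<Phi> (z j)) r)"
    by (simp add: grid_sum_summand[OF \<Phi> r])
  also have "\<dots> \<le> grid_sum \<Phi> r N (z i)"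
    unfolding grid_sum_def using z_mono by (intro sum_mono2) auto
  finally show ?thesis .
qed

text \<open>
  The supremum that governs the linear discrete inequality for \<open>p1 \<le> r\<close> is controlled
  by the integral over the half-open interval together with the diagonal term.
\<close>

lemma grid_sup_le:
  assumes \<Phi>1: "is_profile c d \<Phi>1" and \<Phi>2: "is_profile c d \<Phi>2" and r: "q \<le> r"
    and X: "\<And>x. x \<in> {c..d} \<Longrightarrow> \<Phi>1 x * epow (Jo \<Phi>2 r x) (1 / r) \<le> X"
    and Y: "\<And>x. x \<in> {c..d} \<Longrightarrow> epow (tail d u x) (1 / q) * \<Phi>1 x * \<Phi>2 x \<le> Y"
    and i: "i \<le> N"
  shows "ennreal (grid_val \<Phi>1 i * (\<Sum>j=i..N. (U j powr (1/q) * grid_val \<Phi>2 j) powr r) powr (1/r))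
      \<le> ennreal (4 powr (1/r)) * (X + Y)"
proof -
  have r0: "0 < r" using q r by simp
  define x where "x = z i"
  have x: "x \<in> {c..d}" "x \<le> z N" using z_in z_mono i by (auto simp: x_def)
  define E where "E = epow (tail d u x) (r / q) * epow (\<Phi>2 x) r"
  obtain j where j: "x \<le> z j" "grid_sum \<Phi>2 r N x \<le> 2 * Jo \<Phi>2 r x + 2 * (ennreal (U j powr (r / q)) * epow (\<Phi>2 x) r)"
    using grid_sum_upper[OF \<Phi>2 r, of x N] x by auto
  have "U j \<le> T x" using T_antimono[of x "z j"] j x z_le by (simp add: T_z)
  then have "ennreal (U j powr (r / q)) \<le> epow (tail d u x) (r / q)"
    using x r0 q by (simp add: epow_tail ennreal_leI powr_mono2)
  then have "2 * Jo \<Phi>2 r x + 2 * (ennreal (U j powr (r / q)) * epow (\<Phi>2 x) r) \<le> 2 * (Jo \<Phi>2 r x + E)"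
    unfolding E_def distrib_left by (intro add_left_mono mult_left_mono mult_right_mono) auto
  then have PE: "grid_sum \<Phi>2 r N x \<le> 2 * (Jo \<Phi>2 r x + E)" using j(2) by (rule order_trans[rotated])
  have E': "epow E (1/r) = epow (tail d u x) (1/q) * \<Phi>2 x"
    using r0 q by (simp add: E_def epow_mult epow_epow)
  have "ennreal (grid_val \<Phi>1 i * (\<Sum>j=i..N. (U j powr (1/q) * grid_val \<Phi>2 j) powr r) powr (1/r))
     = \<Phi>1 x * epow (ennreal (\<Sum>j=i..N. (U j powr (1/q) * grid_val \<Phi>2 j) powr r)) (1/r)"
    using r0 by (simp add: x_def grid_val_eq[OF \<Phi>1] epow_ennreal sum_nonneg ennreal_mult)
  also have "\<dots> \<le> \<Phi>1 x * epow (2 * (Jo \<Phi>2 r x + E)) (1/r)"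
    using le_grid_sum_at[OF \<Phi>2 r0, of i N] PE r0
    by (intro mult_left_mono epow_mono) (auto simp: x_def intro: order_trans)
  also have "\<dots> \<le> \<Phi>1 x * (ennreal (2 powr (1/r)) * (ennreal (2 powr (1/r)) * (epow (Jo \<Phi>2 r x) (1/r) + epow E (1/r))))"
  proof -
    have "epow 2 (1/r) = ennreal (2 powr (1/r))" using epow_ennreal[of 2 "1/r"] r0 by simp
    then have "epow (2 * (Jo \<Phi>2 r x + E)) (1/r) = ennreal (2 powr (1/r)) * epow (Jo \<Phi>2 r x + E) (1/r)"
      using epow_mult[of "1/r" 2 "Jo \<Phi>2 r x + E"] r0 by simp
    then show ?thesis using r0 by (simp only:) (intro mult_left_mono epow_add_le, auto)
  qed
  also have "\<dots> = ennreal (4 powr (1/r)) * (\<Phi>1 x * epow (Jo \<Phi>2 r x) (1/r) + epow (tail d u x) (1/q) * \<Phi>1 x * \<Phi>2 x)"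
  proof -
    have "(4::real) powr (1/r) = 2 powr (1/r) * 2 powr (1/r)" using powr_mult[of 2 2 "1/r"] by simp
    then show ?thesis unfolding E' by (simp add: ennreal_mult distrib_left mult_ac)
  qed
  also have "\<dots> \<le> ennreal (4 powr (1/r)) * (X + Y)"
    using X[OF x(1)] Y[OF x(1)] by (intro mult_left_mono add_mono) auto
  finally show ?thesis .
qed

lemma tail_mass_le_J:
  assumes S: "S \<in> sets borel" and yx: "x \<in> {c..d}" "S \<subseteq> {..x}" and r: "0 < r" and SR: "S \<subseteq> R" and R: "R \<in> sets borel"
  shows "epow (tail d u x) (r/q) * emeasure (stieltjes c d G) S
      \<le> (\<integral>\<^sup>+ t\<in>R. epow (tail d u t) (r / q) \<partial>stieltjes c d G)"
proof -
  have "epow (tail d u x) (r/q) * emeasure (stieltjes c d G) S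
     = (\<integral>\<^sup>+ t. epow (tail d u x) (r/q) * indicator S t \<partial>stieltjes c d G)"
    using S by (simp add: nn_integral_cmult_indicator)
  also have "\<dots> \<le> (\<integral>\<^sup>+ t\<in>R. epow (tail d u t) (r / q) \<partial>stieltjes c d G)"
    using yx SR q r
    by (intro nn_integral_mono) (auto intro!: epow_mono tail_antimono split: split_indicator)
  finally show ?thesis .
qed

text \<open>
  Absorption of the diagonal term: apply \<open>profile_split\<close> on \<open>[c, x]\<close>, where
  the tail is at least its value at \<open>x\<close>.
\<close>

lemma diagonal_le_split:
  assumes \<Phi>1: "is_profile c d \<Phi>1" and \<Phi>2: "is_profile c d \<Phi>2" and r: "0 < r1" "0 < r2"
    and X: "\<And>x. x \<in> {c..d} \<Longrightarrow> \<Phi>1 x * epow (Jc \<Phi>2 r2 x) (1 / r2) \<le> X"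
    and Y: "\<And>x. x \<in> {c..d} \<Longrightarrow> \<Phi>2 x * epow (Jo \<Phi>1 r1 x) (1 / r1) \<le> Y"
    and x: "x \<in> {c..d}"
  shows "epow (tail d u x) (1 / q) * \<Phi>1 x * \<Phi>2 x \<le>
     ennreal (2 * (split_const r1 + split_const r2)) * (X + Y)"
proof -
  have sc: "0 < split_const r1" "0 < split_const r2" using r by (simp_all add: split_const_pos)
  have key: "epow (tail d u x) (1 / q) * \<Psi> x \<le> ennreal (split_const r) * epow J (1 / r)"
    if L: "ennreal (1 - (1/2) powr r) * epow (\<Psi> x) r \<le> m" and mJ: "epow (tail d u x) (r/q) * m \<le> J"
      and r0: "0 < r" for \<Psi> r m J
  proof -
    have "ennreal (1 - (1/2) powr r) * (epow (tail d u x) (r/q) * epow (\<Psi> x) r)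
       = epow (tail d u x) (r/q) * (ennreal (1 - (1/2) powr r) * epow (\<Psi> x) r)" by (simp add: mult_ac)
    also have "\<dots> \<le> epow (tail d u x) (r/q) * m" using L by (intro mult_left_mono) auto
    also note mJ
    finally have "epow (epow (tail d u x) (r/q) * epow (\<Psi> x) r) (1 / r) \<le> ennreal (split_const r powr 1) * epow J (1 / r)"
      using r0 by (intro split_const_cancel) auto
    then show ?thesis using r0 q split_const_pos[OF r0] by (simp add: epow_mult epow_epow)
  qed
  show ?thesis
  proof (cases rule: profile_split[OF \<Phi>1 \<Phi>2 r x])
    case (1 y)
    have A: "epow (tail d u x) (1 / q) * \<Phi>2 x \<le> ennreal (split_const r2) * epow (Jc \<Phi>2 r2 y) (1 / r2)"
      by (rule key[where \<Psi> = \<Phi>2 and r = r2, OF 1(4)], rule tail_mass_le_J) (use 1 x r in auto)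
    have "epow (tail d u x) (1 / q) * \<Phi>2 x * \<Phi>1 x
       \<le> ennreal (split_const r2) * epow (Jc \<Phi>2 r2 y) (1 / r2) * (2 * \<Phi>1 y)"
      by (rule mult_mono[OF A 1(3)]) auto
    also have "\<dots> = ennreal (2 * split_const r2) * (\<Phi>1 y * epow (Jc \<Phi>2 r2 y) (1 / r2))"
      using sc by (simp add: ennreal_mult mult_ac)
    also have "\<dots> \<le> ennreal (2 * (split_const r1 + split_const r2)) * (X + Y)"
      using X[of y] 1 x sc by (intro mult_mono ennreal_leI) (auto intro: add_increasing2)
    finally show ?thesis by (simp add: mult_ac)
  next
    case (2 y)
    have A: "epow (tail d u x) (1 / q) * \<Phi>1 x \<le> ennreal (split_const r1) * epow (Jo \<Phi>1 r1 y) (1 / r1)"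
      by (rule key[where \<Psi> = \<Phi>1 and r = r1, OF 2(4)], rule tail_mass_le_J) (use 2 x r in auto)
    have "epow (tail d u x) (1 / q) * \<Phi>1 x * \<Phi>2 x
       \<le> ennreal (split_const r1) * epow (Jo \<Phi>1 r1 y) (1 / r1) * (2 * \<Phi>2 y)"
      by (rule mult_mono[OF A 2(3)]) auto
    also have "\<dots> = ennreal (2 * split_const r1) * (\<Phi>2 y * epow (Jo \<Phi>1 r1 y) (1 / r1))"
      using sc by (simp add: ennreal_mult mult_ac)
    also have "\<dots> \<le> ennreal (2 * (split_const r1 + split_const r2)) * (X + Y)"
      using Y[of y] 2 x sc by (intro mult_mono ennreal_leI) (auto intro: add_increasing)
    finally show ?thesis .
  qed
qed

text \<open>
  The same absorption inside an outer integral: the estimate at \<open>y\<close> persists for all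
  smaller points, because \<open>m\<close> is nonincreasing, and \<open>[c, y]\<close> has outer
  measure \<open>\<Phi>(y)\<^sup>\<kappa>\<close>.
\<close>

lemma grid_diagonal_step:
  fixes m :: "real \<Rightarrow> ennreal"
  assumes \<Phi>: "is_profile c d \<Phi>" and k: "0 < \<kappa>" and r: "0 < r"
    and y: "c \<le> y" "y \<le> z j" "\<Phi> (z j) \<le> 2 * \<Phi> y"
    and L: "ennreal (1 - (1/2) powr r) * epow (\<Psi> (z j)) r \<le> m y"
    and m: "\<And>x. x \<le> y \<Longrightarrow> m y \<le> m x"
  shows "ennreal (U j powr (\<kappa> / q)) * epow (\<Phi> (z j) * \<Psi> (z j)) \<kappa> \<le>
     ennreal ((2 * split_const r) powr \<kappa>) *
       (\<integral>\<^sup>+ x\<in>{c..d}. epow (ennreal (U j powr (r / q)) * m x) (\<kappa> / r) \<partial>stieltjes c d (\<lambda>t. epow (\<Phi> t) \<kappa>))"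
    (is "_ \<le> _ * ?I")
proof -
  let ?\<nu> = "stieltjes c d (\<lambda>t. epow (\<Phi> t) \<kappa>)"
  let ?E = "epow (ennreal (U j powr (r / q)) * m y) (\<kappa> / r)"
  have kr: "0 < \<kappa> / r" using k r by simp
  have sc: "0 < split_const r" using r by (rule split_const_pos)
  have yd: "y \<in> {c..d}" using y z_le[of j] by simp
  have "?E * epow (\<Phi> y) \<kappa> = (\<integral>\<^sup>+ x. ?E * indicator {c..y} x \<partial>?\<nu>)"
    using emeasure_stieltjes_profile[OF \<Phi> k yd] by (simp add: nn_integral_cmult_indicator)
  also have "\<dots> \<le> ?I"
    using m yd kr
    by (intro nn_integral_mono) (auto intro!: epow_mono mult_left_mono split: split_indicator)
  finally have I: "?E * epow (\<Phi> y) \<kappa> \<le> ?I" .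
  have U: "epow (ennreal (U j powr (r / q))) (\<kappa> / r) = ennreal (U j powr (\<kappa> / q))"
    using kr r by (simp add: epow_ennreal powr_powr)
  have "epow (\<Psi> (z j)) \<kappa> = epow (epow (\<Psi> (z j)) r) (\<kappa> / r)" using r k by (simp add: epow_epow)
  also have "\<dots> \<le> ennreal (split_const r powr \<kappa>) * epow (m y) (\<kappa> / r)"
    by (rule split_const_cancel[OF r k L])
  finally have \<Psi>: "epow (\<Psi> (z j)) \<kappa> \<le> ennreal (split_const r powr \<kappa>) * epow (m y) (\<kappa> / r)" .
  have "epow (\<Phi> (z j)) \<kappa> \<le> epow (2 * \<Phi> y) \<kappa>" using y k by (intro epow_mono) auto
  also have "\<dots> = ennreal (2 powr \<kappa>) * epow (\<Phi> y) \<kappa>"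
    using epow_ennreal[of 2 \<kappa>] k by (simp add: epow_mult)
  finally have \<Phi>2: "epow (\<Phi> (z j)) \<kappa> \<le> ennreal (2 powr \<kappa>) * epow (\<Phi> y) \<kappa>" .
  have "ennreal (U j powr (\<kappa> / q)) * epow (\<Phi> (z j) * \<Psi> (z j)) \<kappa>
      = ennreal (U j powr (\<kappa> / q)) * (epow (\<Phi> (z j)) \<kappa> * epow (\<Psi> (z j)) \<kappa>)"
    using k by (simp add: epow_mult)
  also have "\<dots> \<le> ennreal (U j powr (\<kappa> / q)) *
      ((ennreal (2 powr \<kappa>) * epow (\<Phi> y) \<kappa>) * (ennreal (split_const r powr \<kappa>) * epow (m y) (\<kappa> / r)))"
    by (intro mult_left_mono mult_mono \<Psi> \<Phi>2) auto
  also have "\<dots> = ennreal ((2 * split_const r) powr \<kappa>) * (?E * epow (\<Phi> y) \<kappa>)"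
    using kr by (simp add: epow_mult U powr_mult ennreal_mult mult_ac)
  also have "\<dots> \<le> ennreal ((2 * split_const r) powr \<kappa>) * ?I"
    by (intro mult_left_mono I) auto
  finally show ?thesis .
qed

text \<open>
  Since \<open>\<kappa> / r \<ge> 1\<close>, the sum over the grid may be taken inside the power,
  where it is again geometric.
\<close>

lemma grid_integral_powr_le:
  assumes r: "q \<le> r" "r \<le> \<kappa>" and S: "\<And>x. S x \<in> sets borel" "\<And>x. x \<in> {c..d} \<Longrightarrow> S x \<subseteq> {c..d}"
    and anti: "\<And>x y. x \<le> y \<Longrightarrow> S y \<subseteq> S x" and \<mu>: "sets \<mu> = sets borel" and \<nu>: "sets \<nu> = sets borel"
  shows "(\<Sum>j\<le>N. \<integral>\<^sup>+ x\<in>{c..d}. epow (ennreal (U j powr (r / q)) * emeasure \<mu> (S x \<inter> {..z j})) (\<kappa> / r) \<partial>\<nu>)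
     \<le> ennreal (2 powr (\<kappa> / r)) * (\<integral>\<^sup>+ x\<in>{c..d}. epow (\<integral>\<^sup>+ t\<in>S x. epow (tail d u t) (r / q) \<partial>\<mu>) (\<kappa> / r) \<partial>\<nu>)"
proof -
  have r0: "0 < r" and k0: "0 < \<kappa>" and \<gamma>: "1 \<le> r / q" and s: "1 \<le> \<kappa> / r" using r q by auto
  have s0: "0 < \<kappa> / r" using r0 k0 by simp
  have [measurable_cong]: "sets \<nu> = sets borel" by fact
  have ms: "(\<lambda>x. emeasure \<mu> (S x \<inter> {..z j})) \<in> borel_measurable borel" for j
    using anti S \<mu> by (intro borel_measurable_antimono_ennreal emeasure_mono) auto
  have [measurable]: "(\<lambda>x. emeasure \<mu> (S x \<inter> {..z j})) \<in> borel_measurable \<nu>" for j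
    using ms[of j] measurable_cong_sets[OF \<nu> refl] by auto
  have mI: "(\<lambda>x. \<integral>\<^sup>+ t\<in>S x. epow (tail d u t) (r / q) \<partial>\<mu>) \<in> borel_measurable borel"
    using anti by (intro borel_measurable_antimono_ennreal nn_integral_mono mult_left_mono)
      (auto split: split_indicator)
  have [measurable]: "(\<lambda>x. \<integral>\<^sup>+ t\<in>S x. epow (tail d u t) (r / q) \<partial>\<mu>) \<in> borel_measurable \<nu>"
    using mI measurable_cong_sets[OF \<nu> refl] by auto
  let ?e = "\<lambda>j x. epow (ennreal (U j powr (r / q)) * emeasure \<mu> (S x \<inter> {..z j})) (\<kappa> / r)"
  let ?J = "\<lambda>x. \<integral>\<^sup>+ t\<in>S x. epow (tail d u t) (r / q) \<partial>\<mu>"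
  have "(\<Sum>j\<le>N. \<integral>\<^sup>+ x\<in>{c..d}. ?e j x \<partial>\<nu>) = (\<integral>\<^sup>+ x. (\<Sum>j\<le>N. ?e j x * indicator {c..d} x) \<partial>\<nu>)"
    by (rule nn_integral_sum[symmetric]) measurable
  also have "\<dots> \<le> (\<integral>\<^sup>+ x. ennreal (2 powr (\<kappa> / r)) * (epow (?J x) (\<kappa> / r) * indicator {c..d} x) \<partial>\<nu>)"
  proof (rule nn_integral_mono)
    fix x
    show "(\<Sum>j\<le>N. ?e j x * indicator {c..d} x) \<le> ennreal (2 powr (\<kappa> / r)) * (epow (?J x) (\<kappa> / r) * indicator {c..d} x)"
    proof (cases "x \<in> {c..d}")
      case True
      have "(\<Sum>j\<le>N. ?e j x) \<le> epow (\<Sum>j\<le>N. ennreal (U j powr (r / q)) * emeasure \<mu> (S x \<inter> {..z j})) (\<kappa> / r)"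
        using s by (intro sum_epow_le) auto
      also have "\<dots> \<le> epow (2 * ?J x) (\<kappa> / r)"
        using True by (intro epow_mono s0 grid_integral_le \<gamma> S \<mu>)
      also have "\<dots> = ennreal (2 powr (\<kappa> / r)) * epow (?J x) (\<kappa> / r)"
        using epow_ennreal[of 2 "\<kappa> / r"] s0 by (simp add: epow_mult)
      finally show ?thesis using True by simp
    qed simp
  qed
  also have "\<dots> = ennreal (2 powr (\<kappa> / r)) * (\<integral>\<^sup>+ x\<in>{c..d}. epow (?J x) (\<kappa> / r) \<partial>\<nu>)"
    by (rule nn_integral_cmult) measurable
  finally show ?thesis .
qed

abbreviation Kc :: "(real \<Rightarrow> ennreal) \<Rightarrow> (real \<Rightarrow> ennreal) \<Rightarrow> real \<Rightarrow> real \<Rightarrow> ennreal" where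
  "Kc \<Phi> \<Psi> \<kappa> r \<equiv> \<integral>\<^sup>+ x\<in>{c..d}. epow (Jc \<Psi> r x) (\<kappa> / r) \<partial>stieltjes c d (\<lambda>t. epow (\<Phi> t) \<kappa>)"

abbreviation Ko :: "(real \<Rightarrow> ennreal) \<Rightarrow> (real \<Rightarrow> ennreal) \<Rightarrow> real \<Rightarrow> real \<Rightarrow> ennreal" where
  "Ko \<Phi> \<Psi> \<kappa> r \<equiv> \<integral>\<^sup>+ x\<in>{c..d}. epow (Jo \<Psi> r x) (\<kappa> / r) \<partial>stieltjes c d (\<lambda>t. epow (\<Phi> t) \<kappa>)"

lemma Ko_le_Kc: "0 < \<kappa> \<Longrightarrow> 0 < r \<Longrightarrow> Ko \<Phi> \<Psi> \<kappa> r \<le> Kc \<Phi> \<Psi> \<kappa> r"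
  by (intro nn_integral_mono mult_right_mono epow_mono Jo_le_Jc) auto

text \<open>
  The two cases of \<open>profile_split\<close>, used at each grid point, lead to the two summands of
  the characteristic.
\<close>

lemma grid_diagonal_sum:
  assumes \<Phi>1: "is_profile c d \<Phi>1" and \<Phi>2: "is_profile c d \<Phi>2"
    and r: "q \<le> r1" "q \<le> r2" "r1 \<le> \<kappa>" "r2 \<le> \<kappa>"
  shows "(\<Sum>j\<le>N. ennreal (U j powr (\<kappa> / q)) * epow (\<Phi>1 (z j) * \<Phi>2 (z j)) \<kappa>) \<le>
     ennreal ((2 * split_const r2) powr \<kappa> * 2 powr (\<kappa> / r2) + (2 * split_const r1) powr \<kappa> * 2 powr (\<kappa> / r1)) *
     (Kc \<Phi>1 \<Phi>2 \<kappa> r2 + Ko \<Phi>2 \<Phi>1 \<kappa> r1)"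
proof -
  have r0: "0 < r1" "0 < r2" "0 < \<kappa>" using r q by auto
  let ?\<mu>1 = "stieltjes c d (\<lambda>t. epow (\<Phi>1 t) r1)" and ?\<mu>2 = "stieltjes c d (\<lambda>t. epow (\<Phi>2 t) r2)"
  define C1 where "C1 = (2 * split_const r2) powr \<kappa>"
  define C2 where "C2 = (2 * split_const r1) powr \<kappa>"
  define E1 where "E1 j = (\<integral>\<^sup>+ x\<in>{c..d}. epow (ennreal (U j powr (r2 / q)) * emeasure ?\<mu>2 ({x..d} \<inter> {..z j})) (\<kappa> / r2)
      \<partial>stieltjes c d (\<lambda>t. epow (\<Phi>1 t) \<kappa>))" for j
  define E2 where "E2 j = (\<integral>\<^sup>+ x\<in>{c..d}. epow (ennreal (U j powr (r1 / q)) * emeasure ?\<mu>1 ({x<..d} \<inter> {..z j})) (\<kappa> / r1)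
      \<partial>stieltjes c d (\<lambda>t. epow (\<Phi>2 t) \<kappa>))" for j
  have step: "ennreal (U j powr (\<kappa> / q)) * epow (\<Phi>1 (z j) * \<Phi>2 (z j)) \<kappa> \<le> ennreal C1 * E1 j + ennreal C2 * E2 j" for j
  proof (cases rule: profile_split[OF \<Phi>1 \<Phi>2 r0(1,2) z_in[of j]])
    case (1 y)
    have "{y..d} \<inter> {..z j} = {y..z j}" using z_le[of j] by auto
    then have "ennreal (U j powr (\<kappa> / q)) * epow (\<Phi>1 (z j) * \<Phi>2 (z j)) \<kappa> \<le> ennreal C1 * E1 j"
      unfolding C1_def E1_def using 1 r0
      by (intro grid_diagonal_step[OF \<Phi>1, of _ _ y]) (auto intro!: emeasure_mono)
    then show ?thesis by (rule add_increasing2[rotated]) simp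
  next
    case (2 y)
    have "{y<..d} \<inter> {..z j} = {y<..z j}" using z_le[of j] by auto
    then have "ennreal (U j powr (\<kappa> / q)) * epow (\<Phi>2 (z j) * \<Phi>1 (z j)) \<kappa> \<le> ennreal C2 * E2 j"
      unfolding C2_def E2_def using 2 r0
      by (intro grid_diagonal_step[OF \<Phi>2, of _ _ y]) (auto intro!: emeasure_mono)
    then show ?thesis by (intro add_increasing) (simp_all add: mult.commute)
  qed
  have S1: "(\<Sum>j\<le>N. E1 j) \<le> ennreal (2 powr (\<kappa> / r2)) * Kc \<Phi>1 \<Phi>2 \<kappa> r2"
    unfolding E1_def using r by (intro grid_integral_powr_le) auto
  have S2: "(\<Sum>j\<le>N. E2 j) \<le> ennreal (2 powr (\<kappa> / r1)) * Ko \<Phi>2 \<Phi>1 \<kappa> r1"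
    unfolding E2_def using r by (intro grid_integral_powr_le) auto
  have "(\<Sum>j\<le>N. ennreal (U j powr (\<kappa> / q)) * epow (\<Phi>1 (z j) * \<Phi>2 (z j)) \<kappa>)
      \<le> (\<Sum>j\<le>N. ennreal C1 * E1 j + ennreal C2 * E2 j)" by (intro sum_mono step)
  also have "\<dots> = ennreal C1 * (\<Sum>j\<le>N. E1 j) + ennreal C2 * (\<Sum>j\<le>N. E2 j)"
    by (simp add: sum.distrib sum_distrib_left)
  also have "\<dots> \<le> ennreal C1 * (ennreal (2 powr (\<kappa> / r2)) * Kc \<Phi>1 \<Phi>2 \<kappa> r2)
      + ennreal C2 * (ennreal (2 powr (\<kappa> / r1)) * Ko \<Phi>2 \<Phi>1 \<kappa> r1)"
    by (intro add_mono mult_left_mono S1 S2) auto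
  also have "\<dots> \<le> ennreal (C1 * 2 powr (\<kappa> / r2) + C2 * 2 powr (\<kappa> / r1)) * (Kc \<Phi>1 \<Phi>2 \<kappa> r2 + Ko \<Phi>2 \<Phi>1 \<kappa> r1)"
  proof -
    have "ennreal C1 * (ennreal (2 powr (\<kappa> / r2)) * Kc \<Phi>1 \<Phi>2 \<kappa> r2)
        = ennreal (C1 * 2 powr (\<kappa> / r2)) * Kc \<Phi>1 \<Phi>2 \<kappa> r2"
      by (simp add: C1_def ennreal_mult mult.assoc)
    also have "\<dots> \<le> ennreal (C1 * 2 powr (\<kappa> / r2)) * (Kc \<Phi>1 \<Phi>2 \<kappa> r2 + Ko \<Phi>2 \<Phi>1 \<kappa> r1)"
      by (intro mult_left_mono) auto
    finally have a: "ennreal C1 * (ennreal (2 powr (\<kappa> / r2)) * Kc \<Phi>1 \<Phi>2 \<kappa> r2) \<le> \<dots>" .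
    have "ennreal C2 * (ennreal (2 powr (\<kappa> / r1)) * Ko \<Phi>2 \<Phi>1 \<kappa> r1)
        = ennreal (C2 * 2 powr (\<kappa> / r1)) * Ko \<Phi>2 \<Phi>1 \<kappa> r1"
      by (simp add: C2_def ennreal_mult mult.assoc)
    also have "\<dots> \<le> ennreal (C2 * 2 powr (\<kappa> / r1)) * (Kc \<Phi>1 \<Phi>2 \<kappa> r2 + Ko \<Phi>2 \<Phi>1 \<kappa> r1)"
      by (intro mult_left_mono) auto
    finally have b: "ennreal C2 * (ennreal (2 powr (\<kappa> / r1)) * Ko \<Phi>2 \<Phi>1 \<kappa> r1) \<le> \<dots>" .
    show ?thesis using add_mono[OF a b] by (simp add: C1_def C2_def distrib_right)
  qed
  finally show ?thesis unfolding C1_def C2_def .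
qed

text \<open>
  The power \<open>\<Phi>1(z i)\<^sup>\<kappa>\<close> is the outer measure of \<open>[c, z
  i]\<close>. At a point \<open>x\<close> the groups with \<open>z i \<ge> x\<close> are disjoint and
  consist of indices \<open>j\<close> with \<open>z j \<ge> x\<close>, so superadditivity of the power
  bounds their contributions by the full grid sum at \<open>x\<close>, whatever the grouping.
\<close>

lemma grid_grouped_sum_le:
  assumes \<Phi>1: "is_profile c d \<Phi>1" and r: "0 < r" "r \<le> \<kappa>" and \<iota>: "\<And>j. \<iota> j \<le> j"
    and \<Phi>2: "is_profile c d \<Phi>2"
  shows "ennreal (\<Sum>i\<le>N. grid_val \<Phi>1 i powr \<kappa> *
       (\<Sum>j\<in>{j\<in>{..N}. \<iota> j = i}. (U j powr (1/q) * grid_val \<Phi>2 j) powr r) powr (\<kappa> / r))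
     \<le> (\<integral>\<^sup>+ x\<in>{c..d}. epow (grid_sum \<Phi>2 r N x) (\<kappa> / r) \<partial>stieltjes c d (\<lambda>t. epow (\<Phi>1 t) \<kappa>))"
proof -
  let ?\<nu> = "stieltjes c d (\<lambda>t. epow (\<Phi>1 t) \<kappa>)"
  have k: "0 < \<kappa>" and s: "1 \<le> \<kappa> / r" and s0: "0 < \<kappa> / r" using r by auto
  define w where "w j = (U j powr (1/q) * grid_val \<Phi>2 j) powr r" for j
  define g where "g i = (\<Sum>j\<in>{j\<in>{..N}. \<iota> j = i}. w j)" for i
  have w0: "0 \<le> w j" and g0: "0 \<le> g i" for i j by (simp_all add: w_def g_def sum_nonneg)
  have "ennreal (\<Sum>i\<le>N. grid_val \<Phi>1 i powr \<kappa> * g i powr (\<kappa> / r)) = (\<Sum>i\<le>N. epow (ennreal (g i)) (\<kappa> / r) * emeasure ?\<nu> {c..z i})"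
    using k s0 g0 emeasure_stieltjes_profile[OF \<Phi>1 k z_in]
    by (simp add: grid_val_eq[OF \<Phi>1] epow_ennreal ennreal_mult[symmetric] mult.commute)
  also have "\<dots> = (\<integral>\<^sup>+ x. (\<Sum>i\<le>N. epow (ennreal (g i)) (\<kappa> / r) * indicator {c..z i} x) \<partial>?\<nu>)"
    by (subst nn_integral_sum) (simp_all add: nn_integral_cmult_indicator)
  also have "\<dots> \<le> (\<integral>\<^sup>+ x\<in>{c..d}. epow (grid_sum \<Phi>2 r N x) (\<kappa> / r) \<partial>?\<nu>)"
  proof (rule nn_integral_mono)
    fix x
    show "(\<Sum>i\<le>N. epow (ennreal (g i)) (\<kappa> / r) * indicator {c..z i} x) \<le> epow (grid_sum \<Phi>2 r N x) (\<kappa> / r) * indicator {c..d} x"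
    proof (cases "x \<in> {c..d}")
      case True
      have "(\<Sum>i\<in>{i\<in>{..N}. x \<le> z i}. g i) \<le> (\<Sum>j\<in>{j\<in>{..N}. x \<le> z j}. w j)"
      proof -
        have "(\<Sum>i\<in>{i\<in>{..N}. x \<le> z i}. g i) = (\<Sum>i\<in>{i\<in>{..N}. x \<le> z i}. \<Sum>j\<in>{j\<in>{j\<in>{..N}. x \<le> z (\<iota> j)}. \<iota> j = i}. w j)"
          unfolding g_def by (intro sum.cong) auto
        also have "\<dots> = (\<Sum>j\<in>{j\<in>{..N}. x \<le> z (\<iota> j)}. w j)"
          using \<iota> by (intro sum.group) (auto intro: order_trans)
        also have "\<dots> \<le> (\<Sum>j\<in>{j\<in>{..N}. x \<le> z j}. w j)"
          using w0 z_mono[OF \<iota>] by (intro sum_mono2) (auto intro: order_trans)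
        finally show ?thesis .
      qed
      then have gP: "ennreal (\<Sum>i\<in>{i\<in>{..N}. x \<le> z i}. g i) \<le> grid_sum \<Phi>2 r N x"
        unfolding grid_sum_def grid_sum_summand[OF \<Phi>2 r(1)] w_def[symmetric] using w0 by (simp add: ennreal_leI)
      have "(\<Sum>i\<le>N. epow (ennreal (g i)) (\<kappa> / r) * indicator {c..z i} x) = (\<Sum>i\<in>{i\<in>{..N}. x \<le> z i}. epow (ennreal (g i)) (\<kappa> / r))"
        using True by (intro sum.mono_neutral_cong_right) (auto split: split_indicator)
      also have "\<dots> \<le> epow (\<Sum>i\<in>{i\<in>{..N}. x \<le> z i}. ennreal (g i)) (\<kappa> / r)"
        using s by (intro sum_epow_le) auto
      also have "\<dots> \<le> epow (grid_sum \<Phi>2 r N x) (\<kappa> / r)"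
        using gP g0 s0 by (intro epow_mono) auto
      finally show ?thesis using True by simp
    next
      case False
      then have "(\<Sum>i\<le>N. epow (ennreal (g i)) (\<kappa> / r) * indicator {c..z i} x) = 0"
        using z_le by (intro sum.neutral) (auto split: split_indicator intro: order_trans)
      then show ?thesis by (simp only: zero_le)
    qed
  qed
  finally show ?thesis by (simp add: g_def w_def)
qed

lemma grid_sum_powr_integral_le:
  assumes \<Phi>1: "is_profile c d \<Phi>1" and \<Phi>2: "is_profile c d \<Phi>2" and r: "q \<le> r" "r \<le> \<kappa>"
  shows "(\<integral>\<^sup>+ x\<in>{c..d}. epow (grid_sum \<Phi>2 r N x) (\<kappa> / r) \<partial>stieltjes c d (\<lambda>t. epow (\<Phi>1 t) \<kappa>))
     \<le> ennreal (4 powr (\<kappa> / r)) *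
        (Ko \<Phi>1 \<Phi>2 \<kappa> r + (\<Sum>j\<le>N. ennreal (U j powr (\<kappa> / q)) * epow (\<Phi>1 (z j) * \<Phi>2 (z j)) \<kappa>))"
proof -
  let ?\<nu> = "stieltjes c d (\<lambda>t. epow (\<Phi>1 t) \<kappa>)"
  have r0: "0 < r" and k: "0 < \<kappa>" using r q by auto
  then have s0: "0 < \<kappa> / r" by simp
  define b where "b j = ennreal (U j powr (\<kappa> / q)) * epow (\<Phi>2 (z j)) \<kappa>" for j
  have [measurable]: "(\<lambda>x. Jo \<Phi>2 r x) \<in> borel_measurable borel"
    by (intro borel_measurable_antimono_ennreal nn_integral_mono mult_left_mono) (auto split: split_indicator)
  have pt: "epow (grid_sum \<Phi>2 r N x) (\<kappa> / r) * indicator {c..d} x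
     \<le> ennreal (4 powr (\<kappa> / r)) * (epow (Jo \<Phi>2 r x) (\<kappa> / r) * indicator {c..d} x + (\<Sum>j\<le>N. b j * indicator {c..z j} x))" for x
  proof (cases "x \<in> {c..d} \<and> x \<le> z N")
    case True
    then have x: "c \<le> x" "x \<le> d" "x \<le> z N" by auto
    obtain j where j: "j \<le> N" "x \<le> z j"
      "grid_sum \<Phi>2 r N x \<le> 2 * Jo \<Phi>2 r x + 2 * (ennreal (U j powr (r / q)) * epow (\<Phi>2 x) r)"
      using grid_sum_upper[OF \<Phi>2 r(1) x(1,3)] by blast
    let ?F = "ennreal (U j powr (r / q)) * epow (\<Phi>2 x) r"
    have two: "epow 2 (\<kappa> / r) = ennreal (2 powr (\<kappa> / r))" using epow_ennreal[of 2 "\<kappa> / r"] s0 by simp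
    have "epow ?F (\<kappa> / r) = ennreal (U j powr (\<kappa> / q)) * epow (\<Phi>2 x) \<kappa>"
      using s0 r0 k by (simp add: epow_mult epow_epow epow_ennreal powr_powr)
    also have "\<dots> \<le> b j"
      unfolding b_def using profile_mono[OF \<Phi>2 x(1) j(2) z_le] k by (intro mult_left_mono epow_mono) auto
    also have "b j = b j * indicator {c..z j} x" using x j by simp
    also have "\<dots> \<le> (\<Sum>j\<le>N. b j * indicator {c..z j} x)" using j by (intro member_le_sum) auto
    finally have F: "epow ?F (\<kappa> / r) \<le> (\<Sum>j\<le>N. b j * indicator {c..z j} x)" .
    have "epow (grid_sum \<Phi>2 r N x) (\<kappa> / r) \<le> epow (2 * (Jo \<Phi>2 r x + ?F)) (\<kappa> / r)"
      using j s0 by (intro epow_mono) (simp_all add: distrib_left)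
    also have "\<dots> = ennreal (2 powr (\<kappa> / r)) * epow (Jo \<Phi>2 r x + ?F) (\<kappa> / r)"
      using epow_mult[OF s0, of 2 "Jo \<Phi>2 r x + ?F"] two by simp
    also have "\<dots> \<le> ennreal (2 powr (\<kappa> / r)) * (ennreal (2 powr (\<kappa> / r)) * (epow (Jo \<Phi>2 r x) (\<kappa> / r) + epow ?F (\<kappa> / r)))"
      by (intro mult_left_mono epow_add_le s0) auto
    also have "\<dots> = ennreal (4 powr (\<kappa> / r)) * (epow (Jo \<Phi>2 r x) (\<kappa> / r) + epow ?F (\<kappa> / r))"
      using powr_mult[of 2 2 "\<kappa> / r"] by (simp add: mult.assoc[symmetric] ennreal_mult[symmetric])
    also have "\<dots> \<le> ennreal (4 powr (\<kappa> / r)) * (epow (Jo \<Phi>2 r x) (\<kappa> / r) + (\<Sum>j\<le>N. b j * indicator {c..z j} x))"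
      by (intro mult_left_mono add_left_mono F) auto
    finally show ?thesis using x by simp
  next
    case False
    then have "epow (grid_sum \<Phi>2 r N x) (\<kappa> / r) * indicator {c..d} x = 0"
      using grid_sum_eq_0[of N x \<Phi>2 r] s0 by (auto split: split_indicator)
    then show ?thesis by (simp only: zero_le)
  qed
  have "(\<integral>\<^sup>+ x\<in>{c..d}. epow (grid_sum \<Phi>2 r N x) (\<kappa> / r) \<partial>?\<nu>)
     \<le> (\<integral>\<^sup>+ x. ennreal (4 powr (\<kappa> / r)) * (epow (Jo \<Phi>2 r x) (\<kappa> / r) * indicator {c..d} x + (\<Sum>j\<le>N. b j * indicator {c..z j} x)) \<partial>?\<nu>)"
    by (intro nn_integral_mono pt)
  also have "\<dots> = ennreal (4 powr (\<kappa> / r)) * (\<integral>\<^sup>+ x. epow (Jo \<Phi>2 r x) (\<kappa> / r) * indicator {c..d} x + (\<Sum>j\<le>N. b j * indicator {c..z j} x) \<partial>?\<nu>)"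
    by (rule nn_integral_cmult) measurable
  also have "(\<integral>\<^sup>+ x. epow (Jo \<Phi>2 r x) (\<kappa> / r) * indicator {c..d} x + (\<Sum>j\<le>N. b j * indicator {c..z j} x) \<partial>?\<nu>)
      = Ko \<Phi>1 \<Phi>2 \<kappa> r + (\<integral>\<^sup>+ x. (\<Sum>j\<le>N. b j * indicator {c..z j} x) \<partial>?\<nu>)"
    by (rule nn_integral_add) measurable
  also have "(\<integral>\<^sup>+ x. (\<Sum>j\<le>N. b j * indicator {c..z j} x) \<partial>?\<nu>) = (\<Sum>j\<le>N. b j * emeasure ?\<nu> {c..z j})"
    by (subst nn_integral_sum) (simp_all add: nn_integral_cmult_indicator)
  also have "\<dots> = (\<Sum>j\<le>N. ennreal (U j powr (\<kappa> / q)) * epow (\<Phi>1 (z j) * \<Phi>2 (z j)) \<kappa>)"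
    using k by (simp add: b_def emeasure_stieltjes_profile[OF \<Phi>1 k z_in] epow_mult mult_ac)
  finally show ?thesis .
qed

text \<open>
  Passing from \<open>x\<close> to the next grid point increases the profiles and at most halves the
  tail.
\<close>

lemma diagonal_le_of_grid:
  assumes \<Phi>1: "is_profile c d \<Phi>1" and \<Phi>2: "is_profile c d \<Phi>2"
    and D: "\<And>k. U k powr (1/q) * grid_val \<Phi>1 k * grid_val \<Phi>2 k \<le> D" and x: "x \<in> {c..d}"
  shows "epow (tail d u x) (1 / q) * \<Phi>1 x * \<Phi>2 x \<le> ennreal (2 powr (1/q) * D)"
proof (cases "T x = 0")
  case False
  then have Tx: "0 < T x" using T_nonneg[of x] by (simp add: less_le)
  have "\<exists>k. T c / T x < 2 ^ k" by (rule real_arch_pow) simp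
  then obtain k0 where "T c / T x < 2 ^ k0" by blast
  then have "U k0 < T x" using Tx by (simp add: U_def field_simps)
  then have ex: "\<exists>k. x \<le> z k" using T_antimono[of "z k0" x] z_ge[of k0] x T_z[of k0]
    by (metis atLeastAtMost_iff linear not_le)
  define k where "k = (LEAST k. x \<le> z k)"
  have k: "x \<le> z k" unfolding k_def using ex by (rule LeastI_ex)
  have Tk: "T x \<le> 2 * U k"
  proof (cases k)
    case 0
    then show ?thesis using T_antimono[of c x] x T_nonneg[of c] by (simp add: U_def del: T_nonneg)
  next
    case (Suc l)
    then have "\<not> x \<le> z l" using not_less_Least[of l "\<lambda>k. x \<le> z k"] by (simp add: k_def)
    then have "T x \<le> T (z l)" using x z_ge by (intro T_antimono) auto
    then show ?thesis using Suc by (simp add: T_z U_Suc)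
  qed
  have "epow (tail d u x) (1 / q) \<le> ennreal (2 powr (1/q) * U k powr (1/q))"
    using x q Tk powr_mono2[of "1/q" "T x" "2 * U k"] by (simp add: epow_tail powr_mult ennreal_leI)
  then have "epow (tail d u x) (1 / q) * \<Phi>1 x * \<Phi>2 x
     \<le> ennreal (2 powr (1/q) * U k powr (1/q)) * \<Phi>1 (z k) * \<Phi>2 (z k)"
    using x k z_le by (intro mult_mono profile_mono \<Phi>1 \<Phi>2) auto
  also have "\<dots> = ennreal (2 powr (1/q) * (U k powr (1/q) * grid_val \<Phi>1 k * grid_val \<Phi>2 k))"
    by (simp add: grid_val_eq[OF \<Phi>1] grid_val_eq[OF \<Phi>2] ennreal_mult[symmetric] mult.assoc)
  also have "\<dots> \<le> ennreal (2 powr (1/q) * D)" by (intro ennreal_leI mult_left_mono D) auto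
  finally show ?thesis .
next
  case True
  then have "epow (tail d u x) (1 / q) = 0" using x q by (simp add: tail_eq_T)
  then show ?thesis by simp
qed

lemma sup_le_of_grid:
  assumes \<Phi>1: "is_profile c d \<Phi>1" and \<Phi>2: "is_profile c d \<Phi>2" and r: "0 < r"
    and D: "\<And>i N. i \<le> N \<Longrightarrow> grid_val \<Phi>1 i * (\<Sum>j=i..N. (U j powr (1/q) * grid_val \<Phi>2 j) powr r) powr (1/r) \<le> D"
    and x: "x \<in> {c..d}"
  shows "\<Phi>1 x * epow (Jc \<Phi>2 r x) (1 / r) \<le> ennreal (2 powr (1/q) * D)"
proof -
  have r1: "0 < 1 / r" using r by simp
  have "\<Phi>1 x * epow (Jc \<Phi>2 r x) (1 / r) \<le> \<Phi>1 x * epow (SUP N. ennreal (2 powr (r / q)) * grid_sum \<Phi>2 r N x) (1 / r)"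
    by (intro mult_left_mono epow_mono r1 Jc_le_SUP \<Phi>2 r x) auto
  also have "\<dots> = (SUP N. \<Phi>1 x * epow (ennreal (2 powr (r / q)) * grid_sum \<Phi>2 r N x) (1 / r))"
    using r1 by (simp add: epow_SUP SUP_mult_left_ennreal)
  also have "\<dots> \<le> ennreal (2 powr (1/q) * D)"
  proof (rule SUP_least)
    fix N
    show "\<Phi>1 x * epow (ennreal (2 powr (r / q)) * grid_sum \<Phi>2 r N x) (1 / r) \<le> ennreal (2 powr (1/q) * D)"
    proof (cases "x \<le> z N")
      case True
      let ?S = "\<lambda>i. \<Sum>j=i..N. (U j powr (1/q) * grid_val \<Phi>2 j) powr r"
      obtain i where i: "i \<le> N" "x \<le> z i" "grid_sum \<Phi>2 r N x = ennreal (?S i)"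
        using grid_sum_eq[OF \<Phi>2 r True] by blast
      have "\<Phi>1 x * epow (ennreal (2 powr (r / q)) * grid_sum \<Phi>2 r N x) (1 / r)
         \<le> \<Phi>1 (z i) * epow (ennreal (2 powr (r / q)) * grid_sum \<Phi>2 r N x) (1 / r)"
        using x i z_le by (intro mult_right_mono profile_mono \<Phi>1) auto
      also have "\<dots> = ennreal (2 powr (1/q) * (grid_val \<Phi>1 i * ?S i powr (1/r)))"
      proof -
        define S where "S = ?S i"
        have S0: "0 \<le> S" by (simp add: S_def sum_nonneg)
        have "epow (ennreal (2 powr (r / q)) * ennreal S) (1 / r) = ennreal (2 powr (1/q) * S powr (1/r))"
          using r1 r S0 by (simp add: epow_mult epow_ennreal powr_powr ennreal_mult)
        then show ?thesis unfolding i(3) S_def[symmetric]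
          by (simp add: grid_val_eq[OF \<Phi>1] ennreal_mult[symmetric] mult_ac)
      qed
      also have "\<dots> \<le> ennreal (2 powr (1/q) * D)"
        using D[OF i(1)] by (intro ennreal_leI mult_left_mono) auto
      finally show ?thesis .
    next
      case False
      then show ?thesis using r1 by (simp add: grid_sum_eq_0)
    qed
  qed
  finally show ?thesis .
qed

text \<open>
  The step function \<open>grid_sum\<close> takes the values \<open>V i\<close>, and by
  \<open>runmax_lower_levels\<close> its power is dominated by finitely many indicators of intervals
  \<open>[c, z (l n)]\<close>, whose outer measures are \<open>\<Phi>1(z (l
  n))\<^sup>\<kappa>\<close>. The inner integral is the supremum of these step functions, up to a
  constant.
\<close>

lemma Kc_le_of_grid:
  assumes \<Phi>1: "is_profile c d \<Phi>1" and \<Phi>2: "is_profile c d \<Phi>2"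
    and p: "0 < p" "0 < r" "0 < \<kappa>" "1 / r = 1 / \<kappa> + 1 / p" and D: "0 \<le> D"
    and bound: "\<And>N \<alpha>. (\<And>i. 0 \<le> \<alpha> i) \<Longrightarrow>
       lpn {..N} r (\<lambda>j. runmax \<alpha> (grid_val \<Phi>1) j * (U j powr (1/q) * grid_val \<Phi>2 j)) \<le> D * lpn {..N} p \<alpha>"
  shows "Kc \<Phi>1 \<Phi>2 \<kappa> r \<le> ennreal (2 powr (\<kappa> / q) * (4 powr (\<kappa> / r) * D powr \<kappa>))"
proof -
  let ?\<nu> = "stieltjes c d (\<lambda>t. epow (\<Phi>1 t) \<kappa>)"
  define W where "W j = U j powr (1/q) * grid_val \<Phi>2 j" for j
  have W0: "0 \<le> W j" for j by (simp add: W_def)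
  have s0: "0 < \<kappa> / r" using p by simp
  have PN: "(\<integral>\<^sup>+ x\<in>{c..d}. epow (grid_sum \<Phi>2 r N x) (\<kappa> / r) \<partial>?\<nu>) \<le> ennreal (4 powr (\<kappa> / r) * D powr \<kappa>)" for N
  proof (cases "W N = 0")
    case True
    have "W j = 0" if "j \<le> N" for j
    proof -
      have "U N = 0 \<or> grid_val \<Phi>2 N = 0" using True by (simp add: W_def)
      then show ?thesis
      proof
        assume "U N = 0"
        then show ?thesis by (simp add: U_def W_def)
      next
        assume "grid_val \<Phi>2 N = 0"
        then have "grid_val \<Phi>2 j = 0" using monoD[OF grid_val_mono[OF \<Phi>2] that] grid_val_nonneg[of \<Phi>2 j] by simp
        then show ?thesis by (simp add: W_def)
      qed
    qed
    then have "grid_sum \<Phi>2 r N x = 0" for x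
      unfolding grid_sum_def grid_sum_summand[OF \<Phi>2 p(2)] W_def[symmetric] by (intro sum.neutral) auto
    then show ?thesis using s0 by simp
  next
    case False
    then have WN: "0 < W N" using W0[of N] by simp
    define V where "V i = (\<Sum>j=i..N. W j powr r)" for i
    have V0: "0 \<le> V i" for i by (simp add: V_def sum_nonneg)
    obtain M l where ln: "\<And>n. l n \<le> N"
      and A: "\<And>j. j \<le> N \<Longrightarrow> V j powr (\<kappa>/r) \<le> 2 powr (\<kappa>/r) * (\<Sum>n\<in>{n\<in>{..M}. j \<le> l n}. (V 0 / 2^n) powr (\<kappa>/r))"
      and B: "(\<Sum>n\<le>M. (V 0 / 2^n) powr (\<kappa>/r) * grid_val \<Phi>1 (l n) powr \<kappa>) \<le> 2 powr (\<kappa>/r) * D powr \<kappa>"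
      using runmax_lower_levels[of "grid_val \<Phi>1" W p r \<kappa> D N V, OF grid_val_nonneg W0 p D bound[of _ N, folded W_def] WN V_def]
      by blast
    define a where "a n = ennreal (2 powr (\<kappa>/r) * (V 0 / 2^n) powr (\<kappa>/r))" for n
    have pt: "epow (grid_sum \<Phi>2 r N x) (\<kappa> / r) * indicator {c..d} x \<le> (\<Sum>n\<le>M. a n * indicator {c..z (l n)} x)" for x
    proof (cases "x \<in> {c..d} \<and> x \<le> z N")
      case True
      then have x: "c \<le> x" "x \<le> d" "x \<le> z N" by auto
      obtain i where i: "i \<le> N" "x \<le> z i" "grid_sum \<Phi>2 r N x = ennreal (V i)"
        using grid_sum_eq[OF \<Phi>2 p(2) x(3)] by (auto simp: V_def W_def)
      have "epow (grid_sum \<Phi>2 r N x) (\<kappa> / r) * indicator {c..d} x = ennreal (V i powr (\<kappa> / r))"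
        using x s0 V0 by (simp add: i(3) epow_ennreal)
      also have "\<dots> \<le> ennreal (2 powr (\<kappa>/r) * (\<Sum>n\<in>{n\<in>{..M}. i \<le> l n}. (V 0 / 2^n) powr (\<kappa>/r)))"
        by (intro ennreal_leI A i)
      also have "\<dots> = (\<Sum>n\<in>{n\<in>{..M}. i \<le> l n}. a n)"
        by (simp add: a_def sum_distrib_left)
      also have "\<dots> \<le> (\<Sum>n\<le>M. a n * indicator {c..z (l n)} x)"
      proof -
        have "x \<le> z (l n)" if "i \<le> l n" for n using z_mono[OF that] i by simp
        then have "(\<Sum>n\<in>{n\<in>{..M}. i \<le> l n}. a n) = (\<Sum>n\<in>{n\<in>{..M}. i \<le> l n}. a n * indicator {c..z (l n)} x)"
          using x by (intro sum.cong) auto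
        also have "\<dots> \<le> (\<Sum>n\<le>M. a n * indicator {c..z (l n)} x)" by (intro sum_mono2) auto
        finally show ?thesis .
      qed
      finally show ?thesis .
    next
      case False
      then have "epow (grid_sum \<Phi>2 r N x) (\<kappa> / r) * indicator {c..d} x = 0"
        using grid_sum_eq_0[of N x \<Phi>2 r] s0 by (auto split: split_indicator)
      then show ?thesis by (simp only: zero_le)
    qed
    have "(\<integral>\<^sup>+ x\<in>{c..d}. epow (grid_sum \<Phi>2 r N x) (\<kappa> / r) \<partial>?\<nu>)
       \<le> (\<integral>\<^sup>+ x. (\<Sum>n\<le>M. a n * indicator {c..z (l n)} x) \<partial>?\<nu>)" by (intro nn_integral_mono pt)
    also have "\<dots> = (\<Sum>n\<le>M. a n * emeasure ?\<nu> {c..z (l n)})"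
      by (subst nn_integral_sum) (simp_all add: nn_integral_cmult_indicator)
    also have "\<dots> = ennreal (2 powr (\<kappa>/r) * (\<Sum>n\<le>M. (V 0 / 2^n) powr (\<kappa>/r) * grid_val \<Phi>1 (l n) powr \<kappa>))"
      using p(3)
      by (simp add: a_def emeasure_stieltjes_profile[OF \<Phi>1 p(3) z_in] grid_val_eq[OF \<Phi>1] epow_ennreal
          ennreal_mult[symmetric] sum_distrib_left mult.assoc)
    also have "\<dots> \<le> ennreal (2 powr (\<kappa>/r) * (2 powr (\<kappa>/r) * D powr \<kappa>))"
      by (intro ennreal_leI mult_left_mono B) auto
    also have "\<dots> = ennreal (4 powr (\<kappa> / r) * D powr \<kappa>)"
      using powr_mult[of 2 2 "\<kappa> / r"] by (simp add: mult.assoc)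
    finally show ?thesis .
  qed
  have P_inc: "grid_sum \<Phi>2 r N x \<le> grid_sum \<Phi>2 r N' x" if "N \<le> N'" for N N' x
    unfolding grid_sum_def using that by (intro sum_mono2) auto
  let ?f = "\<lambda>N x. epow (ennreal (2 powr (r / q)) * grid_sum \<Phi>2 r N x) (\<kappa> / r) * indicator {c..d} x"
  have "Kc \<Phi>1 \<Phi>2 \<kappa> r \<le> (\<integral>\<^sup>+ x. (SUP N. ?f N x) \<partial>?\<nu>)"
  proof (rule nn_integral_mono)
    fix x
    show "epow (Jc \<Phi>2 r x) (\<kappa> / r) * indicator {c..d} x \<le> (SUP N. ?f N x)"
    proof (cases "x \<in> {c..d}")
      case True
      have "epow (Jc \<Phi>2 r x) (\<kappa> / r) \<le> epow (SUP N. ennreal (2 powr (r / q)) * grid_sum \<Phi>2 r N x) (\<kappa> / r)"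
        by (intro epow_mono s0 Jc_le_SUP \<Phi>2 p True)
      then show ?thesis using True s0 by (simp add: epow_SUP)
    qed simp
  qed
  also have "\<dots> = (SUP N. \<integral>\<^sup>+ x. ?f N x \<partial>?\<nu>)"
  proof (rule nn_integral_monotone_convergence_SUP)
    show "incseq (\<lambda>N x. ?f N x)"
      using P_inc s0 by (intro incseq_SucI le_funI mult_right_mono epow_mono mult_left_mono) auto
  qed measurable
  also have "\<dots> \<le> ennreal (2 powr (\<kappa> / q) * (4 powr (\<kappa> / r) * D powr \<kappa>))"
  proof (rule SUP_least)
    fix N
    have "?f N x = ennreal (2 powr (\<kappa> / q)) * (epow (grid_sum \<Phi>2 r N x) (\<kappa> / r) * indicator {c..d} x)" for x
      using s0 p(2) by (simp add: epow_mult epow_ennreal powr_powr mult.assoc)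
    then have "(\<integral>\<^sup>+ x. ?f N x \<partial>?\<nu>) = ennreal (2 powr (\<kappa> / q)) * (\<integral>\<^sup>+ x\<in>{c..d}. epow (grid_sum \<Phi>2 r N x) (\<kappa> / r) \<partial>?\<nu>)"
      by (simp add: nn_integral_cmult)
    also have "\<dots> \<le> ennreal (2 powr (\<kappa> / q)) * ennreal (4 powr (\<kappa> / r) * D powr \<kappa>)"
      by (intro mult_left_mono PN) auto
    finally show "(\<integral>\<^sup>+ x. ?f N x \<partial>?\<nu>) \<le> ennreal (2 powr (\<kappa> / q) * (4 powr (\<kappa> / r) * D powr \<kappa>))"
      by (simp add: ennreal_mult)
  qed
  finally show ?thesis .
qed

end

section \<open>From sequences to functions: Hardy systems\<close>

text \<open>
  What the discretisation needs to know about a class of nonnegative nondecreasing functions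
  \<open>F\<close> with bounds \<open>n\<close>. Each member is dominated on any finite grid by the
  running maximum of a sequence of norm at most \<open>n\<close>; conversely every sequence is
  realised by a member, with a delay of one grid point. Besides the primitives \<open>Hf\<close> with
  \<open>n = \<parallel>f\<parallel>\<close> also the constants form such a system, which reduces the
  case of an infinite exponent to that of finite ones.
\<close>

definition hardy_system :: "real \<Rightarrow> real \<Rightarrow> real \<Rightarrow> (real \<Rightarrow> ennreal) \<Rightarrow> ((real \<Rightarrow> real) \<times> real) set \<Rightarrow> bool" where
  "hardy_system c d p \<Phi> S \<longleftrightarrow>
    (\<forall>(F, n) \<in> S. 0 \<le> n \<and> (\<forall>x\<in>{c..d}. 0 \<le> F x) \<and> (\<forall>x y. c \<le> x \<longrightarrow> x \<le> y \<longrightarrow> y \<le> d \<longrightarrow> F x \<le> F y) \<and>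
      (\<forall>z N. mono z \<longrightarrow> (\<forall>k. z k \<in> {c..d}) \<longrightarrow>
         (\<exists>\<alpha>. (\<forall>i. 0 \<le> \<alpha> i) \<and> lpn {..N::nat} p \<alpha> \<le> n \<and>
              (\<forall>k\<le>N. F (z k) \<le> 4 * runmax \<alpha> (\<lambda>i. enn2real (\<Phi> (z i))) k)))) \<and>
    (\<forall>z N \<alpha>. strict_mono z \<longrightarrow> (\<forall>k. z k \<in> {c..d}) \<longrightarrow> (\<forall>i. 0 \<le> \<alpha> i) \<longrightarrow>
       (\<exists>(F, n) \<in> S. n \<le> lpn {..N} p \<alpha> \<and> (\<forall>i\<le>N. \<alpha> i * enn2real (\<Phi> (z i)) \<le> 2 * F (z (Suc i)))))"

definition bilinear_bound :: "real \<Rightarrow> real \<Rightarrow> real \<Rightarrow> (real \<Rightarrow> ennreal) \<Rightarrow>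
    ((real \<Rightarrow> real) \<times> real) set \<Rightarrow> ((real \<Rightarrow> real) \<times> real) set \<Rightarrow> real \<Rightarrow> bool" where
  "bilinear_bound c d q u S1 S2 C \<longleftrightarrow>
    (\<forall>(F, n) \<in> S1. \<forall>(G, m) \<in> S2.
       (\<integral>\<^sup>+ t. epow (ennreal (F t * G t)) q * u t \<partial>lebesgue_on {c..d}) \<le> ennreal ((C * n * m) powr q))"

lemma hardy_systemD:
  assumes "hardy_system c d p \<Phi> S" and "(F, n) \<in> S"
  shows "0 \<le> n" and "\<And>x. x \<in> {c..d} \<Longrightarrow> 0 \<le> F x"
    and "\<And>x y. c \<le> x \<Longrightarrow> x \<le> y \<Longrightarrow> y \<le> d \<Longrightarrow> F x \<le> F y"
    and "\<And>z N. mono z \<Longrightarrow> (\<And>k. z k \<in> {c..d}) \<Longrightarrow> \<exists>\<alpha>. (\<forall>i. 0 \<le> \<alpha> i) \<and> lpn {..N::nat} p \<alpha> \<le> n \<and>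
              (\<forall>k\<le>N. F (z k) \<le> 4 * runmax \<alpha> (\<lambda>i. enn2real (\<Phi> (z i))) k)"
proof -
  note a = bspec[OF conjunct1[OF assms(1)[unfolded hardy_system_def]] assms(2), unfolded split]
  show "0 \<le> n" by (rule conjunct1[OF a])
  note b = conjunct2[OF a]
  show "\<And>x. x \<in> {c..d} \<Longrightarrow> 0 \<le> F x" by (rule bspec[OF conjunct1[OF b]])
  note e = conjunct2[OF b]
  show "\<And>x y. c \<le> x \<Longrightarrow> x \<le> y \<Longrightarrow> y \<le> d \<Longrightarrow> F x \<le> F y" using conjunct1[OF e] by blast
  show "\<And>z N. mono z \<Longrightarrow> (\<And>k. z k \<in> {c..d}) \<Longrightarrow> \<exists>\<alpha>. (\<forall>i. 0 \<le> \<alpha> i) \<and> lpn {..N::nat} p \<alpha> \<le> n \<and>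
              (\<forall>k\<le>N. F (z k) \<le> 4 * runmax \<alpha> (\<lambda>i. enn2real (\<Phi> (z i))) k)"
    using conjunct2[OF e] by blast
qed

lemma hardy_system_test:
  assumes "hardy_system c d p \<Phi> S" and "strict_mono z" "\<And>k. z k \<in> {c..d}" "\<And>i. 0 \<le> \<alpha> i"
  obtains F n where "(F, n) \<in> S" "n \<le> lpn {..N::nat} p \<alpha>"
    "\<And>i. i \<le> N \<Longrightarrow> \<alpha> i * enn2real (\<Phi> (z i)) \<le> 2 * F (z (Suc i))"
proof -
  have "\<exists>(F, n) \<in> S. n \<le> lpn {..N} p \<alpha> \<and> (\<forall>i\<le>N. \<alpha> i * enn2real (\<Phi> (z i)) \<le> 2 * F (z (Suc i)))"
    using conjunct2[OF assms(1)[unfolded hardy_system_def]] assms(2-4) by blast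
  then show thesis using that by blast
qed

context weight_grid
begin

text \<open>
  Only initial pieces of the grid occur, so that all sums are finite; the constant is common to them.
\<close>

definition grid_bound :: "(real \<Rightarrow> ennreal) \<Rightarrow> (real \<Rightarrow> ennreal) \<Rightarrow> real \<Rightarrow> real \<Rightarrow> real \<Rightarrow> bool" where
  "grid_bound \<Phi>1 \<Phi>2 p1 p2 D \<longleftrightarrow>
    (\<forall>N \<alpha> \<beta>. (\<forall>i. 0 \<le> \<alpha> i) \<longrightarrow> (\<forall>i. 0 \<le> \<beta> i) \<longrightarrow>
       lpn {..N} q (\<lambda>k. U k powr (1/q) * (runmax \<alpha> (grid_val \<Phi>1) k * runmax \<beta> (grid_val \<Phi>2) k))
         \<le> D * lpn {..N} p1 \<alpha> * lpn {..N} p2 \<beta>)"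

text \<open>
  The estimate for one of the two sums into which the discrete inequality splits.
\<close>

definition half_bound :: "(real \<Rightarrow> ennreal) \<Rightarrow> (real \<Rightarrow> ennreal) \<Rightarrow> real \<Rightarrow> real \<Rightarrow> real \<Rightarrow> bool" where
  "half_bound \<Phi>1 \<Phi>2 p1 p2 D \<longleftrightarrow>
    (\<forall>N \<alpha> \<beta>. (\<forall>i. 0 \<le> \<alpha> i) \<longrightarrow> (\<forall>i. 0 \<le> \<beta> i) \<longrightarrow>
       lpn {..N} q (\<lambda>j. runmax \<alpha> (grid_val \<Phi>1) j * (U j powr (1/q) * grid_val \<Phi>2 j) * \<beta> j)
         \<le> D * lpn {..N} p1 \<alpha> * lpn {..N} p2 \<beta>)"

lemma grid_val_fun: "grid_val \<Phi> = (\<lambda>i. enn2real (\<Phi> (z i)))"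
  by (simp add: grid_val_def fun_eq_iff)

lemma grid_bound_of_halves:
  assumes "half_bound \<Phi>1 \<Phi>2 p1 p2 M1" "half_bound \<Phi>2 \<Phi>1 p2 p1 M2"
  shows "grid_bound \<Phi>1 \<Phi>2 p1 p2 (4 powr (1/q) * (M1 + M2))"
  unfolding grid_bound_def
proof (intro allI impI)
  fix N and \<alpha> \<beta> :: "nat \<Rightarrow> real" assume a: "\<forall>i. 0 \<le> \<alpha> i" and b: "\<forall>i. 0 \<le> \<beta> i"
  have "lpn {..N} q (\<lambda>k. U k powr (1/q) * (runmax \<alpha> (grid_val \<Phi>1) k * runmax \<beta> (grid_val \<Phi>2) k)) \<le>
     4 powr (1/q) * (lpn {..N} q (\<lambda>j. runmax \<alpha> (grid_val \<Phi>1) j * (U j powr (1/q) * grid_val \<Phi>2 j) * \<beta> j)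
          + lpn {..N} q (\<lambda>j. runmax \<beta> (grid_val \<Phi>2) j * (U j powr (1/q) * grid_val \<Phi>1 j) * \<alpha> j))"
    using a b q by (intro runmax_product_split) (auto simp: U_Suc)
  also have "\<dots> \<le> 4 powr (1/q) * (M1 * lpn {..N} p1 \<alpha> * lpn {..N} p2 \<beta> + M2 * lpn {..N} p2 \<beta> * lpn {..N} p1 \<alpha>)"
    using assms a b unfolding half_bound_def by (intro mult_left_mono add_mono) auto
  finally show "lpn {..N} q (\<lambda>k. U k powr (1/q) * (runmax \<alpha> (grid_val \<Phi>1) k * runmax \<beta> (grid_val \<Phi>2) k)) \<le>
     4 powr (1/q) * (M1 + M2) * lpn {..N} p1 \<alpha> * lpn {..N} p2 \<beta>"
    by (simp add: algebra_simps)
qed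

text \<open>
  The factor 16 comes from the factors 4 in the domination of either function. The error \<open>U N
  F(d)\<^sup>q G(d)\<^sup>q\<close> made by stopping at \<open>z N\<close> tends to 0.
\<close>

lemma bilinear_bound_of_grid:
  assumes S: "hardy_system c d p1 \<Phi>1 S1" "hardy_system c d p2 \<Phi>2 S2"
    and D: "grid_bound \<Phi>1 \<Phi>2 p1 p2 D" "0 \<le> D"
  shows "bilinear_bound c d q u S1 S2 (16 * D)"
  unfolding bilinear_bound_def
proof (intro ballI, clarify)
  fix F n G m assume FG: "(F, n) \<in> S1" "(G, m) \<in> S2"
  have F: "0 \<le> n" "\<And>x. x \<in> {c..d} \<Longrightarrow> 0 \<le> F x" "\<And>x y. c \<le> x \<Longrightarrow> x \<le> y \<Longrightarrow> y \<le> d \<Longrightarrow> F x \<le> F y"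
    using hardy_systemD(1-3)[OF S(1) FG(1)] by blast+
  have G: "0 \<le> m" "\<And>x. x \<in> {c..d} \<Longrightarrow> 0 \<le> G x" "\<And>x y. c \<le> x \<Longrightarrow> x \<le> y \<Longrightarrow> y \<le> d \<Longrightarrow> G x \<le> G y"
    using hardy_systemD(1-3)[OF S(2) FG(2)] by blast+
  have zm: "mono z" and zi: "\<forall>k. z k \<in> {c..d}" using z_mono z_in by (auto simp: mono_def)
  define H where "H t = epow (ennreal (F t * G t)) q" for t
  have H_mono: "H s \<le> H t" if "c \<le> s" "s \<le> t" "t \<le> d" for s t
    unfolding H_def using that F G q by (intro epow_mono ennreal_leI mult_mono) auto
  have Hr: "H t = ennreal ((F t * G t) powr q)" if "t \<in> {c..d}" for t
    unfolding H_def using that F G q by (intro epow_ennreal) auto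
  let ?X = "(16 * D * n * m) powr q"
  have N: "(\<integral>\<^sup>+ t. H t * u t \<partial>lebesgue_on {c..d}) \<le> ennreal (?X + U N * (F d * G d) powr q)" for N
  proof -
    obtain \<alpha> where \<alpha>: "\<forall>i. 0 \<le> \<alpha> i" "lpn {..N} p1 \<alpha> \<le> n" "\<forall>k\<le>N. F (z k) \<le> 4 * runmax \<alpha> (grid_val \<Phi>1) k"
      using hardy_systemD(4)[OF S(1) FG(1) zm, of N] zi unfolding grid_val_fun by blast
    obtain \<beta> where \<beta>: "\<forall>i. 0 \<le> \<beta> i" "lpn {..N} p2 \<beta> \<le> m" "\<forall>k\<le>N. G (z k) \<le> 4 * runmax \<beta> (grid_val \<Phi>2) k"
      using hardy_systemD(4)[OF S(2) FG(2) zm, of N] zi unfolding grid_val_fun by blast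
    let ?A = "runmax \<alpha> (grid_val \<Phi>1)" and ?B = "runmax \<beta> (grid_val \<Phi>2)"
    let ?L = "lpn {..N} q (\<lambda>k. U k powr (1/q) * (?A k * ?B k))"
    have A0: "0 \<le> ?A k" and B0: "0 \<le> ?B k" for k using \<alpha> \<beta> by (auto simp: runmax_nonneg)
    have "?L \<le> D * lpn {..N} p1 \<alpha> * lpn {..N} p2 \<beta>" using D \<alpha> \<beta> by (simp add: grid_bound_def)
    also have "\<dots> \<le> D * n * m" using \<alpha> \<beta> D F G by (intro mult_mono) auto
    finally have L: "16 * ?L \<le> 16 * D * n * m" by simp
    have "(\<Sum>k\<le>N. U k * (F (z k) * G (z k)) powr q) \<le> (\<Sum>k\<le>N. (16 * (U k powr (1/q) * (?A k * ?B k))) powr q)"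
    proof (rule sum_mono)
      fix k assume k: "k \<in> {..N}"
      have "F (z k) * G (z k) \<le> (4 * ?A k) * (4 * ?B k)"
        using \<alpha> \<beta> k A0 F(2) G(2) zi by (intro mult_mono) auto
      then have "(F (z k) * G (z k)) powr q \<le> (16 * (?A k * ?B k)) powr q"
        using F(2) G(2) zi q by (intro powr_mono2) auto
      then have "U k * (F (z k) * G (z k)) powr q \<le> (U k powr (1/q)) powr q * (16 * (?A k * ?B k)) powr q"
        using q by (simp add: powr_powr mult_left_mono)
      also have "\<dots> = (U k powr (1/q) * (16 * (?A k * ?B k))) powr q" by (rule powr_mult[symmetric])
      finally show "U k * (F (z k) * G (z k)) powr q \<le> (16 * (U k powr (1/q) * (?A k * ?B k))) powr q"
        by (simp add: mult_ac)
    qed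
    also have "\<dots> = (16 * ?L) powr q"
      using lpn_cmult[of q 16 "{..N}" "\<lambda>k. U k powr (1/q) * (?A k * ?B k)"] q A0 B0
        lpn_powr[of q "{..N}" "\<lambda>k. 16 * (U k powr (1/q) * (?A k * ?B k))"] by simp
    also have "\<dots> \<le> ?X" using L q by (intro powr_mono2) auto
    finally have sum: "(\<Sum>k\<le>N. U k * (F (z k) * G (z k)) powr q) \<le> ?X" .
    have "(\<integral>\<^sup>+ t. H t * u t \<partial>lebesgue_on {c..d}) \<le> (\<Sum>k\<le>N. ennreal (U k) * H (z k)) + ennreal (U N) * H d"
      by (rule integral_grid_upper[OF H_mono])
    also have "\<dots> = ennreal ((\<Sum>k\<le>N. U k * (F (z k) * G (z k)) powr q) + U N * (F d * G d) powr q)"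
      using zi cd by (simp add: Hr ennreal_mult[symmetric] sum_nonneg flip: ennreal_plus)
    also have "\<dots> \<le> ennreal (?X + U N * (F d * G d) powr q)"
      using sum by (intro ennreal_leI) auto
    finally show ?thesis .
  qed
  have "U \<longlonglongrightarrow> 0"
  proof -
    have "(\<lambda>N. T c * (1/2) ^ N) \<longlonglongrightarrow> T c * 0" by (intro tendsto_mult LIMSEQ_realpow_zero) auto
    then show ?thesis by (simp add: U_def[abs_def] power_divide)
  qed
  then have "(\<lambda>N. ennreal (?X + U N * (F d * G d) powr q)) \<longlonglongrightarrow> ennreal (?X + 0 * (F d * G d) powr q)"
    by (intro tendsto_intros)
  then show "(\<integral>\<^sup>+ t. epow (ennreal (F t * G t)) q * u t \<partial>lebesgue_on {c..d}) \<le> ennreal ?X"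
    using N unfolding H_def by (intro LIMSEQ_le_const) auto
qed

text \<open>
  The delay by one grid point and the lower sum cost two halvings of \<open>U\<close>, hence
  \<open>4\<^sup>1\<^sup>/\<^sup>q\<close>; the factors 2 in the realisation of either sequence give
  the other 4.
\<close>

lemma grid_bound_of_bilinear:
  assumes S: "hardy_system c d p1 \<Phi>1 S1" "hardy_system c d p2 \<Phi>2 S2"
    and C: "bilinear_bound c d q u S1 S2 C" "0 \<le> C"
  shows "grid_bound \<Phi>1 \<Phi>2 p1 p2 (4 * 4 powr (1/q) * C)"
  unfolding grid_bound_def
proof (intro allI impI)
  fix N and \<alpha> \<beta> :: "nat \<Rightarrow> real" assume a: "\<forall>i. 0 \<le> \<alpha> i" and b: "\<forall>i. 0 \<le> \<beta> i"
  let ?A = "runmax \<alpha> (grid_val \<Phi>1)" and ?B = "runmax \<beta> (grid_val \<Phi>2)"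
  let ?R = "4 * 4 powr (1/q) * C * lpn {..N} p1 \<alpha> * lpn {..N} p2 \<beta>"
  show "lpn {..N} q (\<lambda>k. U k powr (1/q) * (?A k * ?B k)) \<le> ?R"
  proof (cases "T c = 0")
    case True
    then have "lpn {..N} q (\<lambda>k. U k powr (1/q) * (?A k * ?B k)) = 0"
      by (simp add: U_def lpn_def)
    then show ?thesis using C by simp
  next
    case False
    have zs: "strict_mono z" and zi: "\<forall>k. z k \<in> {c..d}" using z_less[OF False] z_in by (auto simp: strict_mono_def)
    obtain F n where F: "(F, n) \<in> S1" "n \<le> lpn {..N} p1 \<alpha>" "\<And>i. i \<le> N \<Longrightarrow> \<alpha> i * grid_val \<Phi>1 i \<le> 2 * F (z (Suc i))"
      using hardy_system_test[OF S(1) zs, of \<alpha> N] zi a unfolding grid_val_fun by blast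
    obtain G m where G: "(G, m) \<in> S2" "m \<le> lpn {..N} p2 \<beta>" "\<And>i. i \<le> N \<Longrightarrow> \<beta> i * grid_val \<Phi>2 i \<le> 2 * G (z (Suc i))"
      using hardy_system_test[OF S(2) zs, of \<beta> N] zi b unfolding grid_val_fun by blast
    have F': "0 \<le> n" "\<And>x. x \<in> {c..d} \<Longrightarrow> 0 \<le> F x" "\<And>x y. c \<le> x \<Longrightarrow> x \<le> y \<Longrightarrow> y \<le> d \<Longrightarrow> F x \<le> F y"
      using hardy_systemD(1-3)[OF S(1) F(1)] by blast+
    have G': "0 \<le> m" "\<And>x. x \<in> {c..d} \<Longrightarrow> 0 \<le> G x" "\<And>x y. c \<le> x \<Longrightarrow> x \<le> y \<Longrightarrow> y \<le> d \<Longrightarrow> G x \<le> G y"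
      using hardy_systemD(1-3)[OF S(2) G(1)] by blast+
    define H where "H t = epow (ennreal (F t * G t)) q" for t
    have H_mono: "H s \<le> H t" if "c \<le> s" "s \<le> t" "t \<le> d" for s t
      unfolding H_def using that F' G' q by (intro epow_mono ennreal_leI mult_mono) auto
    have Hr: "H t = ennreal ((F t * G t) powr q)" if "t \<in> {c..d}" for t
      unfolding H_def using that F' G' q by (intro epow_ennreal) auto
    have A0: "0 \<le> ?A k" and B0: "0 \<le> ?B k" for k using a b by (auto simp: runmax_nonneg)
    have AF: "?A k \<le> 2 * F (z (Suc k))" if "k \<le> N" for k
    proof -
      obtain i where i: "i \<le> k" "?A k = \<alpha> i * grid_val \<Phi>1 i" using runmax_attained by blast
      have "?A k \<le> 2 * F (z (Suc i))" using F(3)[of i] i that by simp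
      also have "\<dots> \<le> 2 * F (z (Suc k))" using F'(3)[of "z (Suc i)" "z (Suc k)"] z_mono i z_le z_ge by simp
      finally show ?thesis .
    qed
    have BG: "?B k \<le> 2 * G (z (Suc k))" if "k \<le> N" for k
    proof -
      obtain i where i: "i \<le> k" "?B k = \<beta> i * grid_val \<Phi>2 i" using runmax_attained by blast
      have "?B k \<le> 2 * G (z (Suc i))" using G(3)[of i] i that by simp
      also have "\<dots> \<le> 2 * G (z (Suc k))" using G'(3)[of "z (Suc i)" "z (Suc k)"] z_mono i z_le z_ge by simp
      finally show ?thesis .
    qed
    have "ennreal (\<Sum>k\<le>N. U (k + 2) * (F (z (Suc k)) * G (z (Suc k))) powr q)
        = (\<Sum>k\<le>N. ennreal (U (k + 2)) * H (z (Suc k)))"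
      using zi by (simp add: Hr ennreal_mult[symmetric])
    also have "\<dots> \<le> (\<integral>\<^sup>+ t. H t * u t \<partial>lebesgue_on {c..d})" by (rule integral_grid_lower[OF H_mono])
    also have "\<dots> \<le> ennreal ((C * n * m) powr q)"
      unfolding H_def using C(1)[unfolded bilinear_bound_def] F(1) G(1) by blast
    finally have main: "(\<Sum>k\<le>N. U (k + 2) * (F (z (Suc k)) * G (z (Suc k))) powr q) \<le> (C * n * m) powr q" by simp
    show ?thesis
    proof (rule lpn_leI[OF q])
      show "0 \<le> ?R" using C by simp
      have "(\<Sum>k\<le>N. (U k powr (1/q) * (?A k * ?B k)) powr q)
         \<le> (\<Sum>k\<le>N. 4 * 4 powr q * (U (k + 2) * (F (z (Suc k)) * G (z (Suc k))) powr q))"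
      proof (rule sum_mono)
        fix k assume k: "k \<in> {..N}"
        have "?A k * ?B k \<le> (2 * F (z (Suc k))) * (2 * G (z (Suc k)))"
          using AF BG k A0 B0 F'(2) zi by (intro mult_mono) auto
        then have "(?A k * ?B k) powr q \<le> (4 * (F (z (Suc k)) * G (z (Suc k)))) powr q"
          using A0 B0 q by (intro powr_mono2) auto
        also have "\<dots> = 4 powr q * (F (z (Suc k)) * G (z (Suc k))) powr q" by (rule powr_mult)
        finally have "U k * (?A k * ?B k) powr q \<le> U k * (4 powr q * (F (z (Suc k)) * G (z (Suc k))) powr q)"
          by (intro mult_left_mono) auto
        moreover have "(U k powr (1/q) * (?A k * ?B k)) powr q = U k * (?A k * ?B k) powr q"
          using q A0 B0 powr_mult[of "U k powr (1/q)" "?A k * ?B k" q] by (simp add: powr_powr)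
        moreover have "U k = 4 * U (k + 2)" by (simp add: U_Suc)
        ultimately show "(U k powr (1/q) * (?A k * ?B k)) powr q
           \<le> 4 * 4 powr q * (U (k + 2) * (F (z (Suc k)) * G (z (Suc k))) powr q)"
          by (simp add: mult_ac)
      qed
      also have "\<dots> \<le> 4 * 4 powr q * (C * n * m) powr q"
        using main unfolding sum_distrib_left[symmetric] by (intro mult_left_mono) auto
      also have "\<dots> = (4 * 4 powr (1/q) * (C * n * m)) powr q"
        using q C F' G' by (simp add: powr_mult powr_powr)
      also have "\<dots> \<le> ?R powr q"
      proof (rule powr_mono2)
        have "C * n * m \<le> C * lpn {..N} p1 \<alpha> * lpn {..N} p2 \<beta>"
          using F(2) G(2) C F' G' by (intro mult_mono) auto
        then have "4 * 4 powr (1/q) * (C * n * m) \<le> 4 * 4 powr (1/q) * (C * lpn {..N} p1 \<alpha> * lpn {..N} p2 \<beta>)"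
          by (intro mult_left_mono) auto
        then show "4 * 4 powr (1/q) * (C * n * m) \<le> ?R" by (simp add: mult_ac)
      qed (use q C F' G' in auto)
      finally show "(\<Sum>k\<le>N. (U k powr (1/q) * (?A k * ?B k)) powr q) \<le> ?R powr q" .
    qed
  qed
qed

lemma half_bound_sup:
  assumes \<Phi>1: "is_profile c d \<Phi>1" and \<Phi>2: "is_profile c d \<Phi>2"
    and p: "0 < p1" "0 < p2" "p2 \<le> q" and Y0: "0 \<le> Y"
    and Y: "\<And>x. x \<in> {c..d} \<Longrightarrow> epow (tail d u x) (1 / q) * \<Phi>1 x * \<Phi>2 x \<le> ennreal Y"
  shows "half_bound \<Phi>1 \<Phi>2 p1 p2 Y"
  unfolding half_bound_def
proof (intro allI impI)
  fix N and \<alpha> \<beta> :: "nat \<Rightarrow> real" assume a: "\<forall>i. 0 \<le> \<alpha> i" "\<forall>i. 0 \<le> \<beta> i"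
  have "U i powr (1/q) * grid_val \<Phi>1 i * grid_val \<Phi>2 i \<le> Y" for i
  proof -
    have "ennreal (U i powr (1/q) * grid_val \<Phi>1 i * grid_val \<Phi>2 i) = epow (tail d u (z i)) (1 / q) * \<Phi>1 (z i) * \<Phi>2 (z i)"
      using q by (simp add: grid_val_eq[OF \<Phi>1] grid_val_eq[OF \<Phi>2] epow_tail[OF z_in] T_z ennreal_mult)
    also have "\<dots> \<le> ennreal Y" by (rule Y[OF z_in])
    finally show ?thesis using Y0 by simp
  qed
  then show "lpn {..N} q (\<lambda>j. runmax \<alpha> (grid_val \<Phi>1) j * (U j powr (1/q) * grid_val \<Phi>2 j) * \<beta> j)
         \<le> Y * lpn {..N} p1 \<alpha> * lpn {..N} p2 \<beta>"
    using a p grid_val_mono[OF \<Phi>1] by (intro runmax_half_bound_sup) auto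
qed

lemma half_bound_mid:
  assumes \<Phi>1: "is_profile c d \<Phi>1" and \<Phi>2: "is_profile c d \<Phi>2"
    and p: "0 < p1" "0 < p2" "0 < r" "1 / q = 1 / r + 1 / p2" "p1 \<le> r" and XY: "0 \<le> X" "0 \<le> Y"
    and X: "\<And>x. x \<in> {c..d} \<Longrightarrow> \<Phi>1 x * epow (Jo \<Phi>2 r x) (1 / r) \<le> ennreal X"
    and Y: "\<And>x. x \<in> {c..d} \<Longrightarrow> epow (tail d u x) (1 / q) * \<Phi>1 x * \<Phi>2 x \<le> ennreal Y"
  shows "half_bound \<Phi>1 \<Phi>2 p1 p2 (4 powr (1/r) * (X + Y))"
  unfolding half_bound_def
proof (intro allI impI)
  fix N and \<alpha> \<beta> :: "nat \<Rightarrow> real" assume a: "\<forall>i. 0 \<le> \<alpha> i" "\<forall>i. 0 \<le> \<beta> i"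
  have "1 / r \<le> 1 / q" using p by simp
  then have qr: "q \<le> r" using q p(3) by (simp add: field_simps)
  have M: "grid_val \<Phi>1 i * (\<Sum>j=i..N. (U j powr (1/q) * grid_val \<Phi>2 j) powr r) powr (1/r) \<le> 4 powr (1/r) * (X + Y)"
    if "i \<le> N" for i
  proof -
    have "ennreal (grid_val \<Phi>1 i * (\<Sum>j=i..N. (U j powr (1/q) * grid_val \<Phi>2 j) powr r) powr (1/r))
      \<le> ennreal (4 powr (1/r)) * (ennreal X + ennreal Y)"
      by (rule grid_sup_le[OF \<Phi>1 \<Phi>2 qr X Y that])
    also have "\<dots> = ennreal (4 powr (1/r) * (X + Y))" using XY by (simp add: ennreal_mult)
    finally show ?thesis using XY by simp
  qed
  show "lpn {..N} q (\<lambda>j. runmax \<alpha> (grid_val \<Phi>1) j * (U j powr (1/q) * grid_val \<Phi>2 j) * \<beta> j)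
         \<le> 4 powr (1/r) * (X + Y) * lpn {..N} p1 \<alpha> * lpn {..N} p2 \<beta>"
    using a p q XY M by (intro runmax_half_Holder[where r = r] runmax_linear_bound_sup) auto
qed

lemma half_bound_sum:
  assumes \<Phi>1: "is_profile c d \<Phi>1" and \<Phi>2: "is_profile c d \<Phi>2"
    and p: "0 < p1" "0 < p2" "0 < r" "1 / q = 1 / r + 1 / p2" "0 < \<kappa>" "1 / r = 1 / \<kappa> + 1 / p1" and X0: "0 \<le> X" "0 \<le> Y"
    and X: "Ko \<Phi>1 \<Phi>2 \<kappa> r \<le> ennreal X"
    and Y: "\<And>N. (\<Sum>j\<le>N. ennreal (U j powr (\<kappa> / q)) * epow (\<Phi>1 (z j) * \<Phi>2 (z j)) \<kappa>) \<le> ennreal Y"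
  shows "half_bound \<Phi>1 \<Phi>2 p1 p2 (4 powr (1/r) * (X + Y) powr (1/\<kappa>))"
  unfolding half_bound_def
proof (intro allI impI)
  fix N and \<alpha> \<beta> :: "nat \<Rightarrow> real" assume a: "\<forall>i. 0 \<le> \<alpha> i" "\<forall>i. 0 \<le> \<beta> i"
  have "1 / r \<le> 1 / q" using p by simp
  then have qr: "q \<le> r" using q p(3) by (simp add: field_simps)
  have "1 / \<kappa> \<le> 1 / r" using p by simp
  then have rk: "r \<le> \<kappa>" using p(3,5) by (simp add: field_simps)
  let ?M = "4 powr (1/r) * (X + Y) powr (1/\<kappa>)"
  have M: "(\<Sum>i\<le>N. grid_val \<Phi>1 i powr \<kappa> *
       (\<Sum>j\<in>{j\<in>{..N}. \<iota> j = i}. (U j powr (1/q) * grid_val \<Phi>2 j) powr r) powr (\<kappa> / r)) \<le> ?M powr \<kappa>"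
    if \<iota>: "\<And>j. \<iota> j \<le> j" for \<iota>
  proof -
    have "ennreal (\<Sum>i\<le>N. grid_val \<Phi>1 i powr \<kappa> *
       (\<Sum>j\<in>{j\<in>{..N}. \<iota> j = i}. (U j powr (1/q) * grid_val \<Phi>2 j) powr r) powr (\<kappa> / r))
       \<le> (\<integral>\<^sup>+ x\<in>{c..d}. epow (grid_sum \<Phi>2 r N x) (\<kappa> / r) \<partial>stieltjes c d (\<lambda>t. epow (\<Phi>1 t) \<kappa>))"
      by (rule grid_grouped_sum_le[OF \<Phi>1 p(3) rk \<iota> \<Phi>2])
    also have "\<dots> \<le> ennreal (4 powr (\<kappa> / r)) *
        (Ko \<Phi>1 \<Phi>2 \<kappa> r + (\<Sum>j\<le>N. ennreal (U j powr (\<kappa> / q)) * epow (\<Phi>1 (z j) * \<Phi>2 (z j)) \<kappa>))"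
      by (rule grid_sum_powr_integral_le[OF \<Phi>1 \<Phi>2 qr rk])
    also have "\<dots> \<le> ennreal (4 powr (\<kappa> / r)) * (ennreal X + ennreal Y)"
      by (intro mult_left_mono add_mono X Y) auto
    also have "\<dots> = ennreal (4 powr (\<kappa> / r) * (X + Y))" using X0 by (simp add: ennreal_mult)
    also have "4 powr (\<kappa> / r) * (X + Y) = ?M powr \<kappa>" using X0 p(3,5) by (simp add: powr_mult powr_powr)
    finally show ?thesis by simp
  qed
  show "lpn {..N} q (\<lambda>j. runmax \<alpha> (grid_val \<Phi>1) j * (U j powr (1/q) * grid_val \<Phi>2 j) * \<beta> j)
         \<le> ?M * lpn {..N} p1 \<alpha> * lpn {..N} p2 \<beta>"
    using a p q X0 M
    by (intro runmax_half_Holder[where r = r] runmax_linear_bound_sum[where \<kappa> = \<kappa>]) auto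
qed

lemma grid_bound_swap: "grid_bound \<Phi>1 \<Phi>2 p1 p2 D \<Longrightarrow> grid_bound \<Phi>2 \<Phi>1 p2 p1 D"
  unfolding grid_bound_def
proof (intro allI impI)
  fix N and \<alpha> \<beta> :: "nat \<Rightarrow> real"
  assume B: "\<forall>N \<alpha> \<beta>. (\<forall>i. 0 \<le> \<alpha> i) \<longrightarrow> (\<forall>i. 0 \<le> \<beta> i) \<longrightarrow>
       lpn {..N} q (\<lambda>k. U k powr (1/q) * (runmax \<alpha> (grid_val \<Phi>1) k * runmax \<beta> (grid_val \<Phi>2) k))
         \<le> D * lpn {..N} p1 \<alpha> * lpn {..N} p2 \<beta>"
    and a: "\<forall>i. 0 \<le> \<alpha> i" "\<forall>i. 0 \<le> \<beta> i"
  from B[rule_format, of \<beta> \<alpha> N] a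
  show "lpn {..N} q (\<lambda>k. U k powr (1/q) * (runmax \<alpha> (grid_val \<Phi>2) k * runmax \<beta> (grid_val \<Phi>1) k))
         \<le> D * lpn {..N} p2 \<alpha> * lpn {..N} p1 \<beta>" by (simp add: mult_ac)
qed

lemma grid_bound_diag:
  assumes "grid_bound \<Phi>1 \<Phi>2 p1 p2 D" "is_profile c d \<Phi>1" "is_profile c d \<Phi>2" "x \<in> {c..d}"
  shows "epow (tail d u x) (1 / q) * \<Phi>1 x * \<Phi>2 x \<le> ennreal (2 powr (1/q) * D)"
proof (rule diagonal_le_of_grid[OF assms(2,3) _ assms(4)])
  fix k
  show "U k powr (1/q) * grid_val \<Phi>1 k * grid_val \<Phi>2 k \<le> D"
    using assms(1) q unfolding grid_bound_def
    by (intro runmax_product_lower_diag[of "grid_val \<Phi>1" "grid_val \<Phi>2" q k U D p1 p2 k]) auto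
qed

lemma grid_bound_half:
  assumes "grid_bound \<Phi>1 \<Phi>2 p1 p2 D" "0 \<le> D" "0 < r" "0 < p2" "1 / q = 1 / r + 1 / p2" "\<And>i. 0 \<le> \<alpha> i"
  shows "lpn {..N} r (\<lambda>j. runmax \<alpha> (grid_val \<Phi>1) j * (U j powr (1/q) * grid_val \<Phi>2 j)) \<le> D * lpn {..N} p1 \<alpha>"
  using assms q unfolding grid_bound_def
  by (intro runmax_product_lower_half[of "grid_val \<Phi>1" "grid_val \<Phi>2" q r p2 D N U p1 \<alpha>]) auto

lemma grid_bound_sup:
  assumes B: "grid_bound \<Phi>1 \<Phi>2 p1 p2 D" "0 \<le> D" and \<Phi>: "is_profile c d \<Phi>1" "is_profile c d \<Phi>2"
    and r: "0 < r" "0 < p2" "1 / q = 1 / r + 1 / p2" and x: "x \<in> {c..d}"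
  shows "\<Phi>1 x * epow (Jc \<Phi>2 r x) (1 / r) \<le> ennreal (2 powr (1/q) * D)"
proof (rule sup_le_of_grid[OF \<Phi> r(1) _ x])
  fix i N :: nat assume "i \<le> N"
  then show "grid_val \<Phi>1 i * (\<Sum>j=i..N. (U j powr (1/q) * grid_val \<Phi>2 j) powr r) powr (1/r) \<le> D"
    using grid_bound_half[OF B r] r
    by (intro runmax_lower_single[where p = p1]) auto
qed

lemma grid_bound_K:
  assumes B: "grid_bound \<Phi>1 \<Phi>2 p1 p2 D" "0 \<le> D" and \<Phi>: "is_profile c d \<Phi>1" "is_profile c d \<Phi>2"
    and r: "0 < r" "0 < p2" "1 / q = 1 / r + 1 / p2" and k: "0 < p1" "0 < \<kappa>" "1 / r = 1 / \<kappa> + 1 / p1"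
  shows "epow (Kc \<Phi>1 \<Phi>2 \<kappa> r) (1 / \<kappa>) \<le> ennreal (2 powr (1/q) * 4 powr (1/r) * D)"
proof -
  have "Kc \<Phi>1 \<Phi>2 \<kappa> r \<le> ennreal (2 powr (\<kappa> / q) * (4 powr (\<kappa> / r) * D powr \<kappa>))"
    by (rule Kc_le_of_grid[OF \<Phi> k(1) r(1) k(2,3) B(2)]) (rule grid_bound_half[OF B r])
  also have "2 powr (\<kappa> / q) * (4 powr (\<kappa> / r) * D powr \<kappa>) = (2 powr (1/q) * 4 powr (1/r) * D) powr \<kappa>"
    using B(2) by (simp add: powr_mult powr_powr)
  finally show ?thesis
    using k(2) B(2) by (simp add: epow_le_iff epow_ennreal)
qed

end

section \<open>The characteristics for finite exponents\<close>

type_synonym char_fun = "real \<Rightarrow> real \<Rightarrow> (real \<Rightarrow> ennreal) \<Rightarrow> (real \<Rightarrow> ennreal) \<Rightarrow> (real \<Rightarrow> ennreal) \<Rightarrow> ennreal"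

text \<open>
  Two-sided control of the best constant for all Hardy systems with given exponents by a
  characteristic of the tail and the profiles; the important point is that \<open>K\<close> precedes
  the interval, the weight and the profiles.
\<close>

definition characterizes_with :: "real \<Rightarrow> real \<Rightarrow> real \<Rightarrow> char_fun \<Rightarrow> real \<Rightarrow> bool" where
  "characterizes_with q p1 p2 A K \<longleftrightarrow> (\<forall>c d u M \<Phi>1 \<Phi>2 S1 S2.
     weight_grid c d q M u \<longrightarrow> is_profile c d \<Phi>1 \<longrightarrow> is_profile c d \<Phi>2 \<longrightarrow>
     hardy_system c d p1 \<Phi>1 S1 \<longrightarrow> hardy_system c d p2 \<Phi>2 S2 \<longrightarrow>
       (\<forall>C\<ge>0. bilinear_bound c d q u S1 S2 C \<longrightarrow> A c d u \<Phi>1 \<Phi>2 \<le> ennreal (K * C)) \<and>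
       (\<forall>X\<ge>0. A c d u \<Phi>1 \<Phi>2 \<le> ennreal X \<longrightarrow> bilinear_bound c d q u S1 S2 (K * X)))"

definition characterizes :: "real \<Rightarrow> real \<Rightarrow> real \<Rightarrow> char_fun \<Rightarrow> bool" where
  "characterizes q p1 p2 A \<longleftrightarrow> (\<exists>K>0. characterizes_with q p1 p2 A K)"

lemma characterizes_withD:
  assumes "characterizes_with q p1 p2 A K"
    and "weight_grid c d q M u" "is_profile c d \<Phi>1" "is_profile c d \<Phi>2"
    and "hardy_system c d p1 \<Phi>1 S1" "hardy_system c d p2 \<Phi>2 S2"
  shows "0 \<le> C \<Longrightarrow> bilinear_bound c d q u S1 S2 C \<Longrightarrow> A c d u \<Phi>1 \<Phi>2 \<le> ennreal (K * C)"
    and "0 \<le> X \<Longrightarrow> A c d u \<Phi>1 \<Phi>2 \<le> ennreal X \<Longrightarrow> bilinear_bound c d q u S1 S2 (K * X)"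
proof -
  note a = assms(1)[unfolded characterizes_with_def, rule_format, OF assms(2-6)]
  show "0 \<le> C \<Longrightarrow> bilinear_bound c d q u S1 S2 C \<Longrightarrow> A c d u \<Phi>1 \<Phi>2 \<le> ennreal (K * C)"
    by (rule conjunct1[OF a, rule_format])
  show "0 \<le> X \<Longrightarrow> A c d u \<Phi>1 \<Phi>2 \<le> ennreal X \<Longrightarrow> bilinear_bound c d q u S1 S2 (K * X)"
    by (rule conjunct2[OF a, rule_format])
qed

lemma bilinear_bound_mono:
  assumes "bilinear_bound c d q u S1 S2 C" "0 \<le> C" "C \<le> C'" "0 < q"
    and S: "hardy_system c d p1 \<Phi>1 S1" "hardy_system c d p2 \<Phi>2 S2"
  shows "bilinear_bound c d q u S1 S2 C'"
  unfolding bilinear_bound_def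
proof (intro ballI, clarify)
  fix F n G m assume FG: "(F, n) \<in> S1" "(G, m) \<in> S2"
  have nm: "0 \<le> n" "0 \<le> m" using hardy_systemD(1)[OF S(1) FG(1)] hardy_systemD(1)[OF S(2) FG(2)] by auto
  have "(\<integral>\<^sup>+ t. epow (ennreal (F t * G t)) q * u t \<partial>lebesgue_on {c..d}) \<le> ennreal ((C * n * m) powr q)"
    using assms(1) FG unfolding bilinear_bound_def by blast
  also have "\<dots> \<le> ennreal ((C' * n * m) powr q)"
    using nm assms(2-4) by (intro ennreal_leI powr_mono2 mult_right_mono) auto
  finally show "(\<integral>\<^sup>+ t. epow (ennreal (F t * G t)) q * u t \<partial>lebesgue_on {c..d}) \<le> ennreal ((C' * n * m) powr q)" .
qed

lemma characterizesI:
  assumes K: "0 \<le> K1" "0 \<le> K2"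
    and lower: "\<And>c d u M \<Phi>1 \<Phi>2 D. weight_grid c d q M u \<Longrightarrow> is_profile c d \<Phi>1 \<Longrightarrow> is_profile c d \<Phi>2 \<Longrightarrow>
       0 \<le> D \<Longrightarrow> weight_grid.grid_bound c d q u \<Phi>1 \<Phi>2 p1 p2 D \<Longrightarrow> A c d u \<Phi>1 \<Phi>2 \<le> ennreal (K1 * D)"
    and upper: "\<And>c d u M \<Phi>1 \<Phi>2 X. weight_grid c d q M u \<Longrightarrow> is_profile c d \<Phi>1 \<Longrightarrow> is_profile c d \<Phi>2 \<Longrightarrow>
       0 \<le> X \<Longrightarrow> A c d u \<Phi>1 \<Phi>2 \<le> ennreal X \<Longrightarrow> weight_grid.grid_bound c d q u \<Phi>1 \<Phi>2 p1 p2 (K2 * X)"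
  shows "characterizes q p1 p2 A"
proof -
  define K where "K = 1 + K1 * (4 * 4 powr (1/q)) + 16 * K2"
  have K0: "0 < K" using K by (simp add: K_def add_pos_nonneg)
  have KC: "K1 * (4 * 4 powr (1/q) * C) \<le> K * C" "16 * (K2 * C) \<le> K * C" if "0 \<le> C" for C
  proof -
    have "(K1 * (4 * 4 powr (1/q))) * C \<le> K * C" "(16 * K2) * C \<le> K * C"
      using that K by (auto simp: K_def intro!: mult_right_mono)
    then show "K1 * (4 * 4 powr (1/q) * C) \<le> K * C" "16 * (K2 * C) \<le> K * C" by (simp_all add: mult.assoc)
  qed
  have "characterizes_with q p1 p2 A K"
    unfolding characterizes_with_def
  proof (intro allI impI)
    fix c d u M \<Phi>1 \<Phi>2 S1 S2
    assume W: "weight_grid c d q M u" and \<Phi>: "is_profile c d \<Phi>1" "is_profile c d \<Phi>2"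
      and S: "hardy_system c d p1 \<Phi>1 S1" "hardy_system c d p2 \<Phi>2 S2"
    interpret weight_grid c d q M u by fact
    have "A c d u \<Phi>1 \<Phi>2 \<le> ennreal (K * C)" if C: "0 \<le> C" "bilinear_bound c d q u S1 S2 C" for C
    proof -
      have "A c d u \<Phi>1 \<Phi>2 \<le> ennreal (K1 * (4 * 4 powr (1/q) * C))"
        using C by (intro lower[OF W \<Phi>] grid_bound_of_bilinear[OF S]) auto
      also have "\<dots> \<le> ennreal (K * C)" by (intro ennreal_leI KC C)
      finally show ?thesis .
    qed
    moreover have "bilinear_bound c d q u S1 S2 (K * X)" if X: "0 \<le> X" "A c d u \<Phi>1 \<Phi>2 \<le> ennreal X" for X
    proof (rule bilinear_bound_mono[OF _ _ KC(2)[OF X(1)] q S])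
      show "bilinear_bound c d q u S1 S2 (16 * (K2 * X))"
        using X K by (intro bilinear_bound_of_grid[OF S] upper[OF W \<Phi>]) auto
    qed (use K X in auto)
    ultimately show "(\<forall>C\<ge>0. bilinear_bound c d q u S1 S2 C \<longrightarrow> A c d u \<Phi>1 \<Phi>2 \<le> ennreal (K * C)) \<and>
       (\<forall>X\<ge>0. A c d u \<Phi>1 \<Phi>2 \<le> ennreal X \<longrightarrow> bilinear_bound c d q u S1 S2 (K * X))" by simp
  qed
  then show ?thesis using K0 unfolding characterizes_def by blast
qed

lemma characterizes_swap:
  assumes "characterizes q p1 p2 A"
  shows "characterizes q p2 p1 (\<lambda>c d u \<Phi>1 \<Phi>2. A c d u \<Phi>2 \<Phi>1)"
proof -
  have swap: "bilinear_bound c d q u S2 S1 C" if "bilinear_bound c d q u S1 S2 C" for c d u S1 S2 C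
    unfolding bilinear_bound_def
  proof (intro ballI, clarify)
    fix F n G m assume "(F, n) \<in> S2" "(G, m) \<in> S1"
    then have "(\<integral>\<^sup>+ t. epow (ennreal (G t * F t)) q * u t \<partial>lebesgue_on {c..d}) \<le> ennreal ((C * m * n) powr q)"
      using that unfolding bilinear_bound_def by blast
    then show "(\<integral>\<^sup>+ t. epow (ennreal (F t * G t)) q * u t \<partial>lebesgue_on {c..d}) \<le> ennreal ((C * n * m) powr q)"
      by (simp add: mult_ac)
  qed
  obtain K where K: "0 < K" "characterizes_with q p1 p2 A K"
    using assms unfolding characterizes_def by blast
  have "characterizes_with q p2 p1 (\<lambda>c d u \<Phi>1 \<Phi>2. A c d u \<Phi>2 \<Phi>1) K"
    unfolding characterizes_with_def
  proof (intro allI impI conjI)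
    fix c d u M \<Phi>1 \<Phi>2 S1 S2
    assume a: "weight_grid c d q M u" "is_profile c d \<Phi>1" "is_profile c d \<Phi>2"
      "hardy_system c d p2 \<Phi>1 S1" "hardy_system c d p1 \<Phi>2 S2"
    note D = characterizes_withD[OF K(2) a(1,3,2,5,4)]
    fix C :: real assume C: "0 \<le> C"
    show "A c d u \<Phi>2 \<Phi>1 \<le> ennreal (K * C)" if "bilinear_bound c d q u S1 S2 C"
      using C swap[OF that] by (rule D(1))
    show "bilinear_bound c d q u S1 S2 (K * C)" if "A c d u \<Phi>2 \<Phi>1 \<le> ennreal C"
      by (rule swap[OF D(2)[OF C that]])
  qed
  then show ?thesis using K(1) unfolding characterizes_def by blast
qed

lemma characterizes_B1:
  assumes p: "0 < p1" "0 < p2" "p1 \<le> q" "p2 \<le> q"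
  shows "characterizes q p1 p2 (B1 q)"
proof (rule characterizesI)
  show "0 \<le> 2 powr (1/q)" "0 \<le> 2 * 4 powr (1/q)" by simp_all
  fix c d u M \<Phi>1 \<Phi>2 D assume W: "weight_grid c d q M u" and \<Phi>: "is_profile c d \<Phi>1" "is_profile c d \<Phi>2"
    and D: "0 \<le> D" "weight_grid.grid_bound c d q u \<Phi>1 \<Phi>2 p1 p2 D"
  interpret weight_grid c d q M u by fact
  show "B1 q c d u \<Phi>1 \<Phi>2 \<le> ennreal (2 powr (1/q) * D)"
    unfolding B1_def using grid_bound_diag[OF D(2) \<Phi>] by (intro SUP_least)
next
  fix c d u M \<Phi>1 \<Phi>2 X assume W: "weight_grid c d q M u" and \<Phi>: "is_profile c d \<Phi>1" "is_profile c d \<Phi>2"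
    and X: "0 \<le> X" "B1 q c d u \<Phi>1 \<Phi>2 \<le> ennreal X"
  interpret weight_grid c d q M u by fact
  have Y: "epow (tail d u x) (1 / q) * \<Phi>1 x * \<Phi>2 x \<le> ennreal X" if "x \<in> {c..d}" for x
    using X(2) SUP_upper[OF that, of "\<lambda>x. epow (tail d u x) (1 / q) * \<Phi>1 x * \<Phi>2 x"]
    unfolding B1_def by (rule order_trans[rotated])
  then have Y': "epow (tail d u x) (1 / q) * \<Phi>2 x * \<Phi>1 x \<le> ennreal X" if "x \<in> {c..d}" for x
    using that by (simp add: mult_ac)
  have "grid_bound \<Phi>1 \<Phi>2 p1 p2 (4 powr (1/q) * (X + X))"
    using p X Y Y' \<Phi> by (intro grid_bound_of_halves half_bound_sup) auto
  then show "grid_bound \<Phi>1 \<Phi>2 p1 p2 (2 * 4 powr (1/q) * X)" by (simp add: mult_ac)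
qed

lemma conj_exps:
  assumes "0 < q" "q < p"
  shows "0 < r_exp q (ennreal p)" "1 / q = 1 / r_exp q (ennreal p) + 1 / p"
  using assms by (simp_all add: r_exp_def frac_less2)

text \<open>
  With the maximum of \<open>x\<close> and \<open>t\<close> inside the tail the integral over
  \<open>[c, x]\<close> is the diagonal term and the one over \<open>[x, d]\<close> is the inner
  integral, so both terms of the discrete characteristic are contained in this one.
\<close>

lemma characterizes_B2_hat:
  assumes p: "0 < p1" "p1 \<le> q" "q < p2"
  shows "characterizes q p1 p2 (B2_hat q (ennreal p2))"
proof -
  define r where "r = r_exp q (ennreal p2)"
  have q: "0 < q" using p by simp
  have r: "0 < r" "1 / q = 1 / r + 1 / p2" using conj_exps[OF q p(3)] by (simp_all add: r_def)
  have p2: "0 < p2" using p by simp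
  have "1 / r \<le> 1 / q" using r p2 by simp
  then have qr: "q \<le> r" using q r(1) by (simp add: field_simps)
  let ?hat = "\<lambda>c d u \<Phi>2 x. \<integral>\<^sup>+ t\<in>{c..d}. epow (tail d u (max x t)) (r / q) \<partial>stieltjes c d (\<lambda>t. epow (\<Phi>2 t) r)"
  have B2: "B2_hat q (ennreal p2) c d u \<Phi>1 \<Phi>2 = (SUP x\<in>{c..d}. \<Phi>1 x * epow (?hat c d u \<Phi>2 x) (1 / r))" for c d u \<Phi>1 \<Phi>2
    by (simp add: B2_hat_def Let_def r_def)
  show ?thesis
  proof (rule characterizesI)
    show "0 \<le> 2 powr (1/r) * (2 * 2 powr (1/q))" "0 \<le> 4 powr (1/q) * (2 * 4 powr (1/r) + 1)" by simp_all
    fix c d u M \<Phi>1 \<Phi>2 D assume W: "weight_grid c d q M u" and \<Phi>: "is_profile c d \<Phi>1" "is_profile c d \<Phi>2"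
      and D: "0 \<le> D" "weight_grid.grid_bound c d q u \<Phi>1 \<Phi>2 p1 p2 D"
    interpret weight_grid c d q M u by fact
    let ?\<mu> = "stieltjes c d (\<lambda>t. epow (\<Phi>2 t) r)"
    show "B2_hat q (ennreal p2) c d u \<Phi>1 \<Phi>2 \<le> ennreal (2 powr (1/r) * (2 * 2 powr (1/q)) * D)"
      unfolding B2
    proof (rule SUP_least)
      fix x assume x: "x \<in> {c..d}"
      let ?E = "epow (tail d u x) (r / q) * epow (\<Phi>2 x) r"
      have "?hat c d u \<Phi>2 x \<le> (\<integral>\<^sup>+ t. epow (tail d u x) (r / q) * indicator {c..x} t + epow (tail d u t) (r / q) * indicator {x..d} t \<partial>?\<mu>)"
        using x by (intro nn_integral_mono) (auto split: split_indicator simp: max_def)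
      also have "\<dots> = (\<integral>\<^sup>+ t. epow (tail d u x) (r / q) * indicator {c..x} t \<partial>?\<mu>) + Jc \<Phi>2 r x"
        using q r by (intro nn_integral_add) auto
      also have "(\<integral>\<^sup>+ t. epow (tail d u x) (r / q) * indicator {c..x} t \<partial>?\<mu>) = ?E"
        using emeasure_stieltjes_profile[OF \<Phi>(2) r(1) x] by (simp add: nn_integral_cmult_indicator)
      finally have "epow (?hat c d u \<Phi>2 x) (1 / r) \<le> epow (?E + Jc \<Phi>2 r x) (1 / r)"
        using r by (intro epow_mono) auto
      also have "\<dots> \<le> ennreal (2 powr (1/r)) * (epow ?E (1 / r) + epow (Jc \<Phi>2 r x) (1 / r))"
        using r by (intro epow_add_le) auto
      also have "epow ?E (1 / r) = epow (tail d u x) (1 / q) * \<Phi>2 x"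
        using r q by (simp add: epow_mult epow_epow)
      finally have "\<Phi>1 x * epow (?hat c d u \<Phi>2 x) (1 / r)
         \<le> \<Phi>1 x * (ennreal (2 powr (1/r)) * (epow (tail d u x) (1 / q) * \<Phi>2 x + epow (Jc \<Phi>2 r x) (1 / r)))"
        by (intro mult_left_mono) auto
      also have "\<dots> = ennreal (2 powr (1/r)) * (epow (tail d u x) (1 / q) * \<Phi>1 x * \<Phi>2 x + \<Phi>1 x * epow (Jc \<Phi>2 r x) (1 / r))"
        by (simp add: distrib_left mult_ac)
      also have "\<dots> \<le> ennreal (2 powr (1/r)) * (ennreal (2 powr (1/q) * D) + ennreal (2 powr (1/q) * D))"
        using grid_bound_diag[OF D(2) \<Phi> x] grid_bound_sup[OF D(2,1) \<Phi> r(1) p2 r(2) x]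
        by (intro mult_left_mono add_mono) auto
      also have "\<dots> = ennreal (2 powr (1/r) * (2 * 2 powr (1/q)) * D)"
        using D(1) by (simp add: ennreal_mult[symmetric] ennreal_plus[symmetric] mult.assoc del: ennreal_plus)
      finally show "\<Phi>1 x * epow (?hat c d u \<Phi>2 x) (1 / r) \<le> ennreal (2 powr (1/r) * (2 * 2 powr (1/q)) * D)" .
    qed
  next
    fix c d u M \<Phi>1 \<Phi>2 X assume W: "weight_grid c d q M u" and \<Phi>: "is_profile c d \<Phi>1" "is_profile c d \<Phi>2"
      and X: "0 \<le> X" "B2_hat q (ennreal p2) c d u \<Phi>1 \<Phi>2 \<le> ennreal X"
    interpret weight_grid c d q M u by fact
    let ?\<mu> = "stieltjes c d (\<lambda>t. epow (\<Phi>2 t) r)"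
    have le: "\<Phi>1 x * epow (?hat c d u \<Phi>2 x) (1 / r) \<le> ennreal X" if "x \<in> {c..d}" for x
      using X(2) SUP_upper[OF that, of "\<lambda>x. \<Phi>1 x * epow (?hat c d u \<Phi>2 x) (1 / r)"]
      unfolding B2 by (rule order_trans[rotated])
    have 1: "\<Phi>1 x * epow (Jo \<Phi>2 r x) (1 / r) \<le> ennreal X" if x: "x \<in> {c..d}" for x
    proof -
      have "Jo \<Phi>2 r x \<le> ?hat c d u \<Phi>2 x"
        using x by (intro nn_integral_mono) (auto split: split_indicator simp: max_def)
      then have "\<Phi>1 x * epow (Jo \<Phi>2 r x) (1 / r) \<le> \<Phi>1 x * epow (?hat c d u \<Phi>2 x) (1 / r)"
        using r by (intro mult_left_mono epow_mono) auto
      then show ?thesis using le[OF x] by (rule order_trans)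
    qed
    have 2: "epow (tail d u x) (1 / q) * \<Phi>1 x * \<Phi>2 x \<le> ennreal X" if x: "x \<in> {c..d}" for x
    proof -
      have "epow (tail d u x) (r / q) * epow (\<Phi>2 x) r = (\<integral>\<^sup>+ t. epow (tail d u x) (r / q) * indicator {c..x} t \<partial>?\<mu>)"
        using emeasure_stieltjes_profile[OF \<Phi>(2) r(1) x] by (simp add: nn_integral_cmult_indicator)
      also have "\<dots> \<le> ?hat c d u \<Phi>2 x"
        using x by (intro nn_integral_mono) (auto split: split_indicator simp: max_def)
      finally have "epow (epow (tail d u x) (r / q) * epow (\<Phi>2 x) r) (1 / r) \<le> epow (?hat c d u \<Phi>2 x) (1 / r)"
        using r by (intro epow_mono) auto
      then have "\<Phi>1 x * (epow (tail d u x) (1 / q) * \<Phi>2 x) \<le> \<Phi>1 x * epow (?hat c d u \<Phi>2 x) (1 / r)"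
        using r q by (intro mult_left_mono) (simp_all add: epow_mult epow_epow)
      then show ?thesis using le[OF x] by (simp add: mult_ac)
    qed
    have "half_bound \<Phi>1 \<Phi>2 p1 p2 (4 powr (1/r) * (X + X))"
      using p p2 r qr X 1 2 by (intro half_bound_mid[OF \<Phi>]) auto
    moreover have "half_bound \<Phi>2 \<Phi>1 p2 p1 X"
      using p p2 X 2 by (intro half_bound_sup[OF \<Phi>(2,1)]) (auto simp: mult_ac)
    ultimately have "grid_bound \<Phi>1 \<Phi>2 p1 p2 (4 powr (1/q) * (4 powr (1/r) * (X + X) + X))"
      by (rule grid_bound_of_halves)
    then show "grid_bound \<Phi>1 \<Phi>2 p1 p2 (4 powr (1/q) * (2 * 4 powr (1/r) + 1) * X)" by (simp add: algebra_simps)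
  qed
qed

text \<open>
  The condition on the exponents says \<open>p1 \<le> r2\<close> and \<open>p2 \<le> r1\<close>, so
  both halves are of supremum type, and the diagonal term is absorbed.
\<close>

lemma characterizes_B4_B5:
  assumes p: "0 < q" "q < p1" "q < p2" "1 / q \<le> 1 / p1 + 1 / p2"
  shows "characterizes q p1 p2 (\<lambda>c d u \<Phi>1 \<Phi>2. B4 q (ennreal p2) c d u \<Phi>1 \<Phi>2 + B5 q (ennreal p1) c d u \<Phi>1 \<Phi>2)"
proof -
  note q = p(1)
  define r1 where "r1 = r_exp q (ennreal p1)"
  define r2 where "r2 = r_exp q (ennreal p2)"
  have r1: "0 < r1" "1 / q = 1 / r1 + 1 / p1" using conj_exps[OF q p(2)] by (simp_all add: r1_def)
  have r2: "0 < r2" "1 / q = 1 / r2 + 1 / p2" using conj_exps[OF q p(3)] by (simp_all add: r2_def)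
  have p0: "0 < p1" "0 < p2" using p by auto
  have "1 / r2 \<le> 1 / p1" "1 / r1 \<le> 1 / p2" using r1(2) r2(2) p(4) by auto
  then have pr: "p1 \<le> r2" "p2 \<le> r1" using p0 r1(1) r2(1) by (simp_all add: field_simps)
  define K where "K = 2 * (split_const r1 + split_const r2) * 2"
  have K0: "0 \<le> K" using split_const_pos[OF r1(1)] split_const_pos[OF r2(1)] by (simp add: K_def)
  let ?J4 = "\<lambda>c d u \<Phi>2 x. \<integral>\<^sup>+ t\<in>{x..d}. epow (tail d u t) (r2 / q) \<partial>stieltjes c d (\<lambda>t. epow (\<Phi>2 t) r2)"
  let ?J5 = "\<lambda>c d u \<Phi>1 x. \<integral>\<^sup>+ t\<in>{x<..d}. epow (tail d u t) (r1 / q) \<partial>stieltjes c d (\<lambda>t. epow (\<Phi>1 t) r1)"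
  have B4: "B4 q (ennreal p2) c d u \<Phi>1 \<Phi>2 = (SUP x\<in>{c..d}. \<Phi>1 x * epow (?J4 c d u \<Phi>2 x) (1 / r2))" for c d u \<Phi>1 \<Phi>2
    by (simp add: B4_def Let_def r2_def)
  have B5: "B5 q (ennreal p1) c d u \<Phi>1 \<Phi>2 = (SUP x\<in>{c..d}. \<Phi>2 x * epow (?J5 c d u \<Phi>1 x) (1 / r1))" for c d u \<Phi>1 \<Phi>2
    by (simp add: B5_def Let_def r1_def)
  show ?thesis
  proof (rule characterizesI)
    show "0 \<le> 2 * 2 powr (1/q)" "0 \<le> 4 powr (1/q) * (4 powr (1/r2) * (1 + K) + 4 powr (1/r1) * (1 + K))"
      using K0 by simp_all
    fix c d u M \<Phi>1 \<Phi>2 D assume W: "weight_grid c d q M u" and \<Phi>: "is_profile c d \<Phi>1" "is_profile c d \<Phi>2"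
      and D: "0 \<le> D" "weight_grid.grid_bound c d q u \<Phi>1 \<Phi>2 p1 p2 D"
    interpret weight_grid c d q M u by fact
    have "B4 q (ennreal p2) c d u \<Phi>1 \<Phi>2 \<le> ennreal (2 powr (1/q) * D)"
      unfolding B4 by (intro SUP_least grid_bound_sup[OF D(2,1) \<Phi> r2(1) p0(2) r2(2)])
    moreover have "B5 q (ennreal p1) c d u \<Phi>1 \<Phi>2 \<le> ennreal (2 powr (1/q) * D)"
      unfolding B5
    proof (rule SUP_least)
      fix x assume x: "x \<in> {c..d}"
      have "\<Phi>2 x * epow (Jo \<Phi>1 r1 x) (1 / r1) \<le> \<Phi>2 x * epow (Jc \<Phi>1 r1 x) (1 / r1)"
        using r1 by (intro mult_left_mono epow_mono Jo_le_Jc) auto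
      also have "\<dots> \<le> ennreal (2 powr (1/q) * D)"
        by (rule grid_bound_sup[OF grid_bound_swap[OF D(2)] D(1) \<Phi>(2,1) r1(1) p0(1) r1(2) x])
      finally show "\<Phi>2 x * epow (Jo \<Phi>1 r1 x) (1 / r1) \<le> ennreal (2 powr (1/q) * D)" .
    qed
    ultimately have "B4 q (ennreal p2) c d u \<Phi>1 \<Phi>2 + B5 q (ennreal p1) c d u \<Phi>1 \<Phi>2
        \<le> ennreal (2 powr (1/q) * D) + ennreal (2 powr (1/q) * D)" by (rule add_mono)
    also have "\<dots> = ennreal (2 * 2 powr (1/q) * D)"
      using D(1) by (simp add: ennreal_plus[symmetric] del: ennreal_plus)
    finally show "B4 q (ennreal p2) c d u \<Phi>1 \<Phi>2 + B5 q (ennreal p1) c d u \<Phi>1 \<Phi>2 \<le> ennreal (2 * 2 powr (1/q) * D)" .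
  next
    fix c d u M \<Phi>1 \<Phi>2 X assume W: "weight_grid c d q M u" and \<Phi>: "is_profile c d \<Phi>1" "is_profile c d \<Phi>2"
      and X: "0 \<le> X" "B4 q (ennreal p2) c d u \<Phi>1 \<Phi>2 + B5 q (ennreal p1) c d u \<Phi>1 \<Phi>2 \<le> ennreal X"
    interpret weight_grid c d q M u by fact
    have X4: "\<Phi>1 x * epow (Jc \<Phi>2 r2 x) (1 / r2) \<le> ennreal X" if "x \<in> {c..d}" for x
    proof -
      have "\<Phi>1 x * epow (Jc \<Phi>2 r2 x) (1 / r2) \<le> B4 q (ennreal p2) c d u \<Phi>1 \<Phi>2"
        unfolding B4 using that by (intro SUP_upper)
      also have "\<dots> \<le> ennreal X" using X(2) by (rule order_trans[rotated]) simp
      finally show ?thesis .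
    qed
    have X5: "\<Phi>2 x * epow (Jo \<Phi>1 r1 x) (1 / r1) \<le> ennreal X" if "x \<in> {c..d}" for x
    proof -
      have "\<Phi>2 x * epow (Jo \<Phi>1 r1 x) (1 / r1) \<le> B5 q (ennreal p1) c d u \<Phi>1 \<Phi>2"
        unfolding B5 using that by (intro SUP_upper)
      also have "\<dots> \<le> ennreal X" using X(2) by (rule order_trans[rotated]) simp
      finally show ?thesis .
    qed
    have X4': "\<Phi>1 x * epow (Jo \<Phi>2 r2 x) (1 / r2) \<le> ennreal X" if "x \<in> {c..d}" for x
    proof -
      have "\<Phi>1 x * epow (Jo \<Phi>2 r2 x) (1 / r2) \<le> \<Phi>1 x * epow (Jc \<Phi>2 r2 x) (1 / r2)"
        using r2 by (intro mult_left_mono epow_mono Jo_le_Jc) auto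
      then show ?thesis using X4[OF that] by (rule order_trans)
    qed
    have Y: "epow (tail d u x) (1 / q) * \<Phi>1 x * \<Phi>2 x \<le> ennreal (K * X)" if x: "x \<in> {c..d}" for x
    proof -
      have "epow (tail d u x) (1 / q) * \<Phi>1 x * \<Phi>2 x
         \<le> ennreal (2 * (split_const r1 + split_const r2)) * (ennreal X + ennreal X)"
        by (rule diagonal_le_split[OF \<Phi> r1(1) r2(1) X4 X5 x])
      also have "\<dots> = ennreal (K * X)"
        using X(1) split_const_pos[OF r1(1)] split_const_pos[OF r2(1)]
        by (simp add: K_def ennreal_mult[symmetric] ennreal_plus[symmetric] mult.assoc del: ennreal_plus)
      finally show ?thesis .
    qed
    have "half_bound \<Phi>1 \<Phi>2 p1 p2 (4 powr (1/r2) * (X + K * X))"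
      using p0 r2 pr X(1) K0 X4' Y by (intro half_bound_mid[OF \<Phi>]) auto
    moreover have "half_bound \<Phi>2 \<Phi>1 p2 p1 (4 powr (1/r1) * (X + K * X))"
      using p0 r1 pr X(1) K0 X5 Y by (intro half_bound_mid[OF \<Phi>(2,1)]) (auto simp: mult_ac)
    ultimately have "grid_bound \<Phi>1 \<Phi>2 p1 p2 (4 powr (1/q) * (4 powr (1/r2) * (X + K * X) + 4 powr (1/r1) * (X + K * X)))"
      by (rule grid_bound_of_halves)
    then show "grid_bound \<Phi>1 \<Phi>2 p1 p2 (4 powr (1/q) * (4 powr (1/r2) * (1 + K) + 4 powr (1/r1) * (1 + K)) * X)"
      by (simp add: algebra_simps)
  qed
qed

text \<open>
  Here \<open>r2 < p1\<close> and \<open>r1 < p2\<close>, and \<open>1/r2 = 1/\<kappa> + 1/p1\<close>,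
  \<open>1/r1 = 1/\<kappa> + 1/p2\<close>: both halves are of sum type.
\<close>

lemma characterizes_B6_B7:
  assumes p: "0 < q" "q < p1" "q < p2" "1 / p1 + 1 / p2 < 1 / q"
  shows "characterizes q p1 p2 (\<lambda>c d u \<Phi>1 \<Phi>2. B6 q (ennreal p1) (ennreal p2) c d u \<Phi>1 \<Phi>2
      + B7 q (ennreal p1) (ennreal p2) c d u \<Phi>1 \<Phi>2)"
proof -
  note q = p(1)
  define r1 where "r1 = r_exp q (ennreal p1)"
  define r2 where "r2 = r_exp q (ennreal p2)"
  define \<kappa> where "\<kappa> = kappa_exp q (ennreal p1) (ennreal p2)"
  have r1: "0 < r1" "1 / q = 1 / r1 + 1 / p1" using conj_exps[OF q p(2)] by (simp_all add: r1_def)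
  have r2: "0 < r2" "1 / q = 1 / r2 + 1 / p2" using conj_exps[OF q p(3)] by (simp_all add: r2_def)
  have p0: "0 < p1" "0 < p2" using p by auto
  have k: "0 < \<kappa>" "1 / \<kappa> = 1 / q - 1 / p1 - 1 / p2" using p p0 by (simp_all add: \<kappa>_def kappa_exp_def)
  have k2: "1 / r2 = 1 / \<kappa> + 1 / p1" and k1: "1 / r1 = 1 / \<kappa> + 1 / p2" using r1(2) r2(2) k(2) by auto
  have "1 / r1 \<le> 1 / q" using r1(2) p0 by simp
  moreover have "1 / r2 \<le> 1 / q" using r2(2) p0 by simp
  ultimately have qr: "q \<le> r1" "q \<le> r2" using q r1(1) r2(1) by (simp_all add: field_simps)
  have "1 / \<kappa> \<le> 1 / r1" "1 / \<kappa> \<le> 1 / r2" using k1 k2 p0 by simp_all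
  then have rk: "r1 \<le> \<kappa>" "r2 \<le> \<kappa>" using k(1) r1(1) r2(1) by (simp_all add: field_simps)
  define K where "K = (2 * split_const r2) powr \<kappa> * 2 powr (\<kappa> / r2) + (2 * split_const r1) powr \<kappa> * 2 powr (\<kappa> / r1)"
  have K0: "0 \<le> K" by (simp add: K_def)
  define L where "L = (1 + 2 * K) powr (1 / \<kappa>)"
  let ?K6 = "\<lambda>c d u \<Phi>1 \<Phi>2. \<integral>\<^sup>+ x\<in>{c..d}. epow (\<integral>\<^sup>+ t\<in>{x..d}. epow (tail d u t) (r2 / q) \<partial>stieltjes c d (\<lambda>t. epow (\<Phi>2 t) r2)) (\<kappa> / r2)
     \<partial>stieltjes c d (\<lambda>x. epow (\<Phi>1 x) \<kappa>)"
  let ?K7 = "\<lambda>c d u \<Phi>1 \<Phi>2. \<integral>\<^sup>+ x\<in>{c..d}. epow (\<integral>\<^sup>+ t\<in>{x<..d}. epow (tail d u t) (r1 / q) \<partial>stieltjes c d (\<lambda>t. epow (\<Phi>1 t) r1)) (\<kappa> / r1)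
     \<partial>stieltjes c d (\<lambda>x. epow (\<Phi>2 x) \<kappa>)"
  have B6: "B6 q (ennreal p1) (ennreal p2) c d u \<Phi>1 \<Phi>2 = epow (?K6 c d u \<Phi>1 \<Phi>2) (1 / \<kappa>)" for c d u \<Phi>1 \<Phi>2
    by (simp add: B6_def Let_def r2_def \<kappa>_def)
  have B7: "B7 q (ennreal p1) (ennreal p2) c d u \<Phi>1 \<Phi>2 = epow (?K7 c d u \<Phi>1 \<Phi>2) (1 / \<kappa>)" for c d u \<Phi>1 \<Phi>2
    by (simp add: B7_def Let_def r1_def \<kappa>_def)
  show ?thesis
  proof (rule characterizesI)
    show "0 \<le> 2 powr (1/q) * 4 powr (1/r2) + 2 powr (1/q) * 4 powr (1/r1)"
      "0 \<le> 4 powr (1/q) * (4 powr (1/r2) * L + 4 powr (1/r1) * L)"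
      using K0 by (simp_all add: L_def)
    fix c d u M \<Phi>1 \<Phi>2 D assume W: "weight_grid c d q M u" and \<Phi>: "is_profile c d \<Phi>1" "is_profile c d \<Phi>2"
      and D: "0 \<le> D" "weight_grid.grid_bound c d q u \<Phi>1 \<Phi>2 p1 p2 D"
    interpret weight_grid c d q M u by fact
    have "B6 q (ennreal p1) (ennreal p2) c d u \<Phi>1 \<Phi>2 \<le> ennreal (2 powr (1/q) * 4 powr (1/r2) * D)"
      unfolding B6 by (rule grid_bound_K[OF D(2,1) \<Phi> r2(1) p0(2) r2(2) p0(1) k(1) k2])
    moreover have "B7 q (ennreal p1) (ennreal p2) c d u \<Phi>1 \<Phi>2 \<le> ennreal (2 powr (1/q) * 4 powr (1/r1) * D)"
    proof -
      have "B7 q (ennreal p1) (ennreal p2) c d u \<Phi>1 \<Phi>2 \<le> epow (Kc \<Phi>2 \<Phi>1 \<kappa> r1) (1 / \<kappa>)"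
        unfolding B7 using k(1) r1(1) by (intro epow_mono Ko_le_Kc) auto
      also have "\<dots> \<le> ennreal (2 powr (1/q) * 4 powr (1/r1) * D)"
        by (rule grid_bound_K[OF grid_bound_swap[OF D(2)] D(1) \<Phi>(2,1) r1(1) p0(1) r1(2) p0(2) k(1) k1])
      finally show ?thesis .
    qed
    ultimately have "B6 q (ennreal p1) (ennreal p2) c d u \<Phi>1 \<Phi>2 + B7 q (ennreal p1) (ennreal p2) c d u \<Phi>1 \<Phi>2
       \<le> ennreal (2 powr (1/q) * 4 powr (1/r2) * D) + ennreal (2 powr (1/q) * 4 powr (1/r1) * D)" by (rule add_mono)
    also have "\<dots> = ennreal ((2 powr (1/q) * 4 powr (1/r2) + 2 powr (1/q) * 4 powr (1/r1)) * D)"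
      using D(1) by (simp add: ennreal_plus[symmetric] distrib_right del: ennreal_plus)
    finally show "B6 q (ennreal p1) (ennreal p2) c d u \<Phi>1 \<Phi>2 + B7 q (ennreal p1) (ennreal p2) c d u \<Phi>1 \<Phi>2
       \<le> ennreal ((2 powr (1/q) * 4 powr (1/r2) + 2 powr (1/q) * 4 powr (1/r1)) * D)" .
  next
    fix c d u M \<Phi>1 \<Phi>2 X assume W: "weight_grid c d q M u" and \<Phi>: "is_profile c d \<Phi>1" "is_profile c d \<Phi>2"
      and X: "0 \<le> X" "B6 q (ennreal p1) (ennreal p2) c d u \<Phi>1 \<Phi>2 + B7 q (ennreal p1) (ennreal p2) c d u \<Phi>1 \<Phi>2 \<le> ennreal X"
    interpret weight_grid c d q M u by fact
    have "B6 q (ennreal p1) (ennreal p2) c d u \<Phi>1 \<Phi>2 \<le> ennreal X" using X(2) by (rule order_trans[rotated]) simp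
    then have X6: "Kc \<Phi>1 \<Phi>2 \<kappa> r2 \<le> ennreal (X powr \<kappa>)"
      unfolding B6 using X k(1) by (simp add: epow_le_iff epow_ennreal)
    have "B7 q (ennreal p1) (ennreal p2) c d u \<Phi>1 \<Phi>2 \<le> ennreal X" using X(2) by (rule order_trans[rotated]) simp
    then have X7: "Ko \<Phi>2 \<Phi>1 \<kappa> r1 \<le> ennreal (X powr \<kappa>)"
      unfolding B7 using X k(1) by (simp add: epow_le_iff epow_ennreal)
    have X6': "Ko \<Phi>1 \<Phi>2 \<kappa> r2 \<le> ennreal (X powr \<kappa>)"
      using Ko_le_Kc[of \<kappa> r2 \<Phi>1 \<Phi>2] X6 k(1) r2(1) by (auto intro: order_trans)
    have Y: "(\<Sum>j\<le>N. ennreal (U j powr (\<kappa> / q)) * epow (\<Phi>1 (z j) * \<Phi>2 (z j)) \<kappa>) \<le> ennreal (2 * K * X powr \<kappa>)" for N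
    proof -
      have "(\<Sum>j\<le>N. ennreal (U j powr (\<kappa> / q)) * epow (\<Phi>1 (z j) * \<Phi>2 (z j)) \<kappa>) \<le> ennreal K * (Kc \<Phi>1 \<Phi>2 \<kappa> r2 + Ko \<Phi>2 \<Phi>1 \<kappa> r1)"
        unfolding K_def by (rule grid_diagonal_sum[OF \<Phi> qr rk])
      also have "\<dots> \<le> ennreal K * (ennreal (X powr \<kappa>) + ennreal (X powr \<kappa>))"
        by (intro mult_left_mono add_mono X6 X7) auto
      also have "\<dots> = ennreal (2 * K * X powr \<kappa>)"
        using K0 by (simp add: ennreal_mult[symmetric] ennreal_plus[symmetric] mult_ac del: ennreal_plus)
      finally show ?thesis .
    qed
    have LX: "(X powr \<kappa> + 2 * K * X powr \<kappa>) powr (1/\<kappa>) = L * X"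
    proof -
      have "(X powr \<kappa> + 2 * K * X powr \<kappa>) = (1 + 2 * K) * X powr \<kappa>" by (simp add: algebra_simps)
      also have "\<dots> powr (1/\<kappa>) = L * (X powr \<kappa>) powr (1/\<kappa>)" unfolding L_def by (rule powr_mult)
      finally show ?thesis using X k(1) by (simp add: powr_powr)
    qed
    have "half_bound \<Phi>1 \<Phi>2 p1 p2 (4 powr (1/r2) * (X powr \<kappa> + 2 * K * X powr \<kappa>) powr (1/\<kappa>))"
      using p0 r2 k k2 K0 X6' Y by (intro half_bound_sum[OF \<Phi>]) auto
    moreover have "half_bound \<Phi>2 \<Phi>1 p2 p1 (4 powr (1/r1) * (X powr \<kappa> + 2 * K * X powr \<kappa>) powr (1/\<kappa>))"
      using p0 r1 k k1 K0 X7 Y by (intro half_bound_sum[OF \<Phi>(2,1)]) (auto simp: mult.commute)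
    ultimately have "grid_bound \<Phi>1 \<Phi>2 p1 p2 (4 powr (1/q) * (4 powr (1/r2) * (L * X) + 4 powr (1/r1) * (L * X)))"
      unfolding LX by (rule grid_bound_of_halves)
    then show "grid_bound \<Phi>1 \<Phi>2 p1 p2 (4 powr (1/q) * (4 powr (1/r2) * L + 4 powr (1/r1) * L) * X)"
      by (simp add: algebra_simps)
  qed
qed

section \<open>The weighted Hoelder inequality\<close>

lemma conj_exp_real:
  assumes "1 < p"
  shows "1 < conj_exp (ennreal p)" and "1 / p + 1 / conj_exp (ennreal p) = 1"
    and "p * (1 - conj_exp (ennreal p)) + 1 = 1 - conj_exp (ennreal p)"
  using assms by (simp_all add: conj_exp_def field_simps)

text \<open>
  The minimum over \<open>l\<close> of the right side of Young's inequality is Hoelder's bound.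
  Vanishing \<open>X\<close> or \<open>Y\<close>, for which no optimal \<open>l\<close> exists, are
  reached by a limit.
\<close>

lemma Youngs_optimum:
  fixes X Y I p p' :: real
  assumes p: "1 < p" "1 < p'" "1 / p + 1 / p' = 1" and XY: "0 \<le> X" "0 \<le> Y"
    and I: "\<And>l. 0 < l \<Longrightarrow> I \<le> l powr p / p * X + l powr (- p') / p' * Y"
  shows "I \<le> X powr (1 / p) * Y powr (1 / p')"
proof -
  have *: "I \<le> (X + e) powr (1 / p) * (Y + e) powr (1 / p')" if e: "0 < e" for e
  proof -
    define x where "x = X + e"
    define y where "y = Y + e"
    have xy: "0 < x" "0 < y" "X \<le> x" "Y \<le> y" using XY e by (auto simp: x_def y_def)
    \<comment> \<open>with this \<open>l\<close> both terms become multiples of the same product\<close>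
    define l where "l = x powr (- 1 / (p * p')) * y powr (1 / (p * p'))"
    have l: "0 < l" using xy by (simp add: l_def)
    have e1: "- 1 / p' + 1 = 1 / p" and e2: "- 1 / p + 1 = 1 / p'" using p by auto
    have "l powr p * x = x powr (- 1 / p') * y powr (1 / p') * x powr 1"
      using xy p by (simp add: l_def powr_mult powr_powr)
    also have "\<dots> = x powr (- 1 / p' + 1) * y powr (1 / p')" unfolding powr_add by (simp add: mult_ac)
    finally have a: "l powr p * x = x powr (1 / p) * y powr (1 / p')" unfolding e1 .
    have "l powr (- p') * y = x powr (1 / p) * y powr (- 1 / p) * y powr 1"
      using xy p by (simp add: l_def powr_mult powr_powr)
    also have "\<dots> = x powr (1 / p) * y powr (- 1 / p + 1)" unfolding powr_add by (simp add: mult_ac)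
    finally have b: "l powr (- p') * y = x powr (1 / p) * y powr (1 / p')" unfolding e2 .
    have "I \<le> l powr p / p * X + l powr (- p') / p' * Y" by (rule I[OF l])
    also have "\<dots> \<le> l powr p / p * x + l powr (- p') / p' * y"
      using xy p by (intro add_mono mult_left_mono) auto
    also have "\<dots> = (1 / p) * (l powr p * x) + (1 / p') * (l powr (- p') * y)" by simp
    also have "\<dots> = (1 / p + 1 / p') * (x powr (1 / p) * y powr (1 / p'))"
      unfolding a b by (simp only: distrib_right)
    finally show ?thesis unfolding p(3) x_def y_def by simp
  qed
  have "((\<lambda>e. (X + e) powr (1 / p) * (Y + e) powr (1 / p')) \<longlongrightarrow> (X + 0) powr (1 / p) * (Y + 0) powr (1 / p')) (at_right 0)"
  proof (intro tendsto_mult tendsto_powr' tendsto_add tendsto_const tendsto_ident_at disjI2 conjI)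
    show "\<forall>\<^sub>F e in at_right 0. 0 \<le> X + e" "\<forall>\<^sub>F e in at_right 0. 0 \<le> Y + e"
      using XY eventually_at_right_less[of "0::real"] by (auto elim!: eventually_mono)
  qed (use p in auto)
  then have "I \<le> (X + 0) powr (1 / p) * (Y + 0) powr (1 / p')"
    by (rule tendsto_lowerbound) (use * eventually_at_right_less[of "0::real"] in \<open>auto elim!: eventually_mono\<close>)
  then show ?thesis by simp
qed

text \<open>
  In \<open>[0, \<infinity>]\<close> this also covers \<open>v = \<infinity>\<close>, where \<open>a
  \<noteq> 0\<close> makes the first term infinite, and \<open>a = \<infinity>\<close>, as long as
  \<open>v > 0\<close>.
\<close>

lemma weighted_Young_pointwise:
  fixes a v :: ennreal
  assumes p: "1 < p" and v: "0 < v" and l: "0 < l"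
  shows "a \<le> ennreal (l powr p / p) * (epow a p * v)
     + ennreal (l powr (- conj_exp (ennreal p)) / conj_exp (ennreal p)) * epow v (1 - conj_exp (ennreal p))"
proof -
  define p' where "p' = conj_exp (ennreal p)"
  have p': "1 < p'" "1 / p + 1 / p' = 1" "p * (1 - p') + 1 = 1 - p'"
    using conj_exp_real[OF p] by (simp_all add: p'_def)
  consider "a = 0" | "a \<noteq> 0" "a = top \<or> v = top" | "a \<noteq> 0" "a \<noteq> top" "v \<noteq> top" by blast
  then have "a \<le> ennreal (l powr p / p) * (epow a p * v) + ennreal (l powr (- p') / p') * epow v (1 - p')"
  proof cases
    case 2
    have "epow a p \<noteq> 0" using 2 p by (simp add: epow_eq_0_iff)
    then have top: "epow a p * v = top" using 2 p v by (auto simp: ennreal_mult_top ennreal_top_mult)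
    have "ennreal (l powr p / p) * (epow a p * v) = top"
    proof -
      have "0 < l powr p / p" using l p by simp
      then have "ennreal (l powr p / p) \<noteq> 0" by (simp only: ennreal_eq_0_iff not_le)
      then show ?thesis by (simp only: top ennreal_mult_top) simp
    qed
    then show ?thesis by simp
  next
    case 3
    obtain x where x: "a = ennreal x" "0 < x"
      using 3 by (cases a rule: ennreal_cases) (auto simp: less_le)
    obtain y where y: "v = ennreal y" "0 < y"
      using 3 v by (cases v rule: ennreal_cases) (auto simp: less_le)
    have "x = (l * x * y powr (1/p)) * (y powr (- 1 / p) / l)"
      using l y(2) by (simp add: powr_add[symmetric])
    also have "\<dots> \<le> (l * x * y powr (1/p)) powr p / p + (y powr (- 1 / p) / l) powr p' / p'"
      using p p' l x y by (intro Youngs_inequality) auto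
    also have "(l * x * y powr (1/p)) powr p = l powr p * (x powr p * y)"
      using l x y p by (simp add: powr_mult powr_powr)
    also have "(y powr (- 1 / p) / l) powr p' = l powr (- p') * y powr (1 - p')"
    proof -
      have e: "- 1 / p * p' = 1 - p'"
      proof -
        have "p * (- 1 / p * p') = p * (1 - p')" using p p'(3) by simp
        then show ?thesis using p by (simp only: mult_cancel_left) auto
      qed
      have "(y powr (- 1 / p) / l) powr p' = y powr (- 1 / p * p') / l powr p'"
        using l by (simp add: powr_divide powr_powr)
      then show ?thesis unfolding e by (simp add: powr_minus divide_inverse mult.commute)
    qed
    finally have "ennreal x \<le> ennreal (l powr p / p * (x powr p * y) + l powr (- p') / p' * y powr (1 - p'))"
      by (intro ennreal_leI) simp
    also have "\<dots> = ennreal (l powr p / p) * (epow a p * v) + ennreal (l powr (- p') / p') * epow v (1 - p')"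
    proof -
      have "ennreal (l powr p / p * (x powr p * y) + l powr (- p') / p' * y powr (1 - p'))
         = ennreal (l powr p / p * (x powr p * y)) + ennreal (l powr (- p') / p' * y powr (1 - p'))"
        using p p' y by (intro ennreal_plus) auto
      also have "ennreal (l powr p / p * (x powr p * y)) = ennreal (l powr p / p) * (ennreal (x powr p) * ennreal y)"
        using p y by (simp only: ennreal_mult powr_ge_zero divide_nonneg_pos less_imp_le mult_nonneg_nonneg)
      also have "ennreal (l powr (- p') / p' * y powr (1 - p')) = ennreal (l powr (- p') / p') * ennreal (y powr (1 - p'))"
        using p' by (intro ennreal_mult) auto
      finally show ?thesis using x y p p' by (simp add: epow_def)
    qed
    finally show ?thesis using x by simp
  qed simp
  then show ?thesis by (simp add: p'_def)
qed

lemma nn_integral_Holder_weighted: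
  assumes p: "1 < p" and [measurable]: "f \<in> borel_measurable N" "v \<in> borel_measurable N" "E \<in> sets N"
    and v: "\<And>t. t \<in> space N \<Longrightarrow> 0 < v t"
    and X: "(\<integral>\<^sup>+ t\<in>E. (epow (f t) p * v t) \<partial>N) < top"
    and Y: "(\<integral>\<^sup>+ t\<in>E. epow (v t) (1 - conj_exp (ennreal p)) \<partial>N) < top"
  shows "(\<integral>\<^sup>+ t\<in>E. f t \<partial>N) \<le> epow (\<integral>\<^sup>+ t\<in>E. (epow (f t) p * v t) \<partial>N) (1 / p)
     * epow (\<integral>\<^sup>+ t\<in>E. epow (v t) (1 - conj_exp (ennreal p)) \<partial>N) (1 / conj_exp (ennreal p))"
proof -
  define p' where "p' = conj_exp (ennreal p)"
  have p': "1 < p'" "1 / p + 1 / p' = 1"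
    using conj_exp_real[OF p] by (simp_all add: p'_def)
  define x where "x = enn2real (\<integral>\<^sup>+ t\<in>E. (epow (f t) p * v t) \<partial>N)"
  define y where "y = enn2real (\<integral>\<^sup>+ t\<in>E. epow (v t) (1 - p') \<partial>N)"
  have x: "(\<integral>\<^sup>+ t\<in>E. (epow (f t) p * v t) \<partial>N) = ennreal x" "0 \<le> x" using X by (simp_all add: x_def)
  have y: "(\<integral>\<^sup>+ t\<in>E. epow (v t) (1 - p') \<partial>N) = ennreal y" "0 \<le> y" using Y by (simp_all add: y_def p'_def)
  have bound: "(\<integral>\<^sup>+ t\<in>E. f t \<partial>N) \<le> ennreal (l powr p / p * x + l powr (- p') / p' * y)" if l: "0 < l" for l
  proof -
    have "(\<integral>\<^sup>+ t\<in>E. f t \<partial>N) \<le> (\<integral>\<^sup>+ t. ennreal (l powr p / p) * (epow (f t) p * v t * indicator E t)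
        + ennreal (l powr (- p') / p') * (epow (v t) (1 - p') * indicator E t) \<partial>N)"
      using weighted_Young_pointwise[OF p v l, folded p'_def]
      by (intro nn_integral_mono) (auto split: split_indicator)
    also have "\<dots> = ennreal (l powr p / p) * ennreal x + ennreal (l powr (- p') / p') * ennreal y"
      by (simp add: nn_integral_add nn_integral_cmult x y)
    also have "\<dots> = ennreal (l powr p / p * x + l powr (- p') / p' * y)"
      using x y p p' l by (simp add: ennreal_mult[symmetric] ennreal_plus[symmetric] del: ennreal_plus)
    finally show ?thesis .
  qed
  have "(\<integral>\<^sup>+ t\<in>E. f t \<partial>N) < top" using bound[of 1] by (auto simp: less_top[symmetric] top_unique)
  then obtain i where i: "(\<integral>\<^sup>+ t\<in>E. f t \<partial>N) = ennreal i" "0 \<le> i"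
    by (cases "\<integral>\<^sup>+ t\<in>E. f t \<partial>N" rule: ennreal_cases) auto
  have "i \<le> x powr (1 / p) * y powr (1 / p')"
  proof (rule Youngs_optimum[OF p p' x(2) y(2)])
    fix l :: real assume l: "0 < l"
    have "0 \<le> l powr p / p * x + l powr (- p') / p' * y" using x y p p' l by simp
    then show "i \<le> l powr p / p * x + l powr (- p') / p' * y" using bound[OF l] i by simp
  qed
  then show ?thesis
    using x y p p' by (simp add: i p'_def[symmetric] epow_ennreal ennreal_mult[symmetric] ennreal_leI)
qed

text \<open>
  The lower bound makes \<open>1 / v\<close> bounded, and hence the profiles finite and
  right-continuous.
\<close>

locale reg_weight =
  fixes c d \<delta> :: real and v :: "real \<Rightarrow> ennreal"
  assumes cd: "c < d" and \<delta>: "0 < \<delta>"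
    and v_meas [measurable]: "v \<in> borel_measurable (lebesgue_on {c..d})"
    and v_ge: "\<And>t. t \<in> {c..d} \<Longrightarrow> ennreal \<delta> \<le> v t"
begin

abbreviation J :: "real measure" where "J \<equiv> lebesgue_on {c..d}"

lemma v_pos: "t \<in> {c..d} \<Longrightarrow> 0 < v t"
  using v_ge[of t] \<delta> by (metis ennreal_less_zero_iff less_le_trans)

lemma space_J [simp]: "space J = {c..d}"
  by simp

lemma sets_J: "S \<in> sets borel \<Longrightarrow> S \<subseteq> {c..d} \<Longrightarrow> S \<in> sets J"
  by (simp add: sets_restrict_space_iff)

lemma integral_sub: "x \<le> d \<Longrightarrow> (\<integral>\<^sup>+ t. f t \<partial>lebesgue_on {c..x}) = (\<integral>\<^sup>+ t\<in>{c..x}. f t \<partial>J)"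
proof -
  assume "x \<le> d"
  then have "f t * indicator {c..x} t = f t * indicator {c..x} t * indicator {c..d} t" for t
    by (auto split: split_indicator)
  then show ?thesis by (simp only: nn_integral_lebesgue_on[OF lmeasurable_interval(1)[THEN fmeasurableD]])
qed

lemma hardy_eq: "x \<le> d \<Longrightarrow> hardy c f x = (\<integral>\<^sup>+ t\<in>{c..x}. f t \<partial>J)"
  unfolding hardy_def by (rule integral_sub)

lemma emeasure_J: "c \<le> a \<Longrightarrow> a \<le> b \<Longrightarrow> b \<le> d \<Longrightarrow> emeasure J {a..b} = ennreal (b - a)"
  using emeasure_restrict_space[of "{c..d}" lebesgue "{a..b}"] by simp

lemma inv_v_meas [measurable]: "(\<lambda>t. inverse (v t)) \<in> borel_measurable J"
  by measurable

lemma inv_v_le: "t \<in> {c..d} \<Longrightarrow> inverse (v t) \<le> ennreal (1 / \<delta>)"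
  using v_ge[of t] \<delta>
  by (cases "v t" rule: ennreal_cases) (auto simp: inverse_ennreal inverse_eq_divide frac_le)

lemma f_le_inv: "t \<in> {c..d} \<Longrightarrow> a * v t \<le> b \<Longrightarrow> b < top \<Longrightarrow> a \<le> b * inverse (v t)"
proof -
  assume t: "t \<in> {c..d}" and ab: "a * v t \<le> b" "b < top"
  have v0: "v t \<noteq> 0" using v_pos[OF t] by simp
  show ?thesis
  proof (cases "v t = top")
    case True
    have "a = 0"
    proof (rule ccontr)
      assume "a \<noteq> 0"
      then have "a * v t = top" by (simp add: True ennreal_mult_top)
      then show False using ab by (simp add: top_unique)
    qed
    then show ?thesis by simp
  next
    case False
    have "v t * inverse (v t) = 1"
      using False v0 ennreal_divide_self[of "v t"] by (simp add: divide_ennreal_def less_top[symmetric])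
    then have "a = a * v t * inverse (v t)" by (simp only: mult.assoc mult_1_right)
    also have "\<dots> \<le> b * inverse (v t)" using ab by (intro mult_right_mono) auto
    finally show ?thesis .
  qed
qed

end

section \<open>The Hardy operator for a weight bounded below\<close>

lemma runmax_cong: "(\<And>i. i \<le> k \<Longrightarrow> \<alpha> i = \<beta> i) \<Longrightarrow> runmax \<alpha> \<phi> k = runmax \<beta> \<phi> k"
  unfolding runmax_def by (intro arg_cong[where f = Max] image_cong) auto

text \<open>
  An index is a record when \<open>F\<close> exceeds twice its value at the previous record. From one
  record to the next the increment is at least half of the new value and is controlled by the mass
  \<open>R k - R l\<close> between them; these masses are disjoint, so their total is at most \<open>R
  N\<close>. Between records \<open>F\<close> is at most twice the last record value.
\<close>

lemma records_dominate:
  fixes F \<phi> R :: "nat \<Rightarrow> real"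
  assumes p: "0 < p" and nn: "\<And>k. 0 \<le> \<phi> k" "0 \<le> R 0" and R: "mono R"
    and start: "F 0 \<le> R 0 powr (1/p) * \<phi> 0"
    and step: "\<And>l k. l \<le> k \<Longrightarrow> F k - F l \<le> (R k - R l) powr (1/p) * \<phi> k"
  shows "\<exists>\<alpha>. (\<forall>i. 0 \<le> \<alpha> i) \<and> (\<Sum>i\<le>N. \<alpha> i powr p) \<le> R N \<and> (\<forall>k\<le>N. F k \<le> 4 * runmax \<alpha> \<phi> k)"
proof -
  have "\<exists>\<alpha> l. (\<forall>i. 0 \<le> \<alpha> i) \<and> l \<le> N \<and> F l \<le> 2 * (\<alpha> l * \<phi> l) \<and> (\<Sum>i\<le>N. \<alpha> i powr p) \<le> R l \<and>
     (\<forall>k\<le>N. F k \<le> 4 * runmax \<alpha> \<phi> k)"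
  proof (induction N)
    case 0
    define \<alpha> where "\<alpha> i = R 0 powr (1/p)" for i :: nat
    have a: "0 \<le> \<alpha> 0 * \<phi> 0" "F 0 \<le> \<alpha> 0 * \<phi> 0" using nn start by (simp_all add: \<alpha>_def)
    have "F 0 \<le> 4 * runmax \<alpha> \<phi> 0" using a le_runmax[of 0 0 \<alpha> \<phi>] by linarith
    moreover have "F 0 \<le> 2 * (\<alpha> 0 * \<phi> 0)" using a by linarith
    moreover have "(\<Sum>i\<le>0. \<alpha> i powr p) \<le> R 0" using p nn(2) by (simp add: \<alpha>_def powr_powr)
    moreover have "\<forall>i. 0 \<le> \<alpha> i" by (simp add: \<alpha>_def)
    ultimately show ?case by (intro exI[of _ \<alpha>] exI[of _ 0]) simp
  next
    case (Suc N)
    then obtain \<alpha> l where *: "\<And>i. 0 \<le> \<alpha> i" "l \<le> N" "F l \<le> 2 * (\<alpha> l * \<phi> l)" "(\<Sum>i\<le>N. \<alpha> i powr p) \<le> R l"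
      "\<And>k. k \<le> N \<Longrightarrow> F k \<le> 4 * runmax \<alpha> \<phi> k" by blast
    define m where "m = R (Suc N) - R l"
    have m: "0 \<le> m" using monoD[OF R, of l "Suc N"] *(2) by (simp add: m_def)
    \<comment> \<open>a new record receives the mass since the previous record \<open>l\<close>, any other index nothing\<close>
    define a where "a = (if F (Suc N) \<le> 2 * F l then 0 else m powr (1/p))"
    define \<beta> where "\<beta> = \<alpha>(Suc N := a)"
    have a0: "0 \<le> a" by (simp add: a_def)
    have \<beta>0: "0 \<le> \<beta> i" for i using *(1) a0 by (simp add: \<beta>_def)
    have same: "runmax \<beta> \<phi> k = runmax \<alpha> \<phi> k" if "k \<le> N" for k
      using that by (intro runmax_cong) (auto simp: \<beta>_def)
    have sum: "(\<Sum>i\<le>Suc N. \<beta> i powr p) = (\<Sum>i\<le>N. \<alpha> i powr p) + a powr p"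
      by (simp add: \<beta>_def)
    show ?case
    proof (cases "F (Suc N) \<le> 2 * F l")
      case True
      have "\<alpha> l * \<phi> l \<le> runmax \<beta> \<phi> (Suc N)"
        using le_runmax[of l "Suc N" \<beta> \<phi>] *(2) by (simp add: \<beta>_def)
      then have "F (Suc N) \<le> 4 * runmax \<beta> \<phi> (Suc N)" using True *(3) by linarith
      then have "\<forall>k\<le>Suc N. F k \<le> 4 * runmax \<beta> \<phi> k"
        using *(5) same by (auto simp: le_Suc_eq)
      moreover have "(\<Sum>i\<le>Suc N. \<beta> i powr p) \<le> R l" unfolding sum using True *(4) by (simp add: a_def)
      moreover have "F l \<le> 2 * (\<beta> l * \<phi> l)" using *(2,3) by (simp add: \<beta>_def)
      ultimately show ?thesis using \<beta>0 *(2) by (intro exI[of _ \<beta>] exI[of _ l]) auto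
    next
      case False
      have "F (Suc N) - F l \<le> m powr (1/p) * \<phi> (Suc N)" unfolding m_def using *(2) by (intro step) auto
      then have F: "F (Suc N) \<le> 2 * (\<beta> (Suc N) * \<phi> (Suc N))" using False by (simp add: \<beta>_def a_def)
      have b0: "0 \<le> \<beta> (Suc N) * \<phi> (Suc N)" using \<beta>0 nn by simp
      have "F (Suc N) \<le> 4 * runmax \<beta> \<phi> (Suc N)"
        using F b0 le_runmax[of "Suc N" "Suc N" \<beta> \<phi>] by linarith
      then have "\<forall>k\<le>Suc N. F k \<le> 4 * runmax \<beta> \<phi> k"
        using *(5) same by (auto simp: le_Suc_eq)
      moreover have "(\<Sum>i\<le>Suc N. \<beta> i powr p) \<le> R (Suc N)"
        unfolding sum using False *(4) m p by (simp add: a_def powr_powr m_def)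
      ultimately show ?thesis using \<beta>0 F by (intro exI[of _ \<beta>] exI[of _ "Suc N"]) auto
    qed
  qed
  then obtain \<alpha> l where *: "\<forall>i. 0 \<le> \<alpha> i" "l \<le> N" "(\<Sum>i\<le>N. \<alpha> i powr p) \<le> R l"
    "\<forall>k\<le>N. F k \<le> 4 * runmax \<alpha> \<phi> k" by blast
  then show ?thesis using monoD[OF R *(2)] by (intro exI[of _ \<alpha>]) auto
qed

definition hardy_ops :: "ennreal \<Rightarrow> real \<Rightarrow> real \<Rightarrow> (real \<Rightarrow> ennreal) \<Rightarrow> ((real \<Rightarrow> real) \<times> real) set" where
  "hardy_ops p c d v = {(\<lambda>x. enn2real (hardy c f x), enn2real (wnorm p c d v f)) | f.
      f \<in> borel_measurable (lebesgue_on {c..d}) \<and> wnorm p c d v f < \<infinity>}"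

text \<open>
  The default value \<open>\<infinity>\<close> of the essential supremum for a nonmeasurable function
  keeps this true beyond the right end of the interval, where nothing is known about \<open>v\<close>.
\<close>

lemma inv_esssup_mono: "a \<le> b \<Longrightarrow> inv_esssup c v a \<le> inv_esssup c v b"
proof (cases "(\<lambda>t. inverse (v t)) \<in> borel_measurable (lebesgue_on {c<..<b})")
  case True
  assume ab: "a \<le> b"
  have m: "(\<lambda>t. inverse (v t)) \<in> borel_measurable (lebesgue_on {c<..<a})"
    using ab by (intro measurable_restrict_mono[OF True]) auto
  have "AE t in lebesgue_on {c<..<b}. inverse (v t) \<le> inv_esssup c v b"
    unfolding inv_esssup_def by (rule esssup_AE)
  then have "AE t in lebesgue_on {c<..<a}. inverse (v t) \<le> inv_esssup c v b"
    using ab by (auto simp: AE_restrict_space_iff elim!: eventually_mono)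
  then show ?thesis unfolding inv_esssup_def[of c v a] using m by (rule esssup_I[rotated])
next
  case False
  then show ?thesis by (simp add: inv_esssup_def[of c v b] esssup_non_measurable)
qed

text \<open>
  By monotonicity the one-sided limit is an infimum.
\<close>

lemma profile_one:
  "profile 1 c d v x = (if x < d then INF y\<in>{x<..}. inv_esssup c v y else inv_esssup c v d)"
proof -
  have "((inv_esssup c v) \<longlongrightarrow> (INF y\<in>{x<..} \<inter> UNIV. inv_esssup c v y)) (at x within ({x<..} \<inter> UNIV))"
    by (rule Lim_right_bound[where K = 0]) (auto intro: inv_esssup_mono)
  then have "Lim (at_right x) (inv_esssup c v) = (INF y\<in>{x<..}. inv_esssup c v y)"
    by (intro tendsto_Lim) auto
  then show ?thesis by (simp add: profile_def)
qed

context reg_weight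
begin

lemma inv_esssup_le: "x \<le> d \<Longrightarrow> inv_esssup c v x \<le> ennreal (1 / \<delta>)"
  unfolding inv_esssup_def
proof (rule esssup_I)
  assume x: "x \<le> d"
  then show "(\<lambda>t. inverse (v t)) \<in> borel_measurable (lebesgue_on {c<..<x})"
    by (intro measurable_restrict_mono[OF inv_v_meas]) auto
  show "AE t in lebesgue_on {c<..<x}. inverse (v t) \<le> ennreal (1 / \<delta>)"
    using x inv_v_le by (intro AE_I2) auto
qed

lemma profile_one_ge: "x \<le> d \<Longrightarrow> inv_esssup c v x \<le> profile 1 c d v x"
  unfolding profile_one by (auto intro!: INF_greatest inv_esssup_mono)

lemma profile_one_le: "x < y \<Longrightarrow> y \<le> d \<Longrightarrow> profile 1 c d v x \<le> inv_esssup c v y"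
  unfolding profile_one by (auto intro!: INF_lower)

lemma is_profile_one: "is_profile c d (profile 1 c d v)"
  unfolding is_profile_def
proof (intro conjI ballI impI)
  have bound: "profile 1 c d v x \<le> ennreal (1 / \<delta>)" if "x \<le> d" for x
  proof (cases "x < d")
    case True
    then show ?thesis using profile_one_le[of x d] inv_esssup_le[of d] by (meson order_refl order_trans)
  next
    case False
    then show ?thesis using inv_esssup_le[of d] by (simp add: profile_one)
  qed
  show "profile 1 c d v x < \<infinity>" if "x \<in> {c..d}" for x
    using bound[of x] that by (auto simp: less_top[symmetric] top_unique)
  have mono: "profile 1 c d v x \<le> profile 1 c d v y" if "x \<le> y" "y \<le> d" for x y
  proof (cases "x = y")
    case False
    then have "profile 1 c d v x \<le> inv_esssup c v y" using that by (intro profile_one_le) auto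
    also have "\<dots> \<le> profile 1 c d v y" using that by (intro profile_one_ge)
    finally show ?thesis .
  qed simp
  show "profile 1 c d v x \<le> profile 1 c d v y" if "x \<in> {c..d}" "y \<in> {c..d}" "x \<le> y" for x y
    using mono[of x y] that by simp
  show "(profile 1 c d v \<longlongrightarrow> profile 1 c d v x) (at_right x)" if x: "x \<in> {c..<d}" for x
  proof (rule order_tendstoI)
    fix a assume a: "a < profile 1 c d v x"
    have "eventually (\<lambda>t. t \<in> {x<..<d}) (at_right x)" using x eventually_at_right_real by auto
    then show "eventually (\<lambda>t. a < profile 1 c d v t) (at_right x)"
    proof eventually_elim
      case (elim t)
      then show ?case using a mono[of x t] by (auto intro: less_le_trans)
    qed
  next
    fix a assume a: "profile 1 c d v x < a"
    then obtain y where y: "x < y" "inv_esssup c v y < a"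
      using x by (auto simp: profile_one INF_less_iff)
    have "eventually (\<lambda>t. t \<in> {x<..<min y d}) (at_right x)"
      by (rule eventually_at_right_real) (use x y in auto)
    then show "eventually (\<lambda>t. profile 1 c d v t < a) (at_right x)"
    proof eventually_elim
      case (elim t)
      then have "profile 1 c d v t \<le> inv_esssup c v y"
        using profile_one_le[of t "min y d"] inv_esssup_mono[of "min y d" y c v] by (auto intro: order_trans)
      then show ?case using y by (auto intro: le_less_trans)
    qed
  qed
qed

text \<open>
  On \<open>(c, x)\<close> the function \<open>1 / v\<close> is almost everywhere at most the profile
  at \<open>x\<close>, and where \<open>v\<close> is infinite, finiteness of the integral forces
  \<open>f\<close> to vanish.
\<close>

lemma hardy_increment_one:
  assumes [measurable]: "f \<in> borel_measurable J" and x: "x \<in> {c..d}"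
    and E: "E \<in> sets borel" "E \<subseteq> {c..x}" and X: "(\<integral>\<^sup>+ t\<in>E. (f t * v t) \<partial>J) < top"
  shows "(\<integral>\<^sup>+ t\<in>E. f t \<partial>J) \<le> (\<integral>\<^sup>+ t\<in>E. (f t * v t) \<partial>J) * profile 1 c d v x"
proof -
  have [measurable]: "E \<in> sets J" using E x by (intro sets_J) auto
  have 1: "AE t in J. f t * v t * indicator E t \<noteq> top"
    using X by (intro nn_integral_noteq_infinite[unfolded infinity_ennreal_def]) auto
  have "AE t in lebesgue_on {c<..<x}. inverse (v t) \<le> inv_esssup c v x"
    unfolding inv_esssup_def by (rule esssup_AE)
  then have "AE t in lebesgue. t \<in> {c<..<x} \<longrightarrow> inverse (v t) \<le> inv_esssup c v x"
    by (simp add: AE_restrict_space_iff)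
  then have 2: "AE t in J. t \<in> {c<..<x} \<longrightarrow> inverse (v t) \<le> inv_esssup c v x"
    by (auto simp: AE_restrict_space_iff elim!: eventually_mono)
  have "AE t in lebesgue. t \<noteq> c \<and> t \<noteq> x" by (rule AE_I'[of "{c, x}"]) (auto simp flip: negligible_iff_null_sets)
  then have "AE t in lebesgue. t \<in> {c..d} \<longrightarrow> t \<noteq> c \<and> t \<noteq> x" by (rule eventually_mono) simp
  then have 3: "AE t in J. t \<noteq> c \<and> t \<noteq> x" by (rule AE_restrict_space_iff[THEN iffD2, rotated]) simp
  have 4: "AE t in J. t \<in> {c..d}" by (rule AE_I2) simp
  have "AE t in J. f t * indicator E t \<le> f t * v t * indicator E t * profile 1 c d v x"
    using 1 2 3 4
  proof eventually_elim
    case (elim t)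
    show ?case
    proof (cases "t \<in> E")
      case True
      then have t: "t \<in> {c<..<x}" using elim E by auto
      have "f t \<le> (f t * v t) * inverse (v t)"
        using elim True by (intro f_le_inv) (auto simp: less_top[symmetric])
      also have "\<dots> \<le> (f t * v t) * profile 1 c d v x"
        using elim(2) t profile_one_ge[of x] x by (intro mult_left_mono) (auto intro: order_trans)
      finally show ?thesis using True by simp
    qed simp
  qed
  then have "(\<integral>\<^sup>+ t\<in>E. f t \<partial>J) \<le> (\<integral>\<^sup>+ t. f t * v t * indicator E t * profile 1 c d v x \<partial>J)"
    by (rule nn_integral_mono_AE)
  also have "\<dots> = (\<integral>\<^sup>+ t\<in>E. (f t * v t) \<partial>J) * profile 1 c d v x"
    by (rule nn_integral_multc) measurable
  finally show ?thesis .
qed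

text \<open>
  For \<open>p = 1\<close> the extremal functions concentrate on a set where \<open>1/v\<close> is
  nearly maximal. The profile is a limit from the right, so such a set is only available in \<open>(c,
  y)\<close> with \<open>y > x\<close>.
\<close>

lemma hardy_test_one:
  assumes x: "c \<le> x" "x < y" "y \<le> d"
  shows "\<exists>g \<in> borel_measurable J. (\<integral>\<^sup>+ t. (g t * v t) \<partial>J) \<le> 1 \<and> profile 1 c d v x \<le> 2 * hardy c g y"
proof (cases "profile 1 c d v x = 0")
  case True
  then show ?thesis by (intro bexI[of _ "\<lambda>_. 0"]) auto
next
  case False
  have "profile 1 c d v x < top" using is_profile_one x by (auto simp: is_profile_def)
  then obtain s where s: "profile 1 c d v x = ennreal s" "0 < s"
    using False by (cases "profile 1 c d v x" rule: ennreal_cases) (auto simp: less_le)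
  have "ennreal (s / 2) < ennreal s" using s by (simp add: ennreal_lessI)
  also have "\<dots> \<le> inv_esssup c v y" using profile_one_le[of x y] x s by simp
  finally have lt: "ennreal (s / 2) < esssup (lebesgue_on {c<..<y}) (\<lambda>t. inverse (v t))" by (simp add: inv_esssup_def)
  define E where "E = {t \<in> {c<..<y}. ennreal (s / 2) < inverse (v t)}"
  have m: "(\<lambda>t. inverse (v t)) \<in> borel_measurable (lebesgue_on {c<..<y})"
    using x by (intro measurable_restrict_mono[OF inv_v_meas]) auto
  have pos: "0 < emeasure (lebesgue_on {c<..<y}) E"
    using esssup_pos_measure[OF m lt] by (simp add: E_def)
  have Ecd: "E \<subseteq> {c..y}" by (auto simp: E_def)
  have EJ [measurable]: "E \<in> sets J"
  proof -
    have "{t \<in> space J. ennreal (s / 2) < inverse (v t)} \<in> sets J" by measurable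
    moreover have "{c<..<y} \<in> sets J" using x by (intro sets_J) auto
    ultimately have "{t \<in> space J. ennreal (s / 2) < inverse (v t)} \<inter> {c<..<y} \<in> sets J" by auto
    also have "{t \<in> space J. ennreal (s / 2) < inverse (v t)} \<inter> {c<..<y} = E" using x by (auto simp: E_def)
    finally show ?thesis .
  qed
  have "E \<subseteq> {c<..<y}" by (auto simp: E_def)
  then have eq: "emeasure (lebesgue_on {c<..<y}) E = emeasure J E"
    using x by (subst (1 2) emeasure_restrict_space) auto
  have "emeasure J E \<le> emeasure J {c..d}" using Ecd x by (intro emeasure_mono) (auto simp: sets_restrict_space_iff)
  also have "\<dots> < top" using cd emeasure_J[of c d] by simp
  finally obtain e where e: "emeasure J E = ennreal e" "0 < e"
    using pos eq by (cases "emeasure J E" rule: ennreal_cases) auto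
  define g where "g t = ennreal (s / 2 / e) * indicator E t" for t
  have g: "g \<in> borel_measurable J" unfolding g_def by measurable
  have "(\<integral>\<^sup>+ t. (g t * v t) \<partial>J) \<le> (\<integral>\<^sup>+ t. ennreal (1 / e) * indicator E t \<partial>J)"
  proof (rule nn_integral_mono)
    fix t assume "t \<in> space J"
    show "g t * v t \<le> ennreal (1 / e) * indicator E t"
    proof (cases "t \<in> E")
      case True
      then have "ennreal (s / 2) < inverse (v t)" by (simp add: E_def)
      then obtain w where w: "v t = ennreal w" "0 \<le> w"
        by (cases "v t" rule: ennreal_cases) auto
      have "0 < w" using w v_pos[of t] \<open>t \<in> space J\<close> by simp
      then have "ennreal (s / 2) < ennreal (inverse w)"
        using \<open>ennreal (s / 2) < inverse (v t)\<close> w by (simp add: inverse_ennreal)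
      then have "s / 2 * w < 1" using \<open>0 < w\<close> s by (simp add: ennreal_less_iff field_simps)
      then have "s / 2 / e * w \<le> 1 / e" using e by (simp add: field_simps)
      then show ?thesis using True w s e by (simp add: g_def ennreal_mult[symmetric] ennreal_leI)
    qed (simp add: g_def)
  qed
  also have "\<dots> = ennreal (1 / e) * ennreal e" by (simp add: nn_integral_cmult_indicator e)
  also have "\<dots> = 1" using e by (simp add: ennreal_mult[symmetric])
  finally have 1: "(\<integral>\<^sup>+ t. (g t * v t) \<partial>J) \<le> 1" .
  have "hardy c g y = (\<integral>\<^sup>+ t. g t * indicator {c..y} t \<partial>J)" using x by (simp add: hardy_eq)
  also have "\<dots> = (\<integral>\<^sup>+ t. ennreal (s / 2 / e) * indicator E t \<partial>J)"
    using Ecd by (intro nn_integral_cong) (auto simp: g_def split: split_indicator)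
  also have "\<dots> = ennreal (s / 2 / e) * ennreal e" by (simp add: nn_integral_cmult_indicator e)
  also have "\<dots> = ennreal (s / 2)" using e s by (simp add: ennreal_mult[symmetric])
  finally have "2 * hardy c g y = ennreal s" using s by (simp add: ennreal_mult[symmetric] flip: ennreal_numeral)
  then show ?thesis using g 1 s by (intro bexI[of _ g]) auto
qed

lemma dual_weight_le:
  assumes p: "1 < p" and t: "t \<in> {c..d}"
  shows "epow (v t) (1 - conj_exp (ennreal p)) \<le> ennreal (\<delta> powr (1 - conj_exp (ennreal p)))"
  using v_ge[OF t] \<delta> conj_exp_real(1)[OF p]
  by (cases "v t" rule: ennreal_cases) (auto simp: epow_def intro!: ennreal_leI powr_mono2')

lemma integral_split:
  assumes [measurable]: "h \<in> borel_measurable J" and x: "c \<le> x" "x \<le> y" "y \<le> d"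
  shows "(\<integral>\<^sup>+ t\<in>{c..y}. h t \<partial>J) = (\<integral>\<^sup>+ t\<in>{c..x}. h t \<partial>J) + (\<integral>\<^sup>+ t\<in>{x<..y}. h t \<partial>J)"
proof -
  have [measurable]: "{c..x} \<in> sets J" "{x<..y} \<in> sets J" using x by (auto intro!: sets_J)
  have "(\<integral>\<^sup>+ t\<in>{c..y}. h t \<partial>J) = (\<integral>\<^sup>+ t. h t * indicator {c..x} t + h t * indicator {x<..y} t \<partial>J)"
    using x by (intro nn_integral_cong) (auto split: split_indicator)
  also have "\<dots> = (\<integral>\<^sup>+ t\<in>{c..x}. h t \<partial>J) + (\<integral>\<^sup>+ t\<in>{x<..y}. h t \<partial>J)"
    by (rule nn_integral_add) measurable
  finally show ?thesis .
qed

lemma profile_eq: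
  assumes "1 < p" "x \<le> d"
  shows "profile (ennreal p) c d v x
     = epow (\<integral>\<^sup>+ t\<in>{c..x}. epow (v t) (1 - conj_exp (ennreal p)) \<partial>J) (1 / conj_exp (ennreal p))"
proof -
  have "ennreal p \<noteq> 1" using assms by (simp add: ennreal_eq_1)
  then show ?thesis unfolding profile_def integral_sub[OF assms(2)] by simp
qed

lemma is_profile_gt_one:
  assumes p: "1 < p"
  shows "is_profile c d (profile (ennreal p) c d v)"
proof -
  define p' where "p' = conj_exp (ennreal p)"
  have p': "1 < p'" using conj_exp_real[OF p] by (simp add: p'_def)
  define B where "B = \<delta> powr (1 - p')"
  define I where "I x = (\<integral>\<^sup>+ t\<in>{c..x}. epow (v t) (1 - p') \<partial>J)" for x
  have m [measurable]: "(\<lambda>t. epow (v t) (1 - p')) \<in> borel_measurable J" by measurable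
  have B0: "0 \<le> B" by (simp add: B_def)
  have le: "I y \<le> I x + ennreal (B * (y - x))" if "c \<le> x" "x \<le> y" "y \<le> d" for x y
  proof -
    have "(\<integral>\<^sup>+ t\<in>{x<..y}. epow (v t) (1 - p') \<partial>J) \<le> (\<integral>\<^sup>+ t. ennreal B * indicator {x..y} t \<partial>J)"
      using dual_weight_le[OF p] that unfolding B_def p'_def
      by (intro nn_integral_mono) (auto split: split_indicator)
    also have "\<dots> = ennreal B * emeasure J {x..y}"
      using that by (intro nn_integral_cmult_indicator sets_J) auto
    also have "\<dots> = ennreal (B * (y - x))" using that B0 by (simp add: emeasure_J ennreal_mult)
    finally show ?thesis unfolding I_def integral_split[OF m that] by (intro add_left_mono)
  qed
  have mono: "I x \<le> I y" if "x \<le> y" for x y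
    unfolding I_def using that by (intro nn_integral_mono) (auto split: split_indicator)
  have "I c \<le> ennreal 0"
  proof -
    have "I c \<le> (\<integral>\<^sup>+ t. ennreal B * indicator {c..c} t \<partial>J)"
      unfolding I_def using dual_weight_le[OF p] cd unfolding B_def p'_def
      by (intro nn_integral_mono) (auto split: split_indicator)
    also have "\<dots> = ennreal B * emeasure J {c..c}"
      using cd by (intro nn_integral_cmult_indicator sets_J) auto
    also have "\<dots> = 0" using cd emeasure_J[of c c] by simp
    finally show ?thesis by simp
  qed
  then have fin: "I x < top" if "x \<in> {c..d}" for x
    using le[of c x] that by (auto simp: less_top[symmetric] top_unique)
  have \<Phi>: "profile (ennreal p) c d v x = epow (I x) (1 / p')" if "x \<le> d" for x
    using profile_eq[OF p that] by (simp add: I_def p'_def)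
  show ?thesis
    unfolding is_profile_def
  proof (intro conjI ballI impI)
    show "profile (ennreal p) c d v x < \<infinity>" if "x \<in> {c..d}" for x
      using fin[OF that] that p' by (simp add: \<Phi> epow_less_top_iff)
    show "profile (ennreal p) c d v x \<le> profile (ennreal p) c d v y" if "x \<in> {c..d}" "y \<in> {c..d}" "x \<le> y" for x y
      using mono[OF that(3)] that p' by (simp add: \<Phi> epow_mono)
    show "(profile (ennreal p) c d v \<longlongrightarrow> profile (ennreal p) c d v x) (at_right x)" if x: "x \<in> {c..<d}" for x
    proof -
      have ev: "eventually (\<lambda>t. t \<in> {x<..<d}) (at_right x)" by (rule eventually_at_right_real) (use x in auto)
      have "((\<lambda>t. I x + ennreal (B * (t - x))) \<longlongrightarrow> I x + ennreal (B * (x - x))) (at_right x)"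
        by (intro tendsto_intros)
      then have lim: "((\<lambda>t. I x + ennreal (B * (t - x))) \<longlongrightarrow> I x) (at_right x)" by simp
      have "(I \<longlongrightarrow> I x) (at_right x)"
      proof (rule tendsto_sandwich[OF _ _ tendsto_const lim])
        show "eventually (\<lambda>t. I x \<le> I t) (at_right x)"
          using ev by eventually_elim (auto intro: mono)
        show "eventually (\<lambda>t. I t \<le> I x + ennreal (B * (t - x))) (at_right x)"
          using ev by eventually_elim (use x in \<open>auto intro: le\<close>)
      qed
      then have "((\<lambda>t. epow (I t) (1 / p')) \<longlongrightarrow> epow (I x) (1 / p')) (at_right x)"
        using fin[of x] x p' by (intro tendsto_epow) auto
      moreover have "eventually (\<lambda>t. epow (I t) (1 / p') = profile (ennreal p) c d v t) (at_right x)"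
        using ev by eventually_elim (simp add: \<Phi>)
      ultimately have "(profile (ennreal p) c d v \<longlongrightarrow> epow (I x) (1 / p')) (at_right x)"
        by (rule Lim_transform_eventually)
      then show ?thesis using x by (simp add: \<Phi>)
    qed
  qed
qed

lemma is_profile_profile: "1 \<le> p \<Longrightarrow> is_profile c d (profile (ennreal p) c d v)"
  using is_profile_one is_profile_gt_one[of p] by (cases "p = 1") auto

lemma hardy_increment:
  assumes p: "1 \<le> p" and f [measurable]: "f \<in> borel_measurable J" and x: "x \<in> {c..d}"
    and E: "E \<in> sets borel" "E \<subseteq> {c..x}" and X: "(\<integral>\<^sup>+ t\<in>E. (epow (f t) p * v t) \<partial>J) < top"
  shows "(\<integral>\<^sup>+ t\<in>E. f t \<partial>J)
    \<le> epow (\<integral>\<^sup>+ t\<in>E. (epow (f t) p * v t) \<partial>J) (1 / p) * profile (ennreal p) c d v x"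
proof (cases "p = 1")
  case True
  then show ?thesis using hardy_increment_one[OF f x E] X by simp
next
  case False
  then have p1: "1 < p" using p by simp
  define p' where "p' = conj_exp (ennreal p)"
  have p': "1 < p'" using conj_exp_real[OF p1] by (simp add: p'_def)
  have EJ: "E \<in> sets J" using E x by (intro sets_J) auto
  have "(\<integral>\<^sup>+ t\<in>E. epow (v t) (1 - p') \<partial>J) \<le> (\<integral>\<^sup>+ t\<in>{c..x}. epow (v t) (1 - p') \<partial>J)"
    using E by (intro nn_integral_mono) (auto split: split_indicator)
  then have le: "epow (\<integral>\<^sup>+ t\<in>E. epow (v t) (1 - p') \<partial>J) (1 / p') \<le> profile (ennreal p) c d v x"
    unfolding p'_def using x p' profile_eq[OF p1, of x] by (simp add: epow_mono p'_def)
  also have "\<dots> < top" using is_profile_profile[OF p] x by (auto simp: is_profile_def)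
  finally have Y: "(\<integral>\<^sup>+ t\<in>E. epow (v t) (1 - p') \<partial>J) < top" using p' by (simp add: epow_less_top_iff)
  have "(\<integral>\<^sup>+ t\<in>E. f t \<partial>J) \<le> epow (\<integral>\<^sup>+ t\<in>E. (epow (f t) p * v t) \<partial>J) (1 / p)
     * epow (\<integral>\<^sup>+ t\<in>E. epow (v t) (1 - p') \<partial>J) (1 / p')"
    unfolding p'_def
    by (rule nn_integral_Holder_weighted[OF p1 f v_meas EJ _ X Y[unfolded p'_def]]) (use v_pos in auto)
  also have "\<dots> \<le> epow (\<integral>\<^sup>+ t\<in>E. (epow (f t) p * v t) \<partial>J) (1 / p) * profile (ennreal p) c d v x"
    by (intro mult_left_mono le) auto
  finally show ?thesis .
qed

text \<open>
  The extremal function of Hoelder's inequality, \<open>v\<^sup>1\<^sup>-\<^sup>p\<^sup>'\<close> on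
  \<open>[c, x]\<close>, normalised.
\<close>

lemma hardy_test_gt_one:
  assumes p: "1 < p" and x: "c \<le> x" "x \<le> y" "y \<le> d"
  shows "\<exists>g \<in> borel_measurable J. (\<integral>\<^sup>+ t. (epow (g t) p * v t) \<partial>J) \<le> 1 \<and> profile (ennreal p) c d v x \<le> hardy c g y"
proof -
  define p' where "p' = conj_exp (ennreal p)"
  have p': "1 < p'" "1 / p + 1 / p' = 1" "p * (1 - p') + 1 = 1 - p'"
    using conj_exp_real[OF p] by (simp_all add: p'_def)
  define w where "w t = epow (v t) (1 - p') * indicator {c..x} t" for t
  define Y where "Y = (\<integral>\<^sup>+ t. w t \<partial>J)"
  have [measurable]: "{c..x} \<in> sets J" using x by (intro sets_J) auto
  have w [measurable]: "w \<in> borel_measurable J" unfolding w_def by measurable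
  have \<Phi>: "profile (ennreal p) c d v x = epow Y (1 / p')"
    using profile_eq[OF p, of x] x by (simp add: Y_def w_def p'_def)
  show ?thesis
  proof (cases "Y = 0")
    case True
    then show ?thesis unfolding \<Phi> using p p' by (intro bexI[of _ "\<lambda>_. 0"]) auto
  next
    case False
    have "epow Y (1 / p') < top" using is_profile_gt_one[OF p] x by (auto simp: is_profile_def \<Phi>[symmetric])
    then have "Y < top" using p' by (simp add: epow_less_top_iff)
    then obtain s where s: "Y = ennreal s" "0 < s"
      using False by (cases Y rule: ennreal_cases) (auto simp: less_le)
    \<comment> \<open>\<open>w\<^sup>p v = w\<close>, so this factor normalises the norm to 1\<close>
    define g where "g t = w t * ennreal (s powr (- 1 / p))" for t
    have g: "g \<in> borel_measurable J" unfolding g_def by measurable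
    have "(\<integral>\<^sup>+ t. (epow (g t) p * v t) \<partial>J) \<le> (\<integral>\<^sup>+ t. ennreal (1 / s) * w t \<partial>J)"
    proof (rule nn_integral_mono)
      fix t assume "t \<in> space J"
      then have v0: "0 < v t" using v_pos by simp
      have e: "epow (ennreal (s powr (- 1 / p))) p = ennreal (1 / s)"
      proof -
        have "(s powr (- 1 / p)) powr p = s powr (- 1)" using p by (simp only: powr_powr) simp
        then show ?thesis using p s by (simp add: epow_ennreal powr_minus inverse_eq_divide)
      qed
      have "epow (w t) p * v t \<le> w t"
      proof (cases "t \<in> {c..x}")
        case True
        show ?thesis
        proof (cases "v t" rule: ennreal_cases)
          case top
          then have "w t = 0" using p' by (simp add: w_def epow_def)
          then show ?thesis using p by simp
        next
          case (real r)
          then have r: "0 < r" using v0 by simp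
          have wt: "w t = ennreal (r powr (1 - p'))" using True real r p' by (simp add: w_def epow_def)
          have "(r powr (1 - p')) powr p * r powr 1 = r powr (p * (1 - p') + 1)"
            by (simp add: powr_powr powr_add mult.commute)
          then have "(r powr (1 - p')) powr p * r = r powr (1 - p')" using r p'(3) by simp
          then show ?thesis using r p by (simp add: wt real epow_ennreal ennreal_mult[symmetric])
        qed
      qed (use p in \<open>simp add: w_def\<close>)
      then have "ennreal (1 / s) * (epow (w t) p * v t) \<le> ennreal (1 / s) * w t" by (intro mult_left_mono) auto
      then show "epow (g t) p * v t \<le> ennreal (1 / s) * w t"
        using p e by (simp add: g_def epow_mult mult_ac)
    qed
    also have "\<dots> = ennreal (1 / s) * Y" unfolding Y_def by (rule nn_integral_cmult) measurable
    also have "\<dots> = 1" using s by (simp add: ennreal_mult[symmetric])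
    finally have 1: "(\<integral>\<^sup>+ t. (epow (g t) p * v t) \<partial>J) \<le> 1" .
    have "hardy c g y = (\<integral>\<^sup>+ t. g t * indicator {c..y} t \<partial>J)" using x by (simp add: hardy_eq)
    also have "\<dots> = (\<integral>\<^sup>+ t. w t * ennreal (s powr (- 1 / p)) \<partial>J)"
      using x by (intro nn_integral_cong) (auto simp: g_def w_def split: split_indicator)
    also have "\<dots> = Y * ennreal (s powr (- 1 / p))" unfolding Y_def by (rule nn_integral_multc) measurable
    also have "\<dots> = ennreal (s powr 1 * s powr (- 1 / p))" using s by (simp add: ennreal_mult)
    also have "s powr 1 * s powr (- 1 / p) = s powr (1 / p')"
    proof -
      have "1 + (- 1 / p) = 1 / p'" using p'(2) by simp
      then show ?thesis by (simp only: powr_add[symmetric])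
    qed
    finally have "hardy c g y = profile (ennreal p) c d v x" unfolding \<Phi> using s p' by (simp add: epow_ennreal)
    then show ?thesis using g 1 by (intro bexI[of _ g]) auto
  qed
qed

lemma hardy_test:
  assumes p: "1 \<le> p" and x: "c \<le> x" "x < y" "y \<le> d"
  shows "\<exists>g \<in> borel_measurable J. (\<integral>\<^sup>+ t. (epow (g t) p * v t) \<partial>J) \<le> 1 \<and> profile (ennreal p) c d v x \<le> 2 * hardy c g y"
proof (cases "p = 1")
  case True
  then show ?thesis using hardy_test_one[OF x] by simp
next
  case False
  then obtain g where g: "g \<in> borel_measurable J" "(\<integral>\<^sup>+ t. (epow (g t) p * v t) \<partial>J) \<le> 1"
    "profile (ennreal p) c d v x \<le> hardy c g y"
    using hardy_test_gt_one[of p x y] p x by auto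
  have "hardy c g y \<le> 2 * hardy c g y" by (simp add: mult_2)
  then show ?thesis using g by (intro bexI[of _ g]) (auto intro: order_trans)
qed

lemma wnorm_real: "0 < p \<Longrightarrow> wnorm (ennreal p) c d w f = epow (\<integral>\<^sup>+ t. (epow (f t) p * w t) \<partial>J) (1 / p)"
  by (simp add: wnorm_def)

lemma hardy_finite:
  assumes p: "1 \<le> p" and f: "f \<in> borel_measurable J" and nf: "wnorm (ennreal p) c d v f < top"
    and x: "x \<in> {c..d}"
  shows "hardy c f x < top"
proof -
  have p0: "0 < p" using p by simp
  have "(\<integral>\<^sup>+ t\<in>{c..x}. (epow (f t) p * v t) \<partial>J) \<le> (\<integral>\<^sup>+ t. (epow (f t) p * v t) \<partial>J)"
    by (intro nn_integral_mono) (auto split: split_indicator)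
  also have "\<dots> < top" using nf p0 by (simp add: wnorm_real epow_less_top_iff)
  finally have X: "(\<integral>\<^sup>+ t\<in>{c..x}. (epow (f t) p * v t) \<partial>J) < top" .
  have "hardy c f x \<le> epow (\<integral>\<^sup>+ t\<in>{c..x}. (epow (f t) p * v t) \<partial>J) (1 / p) * profile (ennreal p) c d v x"
    using hardy_increment[OF p f x _ order_refl X] x by (simp add: hardy_eq)
  also have "\<dots> < top"
    using X is_profile_profile[OF p] x p0 by (auto simp: ennreal_mult_less_top epow_less_top_iff is_profile_def)
  finally show ?thesis .
qed

text \<open>
  Domination follows from the records of \<open>Hf\<close> along the grid, with the masses of
  \<open>f\<^sup>p v\<close>. Realisation uses the maximum, not the sum, of the scaled test functions:
  its \<open>p\<close>-th power is at most the sum of their \<open>p\<close>-th powers, so overlapping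
  supports do no harm.
\<close>

lemma hardy_system_hardy_ops:
  assumes p: "1 \<le> p"
  shows "hardy_system c d p (profile (ennreal p) c d v) (hardy_ops (ennreal p) c d v)"
proof -
  let ?\<Phi> = "profile (ennreal p) c d v"
  have p0: "0 < p" using p by simp
  have \<Phi>: "is_profile c d ?\<Phi>" by (rule is_profile_profile[OF p])
  have \<Phi>r: "?\<Phi> x = ennreal (enn2real (?\<Phi> x))" if "x \<in> {c..d}" for x
    using \<Phi> that by (simp add: is_profile_def)
  show ?thesis
    unfolding hardy_system_def
  proof (intro conjI ballI allI impI, unfold split_paired_all split, intro conjI ballI allI impI)
    fix F n assume "(F, n) \<in> hardy_ops (ennreal p) c d v"
    then obtain f where f [measurable]: "f \<in> borel_measurable J" and nf: "wnorm (ennreal p) c d v f < top"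
      and F: "F = (\<lambda>x. enn2real (hardy c f x))" and n: "n = enn2real (wnorm (ennreal p) c d v f)"
      by (auto simp: hardy_ops_def)
    show "0 \<le> n" "\<And>x. 0 \<le> F x" by (simp_all add: n F)
    define X where "X E = (\<integral>\<^sup>+ t\<in>E. (epow (f t) p * v t) \<partial>J)" for E
    have X_mono: "X E \<le> X E'" if "E \<subseteq> E'" for E E'
      unfolding X_def using that by (intro nn_integral_mono) (auto split: split_indicator)
    have XJ: "(\<integral>\<^sup>+ t. (epow (f t) p * v t) \<partial>J) = X {c..d}"
      unfolding X_def by (intro nn_integral_cong) auto
    have Xd: "X {c..d} < top" using nf p0 by (simp add: wnorm_real XJ epow_less_top_iff)
    have Xfin: "X E < top" if "E \<subseteq> {c..d}" for E using X_mono[OF that] Xd by (rule le_less_trans)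
    have inc: "(\<integral>\<^sup>+ t\<in>E. f t \<partial>J) \<le> epow (X E) (1 / p) * ?\<Phi> x"
      if "x \<in> {c..d}" "E \<in> sets borel" "E \<subseteq> {c..x}" for E x
    proof -
      have "E \<subseteq> {c..d}" using that(1,3) by force
      then have "(\<integral>\<^sup>+ t\<in>E. (epow (f t) p * v t) \<partial>J) < top" using Xfin[of E] by (simp add: X_def)
      then show ?thesis unfolding X_def using that by (intro hardy_increment p f) auto
    qed
    have H: "hardy c f x < top" if "x \<in> {c..d}" for x using hardy_finite[OF p f nf that] .
    then have HF: "hardy c f x = ennreal (F x)" if "x \<in> {c..d}" for x using that by (simp add: F)
    show "F x \<le> F y" if "c \<le> x" "x \<le> y" "y \<le> d" for x y
    proof -
      have "hardy c f x \<le> hardy c f y"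
        using that unfolding hardy_eq[OF that(3)] hardy_eq[OF order_trans[OF that(2,3)]]
        by (intro nn_integral_mono) (auto split: split_indicator)
      then show ?thesis unfolding F using H[of y] that by (intro enn2real_mono) auto
    qed
    fix z :: "nat \<Rightarrow> real" and N assume z: "mono z" "\<forall>k. z k \<in> {c..d}"
    then have zc: "c \<le> z k" and zd: "z k \<le> d" and zi: "z k \<in> {c..d}" for k by auto
    define R where "R k = enn2real (X {c..z k})" for k
    have XR: "X {c..z k} = ennreal (R k)" for k unfolding R_def using Xfin[of "{c..z k}"] zd[of k] by simp
    have R0: "0 \<le> R k" for k by (simp add: R_def)
    have "mono R"
    proof (rule monoI)
      fix k l :: nat assume "k \<le> l"
      then have "z k \<le> z l" using z by (simp add: monoD)
      then show "R k \<le> R l" unfolding R_def using Xfin[of "{c..z l}"] zd[of l]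
        by (intro enn2real_mono X_mono) auto
    qed
    have step: "F (z k) - F (z l) \<le> (R k - R l) powr (1/p) * enn2real (?\<Phi> (z k))" if "l \<le> k" for l k
    proof -
      have lk: "z l \<le> z k" using z that by (simp add: monoD)
      let ?E = "{z l<..z k}"
      have Esub: "?E \<subseteq> {c..z k}" and Esub': "?E \<subseteq> {c..d}" using zc[of l] zd[of k] by auto
      have "X {c..z k} = X {c..z l} + X ?E"
        unfolding X_def using zc zd lk by (intro integral_split) auto
      moreover obtain e where e: "X ?E = ennreal e" "0 \<le> e"
        using Xfin[OF Esub'] by (cases "X ?E" rule: ennreal_cases) auto
      ultimately have "R k = R l + e"
        using R0[of l] R0[of k] by (simp add: XR ennreal_plus[symmetric] del: ennreal_plus)
      have "hardy c f (z k) = hardy c f (z l) + (\<integral>\<^sup>+ t\<in>?E. f t \<partial>J)"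
        unfolding hardy_eq[OF zd] using zc zd lk by (intro integral_split) auto
      also have "\<dots> \<le> hardy c f (z l) + epow (X ?E) (1 / p) * ?\<Phi> (z k)"
        using Esub zi by (intro add_left_mono inc) auto
      finally have "ennreal (F (z k)) \<le> ennreal (F (z l)) + epow (ennreal e) (1 / p) * ennreal (enn2real (?\<Phi> (z k)))"
        unfolding HF[OF zi] e(1) \<Phi>r[OF zi, symmetric] .
      also have "\<dots> = ennreal (F (z l) + e powr (1/p) * enn2real (?\<Phi> (z k)))"
        using e p0 by (simp add: epow_ennreal F ennreal_mult)
      finally have "F (z k) \<le> F (z l) + e powr (1/p) * enn2real (?\<Phi> (z k))"
        by (subst (asm) ennreal_le_iff) (simp_all add: F)
      then show ?thesis using \<open>R k = R l + e\<close> by simp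
    qed
    have start: "F (z 0) \<le> R 0 powr (1/p) * enn2real (?\<Phi> (z 0))"
    proof -
      have "hardy c f (z 0) \<le> epow (X {c..z 0}) (1 / p) * ?\<Phi> (z 0)"
        using zd zi inc[of "z 0" "{c..z 0}"] by (simp add: hardy_eq)
      then have "ennreal (F (z 0)) \<le> epow (ennreal (R 0)) (1 / p) * ennreal (enn2real (?\<Phi> (z 0)))"
        unfolding HF[OF zi] XR \<Phi>r[OF zi, symmetric] .
      also have "\<dots> = ennreal (R 0 powr (1/p) * enn2real (?\<Phi> (z 0)))"
        using p0 R0 by (simp add: epow_ennreal ennreal_mult)
      finally show ?thesis by simp
    qed
    obtain \<alpha> where \<alpha>: "\<forall>i. 0 \<le> \<alpha> i" "(\<Sum>i\<le>N. \<alpha> i powr p) \<le> R N"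
      "\<forall>k\<le>N. F (z k) \<le> 4 * runmax \<alpha> (\<lambda>i. enn2real (?\<Phi> (z i))) k"
      using records_dominate[of p "\<lambda>i. enn2real (?\<Phi> (z i))" R "\<lambda>k. F (z k)" N, OF p0 _ R0 \<open>mono R\<close> start step]
      by auto
    have "lpn {..N} p \<alpha> \<le> n"
    proof (rule lpn_leI[OF p0])
      have "ennreal (R N) \<le> X {c..d}" unfolding XR[symmetric] using zd[of N] by (intro X_mono) auto
      also have "\<dots> = ennreal (n powr p)"
      proof -
        have "ennreal n = epow (X {c..d}) (1 / p)" using nf p0 by (simp add: n wnorm_real XJ)
        then have "epow (ennreal n) p = epow (epow (X {c..d}) (1 / p)) p" by simp
        then show ?thesis using p0 by (simp add: epow_epow epow_ennreal n)
      qed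
      finally have "R N \<le> n powr p" by simp
      then show "(\<Sum>i\<le>N. \<alpha> i powr p) \<le> n powr p" using \<alpha>(2) by linarith
    qed (simp add: n)
    then show "\<exists>\<alpha>. (\<forall>i. 0 \<le> \<alpha> i) \<and> lpn {..N} p \<alpha> \<le> n \<and>
        (\<forall>k\<le>N. F (z k) \<le> 4 * runmax \<alpha> (\<lambda>i. enn2real (?\<Phi> (z i))) k)" using \<alpha> by blast
  next
    fix z :: "nat \<Rightarrow> real" and N and \<alpha> :: "nat \<Rightarrow> real"
    assume z: "strict_mono z" "\<forall>k. z k \<in> {c..d}" and \<alpha>: "\<forall>i. 0 \<le> \<alpha> i"
    then have zc: "c \<le> z k" and zd: "z k \<le> d" and zi: "z k \<in> {c..d}" for k by auto
    have "\<forall>i. \<exists>g. g \<in> borel_measurable J \<and> (\<integral>\<^sup>+ t. (epow (g t) p * v t) \<partial>J) \<le> 1 \<and> ?\<Phi> (z i) \<le> 2 * hardy c g (z (Suc i))"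
    proof
      fix i
      have "z i < z (Suc i)" using z(1) by (simp add: strict_mono_Suc_iff)
      then show "\<exists>g. g \<in> borel_measurable J \<and> (\<integral>\<^sup>+ t. (epow (g t) p * v t) \<partial>J) \<le> 1 \<and> ?\<Phi> (z i) \<le> 2 * hardy c g (z (Suc i))"
        using hardy_test[OF p zc _ zd, of i "Suc i"] by blast
    qed
    then obtain g where g [measurable]: "\<And>i. g i \<in> borel_measurable J"
      and g1: "\<And>i. (\<integral>\<^sup>+ t. (epow (g i t) p * v t) \<partial>J) \<le> 1"
      and g2: "\<And>i. ?\<Phi> (z i) \<le> 2 * hardy c (g i) (z (Suc i))" by metis
    define f where "f t = (SUP i\<in>{..N}. ennreal (\<alpha> i) * g i t)" for t
    have f [measurable]: "f \<in> borel_measurable J" unfolding f_def by measurable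
    have "(\<integral>\<^sup>+ t. (epow (f t) p * v t) \<partial>J) \<le> (\<integral>\<^sup>+ t. (\<Sum>i\<le>N. ennreal (\<alpha> i powr p) * (epow (g i t) p * v t)) \<partial>J)"
    proof (rule nn_integral_mono)
      fix t
      have "epow (f t) p = (SUP i\<in>{..N}. epow (ennreal (\<alpha> i) * g i t) p)" unfolding f_def using p0 by (intro epow_SUP) auto
      also have "\<dots> \<le> (\<Sum>i\<le>N. epow (ennreal (\<alpha> i) * g i t) p)" by (intro SUP_least member_le_sum) auto
      also have "\<dots> = (\<Sum>i\<le>N. ennreal (\<alpha> i powr p) * epow (g i t) p)"
        using p0 \<alpha> by (simp add: epow_mult epow_ennreal)
      finally have "epow (f t) p * v t \<le> (\<Sum>i\<le>N. ennreal (\<alpha> i powr p) * epow (g i t) p) * v t"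
        by (intro mult_right_mono) auto
      then show "epow (f t) p * v t \<le> (\<Sum>i\<le>N. ennreal (\<alpha> i powr p) * (epow (g i t) p * v t))"
        by (simp add: sum_distrib_right mult.assoc)
    qed
    also have "\<dots> = (\<Sum>i\<le>N. ennreal (\<alpha> i powr p) * (\<integral>\<^sup>+ t. (epow (g i t) p * v t) \<partial>J))"
    proof -
      have "(\<integral>\<^sup>+ t. (\<Sum>i\<le>N. ennreal (\<alpha> i powr p) * (epow (g i t) p * v t)) \<partial>J)
         = (\<Sum>i\<le>N. \<integral>\<^sup>+ t. ennreal (\<alpha> i powr p) * (epow (g i t) p * v t) \<partial>J)"
        by (rule nn_integral_sum) measurable
      also have "\<dots> = (\<Sum>i\<le>N. ennreal (\<alpha> i powr p) * (\<integral>\<^sup>+ t. (epow (g i t) p * v t) \<partial>J))"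
        by (intro sum.cong refl nn_integral_cmult) measurable
      finally show ?thesis .
    qed
    also have "\<dots> \<le> (\<Sum>i\<le>N. ennreal (\<alpha> i powr p) * 1)" by (intro sum_mono mult_left_mono g1) auto
    also have "\<dots> = ennreal (\<Sum>i\<le>N. \<alpha> i powr p)" by simp
    finally have "epow (\<integral>\<^sup>+ t. (epow (f t) p * v t) \<partial>J) (1 / p) \<le> epow (ennreal (\<Sum>i\<le>N. \<alpha> i powr p)) (1 / p)"
      using p0 by (intro epow_mono) auto
    then have nf: "wnorm (ennreal p) c d v f \<le> ennreal (lpn {..N} p \<alpha>)"
      using p0 by (simp add: wnorm_real lpn_def epow_ennreal sum_nonneg)
    then have nfin: "wnorm (ennreal p) c d v f < top" by (auto simp: less_top[symmetric] top_unique)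
    define F where "F = (\<lambda>x. enn2real (hardy c f x))"
    define n where "n = enn2real (wnorm (ennreal p) c d v f)"
    have "(F, n) \<in> hardy_ops (ennreal p) c d v" unfolding hardy_ops_def F_def n_def using f nfin by auto
    moreover have "n \<le> lpn {..N} p \<alpha>" unfolding n_def using nf by (intro enn2real_leI) auto
    moreover have "\<alpha> i * enn2real (?\<Phi> (z i)) \<le> 2 * F (z (Suc i))" if i: "i \<le> N" for i
    proof -
      have HF: "hardy c f (z (Suc i)) = ennreal (F (z (Suc i)))"
        unfolding F_def using hardy_finite[OF p f nfin zi] by simp
      have [measurable]: "{c..z (Suc i)} \<in> sets J" using zd by (intro sets_J) auto
      have "ennreal (\<alpha> i) * ?\<Phi> (z i) \<le> ennreal (\<alpha> i) * (2 * hardy c (g i) (z (Suc i)))"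
        by (intro mult_left_mono g2) auto
      also have "\<dots> = 2 * (\<integral>\<^sup>+ t. ennreal (\<alpha> i) * (g i t * indicator {c..z (Suc i)} t) \<partial>J)"
      proof -
        have "(\<integral>\<^sup>+ t. ennreal (\<alpha> i) * (g i t * indicator {c..z (Suc i)} t) \<partial>J)
           = ennreal (\<alpha> i) * hardy c (g i) (z (Suc i))"
          unfolding hardy_eq[OF zd] by (rule nn_integral_cmult) measurable
        then show ?thesis by (simp add: mult_ac)
      qed
      also have "\<dots> \<le> 2 * (\<integral>\<^sup>+ t. f t * indicator {c..z (Suc i)} t \<partial>J)"
      proof (intro mult_left_mono nn_integral_mono)
        fix t
        have "ennreal (\<alpha> i) * g i t \<le> f t" unfolding f_def using i by (intro SUP_upper) auto
        then show "ennreal (\<alpha> i) * (g i t * indicator {c..z (Suc i)} t) \<le> f t * indicator {c..z (Suc i)} t"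
          by (auto split: split_indicator)
      qed simp
      also have "\<dots> = 2 * ennreal (F (z (Suc i)))" unfolding HF[symmetric] hardy_eq[OF zd] ..
      finally have "ennreal (\<alpha> i) * ennreal (enn2real (?\<Phi> (z i))) \<le> 2 * ennreal (F (z (Suc i)))"
        unfolding \<Phi>r[OF zi, symmetric] .
      then show ?thesis
        using \<alpha> by (simp add: F_def ennreal_mult[symmetric] flip: ennreal_numeral)
    qed
    ultimately show "\<exists>x\<in>hardy_ops (ennreal p) c d v. case x of (F, n) \<Rightarrow> n \<le> lpn {..N} p \<alpha> \<and> (\<forall>i\<le>N. \<alpha> i * enn2real (?\<Phi> (z i)) \<le> 2 * F (z (Suc i)))"
      by (intro bexI[of _ "(F, n)"]) auto
  qed
qed

end

section \<open>Infinite exponents\<close>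

lemma bilinear_boundD:
  assumes "bilinear_bound c d q u S1 S2 C" "(F, n) \<in> S1" "(G, m) \<in> S2"
  shows "(\<integral>\<^sup>+ t. epow (ennreal (F t * G t)) q * u t \<partial>lebesgue_on {c..d}) \<le> ennreal ((C * n * m) powr q)"
proof -
  note a = bspec[OF assms(1)[unfolded bilinear_bound_def] assms(2), unfolded split]
  show ?thesis by (rule bspec[OF a assms(3), unfolded split])
qed

lemma hardy_mono: "x \<le> y \<Longrightarrow> hardy c f x \<le> hardy c f y"
  unfolding hardy_def by (simp add: nn_integral_lebesgue_on) (intro nn_integral_mono, auto split: split_indicator)

lemma borel_measurable_hardy: "hardy c f \<in> borel_measurable (lebesgue_on S)"
proof -
  have "hardy c f \<in> borel_measurable lebesgue"
    using borel_measurable_mono_ennreal[OF hardy_mono[of _ _ c f]] by (intro measurable_completion) simp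
  then show ?thesis by (rule measurable_restrict_space1)
qed

lemma profile_inf: "profile \<infinity> c d v x = hardy c (\<lambda>t. inverse (v t)) x"
  by (simp add: profile_def hardy_def)

lemma borel_measurable_profile_inf: "profile \<infinity> c d v \<in> borel_measurable (lebesgue_on S)"
proof -
  have "profile \<infinity> c d v = hardy c (\<lambda>t. inverse (v t))" by (rule ext) (rule profile_inf)
  then show ?thesis by (simp only: borel_measurable_hardy)
qed

definition hardy_ineq ::
  "real \<Rightarrow> ennreal \<Rightarrow> ennreal \<Rightarrow> real \<Rightarrow> real \<Rightarrow>
   (real \<Rightarrow> ennreal) \<Rightarrow> (real \<Rightarrow> ennreal) \<Rightarrow> (real \<Rightarrow> ennreal) \<Rightarrow> ennreal \<Rightarrow> bool" where
  "hardy_ineq q p1 p2 c d u v1 v2 C \<longleftrightarrow>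
     (\<forall>f \<in> borel_measurable (lebesgue_on {c..d}). \<forall>g \<in> borel_measurable (lebesgue_on {c..d}).
        wnorm p1 c d v1 f < \<infinity> \<longrightarrow> wnorm p2 c d v2 g < \<infinity> \<longrightarrow>
        wnorm (ennreal q) c d u (bilinear_hardy c f g) \<le> C * wnorm p1 c d v1 f * wnorm p2 c d v2 g)"

lemma hardy_const_eq: "hardy_const q p1 p2 c d u v1 v2 = Inf {C. C < \<infinity> \<and> hardy_ineq q p1 p2 c d u v1 v2 C}"
  by (simp add: hardy_const_def hardy_ineq_def)

lemma hardy_ineq_swap: "hardy_ineq q p1 p2 c d u v1 v2 C \<Longrightarrow> hardy_ineq q p2 p1 c d u v2 v1 C"
proof -
  assume h: "hardy_ineq q p1 p2 c d u v1 v2 C"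
  have e: "bilinear_hardy c f g = bilinear_hardy c g f" for f g
    by (simp add: fun_eq_iff bilinear_hardy_def mult.commute)
  show ?thesis
    unfolding hardy_ineq_def
  proof (intro ballI impI)
    fix f g assume fg: "f \<in> borel_measurable (lebesgue_on {c..d})" "g \<in> borel_measurable (lebesgue_on {c..d})"
      "wnorm p2 c d v2 f < \<infinity>" "wnorm p1 c d v1 g < \<infinity>"
    have "wnorm (ennreal q) c d u (bilinear_hardy c g f) \<le> C * wnorm p1 c d v1 g * wnorm p2 c d v2 f"
      using h[unfolded hardy_ineq_def, rule_format, OF fg(2,1,4,3)] .
    then show "wnorm (ennreal q) c d u (bilinear_hardy c f g) \<le> C * wnorm p2 c d v2 f * wnorm p1 c d v1 g"
      by (simp add: e[of f g] mult_ac)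
  qed
qed

lemma hardy_ineq_iff_bilinear_bound:
  assumes q: "0 < q" and C: "0 \<le> C"
    and fin1: "\<And>f x. f \<in> borel_measurable (lebesgue_on {c..d}) \<Longrightarrow> wnorm p1 c d v1 f < top \<Longrightarrow> x \<in> {c..d} \<Longrightarrow> hardy c f x < top"
    and fin2: "\<And>f x. f \<in> borel_measurable (lebesgue_on {c..d}) \<Longrightarrow> wnorm p2 c d v2 f < top \<Longrightarrow> x \<in> {c..d} \<Longrightarrow> hardy c f x < top"
  shows "hardy_ineq q p1 p2 c d u v1 v2 (ennreal C)
     \<longleftrightarrow> bilinear_bound c d q u (hardy_ops p1 c d v1) (hardy_ops p2 c d v2) C"
proof -
  have eq: "wnorm (ennreal q) c d u (bilinear_hardy c f g) \<le> ennreal C * wnorm p1 c d v1 f * wnorm p2 c d v2 g \<longleftrightarrow>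
     (\<integral>\<^sup>+ t. epow (ennreal (enn2real (hardy c f t) * enn2real (hardy c g t))) q * u t \<partial>lebesgue_on {c..d})
       \<le> ennreal ((C * enn2real (wnorm p1 c d v1 f) * enn2real (wnorm p2 c d v2 g)) powr q)"
    if f: "f \<in> borel_measurable (lebesgue_on {c..d})" "wnorm p1 c d v1 f < top"
      and g: "g \<in> borel_measurable (lebesgue_on {c..d})" "wnorm p2 c d v2 g < top" for f g
  proof -
    have int: "(\<integral>\<^sup>+ t. epow (bilinear_hardy c f g t) q * u t \<partial>lebesgue_on {c..d})
       = (\<integral>\<^sup>+ t. epow (ennreal (enn2real (hardy c f t) * enn2real (hardy c g t))) q * u t \<partial>lebesgue_on {c..d})"
      using fin1[OF f] fin2[OF g]
      by (intro nn_integral_cong) (auto simp: bilinear_hardy_def ennreal_mult)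
    have n: "ennreal C * wnorm p1 c d v1 f * wnorm p2 c d v2 g
       = ennreal (C * enn2real (wnorm p1 c d v1 f) * enn2real (wnorm p2 c d v2 g))"
      using f g C by (simp add: ennreal_mult)
    have "wnorm (ennreal q) c d u (bilinear_hardy c f g)
       = epow (\<integral>\<^sup>+ t. epow (bilinear_hardy c f g t) q * u t \<partial>lebesgue_on {c..d}) (1 / q)"
      using q by (simp add: wnorm_def)
    then show ?thesis
      using q C unfolding n by (simp add: int epow_le_iff epow_ennreal)
  qed
  show ?thesis
  proof
    assume h: "hardy_ineq q p1 p2 c d u v1 v2 (ennreal C)"
    show "bilinear_bound c d q u (hardy_ops p1 c d v1) (hardy_ops p2 c d v2) C"
      unfolding bilinear_bound_def
    proof (intro ballI, clarify)
      fix F n G m assume "(F, n) \<in> hardy_ops p1 c d v1" "(G, m) \<in> hardy_ops p2 c d v2"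
      then obtain f g where f: "f \<in> borel_measurable (lebesgue_on {c..d})" "wnorm p1 c d v1 f < top"
        and g: "g \<in> borel_measurable (lebesgue_on {c..d})" "wnorm p2 c d v2 g < top"
        and e: "F = (\<lambda>x. enn2real (hardy c f x))" "n = enn2real (wnorm p1 c d v1 f)"
          "G = (\<lambda>x. enn2real (hardy c g x))" "m = enn2real (wnorm p2 c d v2 g)"
        unfolding hardy_ops_def by auto
      have "wnorm (ennreal q) c d u (bilinear_hardy c f g) \<le> ennreal C * wnorm p1 c d v1 f * wnorm p2 c d v2 g"
        using h f g unfolding hardy_ineq_def by simp
      then show "(\<integral>\<^sup>+ t. epow (ennreal (F t * G t)) q * u t \<partial>lebesgue_on {c..d}) \<le> ennreal ((C * n * m) powr q)"
        unfolding e using eq[OF f g] by blast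
    qed
  next
    assume h: "bilinear_bound c d q u (hardy_ops p1 c d v1) (hardy_ops p2 c d v2) C"
    show "hardy_ineq q p1 p2 c d u v1 v2 (ennreal C)"
      unfolding hardy_ineq_def
    proof (intro ballI impI)
      fix f g assume f: "f \<in> borel_measurable (lebesgue_on {c..d})" and g: "g \<in> borel_measurable (lebesgue_on {c..d})"
        and nf: "wnorm p1 c d v1 f < \<infinity>" and ng: "wnorm p2 c d v2 g < \<infinity>"
      have mem: "(\<lambda>x. enn2real (hardy c f x), enn2real (wnorm p1 c d v1 f)) \<in> hardy_ops p1 c d v1"
        "(\<lambda>x. enn2real (hardy c g x), enn2real (wnorm p2 c d v2 g)) \<in> hardy_ops p2 c d v2"
        using f g nf ng unfolding hardy_ops_def by auto
      have "(\<integral>\<^sup>+ t. epow (ennreal (enn2real (hardy c f t) * enn2real (hardy c g t))) q * u t \<partial>lebesgue_on {c..d})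
        \<le> ennreal ((C * enn2real (wnorm p1 c d v1 f) * enn2real (wnorm p2 c d v2 g)) powr q)"
        by (rule bilinear_boundD[OF h mem])
      then show "wnorm (ennreal q) c d u (bilinear_hardy c f g) \<le> ennreal C * wnorm p1 c d v1 f * wnorm p2 c d v2 g"
        using eq[OF f _ g] nf ng by simp
    qed
  qed
qed

definition const_ops :: "((real \<Rightarrow> real) \<times> real) set" where
  "const_ops = {(\<lambda>_. n, n) | n. 0 \<le> n}"

lemma hardy_system_const_ops:
  assumes q: "0 < q"
  shows "hardy_system c d q (\<lambda>_. 1) const_ops"
  unfolding hardy_system_def
proof (intro conjI ballI allI impI, unfold split_paired_all split, intro conjI ballI allI impI)
  fix F n assume "(F, n) \<in> const_ops"
  then have F: "F = (\<lambda>_. n)" and n: "0 \<le> n" by (auto simp: const_ops_def)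
  show "0 \<le> n" "\<And>x. 0 \<le> F x" "\<And>x y. F x \<le> F y" using F n by auto
  fix z :: "nat \<Rightarrow> real" and N
  define \<alpha> where "\<alpha> i = (if i = 0 then n else 0)" for i :: nat
  have "(\<Sum>i\<le>N. \<alpha> i powr q) = (\<Sum>i\<le>N. if i = 0 then n powr q else 0)"
    by (intro sum.cong) (auto simp: \<alpha>_def)
  then have "lpn {..N} q \<alpha> = n" using q n by (simp add: lpn_def powr_powr)
  moreover have "F (z k) \<le> 4 * runmax \<alpha> (\<lambda>i. enn2real 1) k" for k
    using le_runmax[of 0 k \<alpha> "\<lambda>i. enn2real 1"] n by (simp add: F \<alpha>_def)
  moreover have "\<forall>i. 0 \<le> \<alpha> i" using n by (simp add: \<alpha>_def)
  ultimately show "\<exists>\<alpha>. (\<forall>i. 0 \<le> \<alpha> i) \<and> lpn {..N} q \<alpha> \<le> n \<and> (\<forall>k\<le>N. F (z k) \<le> 4 * runmax \<alpha> (\<lambda>i. enn2real 1) k)"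
    by (intro exI[of _ \<alpha>]) auto
next
  fix z :: "nat \<Rightarrow> real" and N and \<alpha> :: "nat \<Rightarrow> real" assume \<alpha>: "\<forall>i. 0 \<le> \<alpha> i"
  let ?n = "lpn {..N} q \<alpha>"
  have "\<alpha> i \<le> 2 * ?n" if "i \<le> N" for i
    using member_le_lpn[of "{..N}" i q \<alpha>] that q \<alpha> lpn_nonneg[of "{..N}" q \<alpha>] by (simp del: lpn_nonneg)
  then show "\<exists>x\<in>const_ops. case x of (F, n) \<Rightarrow> n \<le> lpn {..N} q \<alpha> \<and> (\<forall>i\<le>N. \<alpha> i * enn2real 1 \<le> 2 * F (z (Suc i)))"
    by (intro bexI[of _ "(\<lambda>_. ?n, ?n)"]) (auto simp: const_ops_def)
qed

context reg_weight
begin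

lemma profile_inf_le: "x \<in> {c..d} \<Longrightarrow> profile \<infinity> c d v x \<le> ennreal (1 / \<delta> * (d - c))"
proof -
  assume x: "x \<in> {c..d}"
  have "profile \<infinity> c d v x \<le> (\<integral>\<^sup>+ t. ennreal (1 / \<delta>) * indicator {c..x} t \<partial>J)"
    unfolding profile_inf using x inv_v_le
    by (simp add: hardy_eq) (intro nn_integral_mono, auto split: split_indicator)
  also have "\<dots> = ennreal (1 / \<delta>) * emeasure J {c..x}"
    using x by (intro nn_integral_cmult_indicator sets_J) auto
  also have "\<dots> = ennreal (1 / \<delta> * (x - c))" using x \<delta> by (simp add: emeasure_J ennreal_mult[symmetric])
  also have "\<dots> \<le> ennreal (1 / \<delta> * (d - c))" using x \<delta> by (intro ennreal_leI mult_left_mono) auto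
  finally show ?thesis .
qed

lemma hardy_le_profile_inf:
  assumes f [measurable]: "f \<in> borel_measurable J" and nf: "wnorm \<infinity> c d v f < top" and x: "x \<in> {c..d}"
  shows "hardy c f x \<le> wnorm \<infinity> c d v f * profile \<infinity> c d v x"
proof -
  let ?n = "wnorm \<infinity> c d v f"
  have [measurable]: "{c..x} \<in> sets J" using x by (intro sets_J) auto
  have "AE t in J. f t * v t \<le> esssup J (\<lambda>t. f t * v t)" by (rule esssup_AE)
  then have "AE t in J. f t * v t \<le> ?n" by (simp add: wnorm_def)
  moreover have "AE t in J. t \<in> {c..d}" by (rule AE_I2) simp
  ultimately have "AE t in J. f t * indicator {c..x} t \<le> ?n * (inverse (v t) * indicator {c..x} t)"
  proof eventually_elim
    case (elim t)
    then have "f t \<le> ?n * inverse (v t)" using nf by (intro f_le_inv) auto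
    then show ?case by (auto split: split_indicator)
  qed
  then have "(\<integral>\<^sup>+ t\<in>{c..x}. f t \<partial>J) \<le> (\<integral>\<^sup>+ t. ?n * (inverse (v t) * indicator {c..x} t) \<partial>J)"
    by (rule nn_integral_mono_AE)
  also have "\<dots> = ?n * (\<integral>\<^sup>+ t\<in>{c..x}. inverse (v t) \<partial>J)" by (rule nn_integral_cmult) measurable
  finally show ?thesis unfolding profile_inf using x by (simp add: hardy_eq)
qed

lemma hardy_finite_inf:
  assumes "f \<in> borel_measurable J" "wnorm \<infinity> c d v f < top" "x \<in> {c..d}"
  shows "hardy c f x < top"
proof -
  have "profile \<infinity> c d v x < top" using profile_inf_le[OF assms(3)] by (rule le_less_trans) simp
  then have "wnorm \<infinity> c d v f * profile \<infinity> c d v x < top" using assms(2) by (simp add: ennreal_mult_less_top)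
  then show ?thesis by (rule le_less_trans[OF hardy_le_profile_inf[OF assms]])
qed

lemma inf_test:
  assumes n: "0 \<le> n"
  defines "f \<equiv> \<lambda>t. ennreal n * inverse (v t)"
  shows "f \<in> borel_measurable J" "wnorm \<infinity> c d v f \<le> ennreal n"
    "x \<in> {c..d} \<Longrightarrow> hardy c f x = ennreal n * profile \<infinity> c d v x"
proof -
  show f [measurable]: "f \<in> borel_measurable J" unfolding f_def by measurable
  have "f t * v t \<le> ennreal n" for t
  proof -
    have "inverse (v t) * v t \<le> 1"
    proof (cases "v t = 0 \<or> v t = top")
      case False
      then have "v t * inverse (v t) = 1"
        using ennreal_divide_self[of "v t"] by (simp add: divide_ennreal_def less_top[symmetric])
      then show ?thesis by (simp add: mult.commute)
    qed auto
    then have "ennreal n * (inverse (v t) * v t) \<le> ennreal n * 1" by (intro mult_left_mono) auto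
    then show ?thesis by (simp add: f_def mult.assoc)
  qed
  then have "esssup J (\<lambda>t. f t * v t) \<le> ennreal n" by (intro esssup_I) auto
  then show "wnorm \<infinity> c d v f \<le> ennreal n" by (simp add: wnorm_def)
  show "hardy c f x = ennreal n * profile \<infinity> c d v x" if x: "x \<in> {c..d}"
  proof -
    have [measurable]: "{c..x} \<in> sets J" using x by (intro sets_J) auto
    have "hardy c f x = (\<integral>\<^sup>+ t. ennreal n * (inverse (v t) * indicator {c..x} t) \<partial>J)"
      using x by (simp add: hardy_eq f_def mult.assoc)
    also have "\<dots> = ennreal n * (\<integral>\<^sup>+ t\<in>{c..x}. inverse (v t) \<partial>J)" by (rule nn_integral_cmult) measurable
    finally show ?thesis unfolding profile_inf using x by (simp add: hardy_eq)
  qed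
qed

text \<open>
  For an infinite exponent \<open>f \<le> \<parallel>f\<parallel> / v\<close> almost everywhere, so
  \<open>Hf \<le> \<parallel>f\<parallel> \<Phi>\<close>, with equality for all multiples of
  \<open>1/v\<close>. The factor \<open>\<Phi>\<^sup>q\<close> moves into the weight and constants
  remain.
\<close>

lemma bilinear_bound_inf_iff:
  assumes q: "0 < q" and C: "0 \<le> C" and S: "hardy_system c d p2 \<Phi>2 S2"
  shows "bilinear_bound c d q u (hardy_ops \<infinity> c d v) S2 C
    \<longleftrightarrow> bilinear_bound c d q (\<lambda>t. epow (profile \<infinity> c d v t) q * u t) const_ops S2 C"
proof
  assume h: "bilinear_bound c d q u (hardy_ops \<infinity> c d v) S2 C"
  show "bilinear_bound c d q (\<lambda>t. epow (profile \<infinity> c d v t) q * u t) const_ops S2 C"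
    unfolding bilinear_bound_def
  proof (intro ballI, clarify)
    fix F n G m assume "(F, n) \<in> const_ops" and G: "(G, m) \<in> S2"
    then have F: "F = (\<lambda>_. n)" and n: "0 \<le> n" by (auto simp: const_ops_def)
    let ?f = "\<lambda>t. ennreal n * inverse (v t)"
    have nf: "wnorm \<infinity> c d v ?f < top" using inf_test(2)[OF n] by (rule le_less_trans) simp
    have mem: "(\<lambda>x. enn2real (hardy c ?f x), enn2real (wnorm \<infinity> c d v ?f)) \<in> hardy_ops \<infinity> c d v"
      unfolding hardy_ops_def using inf_test(1)[OF n] nf by auto
    have m0: "0 \<le> m" and G0: "\<And>t. t \<in> {c..d} \<Longrightarrow> 0 \<le> G t" using hardy_systemD(1,2)[OF S G] by auto
    have "(\<integral>\<^sup>+ t. epow (ennreal (F t * G t)) q * (epow (profile \<infinity> c d v t) q * u t) \<partial>J)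
       = (\<integral>\<^sup>+ t. epow (ennreal (enn2real (hardy c ?f t) * G t)) q * u t \<partial>J)"
    proof (rule nn_integral_cong)
      fix t assume "t \<in> space J"
      then have t: "t \<in> {c..d}" by simp
      have "ennreal (enn2real (hardy c ?f t) * G t) = hardy c ?f t * ennreal (G t)"
        using hardy_finite_inf[OF inf_test(1)[OF n] nf t] G0[OF t] by (simp add: ennreal_mult)
      also have "\<dots> = ennreal (F t * G t) * profile \<infinity> c d v t"
        using n G0[OF t] by (simp add: inf_test(3)[OF n t] F ennreal_mult mult_ac)
      finally show "epow (ennreal (F t * G t)) q * (epow (profile \<infinity> c d v t) q * u t)
          = epow (ennreal (enn2real (hardy c ?f t) * G t)) q * u t"
        using q by (simp add: epow_mult mult.assoc)
    qed
    also have "\<dots> \<le> ennreal ((C * enn2real (wnorm \<infinity> c d v ?f) * m) powr q)"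
      by (rule bilinear_boundD[OF h mem G])
    also have "\<dots> \<le> ennreal ((C * n * m) powr q)"
    proof -
      have "enn2real (wnorm \<infinity> c d v ?f) \<le> n" using inf_test(2)[OF n] n by (intro enn2real_leI)
      then show ?thesis using C m0 q by (intro ennreal_leI powr_mono2 mult_right_mono mult_left_mono) auto
    qed
    finally show "(\<integral>\<^sup>+ t. epow (ennreal (F t * G t)) q * (epow (profile \<infinity> c d v t) q * u t) \<partial>J)
        \<le> ennreal ((C * n * m) powr q)" .
  qed
next
  assume h: "bilinear_bound c d q (\<lambda>t. epow (profile \<infinity> c d v t) q * u t) const_ops S2 C"
  show "bilinear_bound c d q u (hardy_ops \<infinity> c d v) S2 C"
    unfolding bilinear_bound_def
  proof (intro ballI, clarify)
    fix F n G m assume "(F, n) \<in> hardy_ops \<infinity> c d v" and G: "(G, m) \<in> S2"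
    then obtain f where f: "f \<in> borel_measurable J" "wnorm \<infinity> c d v f < top"
      and e: "F = (\<lambda>x. enn2real (hardy c f x))" "n = enn2real (wnorm \<infinity> c d v f)"
      unfolding hardy_ops_def by auto
    have G0: "\<And>t. t \<in> {c..d} \<Longrightarrow> 0 \<le> G t" using hardy_systemD(2)[OF S G] by auto
    have "(\<integral>\<^sup>+ t. epow (ennreal (F t * G t)) q * u t \<partial>J)
       \<le> (\<integral>\<^sup>+ t. epow (ennreal (n * G t)) q * (epow (profile \<infinity> c d v t) q * u t) \<partial>J)"
    proof (rule nn_integral_mono)
      fix t assume "t \<in> space J"
      then have t: "t \<in> {c..d}" by simp
      have "ennreal (F t * G t) = hardy c f t * ennreal (G t)"
        using hardy_finite_inf[OF f t] G0[OF t] by (simp add: e ennreal_mult)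
      also have "\<dots> \<le> (wnorm \<infinity> c d v f * profile \<infinity> c d v t) * ennreal (G t)"
        by (intro mult_right_mono hardy_le_profile_inf f t) auto
      also have "\<dots> = ennreal (n * G t) * profile \<infinity> c d v t"
        using f G0[OF t] by (simp add: e ennreal_mult mult_ac)
      finally have "epow (ennreal (F t * G t)) q \<le> epow (ennreal (n * G t) * profile \<infinity> c d v t) q"
        using q by (intro epow_mono)
      also have "\<dots> = epow (ennreal (n * G t)) q * epow (profile \<infinity> c d v t) q" using q by (rule epow_mult)
      finally have "epow (ennreal (F t * G t)) q * u t \<le> epow (ennreal (n * G t)) q * epow (profile \<infinity> c d v t) q * u t"
        by (intro mult_right_mono) auto
      then show "epow (ennreal (F t * G t)) q * u t \<le> epow (ennreal (n * G t)) q * (epow (profile \<infinity> c d v t) q * u t)"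
        by (simp add: mult.assoc)
    qed
    also have "\<dots> \<le> ennreal ((C * n * m) powr q)"
    proof -
      have mem: "(\<lambda>_. n, n) \<in> const_ops" by (auto simp: const_ops_def e)
      show ?thesis by (rule bilinear_boundD[OF h mem G])
    qed
    finally show "(\<integral>\<^sup>+ t. epow (ennreal (F t * G t)) q * u t \<partial>J) \<le> ennreal ((C * n * m) powr q)" .
  qed
qed

lemma weight_grid_inf:
  assumes "weight_grid c d q M u"
  shows "\<exists>M'. weight_grid c d q M' (\<lambda>t. epow (profile \<infinity> c d v t) q * u t)"
proof -
  interpret weight_grid c d q M u by fact
  define b where "b = 1 / \<delta> * (d - c)"
  have b: "0 \<le> b" using \<delta> cd by (simp add: b_def)
  note [measurable] = borel_measurable_profile_inf
  have [measurable]: "u \<in> borel_measurable J" by (rule u_meas)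
  have "weight_grid c d q (b powr q * M) (\<lambda>t. epow (profile \<infinity> c d v t) q * u t)"
  proof
    fix t assume t: "t \<in> {c..d}"
    have "epow (profile \<infinity> c d v t) q * u t \<le> epow (ennreal b) q * ennreal M"
      using profile_inf_le[OF t] u_le[OF t] q by (intro mult_mono epow_mono) (auto simp: b_def)
    also have "\<dots> = ennreal (b powr q * M)" using b M q by (simp add: epow_ennreal ennreal_mult)
    finally show "epow (profile \<infinity> c d v t) q * u t \<le> ennreal (b powr q * M)" .
  next
    show "(\<lambda>t. epow (profile \<infinity> c d v t) q * u t) \<in> borel_measurable (lebesgue_on {c..d})"
      by measurable
  qed (use cd q M in auto)
  then show ?thesis by blast
qed

end

section \<open>Regularisation\<close>

lemma reg_u_le: "reg_u m u t \<le> u t"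
  by (simp add: reg_u_def)

lemma reg_u_meas: "u \<in> borel_measurable N \<Longrightarrow> reg_u m u \<in> borel_measurable N"
  unfolding reg_u_def[abs_def] by measurable

lemma reg_v_meas: "v \<in> borel_measurable N \<Longrightarrow> reg_v m v \<in> borel_measurable N"
  unfolding reg_v_def[abs_def] by (intro borel_measurable_add) auto

lemma wnorm_mono_weight:
  assumes "1 \<le> p" and m: "(\<lambda>t. f t * v t) \<in> borel_measurable (lebesgue_on {c..d})" and le: "\<And>t. v t \<le> w t"
  shows "wnorm p c d v f \<le> wnorm p c d w f"
proof (cases "p = \<infinity>")
  case True
  then show ?thesis using m le by (simp add: wnorm_def) (intro esssup_mono mult_left_mono, auto)
next
  case False
  then have "p < top" by (simp add: less_top)
  then have p: "0 < enn2real p" using assms(1) by (simp add: enn2real_positive_iff less_le_trans[OF _ assms(1)])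
  show ?thesis using p False le
    by (simp add: wnorm_def) (intro epow_mono nn_integral_mono mult_left_mono, auto)
qed

lemma wnorm_mono_fun:
  assumes "1 \<le> p" and m: "(\<lambda>t. f t * v t) \<in> borel_measurable (lebesgue_on {c..d})" and le: "\<And>t. f t \<le> g t"
  shows "wnorm p c d v f \<le> wnorm p c d v g"
proof (cases "p = \<infinity>")
  case True
  then show ?thesis using m le by (simp add: wnorm_def) (intro esssup_mono mult_right_mono, auto)
next
  case False
  then have "p < top" by (simp add: less_top)
  then have p: "0 < enn2real p" using assms(1) by (simp add: enn2real_positive_iff less_le_trans[OF _ assms(1)])
  show ?thesis using p False le
    by (simp add: wnorm_def) (intro epow_mono nn_integral_mono mult_right_mono, auto intro!: epow_mono)
qed

lemma wnorm_ennreal: "0 < q \<Longrightarrow> wnorm (ennreal q) c d u h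
    = epow (\<integral>\<^sup>+ t. epow (h t) q * u t \<partial>lebesgue_on {c..d}) (1 / q)"
  by (simp add: wnorm_def)

lemma wnorm_mono_outer:
  assumes "0 < q" "\<And>t. u t \<le> w t"
  shows "wnorm (ennreal q) c d u h \<le> wnorm (ennreal q) c d w h"
  unfolding wnorm_ennreal[OF assms(1)] using assms
  by (intro epow_mono nn_integral_mono mult_left_mono) auto

text \<open>
  Regularisation raises the norms on the right and lowers the one on the left.
\<close>

lemma hardy_ineq_reg:
  assumes q: "0 < q" and p: "1 \<le> p1" "1 \<le> p2"
    and v1: "v1 \<in> borel_measurable (lebesgue_on {c..d})" and v2: "v2 \<in> borel_measurable (lebesgue_on {c..d})"
    and h: "hardy_ineq q p1 p2 c d u v1 v2 C"
  shows "hardy_ineq q p1 p2 c d (reg_u m u) (reg_v m v1) (reg_v m v2) C"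
  unfolding hardy_ineq_def
proof (intro ballI impI)
  fix f g assume f [measurable]: "f \<in> borel_measurable (lebesgue_on {c..d})"
    and g [measurable]: "g \<in> borel_measurable (lebesgue_on {c..d})"
    and nf: "wnorm p1 c d (reg_v m v1) f < \<infinity>" and ng: "wnorm p2 c d (reg_v m v2) g < \<infinity>"
  note [measurable] = v1 v2
  have lf: "wnorm p1 c d v1 f \<le> wnorm p1 c d (reg_v m v1) f"
    by (intro wnorm_mono_weight p) (auto simp: reg_v_def)
  have lg: "wnorm p2 c d v2 g \<le> wnorm p2 c d (reg_v m v2) g"
    by (intro wnorm_mono_weight p) (auto simp: reg_v_def)
  have "wnorm (ennreal q) c d (reg_u m u) (bilinear_hardy c f g) \<le> wnorm (ennreal q) c d u (bilinear_hardy c f g)"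
    by (intro wnorm_mono_outer q reg_u_le)
  also have "\<dots> \<le> C * wnorm p1 c d v1 f * wnorm p2 c d v2 g"
    using h f g le_less_trans[OF lf nf] le_less_trans[OF lg ng] unfolding hardy_ineq_def by simp
  also have "\<dots> \<le> C * wnorm p1 c d (reg_v m v1) f * wnorm p2 c d (reg_v m v2) g"
    by (intro mult_mono lf lg) auto
  finally show "wnorm (ennreal q) c d (reg_u m u) (bilinear_hardy c f g)
     \<le> C * wnorm p1 c d (reg_v m v1) f * wnorm p2 c d (reg_v m v2) g" .
qed

text \<open>
  A bounded function has a finite integral of its \<open>p\<close>-th power over \<open>[c,
  d]\<close>, so the contribution of \<open>1/m\<close> vanishes in the limit. For unbounded functions
  it could be infinite for every \<open>m\<close>.
\<close>

lemma wnorm_reg_tendsto: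
  assumes p: "1 \<le> p" and cd: "c < d" and f [measurable]: "f \<in> borel_measurable (lebesgue_on {c..d})"
    and v [measurable]: "v \<in> borel_measurable (lebesgue_on {c..d})"
    and b: "\<And>t. f t \<le> of_nat n" and fin: "wnorm p c d v f < top"
  shows "(\<lambda>m. wnorm p c d (reg_v m v) f) \<longlonglongrightarrow> wnorm p c d v f"
proof -
  have lim0: "(\<lambda>m. ennreal (B * (1 / real m))) \<longlonglongrightarrow> ennreal (B * 0)" for B
    by (intro tendsto_ennrealI tendsto_mult tendsto_const lim_1_over_n)
  show ?thesis
  proof (cases "p = top")
    case True
    have eq: "wnorm p c d w f = esssup (lebesgue_on {c..d}) (\<lambda>t. f t * w t)" for w
      by (simp add: wnorm_def True)
    have "(\<lambda>m. wnorm p c d v f + ennreal (real n * (1 / real m))) \<longlonglongrightarrow> wnorm p c d v f + ennreal (real n * 0)"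
      by (intro tendsto_add tendsto_const lim0)
    then have up: "(\<lambda>m. wnorm p c d v f + ennreal (real n * (1 / real m))) \<longlonglongrightarrow> wnorm p c d v f" by simp
    show ?thesis
    proof (rule tendsto_sandwich[OF _ _ tendsto_const up])
      show "\<forall>\<^sub>F m in sequentially. wnorm p c d v f \<le> wnorm p c d (reg_v m v) f"
        by (intro always_eventually allI wnorm_mono_weight p) (auto simp: reg_v_def)
      have "wnorm p c d (reg_v m v) f \<le> wnorm p c d v f + ennreal (real n * (1 / real m))" for m
        unfolding eq
      proof (rule esssup_I)
        have [measurable]: "reg_v m v \<in> borel_measurable (lebesgue_on {c..d})" by (rule reg_v_meas[OF v])
        show "(\<lambda>t. f t * reg_v m v t) \<in> borel_measurable (lebesgue_on {c..d})" by measurable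
        have "AE t in lebesgue_on {c..d}. f t * v t \<le> esssup (lebesgue_on {c..d}) (\<lambda>t. f t * v t)" by (rule esssup_AE)
        then show "AE t in lebesgue_on {c..d}. f t * reg_v m v t
            \<le> esssup (lebesgue_on {c..d}) (\<lambda>t. f t * v t) + ennreal (real n * (1 / real m))"
        proof (rule eventually_mono)
          fix t assume "f t * v t \<le> esssup (lebesgue_on {c..d}) (\<lambda>t. f t * v t)"
          moreover have "f t * ennreal (1 / real m) \<le> ennreal (real n * (1 / real m))"
          proof -
            have "f t * ennreal (1 / real m) \<le> of_nat n * ennreal (1 / real m)" by (intro mult_right_mono b) auto
            also have "\<dots> = ennreal (real n * (1 / real m))"
              unfolding ennreal_of_nat_eq_real_of_nat by (rule ennreal_mult[symmetric]) auto
            finally show ?thesis .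
          qed
          ultimately show "f t * reg_v m v t \<le> esssup (lebesgue_on {c..d}) (\<lambda>t. f t * v t) + ennreal (real n * (1 / real m))"
            unfolding reg_v_def distrib_left by (rule add_mono)
        qed
      qed
      then show "\<forall>\<^sub>F m in sequentially. wnorm p c d (reg_v m v) f \<le> wnorm p c d v f + ennreal (real n * (1 / real m))"
        by (intro always_eventually allI)
    qed
  next
    case False
    define e where "e = enn2real p"
    have p_eq: "p = ennreal e" using False by (simp add: e_def less_top[symmetric])
    have e: "1 \<le> e" using p unfolding p_eq by (simp add: ennreal_ge_1)
    then have e0: "0 < e" by simp
    define A where "A = (\<integral>\<^sup>+ t. epow (f t) e * v t \<partial>lebesgue_on {c..d})"
    define B where "B = (\<integral>\<^sup>+ t. epow (f t) e \<partial>lebesgue_on {c..d})"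
    have "B \<le> (\<integral>\<^sup>+ t. ennreal (real n powr e) \<partial>lebesgue_on {c..d})"
      unfolding B_def
    proof (rule nn_integral_mono)
      fix t
      have "epow (f t) e \<le> epow (ennreal (real n)) e"
        using b[of t] e0 by (intro epow_mono) (auto simp: ennreal_of_nat_eq_real_of_nat)
      then show "epow (f t) e \<le> ennreal (real n powr e)" using e0 by (simp add: epow_ennreal)
    qed
    also have "\<dots> = ennreal (real n powr e) * emeasure (lebesgue_on {c..d}) {c..d}"
      by (simp add: emeasure_restrict_space)
    also have "\<dots> < top" using cd by (simp add: emeasure_restrict_space ennreal_mult_less_top)
    finally obtain s where s: "B = ennreal s" "0 \<le> s" by (cases B rule: ennreal_cases) auto
    have int: "(\<integral>\<^sup>+ t. epow (f t) e * reg_v m v t \<partial>lebesgue_on {c..d}) = A + ennreal (s * (1 / real m))" for m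
    proof -
      have "(\<integral>\<^sup>+ t. epow (f t) e * reg_v m v t \<partial>lebesgue_on {c..d})
          = (\<integral>\<^sup>+ t. epow (f t) e * v t + epow (f t) e * ennreal (1 / real m) \<partial>lebesgue_on {c..d})"
        by (simp add: reg_v_def distrib_left)
      also have "\<dots> = A + (\<integral>\<^sup>+ t. epow (f t) e * ennreal (1 / real m) \<partial>lebesgue_on {c..d})"
        unfolding A_def by (rule nn_integral_add) measurable
      also have "(\<integral>\<^sup>+ t. epow (f t) e * ennreal (1 / real m) \<partial>lebesgue_on {c..d}) = B * ennreal (1 / real m)"
        unfolding B_def by (rule nn_integral_multc) measurable
      also have "\<dots> = ennreal (s * (1 / real m))" unfolding s(1) using s(2) by (intro ennreal_mult[symmetric]) auto
      finally show ?thesis .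
    qed
    have A: "A < top" using fin e0 unfolding p_eq by (simp add: wnorm_ennreal A_def[symmetric] epow_less_top_iff)
    have "(\<lambda>m. A + ennreal (s * (1 / real m))) \<longlonglongrightarrow> A + ennreal (s * 0)"
      by (intro tendsto_add tendsto_const lim0)
    then have "(\<lambda>m. A + ennreal (s * (1 / real m))) \<longlonglongrightarrow> A" by simp
    then have "(\<lambda>m. epow (A + ennreal (s * (1 / real m))) (1 / e)) \<longlonglongrightarrow> epow A (1 / e)"
      using A e0 by (intro tendsto_epow) auto
    then show ?thesis unfolding p_eq wnorm_ennreal[OF e0] int A_def .
  qed
qed

lemma SUP_min_of_nat: "(SUP n. min x (of_nat n)) = (x::ennreal)"
proof -
  have "(SUP n. inf x (of_nat n)) = inf x (SUP n. of_nat n)" by (rule inf_SUP[symmetric])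
  then show ?thesis by (simp add: ennreal_SUP_of_nat_eq_top inf_min)
qed

lemma min_of_nat_mono: "n \<le> k \<Longrightarrow> min (x::ennreal) (of_nat n) \<le> min x (of_nat k)"
  by (intro min.mono) auto

lemma hardy_SUP_truncation:
  assumes f: "f \<in> borel_measurable (lebesgue_on {c..d})" and t: "t \<le> d"
  shows "hardy c f t = (SUP n. hardy c (\<lambda>s. min (f s) (of_nat n)) t)"
proof -
  have [measurable]: "f \<in> borel_measurable (lebesgue_on {c..t})"
    using t by (intro measurable_restrict_mono[OF f]) auto
  have "(\<integral>\<^sup>+ s. (SUP n. min (f s) (of_nat n)) \<partial>lebesgue_on {c..t}) = (SUP n. \<integral>\<^sup>+ s. min (f s) (of_nat n) \<partial>lebesgue_on {c..t})"
  proof (rule nn_integral_monotone_convergence_SUP)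
    show "incseq (\<lambda>n s. min (f s) (of_nat n))" by (intro incseq_SucI le_funI min_of_nat_mono) simp
  qed measurable
  then show ?thesis by (simp add: hardy_def SUP_min_of_nat)
qed

lemma truncated_bound_extends:
  fixes X :: ennreal
  assumes q: "0 < q" and f: "f \<in> borel_measurable (lebesgue_on {c..d})"
    and w [measurable]: "w \<in> borel_measurable (lebesgue_on {c..d})" and h [measurable]: "h \<in> borel_measurable (lebesgue_on {c..d})"
    and b: "\<And>n. (\<integral>\<^sup>+ t. epow (hardy c (\<lambda>s. min (f s) (of_nat n)) t * h t) q * w t \<partial>lebesgue_on {c..d}) \<le> X"
  shows "(\<integral>\<^sup>+ t. epow (hardy c f t * h t) q * w t \<partial>lebesgue_on {c..d}) \<le> X"
proof -
  let ?f = "\<lambda>n s. min (f s) (of_nat n)"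
  note [measurable] = borel_measurable_hardy
  have "(\<integral>\<^sup>+ t. epow (hardy c f t * h t) q * w t \<partial>lebesgue_on {c..d})
     = (\<integral>\<^sup>+ t. (SUP n. epow (hardy c (?f n) t * h t) q * w t) \<partial>lebesgue_on {c..d})"
  proof (rule nn_integral_cong)
    fix t assume "t \<in> space (lebesgue_on {c..d})"
    then have "hardy c f t = (SUP n. hardy c (?f n) t)" using f by (intro hardy_SUP_truncation) auto
    then show "epow (hardy c f t * h t) q * w t = (SUP n. epow (hardy c (?f n) t * h t) q * w t)"
      using q by (simp add: SUP_mult_right_ennreal epow_SUP)
  qed
  also have "\<dots> = (SUP n. \<integral>\<^sup>+ t. epow (hardy c (?f n) t * h t) q * w t \<partial>lebesgue_on {c..d})"
  proof (rule nn_integral_monotone_convergence_SUP)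
    have "hardy c (?f n) t \<le> hardy c (?f (Suc n)) t" for n t
      unfolding hardy_def by (intro nn_integral_mono min_of_nat_mono) simp
    then show "incseq (\<lambda>n t. epow (hardy c (?f n) t * h t) q * w t)"
      using q by (intro incseq_SucI le_funI mult_right_mono epow_mono) auto
  qed measurable
  also have "\<dots> \<le> X" by (intro SUP_least b)
  finally show ?thesis .
qed

lemma reg_u_bound_extends:
  fixes X :: ennreal
  assumes u [measurable]: "u \<in> borel_measurable (lebesgue_on {c..d})" and h [measurable]: "h \<in> borel_measurable (lebesgue_on {c..d})"
    and b: "\<And>n. (\<integral>\<^sup>+ t. h t * reg_u n u t \<partial>lebesgue_on {c..d}) \<le> X"
  shows "(\<integral>\<^sup>+ t. h t * u t \<partial>lebesgue_on {c..d}) \<le> X"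
proof -
  have [measurable]: "reg_u n u \<in> borel_measurable (lebesgue_on {c..d})" for n by (rule reg_u_meas[OF u])
  have "u t = (SUP n. reg_u n u t)" for t by (simp add: reg_u_def SUP_min_of_nat)
  then have "(\<integral>\<^sup>+ t. h t * u t \<partial>lebesgue_on {c..d}) = (\<integral>\<^sup>+ t. (SUP n. h t * reg_u n u t) \<partial>lebesgue_on {c..d})"
    by (simp add: SUP_mult_left_ennreal)
  also have "\<dots> = (SUP n. \<integral>\<^sup>+ t. h t * reg_u n u t \<partial>lebesgue_on {c..d})"
  proof (rule nn_integral_monotone_convergence_SUP)
    show "incseq (\<lambda>n t. h t * reg_u n u t)"
      unfolding reg_u_def by (intro incseq_SucI le_funI mult_left_mono min_of_nat_mono) auto
  qed measurable
  also have "\<dots> \<le> X" by (intro SUP_least b)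
  finally show ?thesis .
qed

text \<open>
  For truncated functions and a fixed \<open>reg_u m u\<close> the weights \<open>reg_v j v1\<close>,
  \<open>reg_v j v2\<close> pass to their limits. Then the truncations of \<open>u\<close>,
  \<open>f\<close> and \<open>g\<close> are removed one after the other, each by monotone convergence
  with the others fixed, which avoids limits of products of the form \<open>0 \<cdot>
  \<infinity>\<close>.
\<close>

lemma hardy_ineq_of_reg:
  assumes q: "0 < q" and p: "1 \<le> p1" "1 \<le> p2" and cd: "c < d"
    and u: "u \<in> borel_measurable (lebesgue_on {c..d})"
    and v1: "v1 \<in> borel_measurable (lebesgue_on {c..d})" and v2: "v2 \<in> borel_measurable (lebesgue_on {c..d})"
    and C: "C < top"
    and h: "\<And>m. 1 \<le> m \<Longrightarrow> hardy_ineq q p1 p2 c d (reg_u m u) (reg_v m v1) (reg_v m v2) C"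
  shows "hardy_ineq q p1 p2 c d u v1 v2 C"
  unfolding hardy_ineq_def
proof (intro ballI impI)
  fix f g assume f [measurable]: "f \<in> borel_measurable (lebesgue_on {c..d})"
    and g [measurable]: "g \<in> borel_measurable (lebesgue_on {c..d})"
    and nf: "wnorm p1 c d v1 f < \<infinity>" and ng: "wnorm p2 c d v2 g < \<infinity>"
  note [measurable] = u v1 v2 borel_measurable_hardy
  let ?X = "C * wnorm p1 c d v1 f * wnorm p2 c d v2 g"
  define F where "F n s = min (f s) (of_nat n)" for n :: nat and s
  define G where "G n s = min (g s) (of_nat n)" for n :: nat and s
  have mF [measurable]: "F n \<in> borel_measurable (lebesgue_on {c..d})" for n unfolding F_def by measurable
  have mG [measurable]: "G n \<in> borel_measurable (lebesgue_on {c..d})" for n unfolding G_def by measurable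
  have FX: "wnorm p1 c d v1 (F n) \<le> wnorm p1 c d v1 f" for n
    by (intro wnorm_mono_fun p) (auto simp: F_def)
  have GX: "wnorm p2 c d v2 (G n) \<le> wnorm p2 c d v2 g" for n
    by (intro wnorm_mono_fun p) (auto simp: G_def)
  have Ffin: "wnorm p1 c d v1 (F n) < top" and Gfin: "wnorm p2 c d v2 (G n) < top" for n
    using le_less_trans[OF FX nf] le_less_trans[OF GX ng] by simp_all
  have step: "wnorm (ennreal q) c d (reg_u m u) (bilinear_hardy c (F n) (G k)) \<le> ?X" for m n k
  proof -
    have tF: "(\<lambda>j. wnorm p1 c d (reg_v j v1) (F n)) \<longlonglongrightarrow> wnorm p1 c d v1 (F n)"
      by (rule wnorm_reg_tendsto[OF p(1) cd mF v1 _ Ffin, where n = n]) (simp add: F_def)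
    have tG: "(\<lambda>j. wnorm p2 c d (reg_v j v2) (G k)) \<longlonglongrightarrow> wnorm p2 c d v2 (G k)"
      by (rule wnorm_reg_tendsto[OF p(2) cd mG v2 _ Gfin, where n = k]) (simp add: G_def)
    have "(\<lambda>j. C * wnorm p1 c d (reg_v j v1) (F n) * wnorm p2 c d (reg_v j v2) (G k))
       \<longlonglongrightarrow> C * wnorm p1 c d v1 (F n) * wnorm p2 c d v2 (G k)"
      using C Ffin[of n] Gfin[of k]
      by (intro tendsto_mult_ennreal tendsto_const tF tG) (auto simp: ennreal_mult_eq_top_iff)
    moreover have "\<forall>\<^sub>F j in sequentially. wnorm (ennreal q) c d (reg_u m u) (bilinear_hardy c (F n) (G k))
        \<le> C * wnorm p1 c d (reg_v j v1) (F n) * wnorm p2 c d (reg_v j v2) (G k)"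
    proof -
      have "\<forall>\<^sub>F j in sequentially. wnorm p1 c d (reg_v j v1) (F n) < top" using order_tendstoD(2)[OF tF Ffin] .
      moreover have "\<forall>\<^sub>F j in sequentially. wnorm p2 c d (reg_v j v2) (G k) < top" using order_tendstoD(2)[OF tG Gfin] .
      moreover have "\<forall>\<^sub>F j in sequentially. max m 1 \<le> j" by (rule eventually_ge_at_top)
      ultimately show ?thesis
      proof eventually_elim
        case (elim j)
        have "wnorm (ennreal q) c d (reg_u m u) (bilinear_hardy c (F n) (G k))
           \<le> wnorm (ennreal q) c d (reg_u j u) (bilinear_hardy c (F n) (G k))"
          unfolding reg_u_def using elim(3) by (intro wnorm_mono_outer q min_of_nat_mono) auto
        also have "\<dots> \<le> C * wnorm p1 c d (reg_v j v1) (F n) * wnorm p2 c d (reg_v j v2) (G k)"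
          using h[of j] elim mF mG unfolding hardy_ineq_def by simp
        finally show ?case .
      qed
    qed
    ultimately have "wnorm (ennreal q) c d (reg_u m u) (bilinear_hardy c (F n) (G k))
       \<le> C * wnorm p1 c d v1 (F n) * wnorm p2 c d v2 (G k)"
      by (rule tendsto_lowerbound) simp
    also have "\<dots> \<le> ?X" by (intro mult_mono FX GX) auto
    finally show ?thesis .
  qed
  have 1: "(\<integral>\<^sup>+ t. epow (hardy c (F n) t * hardy c (G k) t) q * u t \<partial>lebesgue_on {c..d}) \<le> epow ?X q" for n k
  proof (rule reg_u_bound_extends[OF u])
    show "(\<integral>\<^sup>+ t. epow (hardy c (F n) t * hardy c (G k) t) q * reg_u m u t \<partial>lebesgue_on {c..d}) \<le> epow ?X q" for m
      using step[of m n k] q by (simp add: wnorm_ennreal epow_le_iff bilinear_hardy_def)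
  qed measurable
  have 2: "(\<integral>\<^sup>+ t. epow (hardy c f t * hardy c (G k) t) q * u t \<partial>lebesgue_on {c..d}) \<le> epow ?X q" for k
    by (rule truncated_bound_extends[OF q f u _ 1[unfolded F_def]]) measurable
  have "(\<integral>\<^sup>+ t. epow (hardy c g t * hardy c f t) q * u t \<partial>lebesgue_on {c..d}) \<le> epow ?X q"
  proof (rule truncated_bound_extends[OF q g u])
    show "(\<integral>\<^sup>+ t. epow (hardy c (\<lambda>s. min (g s) (of_nat k)) t * hardy c f t) q * u t \<partial>lebesgue_on {c..d}) \<le> epow ?X q" for k
      using 2[of k] by (simp add: G_def[abs_def] mult.commute)
  qed measurable
  then show "wnorm (ennreal q) c d u (bilinear_hardy c f g) \<le> ?X"
    using q by (simp add: wnorm_ennreal epow_le_iff bilinear_hardy_def mult.commute)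
qed

section \<open>The equivalence\<close>

text \<open>
  The analogue of \<open>characterizes_with\<close> for the operator itself and exponents in
  \<open>[1, \<infinity>]\<close>, for bounded \<open>u\<close> and \<open>v\<close>'s bounded below.
\<close>

definition governs_with :: "real \<Rightarrow> ennreal \<Rightarrow> ennreal \<Rightarrow> char_fun \<Rightarrow> real \<Rightarrow> bool" where
  "governs_with q p1 p2 A K \<longleftrightarrow> (\<forall>c d u M \<delta> v1 v2.
     weight_grid c d q M u \<longrightarrow> reg_weight c d \<delta> v1 \<longrightarrow> reg_weight c d \<delta> v2 \<longrightarrow>
       (\<forall>C\<ge>0. hardy_ineq q p1 p2 c d u v1 v2 (ennreal C) \<longrightarrow>
          A c d u (profile p1 c d v1) (profile p2 c d v2) \<le> ennreal (K * C)) \<and>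
       (\<forall>X\<ge>0. A c d u (profile p1 c d v1) (profile p2 c d v2) \<le> ennreal X \<longrightarrow>
          hardy_ineq q p1 p2 c d u v1 v2 (ennreal (K * X))))"

lemma governs_withD:
  assumes "governs_with q p1 p2 A K"
    and "weight_grid c d q M u" "reg_weight c d \<delta> v1" "reg_weight c d \<delta> v2"
  shows "0 \<le> C \<Longrightarrow> hardy_ineq q p1 p2 c d u v1 v2 (ennreal C) \<Longrightarrow>
       A c d u (profile p1 c d v1) (profile p2 c d v2) \<le> ennreal (K * C)"
    and "0 \<le> X \<Longrightarrow> A c d u (profile p1 c d v1) (profile p2 c d v2) \<le> ennreal X \<Longrightarrow>
       hardy_ineq q p1 p2 c d u v1 v2 (ennreal (K * X))"
proof -
  note a = assms(1)[unfolded governs_with_def, rule_format, OF assms(2-4)]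
  show "0 \<le> C \<Longrightarrow> hardy_ineq q p1 p2 c d u v1 v2 (ennreal C) \<Longrightarrow>
       A c d u (profile p1 c d v1) (profile p2 c d v2) \<le> ennreal (K * C)"
    by (rule conjunct1[OF a, rule_format])
  show "0 \<le> X \<Longrightarrow> A c d u (profile p1 c d v1) (profile p2 c d v2) \<le> ennreal X \<Longrightarrow>
       hardy_ineq q p1 p2 c d u v1 v2 (ennreal (K * X))"
    by (rule conjunct2[OF a, rule_format])
qed

lemma governs_finite:
  assumes A: "characterizes q p1 p2 A" and q: "0 < q" and p: "1 \<le> p1" "1 \<le> p2"
  shows "\<exists>K>0. governs_with q (ennreal p1) (ennreal p2) A K"
proof -
  obtain K where K: "0 < K" "characterizes_with q p1 p2 A K" using A unfolding characterizes_def by blast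
  have "governs_with q (ennreal p1) (ennreal p2) A K"
    unfolding governs_with_def
  proof (intro allI impI)
    fix c d u M \<delta> v1 v2
    assume W: "weight_grid c d q M u" and v1: "reg_weight c d \<delta> v1" and v2: "reg_weight c d \<delta> v2"
    interpret v1: reg_weight c d \<delta> v1 by fact
    interpret v2: reg_weight c d \<delta> v2 by fact
    let ?P1 = "profile (ennreal p1) c d v1" and ?P2 = "profile (ennreal p2) c d v2"
    note D = characterizes_withD[OF K(2) W v1.is_profile_profile[OF p(1)] v2.is_profile_profile[OF p(2)]
        v1.hardy_system_hardy_ops[OF p(1)] v2.hardy_system_hardy_ops[OF p(2)]]
    have iff: "hardy_ineq q (ennreal p1) (ennreal p2) c d u v1 v2 (ennreal C)
      \<longleftrightarrow> bilinear_bound c d q u (hardy_ops (ennreal p1) c d v1) (hardy_ops (ennreal p2) c d v2) C" if "0 \<le> C" for C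
      using v1.hardy_finite[OF p(1)] v2.hardy_finite[OF p(2)]
      by (intro hardy_ineq_iff_bilinear_bound q that) auto
    show "(\<forall>C\<ge>0. hardy_ineq q (ennreal p1) (ennreal p2) c d u v1 v2 (ennreal C) \<longrightarrow> A c d u ?P1 ?P2 \<le> ennreal (K * C)) \<and>
       (\<forall>X\<ge>0. A c d u ?P1 ?P2 \<le> ennreal X \<longrightarrow> hardy_ineq q (ennreal p1) (ennreal p2) c d u v1 v2 (ennreal (K * X)))"
      using D K(1) by (simp add: iff)
  qed
  then show ?thesis using K(1) by blast
qed

lemma governs_swap:
  assumes "governs_with q p1 p2 A K"
  shows "governs_with q p2 p1 (\<lambda>c d u \<Phi>1 \<Phi>2. A c d u \<Phi>2 \<Phi>1) K"
  unfolding governs_with_def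
proof (intro allI impI conjI)
  fix c d u M \<delta> v1 v2
  assume a: "weight_grid c d q M u" "reg_weight c d \<delta> v1" "reg_weight c d \<delta> v2"
  note D = governs_withD[OF assms a(1,3,2)]
  fix C :: real assume C: "0 \<le> C"
  show "A c d u (profile p1 c d v2) (profile p2 c d v1) \<le> ennreal (K * C)"
    if "hardy_ineq q p2 p1 c d u v1 v2 (ennreal C)"
    using C hardy_ineq_swap[OF that] by (rule D(1))
  show "hardy_ineq q p2 p1 c d u v1 v2 (ennreal (K * C))"
    if "A c d u (profile p1 c d v2) (profile p2 c d v1) \<le> ennreal C"
    by (rule hardy_ineq_swap[OF D(2)[OF C that]])
qed

text \<open>
  The constants form a Hardy system with exponent \<open>q\<close> and profile 1, so a characteristic
  for the exponents \<open>q\<close> and \<open>p2\<close> applies, with the weight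
  \<open>\<Phi>1\<^sup>q u\<close>.
\<close>

lemma governs_inf_left:
  assumes A: "characterizes q q p2 A" and q: "0 < q" and p: "1 \<le> p2"
  shows "\<exists>K>0. governs_with q \<infinity> (ennreal p2) (\<lambda>c d u \<Phi>1 \<Phi>2. A c d (\<lambda>t. epow (\<Phi>1 t) q * u t) (\<lambda>_. 1) \<Phi>2) K"
proof -
  obtain K where K: "0 < K" "characterizes_with q q p2 A K" using A unfolding characterizes_def by blast
  have "governs_with q \<infinity> (ennreal p2) (\<lambda>c d u \<Phi>1 \<Phi>2. A c d (\<lambda>t. epow (\<Phi>1 t) q * u t) (\<lambda>_. 1) \<Phi>2) K"
    unfolding governs_with_def
  proof (intro allI impI)
    fix c d u M \<delta> v1 v2
    assume W: "weight_grid c d q M u" and v1: "reg_weight c d \<delta> v1" and v2: "reg_weight c d \<delta> v2"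
    interpret v1: reg_weight c d \<delta> v1 by fact
    interpret v2: reg_weight c d \<delta> v2 by fact
    let ?P1 = "profile \<infinity> c d v1" and ?P2 = "profile (ennreal p2) c d v2"
    let ?w = "\<lambda>t. epow (?P1 t) q * u t"
    obtain M' where W': "weight_grid c d q M' ?w" using v1.weight_grid_inf[OF W] by blast
    note S2 = v2.hardy_system_hardy_ops[OF p]
    note D = characterizes_withD[OF K(2) W' is_profile_const v2.is_profile_profile[OF p]
        hardy_system_const_ops[OF q] S2]
    have iff: "hardy_ineq q \<infinity> (ennreal p2) c d u v1 v2 (ennreal C)
      \<longleftrightarrow> bilinear_bound c d q ?w const_ops (hardy_ops (ennreal p2) c d v2) C" if C: "0 \<le> C" for C
      unfolding v1.bilinear_bound_inf_iff[OF q C S2, symmetric]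
      using v1.hardy_finite_inf v2.hardy_finite[OF p]
      by (intro hardy_ineq_iff_bilinear_bound q that) auto
    show "(\<forall>C\<ge>0. hardy_ineq q \<infinity> (ennreal p2) c d u v1 v2 (ennreal C) \<longrightarrow> A c d ?w (\<lambda>_. 1) ?P2 \<le> ennreal (K * C)) \<and>
       (\<forall>X\<ge>0. A c d ?w (\<lambda>_. 1) ?P2 \<le> ennreal X \<longrightarrow> hardy_ineq q \<infinity> (ennreal p2) c d u v1 v2 (ennreal (K * X)))"
    proof (intro conjI allI impI)
      fix C :: real assume "0 \<le> C" "hardy_ineq q \<infinity> (ennreal p2) c d u v1 v2 (ennreal C)"
      then show "A c d ?w (\<lambda>_. 1) ?P2 \<le> ennreal (K * C)" using D(1)[of C] iff[of C] by blast
    next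
      fix X :: real assume X: "0 \<le> X" "A c d ?w (\<lambda>_. 1) ?P2 \<le> ennreal X"
      have "0 \<le> K * X" using X(1) K(1) by simp
      then show "hardy_ineq q \<infinity> (ennreal p2) c d u v1 v2 (ennreal (K * X))" using D(2)[OF X] iff[of "K * X"] by blast
    qed
  qed
  then show ?thesis using K(1) by blast
qed

text \<open>
  Both extremals \<open>1/v1\<close> and \<open>1/v2\<close> are exact, so no constant is lost.
\<close>

lemma governs_inf_inf:
  assumes q: "0 < q"
  shows "governs_with q \<infinity> \<infinity> (B_inf_inf q) 1"
  unfolding governs_with_def
proof (intro allI impI)
  fix c d u M \<delta> v1 v2
  assume W: "weight_grid c d q M u" and v1: "reg_weight c d \<delta> v1" and v2: "reg_weight c d \<delta> v2"
  interpret v1: reg_weight c d \<delta> v1 by fact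
  interpret v2: reg_weight c d \<delta> v2 by fact
  let ?P1 = "profile \<infinity> c d v1" and ?P2 = "profile \<infinity> c d v2"
  have B: "B_inf_inf q c d u ?P1 ?P2 = epow (\<integral>\<^sup>+ t. epow (?P1 t * ?P2 t) q * u t \<partial>lebesgue_on {c..d}) (1 / q)"
    by (simp add: B_inf_inf_def)
  have lower: "B_inf_inf q c d u ?P1 ?P2 \<le> ennreal C"
    if C: "0 \<le> C" and h: "hardy_ineq q \<infinity> \<infinity> c d u v1 v2 (ennreal C)" for C
  proof -
    let ?f = "\<lambda>t. ennreal 1 * inverse (v1 t)" and ?g = "\<lambda>t. ennreal 1 * inverse (v2 t)"
    note f = v1.inf_test[of 1, OF zero_le_one] and g = v2.inf_test[of 1, OF zero_le_one]
    have nf: "wnorm \<infinity> c d v1 ?f < \<infinity>" using f(2) by (rule le_less_trans) simp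
    have ng: "wnorm \<infinity> c d v2 ?g < \<infinity>" using g(2) by (rule le_less_trans) simp
    have "B_inf_inf q c d u ?P1 ?P2 = wnorm (ennreal q) c d u (bilinear_hardy c ?f ?g)"
      unfolding B wnorm_ennreal[OF q] using f(3) g(3)
      by (intro arg_cong2[where f = epow] nn_integral_cong refl) (simp add: bilinear_hardy_def)
    also have "\<dots> \<le> ennreal C * wnorm \<infinity> c d v1 ?f * wnorm \<infinity> c d v2 ?g"
      using h[unfolded hardy_ineq_def, rule_format, OF f(1) g(1) nf ng] .
    also have "\<dots> \<le> ennreal C * ennreal 1 * ennreal 1" by (intro mult_mono f(2) g(2)) auto
    finally show ?thesis by simp
  qed
  have upper: "hardy_ineq q \<infinity> \<infinity> c d u v1 v2 (ennreal X)" if X: "B_inf_inf q c d u ?P1 ?P2 \<le> ennreal X" for X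
    unfolding hardy_ineq_def
  proof (intro ballI impI)
    fix f g assume f: "f \<in> borel_measurable (lebesgue_on {c..d})" and g: "g \<in> borel_measurable (lebesgue_on {c..d})"
      and nf: "wnorm \<infinity> c d v1 f < \<infinity>" and ng: "wnorm \<infinity> c d v2 g < \<infinity>"
    let ?n = "wnorm \<infinity> c d v1 f" and ?m = "wnorm \<infinity> c d v2 g"
    note [measurable] = borel_measurable_profile_inf
    have [measurable]: "u \<in> borel_measurable (lebesgue_on {c..d})"
      using W by (simp add: weight_grid_def)
    have "(\<integral>\<^sup>+ t. epow (bilinear_hardy c f g t) q * u t \<partial>lebesgue_on {c..d})
       \<le> (\<integral>\<^sup>+ t. epow (?n * ?m) q * (epow (?P1 t * ?P2 t) q * u t) \<partial>lebesgue_on {c..d})"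
    proof (rule nn_integral_mono)
      fix t assume "t \<in> space (lebesgue_on {c..d})"
      then have t: "t \<in> {c..d}" by simp
      have "bilinear_hardy c f g t \<le> (?n * ?P1 t) * (?m * ?P2 t)"
        unfolding bilinear_hardy_def using nf ng
        by (intro mult_mono v1.hardy_le_profile_inf v2.hardy_le_profile_inf f g t) auto
      also have "\<dots> = (?n * ?m) * (?P1 t * ?P2 t)" by (simp only: mult_ac)
      finally have "epow (bilinear_hardy c f g t) q \<le> epow (?n * ?m) q * epow (?P1 t * ?P2 t) q"
        using q by (simp only: epow_mult[symmetric]) (intro epow_mono, auto)
      then have "epow (bilinear_hardy c f g t) q * u t \<le> epow (?n * ?m) q * epow (?P1 t * ?P2 t) q * u t"
        by (intro mult_right_mono) auto
      then show "epow (bilinear_hardy c f g t) q * u t \<le> epow (?n * ?m) q * (epow (?P1 t * ?P2 t) q * u t)"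
        by (simp only: mult.assoc)
    qed
    also have "\<dots> = epow (?n * ?m) q * (\<integral>\<^sup>+ t. epow (?P1 t * ?P2 t) q * u t \<partial>lebesgue_on {c..d})"
      by (rule nn_integral_cmult) measurable
    finally have "wnorm (ennreal q) c d u (bilinear_hardy c f g)
       \<le> epow (epow (?n * ?m) q * (\<integral>\<^sup>+ t. epow (?P1 t * ?P2 t) q * u t \<partial>lebesgue_on {c..d})) (1 / q)"
      unfolding wnorm_ennreal[OF q] using q by (intro epow_mono) auto
    also have "\<dots> = (?n * ?m) * B_inf_inf q c d u ?P1 ?P2"
      unfolding B using q epow_mult[of "1/q"] epow_epow[of q "1/q"] by (simp only: zero_less_divide_1_iff) simp
    also have "\<dots> \<le> (?n * ?m) * ennreal X" by (intro mult_left_mono X) auto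
    finally show "wnorm (ennreal q) c d u (bilinear_hardy c f g) \<le> ennreal X * ?n * ?m" by (simp only: mult_ac)
  qed
  show "(\<forall>C\<ge>0. hardy_ineq q \<infinity> \<infinity> c d u v1 v2 (ennreal C) \<longrightarrow> B_inf_inf q c d u ?P1 ?P2 \<le> ennreal (1 * C)) \<and>
     (\<forall>X\<ge>0. B_inf_inf q c d u ?P1 ?P2 \<le> ennreal X \<longrightarrow> hardy_ineq q \<infinity> \<infinity> c d u v1 v2 (ennreal (1 * X)))"
    using lower upper by (simp only: mult_1) blast
qed

text \<open>
  With the first profile equal to 1 the characteristic of the finite case is largest at \<open>x =
  c\<close>.
\<close>

lemma B_inf_2_cases:
  "B_inf_2 q (ennreal p2) c d u \<Phi>1 \<Phi>2 =
     (if ennreal p2 \<le> ennreal q then B1 q c d (\<lambda>t. epow (\<Phi>1 t) q * u t) (\<lambda>_. 1) \<Phi>2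
      else B2_hat q (ennreal p2) c d (\<lambda>t. epow (\<Phi>1 t) q * u t) (\<lambda>_. 1) \<Phi>2)"
  if "c < d" "0 < q" "q < p2 \<or> p2 \<le> q"
proof (cases "ennreal p2 \<le> ennreal q")
  case True
  then show ?thesis by (simp add: B_inf_2_def B1_def Let_def mult.commute)
next
  case False
  define r where "r = r_exp q (ennreal p2)"
  define w where "w t = epow (\<Phi>1 t) q * u t" for t
  have "q < p2" using False that(3) by (auto simp: ennreal_leI)
  then have r: "0 < r" using conj_exps(1)[OF that(2)] by (simp add: r_def)
  let ?\<mu> = "stieltjes c d (\<lambda>x. epow (\<Phi>2 x) r)"
  let ?h = "\<lambda>x. epow (\<integral>\<^sup>+ t\<in>{c..d}. epow (tail d w (max x t)) (r / q) \<partial>?\<mu>) (1 / r)"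
  have "(SUP x\<in>{c..d}. ?h x) = ?h c"
  proof (rule antisym)
    show "(SUP x\<in>{c..d}. ?h x) \<le> ?h c"
      using r that(2)
      by (intro SUP_least epow_mono nn_integral_mono mult_right_mono tail_antimono) auto
    show "?h c \<le> (SUP x\<in>{c..d}. ?h x)" using that(1) by (intro SUP_upper) auto
  qed
  also have "?h c = epow (\<integral>\<^sup>+ t\<in>{c..d}. epow (tail d w t) (r / q) \<partial>?\<mu>) (1 / r)"
    by (intro arg_cong2[where f = epow] nn_integral_cong refl) (auto split: split_indicator simp: max_def)
  finally show ?thesis
    using False by (simp add: B_inf_2_def B2_hat_def Let_def r_def[symmetric] w_def[abs_def])
qed

lemma B_1_inf_eq: "B_1_inf q p1 c d u \<Phi>1 \<Phi>2 = B_inf_2 q p1 c d u \<Phi>2 \<Phi>1"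
  by (simp add: B_1_inf_def B_inf_2_def)

lemma B3_hat_eq: "B3_hat q p1 c d u \<Phi>1 \<Phi>2 = B2_hat q p1 c d u \<Phi>2 \<Phi>1"
  by (simp add: B3_hat_def B2_hat_def)

lemma governs_B_inf_2:
  assumes q: "0 < q" and p: "1 \<le> p2"
  shows "\<exists>K>0. governs_with q \<infinity> (ennreal p2) (B_inf_2 q (ennreal p2)) K"
proof -
  define A where "A = (if p2 \<le> q then B1 q else B2_hat q (ennreal p2))"
  have "characterizes q q p2 A"
    unfolding A_def using characterizes_B1[of q p2 q] characterizes_B2_hat[of q q p2] q p by auto
  then obtain K where K: "0 < K"
    "governs_with q \<infinity> (ennreal p2) (\<lambda>c d u \<Phi>1 \<Phi>2. A c d (\<lambda>t. epow (\<Phi>1 t) q * u t) (\<lambda>_. 1) \<Phi>2) K"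
    using governs_inf_left q p by blast
  have "governs_with q \<infinity> (ennreal p2) (B_inf_2 q (ennreal p2)) K"
    unfolding governs_with_def
  proof (intro allI impI)
    fix c d u M \<delta> v1 v2
    assume a: "weight_grid c d q M u" "reg_weight c d \<delta> v1" "reg_weight c d \<delta> v2"
    have "c < d" using a(1) by (simp add: weight_grid_def)
    then have e: "B_inf_2 q (ennreal p2) c d u \<Phi>1 \<Phi>2 = A c d (\<lambda>t. epow (\<Phi>1 t) q * u t) (\<lambda>_. 1) \<Phi>2" for \<Phi>1 \<Phi>2
      using q by (subst B_inf_2_cases) (auto simp: A_def)
    show "(\<forall>C\<ge>0. hardy_ineq q \<infinity> (ennreal p2) c d u v1 v2 (ennreal C) \<longrightarrow>
          B_inf_2 q (ennreal p2) c d u (profile \<infinity> c d v1) (profile (ennreal p2) c d v2) \<le> ennreal (K * C)) \<and>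
       (\<forall>X\<ge>0. B_inf_2 q (ennreal p2) c d u (profile \<infinity> c d v1) (profile (ennreal p2) c d v2) \<le> ennreal X \<longrightarrow>
          hardy_ineq q \<infinity> (ennreal p2) c d u v1 v2 (ennreal (K * X)))"
      unfolding e using governs_withD[OF K(2) a] by blast
  qed
  then show ?thesis using K(1) by blast
qed

text \<open>
  The characteristic before regularisation: for any weight and any pair of profiles.
\<close>

definition case_char :: "real \<Rightarrow> ennreal \<Rightarrow> ennreal \<Rightarrow> char_fun" where
  "case_char q p1 p2 c d u \<Phi>1 \<Phi>2 =
     (if p1 < \<infinity> \<and> p2 < \<infinity> \<and> p1 \<le> ennreal q \<and> p2 \<le> ennreal q then B1 q c d u \<Phi>1 \<Phi>2
         else if p1 \<le> ennreal q \<and> ennreal q < p2 \<and> p2 < \<infinity> then B2_hat q p2 c d u \<Phi>1 \<Phi>2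
         else if p2 \<le> ennreal q \<and> ennreal q < p1 \<and> p1 < \<infinity> then B3_hat q p1 c d u \<Phi>1 \<Phi>2
         else if p1 < \<infinity> \<and> p2 < \<infinity> \<and> ennreal q < min p1 p2 \<and> 1 / ennreal q \<le> 1 / p1 + 1 / p2
           then B4 q p2 c d u \<Phi>1 \<Phi>2 + B5 q p1 c d u \<Phi>1 \<Phi>2
         else if p1 < \<infinity> \<and> p2 < \<infinity> \<and> ennreal q < min p1 p2 \<and> 1 / ennreal q > 1 / p1 + 1 / p2
           then B6 q p1 p2 c d u \<Phi>1 \<Phi>2 + B7 q p1 p2 c d u \<Phi>1 \<Phi>2
         else if p1 = \<infinity> \<and> p2 < \<infinity> then B_inf_2 q p2 c d u \<Phi>1 \<Phi>2
         else if p1 < \<infinity> \<and> p2 = \<infinity> then B_1_inf q p1 c d u \<Phi>1 \<Phi>2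
         else B_inf_inf q c d u \<Phi>1 \<Phi>2)"

lemma reg_char_eq: "reg_char q p1 p2 c d u v1 v2 m =
    case_char q p1 p2 c d (reg_u m u) (profile p1 c d (reg_v m v1)) (profile p2 c d (reg_v m v2))"
  unfolding reg_char_def case_char_def Let_def ..

lemma case_char_inf_inf: "case_char q \<infinity> \<infinity> = B_inf_inf q"
  by (intro ext) (simp add: case_char_def)

lemma governs_case_char:
  assumes q: "0 < q" and p: "1 \<le> p1" "1 \<le> p2"
  shows "\<exists>K>0. governs_with q p1 p2 (case_char q p1 p2) K"
proof -
  consider (fin) "p1 < top" "p2 < top" | (l) "p1 = top" "p2 < top" | (r) "p1 < top" "p2 = top" | (i) "p1 = top" "p2 = top"
    by (auto simp: less_top[symmetric])
  then show ?thesis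
  proof cases
    case i
    then show ?thesis using governs_inf_inf[OF q] case_char_inf_inf[of q] by (intro exI[of _ 1]) simp
  next
    case l
    define b where "b = enn2real p2"
    have b: "p2 = ennreal b" using l by (simp add: b_def)
    then have b1: "1 \<le> b" using p by (simp add: ennreal_ge_1)
    have "case_char q p1 p2 = B_inf_2 q (ennreal b)"
      by (intro ext) (simp add: case_char_def l(1) b top_unique)
    then show ?thesis using governs_B_inf_2[OF q b1] l by (simp add: b)
  next
    case r
    define a where "a = enn2real p1"
    have a: "p1 = ennreal a" using r by (simp add: a_def)
    then have a1: "1 \<le> a" using p by (simp add: ennreal_ge_1)
    obtain K where K: "0 < K" "governs_with q \<infinity> (ennreal a) (B_inf_2 q (ennreal a)) K"
      using governs_B_inf_2[OF q a1] by blast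
    have "case_char q p1 p2 = (\<lambda>c d u \<Phi>1 \<Phi>2. B_inf_2 q (ennreal a) c d u \<Phi>2 \<Phi>1)"
      by (intro ext) (simp add: case_char_def r(2) a top_unique B_1_inf_eq)
    then show ?thesis using governs_swap[OF K(2)] K(1) r by (auto simp: a)
  next
    case fin
    define a where "a = enn2real p1"
    define b where "b = enn2real p2"
    have ab: "p1 = ennreal a" "p2 = ennreal b" using fin by (simp_all add: a_def b_def)
    then have ab1: "1 \<le> a" "1 \<le> b" using p by (simp_all add: ennreal_ge_1)
    have inv: "1 / ennreal q \<le> 1 / ennreal a + 1 / ennreal b \<longleftrightarrow> 1 / q \<le> 1 / a + 1 / b"
    proof -
      have "1 / ennreal q = ennreal (1 / q)" "1 / ennreal a = ennreal (1 / a)" "1 / ennreal b = ennreal (1 / b)"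
        using q ab1 divide_ennreal[of 1 q] divide_ennreal[of 1 a] divide_ennreal[of 1 b] by simp_all
      then show ?thesis using ab1 by (simp add: ennreal_plus[symmetric] del: ennreal_plus)
    qed
    have lt: "ennreal q < ennreal x \<longleftrightarrow> q < x" "ennreal x \<le> ennreal q \<longleftrightarrow> x \<le> q" if "1 \<le> x" for x
      using q that by (simp_all add: ennreal_less_iff)
    have "characterizes q a b (case_char q p1 p2)"
    proof -
      consider "a \<le> q" "b \<le> q" | "a \<le> q" "q < b" | "b \<le> q" "q < a"
        | "q < a" "q < b" "1 / q \<le> 1 / a + 1 / b" | "q < a" "q < b" "1 / a + 1 / b < 1 / q" by linarith
      then show ?thesis
      proof cases
        case 1
        then have "case_char q p1 p2 = B1 q"
          by (intro ext) (simp add: case_char_def ab lt ab1)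
        then show ?thesis using characterizes_B1[of a b q] 1 ab1 by simp
      next
        case 2
        then have "case_char q p1 p2 = B2_hat q (ennreal b)"
          by (intro ext) (simp add: case_char_def ab lt ab1)
        then show ?thesis using characterizes_B2_hat[of a q b] 2 ab1 by simp
      next
        case 3
        then have "case_char q p1 p2 = (\<lambda>c d u \<Phi>1 \<Phi>2. B2_hat q (ennreal a) c d u \<Phi>2 \<Phi>1)"
          by (intro ext) (simp add: case_char_def ab lt ab1 B3_hat_eq)
        then show ?thesis using characterizes_swap[OF characterizes_B2_hat[of b q a]] 3 ab1 by simp
      next
        case 4
        then have "case_char q p1 p2 = (\<lambda>c d u \<Phi>1 \<Phi>2. B4 q (ennreal b) c d u \<Phi>1 \<Phi>2 + B5 q (ennreal a) c d u \<Phi>1 \<Phi>2)"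
          by (intro ext) (simp add: case_char_def ab lt ab1 inv)
        then show ?thesis using characterizes_B4_B5[OF q 4] by simp
      next
        case 5
        then have n: "\<not> 1 / ennreal q \<le> 1 / ennreal a + 1 / ennreal b" unfolding inv by simp
        then have n': "1 / ennreal a + 1 / ennreal b < 1 / ennreal q" by (simp only: not_le)
        from 5 have "case_char q p1 p2 = (\<lambda>c d u \<Phi>1 \<Phi>2. B6 q (ennreal a) (ennreal b) c d u \<Phi>1 \<Phi>2 + B7 q (ennreal a) (ennreal b) c d u \<Phi>1 \<Phi>2)"
          by (intro ext) (simp add: case_char_def ab lt ab1 n n')
        then show ?thesis using characterizes_B6_B7[OF q 5] by simp
      qed
    qed
    then show ?thesis using governs_finite[OF _ q ab1] by (simp add: ab)
  qed
qed

lemma weight_grid_reg: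
  assumes "c < d" "0 < q" "u \<in> borel_measurable (lebesgue_on {c..d})"
  shows "weight_grid c d q (real m) (reg_u m u)"
  using assms by unfold_locales (auto simp: reg_u_meas reg_u_def ennreal_of_nat_eq_real_of_nat)

lemma reg_weight_reg:
  assumes "c < d" "1 \<le> m" "v \<in> borel_measurable (lebesgue_on {c..d})"
  shows "reg_weight c d (1 / real m) (reg_v m v)"
  using assms by unfold_locales (auto simp: reg_v_meas reg_v_def)

text \<open>
  A constant is admissible exactly when it is admissible for every regularisation, so the supremum of
  the characteristics is compared with the infimum of the admissible constants.
\<close>

lemma hardy_const_equiv:
  assumes G: "governs_with q p1 p2 A K" and K: "0 < K" and q: "0 < q" and p: "1 \<le> p1" "1 \<le> p2" and cd: "c < d"
    and u: "u \<in> borel_measurable (lebesgue_on {c..d})"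
    and v1: "v1 \<in> borel_measurable (lebesgue_on {c..d})" and v2: "v2 \<in> borel_measurable (lebesgue_on {c..d})"
  defines "S \<equiv> SUP m\<in>{1..}. A c d (reg_u m u) (profile p1 c d (reg_v m v1)) (profile p2 c d (reg_v m v2))"
  shows "ennreal (1 / K) * S \<le> hardy_const q p1 p2 c d u v1 v2"
    and "hardy_const q p1 p2 c d u v1 v2 \<le> ennreal K * S"
proof -
  have D: "0 \<le> C \<Longrightarrow> hardy_ineq q p1 p2 c d (reg_u m u) (reg_v m v1) (reg_v m v2) (ennreal C) \<Longrightarrow>
       A c d (reg_u m u) (profile p1 c d (reg_v m v1)) (profile p2 c d (reg_v m v2)) \<le> ennreal (K * C)"
    "0 \<le> C \<Longrightarrow> A c d (reg_u m u) (profile p1 c d (reg_v m v1)) (profile p2 c d (reg_v m v2)) \<le> ennreal C \<Longrightarrow>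
       hardy_ineq q p1 p2 c d (reg_u m u) (reg_v m v1) (reg_v m v2) (ennreal (K * C))" if "1 \<le> m" for m C
    using governs_withD[OF G weight_grid_reg[OF cd q u] reg_weight_reg[OF cd that v1] reg_weight_reg[OF cd that v2]] by blast+
  show "ennreal (1 / K) * S \<le> hardy_const q p1 p2 c d u v1 v2"
    unfolding hardy_const_eq
  proof (rule Inf_greatest, clarify)
    fix C :: ennreal assume C: "C < \<infinity>" and h: "hardy_ineq q p1 p2 c d u v1 v2 C"
    define x where "x = enn2real C"
    have x: "C = ennreal x" "0 \<le> x" using C by (simp_all add: x_def)
    have "S \<le> ennreal (K * x)"
      unfolding S_def
    proof (rule SUP_least)
      fix m :: nat assume "m \<in> {1..}"
      then show "A c d (reg_u m u) (profile p1 c d (reg_v m v1)) (profile p2 c d (reg_v m v2)) \<le> ennreal (K * x)"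
        using D(1)[of m x] hardy_ineq_reg[OF q p v1 v2 h[unfolded x], of m] x by simp
    qed
    then have "ennreal (1 / K) * S \<le> ennreal (1 / K) * ennreal (K * x)" by (intro mult_left_mono) auto
    also have "\<dots> = C" using K x by (simp add: ennreal_mult[symmetric])
    finally show "ennreal (1 / K) * S \<le> C" .
  qed
  show "hardy_const q p1 p2 c d u v1 v2 \<le> ennreal K * S"
  proof (cases "S = top")
    case True
    then show ?thesis using K by (simp add: ennreal_mult_top)
  next
    case False
    define x where "x = enn2real S"
    have x: "S = ennreal x" "0 \<le> x" using False by (simp_all add: x_def less_top[symmetric])
    have "hardy_ineq q p1 p2 c d u v1 v2 (ennreal (K * x))"
    proof (rule hardy_ineq_of_reg[OF q p cd u v1 v2])
      fix m :: nat assume m: "1 \<le> m"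
      have "A c d (reg_u m u) (profile p1 c d (reg_v m v1)) (profile p2 c d (reg_v m v2)) \<le> S"
        unfolding S_def using m by (intro SUP_upper) auto
      then show "hardy_ineq q p1 p2 c d (reg_u m u) (reg_v m v1) (reg_v m v2) (ennreal (K * x))"
        using D(2)[OF m x(2)] x(1) by simp
    qed simp
    then have "hardy_const q p1 p2 c d u v1 v2 \<le> ennreal (K * x)"
      unfolding hardy_const_eq by (intro Inf_lower) simp
    then show ?thesis using K x by (simp add: ennreal_mult)
  qed
qed

theorem theorem6p2:
  fixes q :: real and p1 p2 :: ennreal
  assumes "0 < q" and "1 \<le> p1" and "1 \<le> p2"
  shows "(\<exists>k K :: real. 0 < k \<and> k \<le> K \<and>
            (\<forall>(c::real) d u v1 v2.
               c < d \<longrightarrow>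
               u \<in> borel_measurable (lebesgue_on {c..d}) \<longrightarrow>
               v1 \<in> borel_measurable (lebesgue_on {c..d}) \<longrightarrow>
               v2 \<in> borel_measurable (lebesgue_on {c..d}) \<longrightarrow>
               ennreal k * op_char q p1 p2 c d u v1 v2 \<le> hardy_const q p1 p2 c d u v1 v2 \<and>
               hardy_const q p1 p2 c d u v1 v2 \<le> ennreal K * op_char q p1 p2 c d u v1 v2)) \<and>
         (p1 = \<infinity> \<and> p2 = \<infinity> \<longrightarrow>
            (\<forall>(c::real) d u v1 v2.
               c < d \<longrightarrow>
               u \<in> borel_measurable (lebesgue_on {c..d}) \<longrightarrow>
               v1 \<in> borel_measurable (lebesgue_on {c..d}) \<longrightarrow>
               v2 \<in> borel_measurable (lebesgue_on {c..d}) \<longrightarrow>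
               hardy_const q p1 p2 c d u v1 v2 =
                 (SUP m\<in>{1..}. B_inf_inf q c d (reg_u m u)
                    (profile p1 c d (reg_v m v1)) (profile p2 c d (reg_v m v2)))))"
proof (intro conjI impI allI)
  obtain K where K: "0 < K" "governs_with q p1 p2 (case_char q p1 p2) K"
    using governs_case_char[OF assms] by blast
  show "\<exists>k K :: real. 0 < k \<and> k \<le> K \<and>
            (\<forall>(c::real) d u v1 v2.
               c < d \<longrightarrow>
               u \<in> borel_measurable (lebesgue_on {c..d}) \<longrightarrow>
               v1 \<in> borel_measurable (lebesgue_on {c..d}) \<longrightarrow>
               v2 \<in> borel_measurable (lebesgue_on {c..d}) \<longrightarrow>
               ennreal k * op_char q p1 p2 c d u v1 v2 \<le> hardy_const q p1 p2 c d u v1 v2 \<and>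
               hardy_const q p1 p2 c d u v1 v2 \<le> ennreal K * op_char q p1 p2 c d u v1 v2)"
  proof (rule exI[of _ "1 / K"], rule exI[of _ "max (1 / K) K"], intro conjI allI impI)
    fix c d :: real and u v1 v2 :: "real \<Rightarrow> ennreal"
    assume a: "c < d" "u \<in> borel_measurable (lebesgue_on {c..d})"
      "v1 \<in> borel_measurable (lebesgue_on {c..d})" "v2 \<in> borel_measurable (lebesgue_on {c..d})"
    note E = hardy_const_equiv[OF K(2,1) assms a, folded reg_char_eq, folded op_char_def]
    show "ennreal (1 / K) * op_char q p1 p2 c d u v1 v2 \<le> hardy_const q p1 p2 c d u v1 v2" by (rule E(1))
    have "ennreal K * op_char q p1 p2 c d u v1 v2 \<le> ennreal (max (1 / K) K) * op_char q p1 p2 c d u v1 v2"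
      by (intro mult_right_mono ennreal_leI) auto
    with E(2) show "hardy_const q p1 p2 c d u v1 v2 \<le> ennreal (max (1 / K) K) * op_char q p1 p2 c d u v1 v2"
      by (rule order_trans)
  qed (use K in auto)
next
  fix c d :: real and u v1 v2 :: "real \<Rightarrow> ennreal"
  assume p: "p1 = \<infinity> \<and> p2 = \<infinity>" and a: "c < d" "u \<in> borel_measurable (lebesgue_on {c..d})"
    "v1 \<in> borel_measurable (lebesgue_on {c..d})" "v2 \<in> borel_measurable (lebesgue_on {c..d})"
  have "governs_with q p1 p2 (B_inf_inf q) 1" using governs_inf_inf[OF assms(1)] p by simp
  from hardy_const_equiv[OF this zero_less_one assms a]
  show "hardy_const q p1 p2 c d u v1 v2 = (SUP m\<in>{1..}. B_inf_inf q c d (reg_u m u)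
                    (profile p1 c d (reg_v m v1)) (profile p2 c d (reg_v m v2)))"
    by (intro antisym) simp_all
qed

end
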